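(* Let $R=K$ be a field. The category of affine functors of monoids is anti-equivalent to the category of functors of commutative bialgebras.
   Context: $R=K$ is a field. All functors are covariant functors from the category of commutative $R$-algebras (associative with unit) to sets; tensor products, direct and inverse limits of functors of modules are taken pointwise. $\mathcal R$ is the functor of rings $\mathcal R(S)=S$. A functor of $\mathcal R$-modules is a functor $\mathbb M$ with morphisms of functors $\mathbb M\times\mathbb M\to\mathbb M$ and $\mathcal R\times\mathbb M\to\mathbb M$ making each $\mathbb M(S)$ an $S$-module; morphisms of functors of $\mathcal R$-modules are morphisms of functors that are $S$-linear for each $S$. $\mathbb M^*$ is defined by $\mathbb M^*(S)=\mathrm{Hom}_{\mathcal S}(\mathbb M_{|S},\mathcal S)$, where $_{|S}$ denotes restriction to commutative $S$-algebras (only functors for which such Homs are sets are considered); $\mathbb M$ is reflexive if the natural morphism $\mathbb M\to\mathbb M^{**}$ is an isomorphism. For an $R$-module $M$, $\mathcal M(S)=M\otimes_RS$ is the quasi-coherent module associated with $M$. A functor of $\mathcal R$-algebras is a functor of (associative, unital) rings $\mathbb A$ with a morphism of functors of rings $\mathcal R\to\mathbb A$ with central image. If $A$ is an $R$-algebra, $\mathcal A$ is called a quasi-coherent algebra. A functor of $\mathcal R$-algebras is a functor of pro-quasicoherent algebras if it is the inverse limit of its quasi-coherent algebra quotients. Put $\mathbb M\tilde\otimes\mathbb N:=(\mathbb M^*\otimes_{\mathcal R}\mathbb N^* )^*$. If $\mathbb A,\mathbb B$ are reflexive functors of pro-quasicoherent algebras with quasi-coherent algebra quotients $\{\mathcal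 A_i\}$, $\{\mathcal B_j\}$, then $\mathbb A\tilde\otimes\mathbb B=\varprojlim_{i,j}(\mathcal A_i\otimes\mathcal B_j)$, which is thereby a functor of algebras. A functor of bialgebras is a reflexive functor $\mathbb B$ of pro-quasicoherent algebras such that $\mathbb B^*$ is also a functor of $\mathcal R$-algebras and the dual morphisms $\mathbb B=\mathbb B^{**}\to(\mathbb B^*\otimes\mathbb B^* )^*=\mathbb B\tilde\otimes\mathbb B$ and $\mathbb B\to\mathcal R$ of the multiplication morphism $\mathbb B^*\otimes\mathbb B^*\to\mathbb B^*$ and the unit morphism $\mathcal R\to\mathbb B^*$ are morphisms of functors of $\mathcal R$-algebras. It is a functor of commutative bialgebras if the algebra $\mathbb B$ is commutative. A morphism of functors of bialgebras $f:\mathbb B\to\mathbb B'$ is a morphism of $\mathcal R$-modules such that $f$ and $f^*:\mathbb B'^*\to\mathbb B^*$ are morphisms of functors of $\mathcal R$-algebras. For a functor of commutative $\mathcal R$-algebras $\mathbb A$, $(\mathrm{Spec}\,\mathbb A)(S)=\mathrm{Hom}_{\mathcal R\text{-alg}}(\mathbb A,\mathcal S)$, where $\mathcal S(R')=S\otimes_RR'$. For a functor of sets $\mathbb X$, its functor of functions $\mathbb A_{\mathbb X}$ is given by $\mathbb A_{\mathbb X}(S)=\mathrm{Hom}(\mathbb X_{|S},\mathcal R_{|S})$ (morphisms of functors of sets). $\mathbb X$ is affine if $\mathbb X=\mathrm{Spec}\,\mathbb A_{\mathbb X}$ (via the natural morphism) and $\mathbb A_{\mathbb X}$ is a reflexive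 functor of $\mathcal R$-modules. An affine functor of monoids is an affine functor that is a functor of monoids; morphisms are morphisms of functors of monoids. *)

theory Defs
  imports "HOL-Algebra.Module" "HOL-Algebra.Coset" "HOL-Algebra.Free_Abelian_Groups"
    "HOL-Library.Equipollence"
begin

section \<open>Commutative algebras over the base field\<close>

text \<open>
  The type \<open>'u\<close> plays the role of the universe of sets: a set is small if its cardinality is strictly
  below that of \<open>'u\<close>, so that up to bijection the small sets are the small subsets of \<open>'u\<close>
  (a Grothendieck universe, if the cardinality of \<open>'u\<close> is inaccessible).  The commutative
  \<open>K\<close>-algebras are those with small carrier in \<open>'u\<close>, and a functor takes values in sets if its
  values are small.  Functors with values in larger types occur as duals and as functors of
  functions; that they still take values in sets is an explicit hypothesis where the theory needs it.
\<close>

type_synonym 'u alg = "('u, 'u) module"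

definition CAlg :: "'u ring \<Rightarrow> 'u alg set" where
  "CAlg K = {S. algebra K S \<and> carrier S \<prec> (UNIV :: 'u set)}"

text \<open>Homomorphisms are extensional, so that equality of functions is equality of homomorphisms.\<close>

definition lin_hom ::
    "('r, 'y) ring_scheme \<Rightarrow> ('r, 'a) module \<Rightarrow> ('r, 'b) module \<Rightarrow> ('a \<Rightarrow> 'b) set" where
  "lin_hom R M N = {f \<in> carrier M \<rightarrow>\<^sub>E carrier N.
     (\<forall>x\<in>carrier M. \<forall>y\<in>carrier M. f (x \<oplus>\<^bsub>M\<^esub> y) = f x \<oplus>\<^bsub>N\<^esub> f y) \<and>
     (\<forall>r\<in>carrier R. \<forall>x\<in>carrier M. f (r \<odot>\<^bsub>M\<^esub> x) = r \<odot>\<^bsub>N\<^esub> f x)}"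

definition alg_hom ::
    "('r, 'y) ring_scheme \<Rightarrow> ('r, 'a) module \<Rightarrow> ('r, 'b) module \<Rightarrow> ('a \<Rightarrow> 'b) set" where
  "alg_hom R A B = lin_hom R A B \<inter> ring_hom A B"

definition idm :: "('a, 'z) partial_object_scheme \<Rightarrow> 'a \<Rightarrow> 'a" where
  "idm S = (\<lambda>x\<in>carrier S. x)"

text \<open>Associative unital, not necessarily commutative, algebras; the structure morphism is
  \<open>r \<mapsto> r \<odot> \<one>\<close>, whose image is central.\<close>

definition assoc_algebra :: "('r, 'y) ring_scheme \<Rightarrow> ('r, 'a) module \<Rightarrow> bool" where
  "assoc_algebra R A \<longleftrightarrow> module R A \<and> ring A \<and>
     (\<forall>r\<in>carrier R. \<forall>a\<in>carrier A. \<forall>b\<in>carrier A.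
        (r \<odot>\<^bsub>A\<^esub> a) \<otimes>\<^bsub>A\<^esub> b = r \<odot>\<^bsub>A\<^esub> (a \<otimes>\<^bsub>A\<^esub> b) \<and>
        a \<otimes>\<^bsub>A\<^esub> (r \<odot>\<^bsub>A\<^esub> b) = r \<odot>\<^bsub>A\<^esub> (a \<otimes>\<^bsub>A\<^esub> b))"


section \<open>Functors on commutative algebras\<close>

text \<open>The parameter \<open>'s\<close> is the type of records carrying the structure of the values: sets, monoids,
  or modules and algebras (for a functor of modules, the fields \<open>mult\<close> and \<open>one\<close> are meaningless).\<close>

record ('u, 'a, 's) func =
  Ob :: "'u alg \<Rightarrow> 's"
  Ar :: "'u alg \<Rightarrow> 'u alg \<Rightarrow> ('u \<Rightarrow> 'u) \<Rightarrow> 'a \<Rightarrow> 'a"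

type_synonym ('u, 'a) mfunc = "('u, 'a, ('u, 'a) module) func"

definition set_functor :: "'u ring \<Rightarrow> ('u, 'a, ('a, 'z) partial_object_scheme) func \<Rightarrow> bool" where
  "set_functor K F \<longleftrightarrow>
     (\<forall>S\<in>CAlg K. \<forall>T\<in>CAlg K. \<forall>f\<in>alg_hom K S T. Ar F S T f \<in> carrier (Ob F S) \<rightarrow> carrier (Ob F T)) \<and>
     (\<forall>S\<in>CAlg K. \<forall>x\<in>carrier (Ob F S). Ar F S S (idm S) x = x) \<and>
     (\<forall>S\<in>CAlg K. \<forall>T\<in>CAlg K. \<forall>V\<in>CAlg K. \<forall>f\<in>alg_hom K S T. \<forall>g\<in>alg_hom K T V.
        \<forall>x\<in>carrier (Ob F S). Ar F S V (compose (carrier S) g f) x = Ar F T V g (Ar F S T f x))"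

definition small_functor :: "'u ring \<Rightarrow> ('u, 'a, ('a, 'z) partial_object_scheme) func \<Rightarrow> bool" where
  "small_functor K F \<longleftrightarrow> (\<forall>S\<in>CAlg K. carrier (Ob F S) \<prec> (UNIV :: 'u set))"

definition Mor :: "'u ring \<Rightarrow> ('u, 'a, ('a, 'y) partial_object_scheme) func \<Rightarrow>
    ('u, 'b, ('b, 'z) partial_object_scheme) func \<Rightarrow> ('u alg \<Rightarrow> 'a \<Rightarrow> 'b) set" where
  "Mor K F G = {\<phi> \<in> (\<Pi>\<^sub>E S\<in>CAlg K. carrier (Ob F S) \<rightarrow>\<^sub>E carrier (Ob G S)).
     \<forall>S\<in>CAlg K. \<forall>T\<in>CAlg K. \<forall>f\<in>alg_hom K S T. \<forall>x\<in>carrier (Ob F S).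
       \<phi> T (Ar F S T f x) = Ar G S T f (\<phi> S x)}"

definition mod_functor :: "'u ring \<Rightarrow> ('u, 'a) mfunc \<Rightarrow> bool" where
  "mod_functor K M \<longleftrightarrow> set_functor K M \<and> (\<forall>S\<in>CAlg K. module S (Ob M S)) \<and>
     (\<forall>S\<in>CAlg K. \<forall>T\<in>CAlg K. \<forall>f\<in>alg_hom K S T. \<forall>x\<in>carrier (Ob M S).
        (\<forall>y\<in>carrier (Ob M S).
           Ar M S T f (x \<oplus>\<^bsub>Ob M S\<^esub> y) = Ar M S T f x \<oplus>\<^bsub>Ob M T\<^esub> Ar M S T f y) \<and>
        (\<forall>s\<in>carrier S. Ar M S T f (s \<odot>\<^bsub>Ob M S\<^esub> x) = f s \<odot>\<^bsub>Ob M T\<^esub> Ar M S T f x))"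

definition Mod_mor :: "'u ring \<Rightarrow> ('u, 'a) mfunc \<Rightarrow> ('u, 'b) mfunc \<Rightarrow> ('u alg \<Rightarrow> 'a \<Rightarrow> 'b) set" where
  "Mod_mor K M N = {\<phi> \<in> Mor K M N. \<forall>S\<in>CAlg K. \<phi> S \<in> lin_hom S (Ob M S) (Ob N S)}"

definition alg_functor :: "'u ring \<Rightarrow> ('u, 'a) mfunc \<Rightarrow> bool" where
  "alg_functor K A \<longleftrightarrow> mod_functor K A \<and> (\<forall>S\<in>CAlg K. assoc_algebra S (Ob A S)) \<and>
     (\<forall>S\<in>CAlg K. \<forall>T\<in>CAlg K. \<forall>f\<in>alg_hom K S T. Ar A S T f \<in> ring_hom (Ob A S) (Ob A T))"

definition Alg_mor :: "'u ring \<Rightarrow> ('u, 'a) mfunc \<Rightarrow> ('u, 'b) mfunc \<Rightarrow> ('u alg \<Rightarrow> 'a \<Rightarrow> 'b) set" where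
  "Alg_mor K A B = {\<phi> \<in> Mod_mor K A B. \<forall>S\<in>CAlg K. \<phi> S \<in> ring_hom (Ob A S) (Ob B S)}"

definition Rfun :: "('u, 'u) mfunc" where
  "Rfun = \<lparr>Ob = (\<lambda>T. T\<lparr>smult := monoid.mult T\<rparr>), Ar = (\<lambda>S T f. f)\<rparr>"


section \<open>Restriction, functors of functions, duals\<close>

text \<open>A commutative \<open>S\<close>-algebra is encoded as a commutative \<open>K\<close>-algebra \<open>T\<close> with a homomorphism
  \<open>f : S \<rightarrow> T\<close>, and a morphism \<open>(T, f) \<rightarrow> (T', f')\<close> is a homomorphism \<open>g : T \<rightarrow> T'\<close> with \<open>g \<circ> f = f'\<close>.\<close>

definition SAlg :: "'u ring \<Rightarrow> 'u alg \<Rightarrow> ('u alg \<times> ('u \<Rightarrow> 'u)) set" where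
  "SAlg K S = (SIGMA T:CAlg K. alg_hom K S T)"

type_synonym ('u, 'a) nt = "'u alg \<times> ('u \<Rightarrow> 'u) \<Rightarrow> 'a \<Rightarrow> 'u"

text \<open>The morphisms of functors of sets from \<open>X\<close> restricted to \<open>S\<close>-algebras to \<open>Rfun\<close> restricted to
  \<open>S\<close>-algebras.\<close>

definition fun_on :: "'u ring \<Rightarrow> ('u, 'a, ('a, 'z) partial_object_scheme) func \<Rightarrow> 'u alg \<Rightarrow>
    ('u, 'a) nt set" where
  "fun_on K X S = {\<theta> \<in> (\<Pi>\<^sub>E p\<in>SAlg K S. carrier (Ob X (fst p)) \<rightarrow>\<^sub>E carrier (fst p)).
     \<forall>(T, f)\<in>SAlg K S. \<forall>T'\<in>CAlg K. \<forall>g\<in>alg_hom K T T'. \<forall>x\<in>carrier (Ob X T).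
       \<theta> (T', compose (carrier S) g f) (Ar X T T' g x) = g (\<theta> (T, f) x)}"

definition nt_restrict :: "'u ring \<Rightarrow> ('u, 'a, ('a, 'z) partial_object_scheme) func \<Rightarrow> 'u alg \<Rightarrow>
    ('u alg \<Rightarrow> ('u \<Rightarrow> 'u) \<Rightarrow> 'a \<Rightarrow> 'u) \<Rightarrow> ('u, 'a) nt" where
  "nt_restrict K X S h = (\<lambda>(T, f)\<in>SAlg K S. \<lambda>x\<in>carrier (Ob X T). h T f x)"

definition fun_functor :: "'u ring \<Rightarrow> ('u, 'a, ('a, 'z) partial_object_scheme) func \<Rightarrow>
    ('u, ('u, 'a) nt) mfunc" where
  "fun_functor K X = \<lparr>
     Ob = (\<lambda>S. \<lparr>carrier = fun_on K X S,
       monoid.mult = (\<lambda>\<theta> \<eta>. nt_restrict K X S (\<lambda>T f x. \<theta> (T, f) x \<otimes>\<^bsub>T\<^esub> \<eta> (T, f) x)),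
       one = nt_restrict K X S (\<lambda>T f x. \<one>\<^bsub>T\<^esub>),
       ring.zero = nt_restrict K X S (\<lambda>T f x. \<zero>\<^bsub>T\<^esub>),
       add = (\<lambda>\<theta> \<eta>. nt_restrict K X S (\<lambda>T f x. \<theta> (T, f) x \<oplus>\<^bsub>T\<^esub> \<eta> (T, f) x)),
       smult = (\<lambda>s \<theta>. nt_restrict K X S (\<lambda>T f x. f s \<otimes>\<^bsub>T\<^esub> \<theta> (T, f) x))\<rparr>),
     Ar = (\<lambda>S S' h \<theta>. nt_restrict K X S' (\<lambda>T f. \<theta> (T, compose (carrier S) f h)))\<rparr>"

text \<open>The dual is a functor of modules only; the inherited \<open>mult\<close> and \<open>one\<close> are irrelevant.  The
  restriction of \<open>Rfun\<close> to \<open>S\<close>-algebras is the functor of rings associated with \<open>S\<close>.\<close>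

definition dual :: "'u ring \<Rightarrow> ('u, 'a) mfunc \<Rightarrow> ('u, ('u, 'a) nt) mfunc" where
  "dual K M = (fun_functor K M)\<lparr>Ob := (\<lambda>S. (Ob (fun_functor K M) S)\<lparr>carrier :=
     {\<theta> \<in> fun_on K M S. \<forall>(T, f)\<in>SAlg K S. \<theta> (T, f) \<in> lin_hom T (Ob M T) (Ob Rfun T)}\<rparr>)\<rparr>"

definition dual_map :: "'u ring \<Rightarrow> ('u, 'a) mfunc \<Rightarrow> ('u, 'b) mfunc \<Rightarrow> ('u alg \<Rightarrow> 'a \<Rightarrow> 'b) \<Rightarrow>
    'u alg \<Rightarrow> ('u, 'b) nt \<Rightarrow> ('u, 'a) nt" where
  "dual_map K M N \<phi> = (\<lambda>S\<in>CAlg K. \<lambda>\<theta>\<in>carrier (Ob (dual K N) S).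
     nt_restrict K M S (\<lambda>T f x. \<theta> (T, f) (\<phi> T x)))"

text \<open>The natural morphism to the bidual.\<close>

definition bidual :: "'u ring \<Rightarrow> ('u, 'a) mfunc \<Rightarrow> 'u alg \<Rightarrow> 'a \<Rightarrow> ('u, ('u, 'a) nt) nt" where
  "bidual K M S m = nt_restrict K (dual K M) S (\<lambda>T f \<theta>. \<theta> (T, idm T) (Ar M S T f m))"

definition reflexive :: "'u ring \<Rightarrow> ('u, 'a) mfunc \<Rightarrow> bool" where
  "reflexive K M \<longleftrightarrow> mod_functor K M \<and> small_functor K M \<and> small_functor K (dual K M) \<and>
     (\<forall>S\<in>CAlg K. bij_betw (bidual K M S) (carrier (Ob M S)) (carrier (Ob (dual K (dual K M)) S)))"


section \<open>Tensor products\<close>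

definition tensor_rel :: "('r, 'y) ring_scheme \<Rightarrow> ('r, 'a) module \<Rightarrow> ('r, 'b) module \<Rightarrow>
    ('a \<times> 'b \<Rightarrow>\<^sub>0 int) set" where
  "tensor_rel R M N = generate (free_Abelian_group (carrier M \<times> carrier N))
     ({frag_of (m \<oplus>\<^bsub>M\<^esub> m', n) - frag_of (m, n) - frag_of (m', n) | m m' n.
         m \<in> carrier M \<and> m' \<in> carrier M \<and> n \<in> carrier N} \<union>
      {frag_of (m, n \<oplus>\<^bsub>N\<^esub> n') - frag_of (m, n) - frag_of (m, n') | m n n'.
         m \<in> carrier M \<and> n \<in> carrier N \<and> n' \<in> carrier N} \<union>
      {frag_of (r \<odot>\<^bsub>M\<^esub> m, n) - frag_of (m, r \<odot>\<^bsub>N\<^esub> n) | r m n.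
         r \<in> carrier R \<and> m \<in> carrier M \<and> n \<in> carrier N})"

definition tensor_group :: "('r, 'y) ring_scheme \<Rightarrow> ('r, 'a) module \<Rightarrow> ('r, 'b) module \<Rightarrow>
    ('a \<times> 'b \<Rightarrow>\<^sub>0 int) set monoid" where
  "tensor_group R M N = free_Abelian_group (carrier M \<times> carrier N) Mod tensor_rel R M N"

definition tensor_class :: "('r, 'y) ring_scheme \<Rightarrow> ('r, 'a) module \<Rightarrow> ('r, 'b) module \<Rightarrow>
    ('a \<times> 'b \<Rightarrow>\<^sub>0 int) \<Rightarrow> ('a \<times> 'b \<Rightarrow>\<^sub>0 int) set" where
  "tensor_class R M N x =
     r_coset (free_Abelian_group (carrier M \<times> carrier N)) (tensor_rel R M N) x"

definition rep :: "'a set \<Rightarrow> 'a" where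
  "rep X = (SOME x. x \<in> X)"

text \<open>The map into \<open>M \<otimes>\<^sub>R N\<close> which sends \<open>a \<otimes> b\<close> to \<open>m \<otimes> n\<close> where \<open>(m, n) = \<phi> (a, b)\<close>.  It and the
  product below are defined on representatives, and are only used where this is well-defined.\<close>

definition tensor_map :: "('r, 'y) ring_scheme \<Rightarrow> ('r, 'c) module \<Rightarrow> ('r, 'd) module \<Rightarrow>
    ('a \<times> 'b \<Rightarrow> 'c \<times> 'd) \<Rightarrow> ('a \<times> 'b \<Rightarrow>\<^sub>0 int) set \<Rightarrow> ('c \<times> 'd \<Rightarrow>\<^sub>0 int) set" where
  "tensor_map R M N \<phi> X = tensor_class R M N (frag_extend (\<lambda>p. frag_of (\<phi> p)) (rep X))"

text \<open>The fields \<open>mult\<close> and \<open>one\<close> are meaningful for algebras \<open>M\<close> and \<open>N\<close>: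
  \<open>(a \<otimes> b) (c \<otimes> d) = ac \<otimes> bd\<close>.\<close>

definition tensor :: "('r, 'y) ring_scheme \<Rightarrow> ('r, 'a) module \<Rightarrow> ('r, 'b) module \<Rightarrow>
    ('r, ('a \<times> 'b \<Rightarrow>\<^sub>0 int) set) module" where
  "tensor R M N = \<lparr>carrier = carrier (tensor_group R M N),
     monoid.mult = (\<lambda>X Y. tensor_class R M N
       (frag_extend (\<lambda>(a, b). frag_extend (\<lambda>(c, d). frag_of (a \<otimes>\<^bsub>M\<^esub> c, b \<otimes>\<^bsub>N\<^esub> d)) (rep Y)) (rep X))),
     one = tensor_class R M N (frag_of (\<one>\<^bsub>M\<^esub>, \<one>\<^bsub>N\<^esub>)),
     ring.zero = one (tensor_group R M N),
     add = monoid.mult (tensor_group R M N),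
     smult = (\<lambda>r. tensor_map R M N (map_prod (smult M r) id))\<rparr>"

text \<open>The linear map \<open>m \<otimes> n \<mapsto> h (m, n)\<close> induced by a bilinear map \<open>h\<close> into the additive group of \<open>P\<close>.\<close>

definition tensor_lift ::
    "('c, 'z) ring_scheme \<Rightarrow> ('a \<times> 'b \<Rightarrow> 'c) \<Rightarrow> ('a \<times> 'b \<Rightarrow>\<^sub>0 int) set \<Rightarrow> 'c" where
  "tensor_lift P h X =
     (\<Oplus>\<^bsub>P\<^esub>p\<in>Poly_Mapping.keys (rep X). [Poly_Mapping.lookup (rep X) p] \<cdot>\<^bsub>P\<^esub> h p)"

definition tensor_functor ::
    "('u, 'a) mfunc \<Rightarrow> ('u, 'b) mfunc \<Rightarrow> ('u, ('a \<times> 'b \<Rightarrow>\<^sub>0 int) set) mfunc" where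
  "tensor_functor M N = \<lparr>Ob = (\<lambda>S. tensor S (Ob M S) (Ob N S)),
     Ar = (\<lambda>S T f. tensor_map T (Ob M T) (Ob N T) (map_prod (Ar M S T f) (Ar N S T f)))\<rparr>"

text \<open>The natural morphism \<open>M \<otimes> N \<rightarrow> (M* \<otimes> N*)*\<close>, \<open>(m \<otimes> n) (\<alpha> \<otimes> \<beta>) = \<alpha>(m) \<beta>(n)\<close>.\<close>

definition tensor_eval :: "'u ring \<Rightarrow> ('u, 'a) mfunc \<Rightarrow> ('u, 'b) mfunc \<Rightarrow> 'u alg \<Rightarrow>
    ('a \<times> 'b \<Rightarrow>\<^sub>0 int) set \<Rightarrow> ('u, (('u, 'a) nt \<times> ('u, 'b) nt \<Rightarrow>\<^sub>0 int) set) nt" where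
  "tensor_eval K M N S t = nt_restrict K (tensor_functor (dual K M) (dual K N)) S
     (\<lambda>T f. tensor_lift T (\<lambda>(\<alpha>, \<beta>).
        tensor_lift T (\<lambda>(m, n). \<alpha> (T, idm T) m \<otimes>\<^bsub>T\<^esub> \<beta> (T, idm T) n)
          (Ar (tensor_functor M N) S T f t)))"


section \<open>Quasi-coherent algebras\<close>

text \<open>For a small commutative \<open>S\<close>, the algebra \<open>A \<otimes>\<^sub>K S\<close> must again be an object of \<^term>\<open>CAlg K\<close>,
  so for small \<open>A\<close> it is transported to \<open>'u\<close> along an arbitrarily chosen injection.\<close>

definition enc :: "('r, 'a) module \<Rightarrow> 'a \<Rightarrow> 'u" where
  "enc M = (SOME e. inj_on e (carrier M))"

definition dec :: "('r, 'a) module \<Rightarrow> 'u \<Rightarrow> 'a" where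
  "dec M = inv_into (carrier M) (enc M)"

definition copy :: "('r, 'a) module \<Rightarrow> ('r, 'u) module" where
  "copy M = \<lparr>carrier = enc M ` carrier M,
     monoid.mult = (\<lambda>x y. enc M (dec M x \<otimes>\<^bsub>M\<^esub> dec M y)),
     one = enc M \<one>\<^bsub>M\<^esub>,
     ring.zero = enc M \<zero>\<^bsub>M\<^esub>,
     add = (\<lambda>x y. enc M (dec M x \<oplus>\<^bsub>M\<^esub> dec M y)),
     smult = (\<lambda>r x. enc M (r \<odot>\<^bsub>M\<^esub> dec M x))\<rparr>"

definition tens :: "'u ring \<Rightarrow> 'u alg \<Rightarrow> 'u alg \<Rightarrow> 'u alg" where
  "tens K A S = copy (tensor K A S)"

definition pure_tens :: "'u ring \<Rightarrow> 'u alg \<Rightarrow> 'u alg \<Rightarrow> 'u \<Rightarrow> 'u \<Rightarrow> 'u" where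
  "pure_tens K A S a s = enc (tensor K A S) (tensor_class K A S (frag_of (a, s)))"

definition tens_map :: "'u ring \<Rightarrow> 'u alg \<Rightarrow> 'u alg \<Rightarrow> 'u alg \<Rightarrow> 'u alg \<Rightarrow>
    ('u \<Rightarrow> 'u) \<Rightarrow> ('u \<Rightarrow> 'u) \<Rightarrow> 'u \<Rightarrow> 'u" where
  "tens_map K A S A' S' h f x = enc (tensor K A' S')
     (tensor_map K A' S' (map_prod h f) (dec (tensor K A S) x))"

text \<open>The functor of algebras \<open>S \<mapsto> A \<otimes>\<^sub>K S\<close>, with scalars \<open>s (a \<otimes> t) = a \<otimes> st = (1 \<otimes> s) (a \<otimes> t)\<close>.\<close>

definition qc :: "'u ring \<Rightarrow> 'u alg \<Rightarrow> ('u, 'u) mfunc" where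
  "qc K A = \<lparr>
     Ob = (\<lambda>S. (tens K A S)\<lparr>smult := (\<lambda>s x. pure_tens K A S \<one>\<^bsub>A\<^esub> s \<otimes>\<^bsub>tens K A S\<^esub> x)\<rparr>),
     Ar = (\<lambda>S T f. tens_map K A S A T id f)\<rparr>"

text \<open>A quotient is a pointwise surjective morphism of functors of algebras.\<close>

definition qc_quotients :: "'u ring \<Rightarrow> ('u, 'a) mfunc \<Rightarrow> ('u alg \<times> ('u alg \<Rightarrow> 'a \<Rightarrow> 'u)) set" where
  "qc_quotients K B = {(A, p). assoc_algebra K A \<and> carrier A \<prec> (UNIV :: 'u set) \<and>
     p \<in> Alg_mor K B (qc K A) \<and>
     (\<forall>S\<in>CAlg K. p S ` carrier (Ob B S) = carrier (Ob (qc K A) S))}"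

definition qc_limit :: "'u ring \<Rightarrow> ('u, 'a) mfunc \<Rightarrow> 'u alg \<Rightarrow>
    ('u alg \<times> ('u alg \<Rightarrow> 'a \<Rightarrow> 'u) \<Rightarrow> 'u) set" where
  "qc_limit K B S = {x \<in> (\<Pi>\<^sub>E i\<in>qc_quotients K B. carrier (Ob (qc K (fst i)) S)).
     \<forall>(A, p)\<in>qc_quotients K B. \<forall>(A', p')\<in>qc_quotients K B. \<forall>\<psi>\<in>Alg_mor K (qc K A) (qc K A').
       (\<forall>T\<in>CAlg K. \<forall>b\<in>carrier (Ob B T). \<psi> T (p T b) = p' T b) \<longrightarrow> \<psi> S (x (A, p)) = x (A', p')}"

definition pro_quasicoherent :: "'u ring \<Rightarrow> ('u, 'a) mfunc \<Rightarrow> bool" where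
  "pro_quasicoherent K B \<longleftrightarrow> alg_functor K B \<and>
     (\<forall>S\<in>CAlg K. bij_betw (\<lambda>b. \<lambda>(A, p)\<in>qc_quotients K B. p S b)
        (carrier (Ob B S)) (qc_limit K B S))"


section \<open>The completed tensor product\<close>

definition ttensor :: "'u ring \<Rightarrow> ('u, 'a) mfunc \<Rightarrow> ('u, 'b) mfunc \<Rightarrow>
    ('u, ('u, (('u, 'a) nt \<times> ('u, 'b) nt \<Rightarrow>\<^sub>0 int) set) nt) mfunc" where
  "ttensor K M N = dual K (tensor_functor (dual K M) (dual K N))"

text \<open>The projection of the completed tensor product \<open>(B* \<otimes> C*)*\<close> to \<open>qc A \<otimes> qc A'\<close>, for quotients
  \<open>p : B \<rightarrow> qc A\<close> and \<open>q : C \<rightarrow> qc A'\<close>: the dual of \<open>p* \<otimes> q*\<close> goes to \<open>((qc A)* \<otimes> (qc A')*)*\<close>, which is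
  identified with \<open>qc A \<otimes> qc A'\<close> by \<^const>\<open>tensor_eval\<close>.\<close>

fun ttensor_proj :: "'u ring \<Rightarrow> ('u, 'a) mfunc \<Rightarrow> ('u, 'b) mfunc \<Rightarrow>
    'u alg \<times> ('u alg \<Rightarrow> 'a \<Rightarrow> 'u) \<Rightarrow> 'u alg \<times> ('u alg \<Rightarrow> 'b \<Rightarrow> 'u) \<Rightarrow> 'u alg \<Rightarrow>
    ('u, (('u, 'a) nt \<times> ('u, 'b) nt \<Rightarrow>\<^sub>0 int) set) nt \<Rightarrow> ('u \<times> 'u \<Rightarrow>\<^sub>0 int) set" where
  "ttensor_proj K B C (A, p) (A', q) S \<omega> =
     inv_into (carrier (Ob (tensor_functor (qc K A) (qc K A')) S))
       (tensor_eval K (qc K A) (qc K A') S)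
       (dual_map K (tensor_functor (dual K (qc K A)) (dual K (qc K A')))
          (tensor_functor (dual K B) (dual K C))
          (\<lambda>T. tensor_map T (Ob (dual K B) T) (Ob (dual K C) T)
             (map_prod (dual_map K B (qc K A) p T) (dual_map K C (qc K A') q T)))
          S \<omega>)"

text \<open>The completed tensor product is the inverse limit of the \<open>qc A \<otimes> qc A'\<close> along these projections,
  whence its algebra structure: the one for which they all are homomorphisms.\<close>

definition ttensor_alg :: "'u ring \<Rightarrow> ('u, 'a) mfunc \<Rightarrow> ('u, 'b) mfunc \<Rightarrow>
    ('u, ('u, (('u, 'a) nt \<times> ('u, 'b) nt \<Rightarrow>\<^sub>0 int) set) nt) mfunc" where
  "ttensor_alg K B C = (ttensor K B C)\<lparr>Ob := (\<lambda>S. (Ob (ttensor K B C) S)\<lparr>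
     monoid.mult := (\<lambda>\<omega> \<omega>'. THE \<omega>''. \<omega>'' \<in> carrier (Ob (ttensor K B C) S) \<and>
       (\<forall>i\<in>qc_quotients K B. \<forall>j\<in>qc_quotients K C.
          ttensor_proj K B C i j S \<omega>'' =
            ttensor_proj K B C i j S \<omega>
            \<otimes>\<^bsub>Ob (tensor_functor (qc K (fst i)) (qc K (fst j))) S\<^esub>
            ttensor_proj K B C i j S \<omega>')),
     one := (THE \<omega>. \<omega> \<in> carrier (Ob (ttensor K B C) S) \<and>
       (\<forall>i\<in>qc_quotients K B. \<forall>j\<in>qc_quotients K C.
          ttensor_proj K B C i j S \<omega> =
            \<one>\<^bsub>Ob (tensor_functor (qc K (fst i)) (qc K (fst j))) S\<^esub>))\<rparr>)\<rparr>"


section \<open>Functors of commutative bialgebras\<close>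

text \<open>The algebra structures on \<open>B\<close> and on its dual are both part of the data.\<close>

record 'u bialg =
  Alg :: "('u, 'u) mfunc"
  dmult :: "'u alg \<Rightarrow> ('u, 'u) nt \<Rightarrow> ('u, 'u) nt \<Rightarrow> ('u, 'u) nt"
  dunit :: "'u alg \<Rightarrow> ('u, 'u) nt"

definition dual_alg :: "'u ring \<Rightarrow> 'u bialg \<Rightarrow> ('u, ('u, 'u) nt) mfunc" where
  "dual_alg K B = (dual K (Alg B))\<lparr>Ob := (\<lambda>S. (Ob (dual K (Alg B)) S)\<lparr>
     monoid.mult := dmult B S, one := dunit B S\<rparr>)\<rparr>"

text \<open>The dual morphism of the multiplication \<open>B* \<otimes> B* \<rightarrow> B*\<close>, and the dual morphism of the unit
  \<open>Rfun \<rightarrow> B*\<close> followed by the identification of the dual of \<open>Rfun\<close> with \<open>Rfun\<close>.\<close>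

definition comult :: "'u ring \<Rightarrow> 'u bialg \<Rightarrow> 'u alg \<Rightarrow> 'u \<Rightarrow>
    ('u, (('u, 'u) nt \<times> ('u, 'u) nt \<Rightarrow>\<^sub>0 int) set) nt" where
  "comult K B = (\<lambda>S\<in>CAlg K. \<lambda>b\<in>carrier (Ob (Alg B) S).
     dual_map K (tensor_functor (dual K (Alg B)) (dual K (Alg B))) (dual K (Alg B))
       (\<lambda>T. tensor_lift (Ob (dual_alg K B) T) (\<lambda>(\<alpha>, \<beta>). \<alpha> \<otimes>\<^bsub>Ob (dual_alg K B) T\<^esub> \<beta>))
       S (bidual K (Alg B) S b))"

definition counit :: "'u ring \<Rightarrow> 'u bialg \<Rightarrow> 'u alg \<Rightarrow> 'u \<Rightarrow> 'u" where
  "counit K B = (\<lambda>S\<in>CAlg K. \<lambda>b\<in>carrier (Ob (Alg B) S).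
     dual_map K Rfun (dual K (Alg B))
       (\<lambda>T t. t \<odot>\<^bsub>Ob (dual_alg K B) T\<^esub> \<one>\<^bsub>Ob (dual_alg K B) T\<^esub>)
       S (bidual K (Alg B) S b) (S, idm S) \<one>\<^bsub>S\<^esub>)"

definition bialgebra :: "'u ring \<Rightarrow> 'u bialg \<Rightarrow> bool" where
  "bialgebra K B \<longleftrightarrow> reflexive K (Alg B) \<and> pro_quasicoherent K (Alg B) \<and>
     alg_functor K (dual_alg K B) \<and>
     comult K B \<in> Alg_mor K (Alg B) (ttensor_alg K (Alg B) (Alg B)) \<and>
     counit K B \<in> Alg_mor K (Alg B) Rfun"

definition comm_bialgebra :: "'u ring \<Rightarrow> 'u bialg \<Rightarrow> bool" where
  "comm_bialgebra K B \<longleftrightarrow> bialgebra K B \<and> (\<forall>S\<in>CAlg K. cring (Ob (Alg B) S))"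

definition bialg_mor :: "'u ring \<Rightarrow> 'u bialg \<Rightarrow> 'u bialg \<Rightarrow> ('u alg \<Rightarrow> 'u \<Rightarrow> 'u) set" where
  "bialg_mor K B B' = {f \<in> Alg_mor K (Alg B) (Alg B').
     dual_map K (Alg B) (Alg B') f \<in> Alg_mor K (dual_alg K B') (dual_alg K B)}"


section \<open>Affine functors of monoids\<close>

definition Spec :: "'u ring \<Rightarrow> ('u, 'a) mfunc \<Rightarrow>
    ('u, 'u alg \<Rightarrow> 'a \<Rightarrow> 'u, ('u alg \<Rightarrow> 'a \<Rightarrow> 'u) partial_object) func" where
  "Spec K A = \<lparr>Ob = (\<lambda>S. \<lparr>carrier = Alg_mor K A (qc K S)\<rparr>),
     Ar = (\<lambda>S T h \<phi>. \<lambda>R\<in>CAlg K. \<lambda>a\<in>carrier (Ob A R). tens_map K S R T R h id (\<phi> R a))\<rparr>"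

text \<open>The natural morphism from \<open>X\<close> to the spectrum of its functions: a point \<open>x \<in> X(S)\<close> and a function
  \<open>\<theta>\<close> over \<open>R\<close> have images over \<open>S \<otimes>\<^sub>K R\<close>, the value of the latter at the former being in \<open>S \<otimes>\<^sub>K R\<close>.\<close>

definition to_Spec :: "'u ring \<Rightarrow> ('u, 'a, ('a, 'z) partial_object_scheme) func \<Rightarrow> 'u alg \<Rightarrow> 'a \<Rightarrow>
    'u alg \<Rightarrow> ('u, 'a) nt \<Rightarrow> 'u" where
  "to_Spec K X S x = (\<lambda>R\<in>CAlg K. \<lambda>\<theta>\<in>carrier (Ob (fun_functor K X) R).
     \<theta> (tens K S R, \<lambda>r\<in>carrier R. pure_tens K S R \<one>\<^bsub>S\<^esub> r)
       (Ar X S (tens K S R) (\<lambda>s\<in>carrier S. pure_tens K S R s \<one>\<^bsub>R\<^esub>) x))"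

definition affine :: "'u ring \<Rightarrow> ('u, 'a, ('a, 'z) partial_object_scheme) func \<Rightarrow> bool" where
  "affine K X \<longleftrightarrow> set_functor K X \<and> small_functor K X \<and> reflexive K (fun_functor K X) \<and>
     (\<forall>S\<in>CAlg K. bij_betw (to_Spec K X S) (carrier (Ob X S))
        (carrier (Ob (Spec K (fun_functor K X)) S)))"

type_synonym 'u monfunc = "('u, 'u, 'u monoid) func"

definition monoid_functor :: "'u ring \<Rightarrow> 'u monfunc \<Rightarrow> bool" where
  "monoid_functor K X \<longleftrightarrow> set_functor K X \<and> (\<forall>S\<in>CAlg K. monoid (Ob X S)) \<and>
     (\<forall>S\<in>CAlg K. \<forall>T\<in>CAlg K. \<forall>f\<in>alg_hom K S T.
        Ar X S T f \<in> hom (Ob X S) (Ob X T) \<and> Ar X S T f \<one>\<^bsub>Ob X S\<^esub> = \<one>\<^bsub>Ob X T\<^esub>)"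

definition Mon_mor :: "'u ring \<Rightarrow> 'u monfunc \<Rightarrow> 'u monfunc \<Rightarrow> ('u alg \<Rightarrow> 'u \<Rightarrow> 'u) set" where
  "Mon_mor K X Y = {\<phi> \<in> Mor K X Y. \<forall>S\<in>CAlg K.
     \<phi> S \<in> hom (Ob X S) (Ob Y S) \<and> \<phi> S \<one>\<^bsub>Ob X S\<^esub> = \<one>\<^bsub>Ob Y S\<^esub>}"


section \<open>Categories and anti-equivalence\<close>

text \<open>\<open>Comp C x y z g f\<close> is the composite \<open>g \<circ> f\<close> of \<open>f : x \<rightarrow> y\<close> and \<open>g : y \<rightarrow> z\<close>.\<close>

record ('o, 'm) cat =
  Obj :: "'o set"
  Hom :: "'o \<Rightarrow> 'o \<Rightarrow> 'm set"
  Idt :: "'o \<Rightarrow> 'm"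
  Comp :: "'o \<Rightarrow> 'o \<Rightarrow> 'o \<Rightarrow> 'm \<Rightarrow> 'm \<Rightarrow> 'm"

definition is_category :: "('o, 'm) cat \<Rightarrow> bool" where
  "is_category C \<longleftrightarrow>
     (\<forall>x\<in>Obj C. Idt C x \<in> Hom C x x) \<and>
     (\<forall>x\<in>Obj C. \<forall>y\<in>Obj C. \<forall>z\<in>Obj C. \<forall>f\<in>Hom C x y. \<forall>g\<in>Hom C y z. Comp C x y z g f \<in> Hom C x z) \<and>
     (\<forall>x\<in>Obj C. \<forall>y\<in>Obj C. \<forall>f\<in>Hom C x y.
        Comp C x x y f (Idt C x) = f \<and> Comp C x y y (Idt C y) f = f) \<and>
     (\<forall>w\<in>Obj C. \<forall>x\<in>Obj C. \<forall>y\<in>Obj C. \<forall>z\<in>Obj C. \<forall>f\<in>Hom C w x. \<forall>g\<in>Hom C x y. \<forall>h\<in>Hom C y z.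
        Comp C w y z h (Comp C w x y g f) = Comp C w x z (Comp C x y z h g) f)"

definition opposite :: "('o, 'm) cat \<Rightarrow> ('o, 'm) cat" where
  "opposite C = \<lparr>Obj = Obj C, Hom = (\<lambda>x y. Hom C y x), Idt = Idt C,
     Comp = (\<lambda>x y z g f. Comp C z y x f g)\<rparr>"

definition is_functor :: "('o, 'm) cat \<Rightarrow> ('p, 'n) cat \<Rightarrow> ('o \<Rightarrow> 'p) \<Rightarrow> ('o \<Rightarrow> 'o \<Rightarrow> 'm \<Rightarrow> 'n) \<Rightarrow> bool" where
  "is_functor C D Fo Fm \<longleftrightarrow>
     (\<forall>x\<in>Obj C. Fo x \<in> Obj D \<and> Fm x x (Idt C x) = Idt D (Fo x)) \<and>
     (\<forall>x\<in>Obj C. \<forall>y\<in>Obj C. \<forall>f\<in>Hom C x y. Fm x y f \<in> Hom D (Fo x) (Fo y)) \<and>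
     (\<forall>x\<in>Obj C. \<forall>y\<in>Obj C. \<forall>z\<in>Obj C. \<forall>f\<in>Hom C x y. \<forall>g\<in>Hom C y z.
        Fm x z (Comp C x y z g f) = Comp D (Fo x) (Fo y) (Fo z) (Fm y z g) (Fm x y f))"

definition iso_in :: "('o, 'm) cat \<Rightarrow> 'o \<Rightarrow> 'o \<Rightarrow> 'm \<Rightarrow> bool" where
  "iso_in C x y f \<longleftrightarrow> f \<in> Hom C x y \<and>
     (\<exists>g\<in>Hom C y x. Comp C x y x g f = Idt C x \<and> Comp C y x y f g = Idt C y)"

text \<open>Natural isomorphism from an endofunctor to the identity functor.\<close>

definition iso_to_identity :: "('o, 'm) cat \<Rightarrow> ('o \<Rightarrow> 'o) \<Rightarrow> ('o \<Rightarrow> 'o \<Rightarrow> 'm \<Rightarrow> 'm) \<Rightarrow> bool" where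
  "iso_to_identity C Eo Em \<longleftrightarrow> (\<exists>\<tau>.
     (\<forall>x\<in>Obj C. iso_in C (Eo x) x (\<tau> x)) \<and>
     (\<forall>x\<in>Obj C. \<forall>y\<in>Obj C. \<forall>f\<in>Hom C x y.
        Comp C (Eo x) (Eo y) y (\<tau> y) (Em x y f) = Comp C (Eo x) x y f (\<tau> x)))"

definition equivalent :: "('o, 'm) cat \<Rightarrow> ('p, 'n) cat \<Rightarrow> bool" where
  "equivalent C D \<longleftrightarrow> is_category C \<and> is_category D \<and> (\<exists>Fo Fm Go Gm.
     is_functor C D Fo Fm \<and> is_functor D C Go Gm \<and>
     iso_to_identity C (\<lambda>x. Go (Fo x)) (\<lambda>x y f. Gm (Fo x) (Fo y) (Fm x y f)) \<and>
     iso_to_identity D (\<lambda>x. Fo (Go x)) (\<lambda>x y f. Fm (Go x) (Go y) (Gm x y f)))"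

definition anti_equivalent :: "('o, 'm) cat \<Rightarrow> ('p, 'n) cat \<Rightarrow> bool" where
  "anti_equivalent C D \<longleftrightarrow> equivalent (opposite C) D"

definition AffineMonoids :: "'u ring \<Rightarrow> ('u monfunc, 'u alg \<Rightarrow> 'u \<Rightarrow> 'u) cat" where
  "AffineMonoids K = \<lparr>Obj = {X. affine K X \<and> monoid_functor K X},
     Hom = Mon_mor K,
     Idt = (\<lambda>X. \<lambda>S\<in>CAlg K. idm (Ob X S)),
     Comp = (\<lambda>X Y Z \<psi> \<phi>. \<lambda>S\<in>CAlg K. compose (carrier (Ob X S)) (\<psi> S) (\<phi> S))\<rparr>"

definition CommBialgebras :: "'u ring \<Rightarrow> ('u bialg, 'u alg \<Rightarrow> 'u \<Rightarrow> 'u) cat" where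
  "CommBialgebras K = \<lparr>Obj = {B. comm_bialgebra K B},
     Hom = bialg_mor K,
     Idt = (\<lambda>B. \<lambda>S\<in>CAlg K. idm (Ob (Alg B) S)),
     Comp = (\<lambda>A B C g f. \<lambda>S\<in>CAlg K. compose (carrier (Ob (Alg A) S)) (g S) (f S))\<rparr>"

end

theory Submission
  imports Defs
begin

text \<open>
  Let \<open>X\<close> be an affine functor and \<open>B\<close> its functor of functions; the points of \<open>X\<close> over \<open>S\<close> are the
  characters of \<open>B\<close> over \<open>S\<close>.  Over a field, functionals separate the elements of tensor products,
  so the image of a morphism from a reflexive functor to a quasi-coherent algebra is quasi-coherent.
  Hence every point over \<open>T\<close> comes along an injection \<open>A \<rightarrow> T\<close> from a quasi-coherent quotient \<open>qc K A\<close> of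
  \<open>B\<close>, and a reflexive functor of commutative algebras is the limit of its quasi-coherent quotients
  if and only if it consists of all functions on its functor of characters.  By reflexivity, a linear
  form on the dual of \<open>B\<close> is an element of \<open>B\<close>, so it vanishes if it vanishes at the points.  Thus the
  completed tensor product of \<open>B\<close> with itself is the algebra of functions on \<open>X \<times> X\<close>, a multiplication
  on \<open>X\<close> extends uniquely to the dual of \<open>B\<close> by convolution, and the comultiplication of \<open>B\<close> is
  multiplicative if and only if products of characters are characters.
\<close>

text \<open>Both directions rest on one device: an evaluation \<open>ev S x b\<close> of points
  against elements of \<open>B\<close>. In the locale \<open>char_pairing\<close> the points are all
  characters of \<open>B\<close>; in \<open>pairing\<close>, \<open>B\<close> is moreover all
  functions on the points. Quotients and the completed tensor product are studied for an arbitrary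
  pairing, which applies both to the functions on an affine functor and to the characters of a
  bialgebra. This detour is forced by size: functions and characters live in types above
  \<open>'u\<close>, while the objects of both categories take values in \<open>'u\<close>. Only
  copies along arbitrarily chosen injections are available, and no construction is literally inverse
  to another. For the same reason the equivalence is read off from a relation, adjointness with
  respect to the evaluations, instead of from formulas for two functors. The field enters through
  functionals that kill a subspace and are 1 at a given vector outside it; they replace bases and
  flatness. Uncountability of \<open>'u\<close> enters through cardinality: tensor products are
  quotients of free abelian groups, whose integer coefficients must not leave the small
  sets.\<close>

abbreviation (input) plus_in ("(_ +[_]/ _)" [65, 0, 66] 65) where "x +[R] y \<equiv> add R x y"
abbreviation (input) times_in ("(_ *[_]/ _)" [70, 0, 71] 70) where "x *[R] y \<equiv> monoid.mult R x y"
abbreviation (input) smult_in ("(_ \<cdot>[_]/ _)" [70, 0, 71] 70) where "r \<cdot>[M] x \<equiv> smult M r x"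
abbreviation (input) one_in ("1[_]") where "1[R] \<equiv> one R"
abbreviation (input) zero_in ("0[_]") where "0[R] \<equiv> ring.zero R"
abbreviation (input) comp_on ("(_ o[_]/ _)" [56, 0, 55] 55) where "g o[S] f \<equiv> compose (carrier S) g f"
abbreviation (input) elements (infixl "$" 90) where "F $ S \<equiv> carrier (Ob F S)"

section \<open>Tensor products of modules\<close>

text \<open>On the target only an addition is used, so scalars appear as balancedness and not as
  linearity. Linearity over \<open>R\<close>, where it holds, is recovered later by induction on
  pure tensors.\<close>

definition bilin :: "('r, 'y) ring_scheme => ('r, 'a) module => ('r, 'b) module =>
    ('c, 'z) ring_scheme => ('a \<times> 'b => 'c) => bool" where
  "bilin R M N P h \<longleftrightarrow>
     (\<forall>m\<in>carrier M. \<forall>n\<in>carrier N. h (m, n) \<in> carrier P) \<and>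
     (\<forall>m\<in>carrier M. \<forall>m'\<in>carrier M. \<forall>n\<in>carrier N. h (m +[M] m', n) = h (m, n) +[P] h (m', n)) \<and>
     (\<forall>m\<in>carrier M. \<forall>n\<in>carrier N. \<forall>n'\<in>carrier N. h (m, n +[N] n') = h (m, n) +[P] h (m, n')) \<and>
     (\<forall>r\<in>carrier R. \<forall>m\<in>carrier M. \<forall>n\<in>carrier N. h (r \<cdot>[M] m, n) = h (m, r \<cdot>[N] n))"

lemma bilinI:
  assumes "\<And>m n. m \<in> carrier M ==> n \<in> carrier N ==> h (m, n) \<in> carrier P"
    and "\<And>m m' n. m \<in> carrier M ==> m' \<in> carrier M ==> n \<in> carrier N ==>
    h (m +[M] m', n) = h (m, n) +[P] h (m', n)"
    and "\<And>m n n'. m \<in> carrier M ==> n \<in> carrier N ==> n' \<in> carrier N ==>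
    h (m, n +[N] n') = h (m, n) +[P] h (m, n')"
    and "\<And>r m n. r \<in> carrier R ==> m \<in> carrier M ==> n \<in> carrier N ==>
    h (r \<cdot>[M] m, n) = h (m, r \<cdot>[N] n)"
  shows "bilin R M N P h"
  using assms by (auto simp: bilin_def)

definition ptens :: "('r, 'y) ring_scheme => ('r, 'a) module => ('r, 'b) module => 'a => 'b =>
    ('a \<times> 'b \<Rightarrow>\<^sub>0 int) set" where
  "ptens R M N m n = tensor_class R M N (frag_of (m, n))"

text \<open>The additive extension of \<open>h\<close> to the free abelian group, separated from the
  representative chosen in \<open>tensor_lift\<close>: well-definedness becomes vanishing of
  \<open>frag_sum P h\<close> on \<open>tensor_rel\<close>.\<close>

definition frag_sum :: "('c, 'z) ring_scheme => ('a => 'c) => ('a \<Rightarrow>\<^sub>0 int) => 'c" where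
  "frag_sum P h x = (\<Oplus>\<^bsub>P\<^esub>p\<in>Poly_Mapping.keys x. [Poly_Mapping.lookup x p] \<cdot>\<^bsub>P\<^esub> h p)"

lemma tensor_lift_frag_sum: "tensor_lift P h X = frag_sum P h (rep X)"
  by (simp add: tensor_lift_def frag_sum_def)

lemma lookup_notin: "p \<notin> Poly_Mapping.keys x ==> Poly_Mapping.lookup x p = 0"
  by (simp add: in_keys_iff)

lemma (in abelian_group) add_int_pow_simps:
  assumes "x \<in> carrier G"
  shows "add_pow G (n::int) x \<in> carrier G" "add_pow G (0::int) x = \<zero>" "add_pow G (1::int) x = x"
    "add_pow G (m + n) x = add_pow G m x \<oplus> add_pow G n x"
  using assms group.int_pow_closed[OF a_group, of x n] group.int_pow_mult[OF a_group, of x m n]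
    group.int_pow_1[OF a_group, of x] by (simp_all add: add_pow_def)

context
  fixes P :: "('c, 'z) ring_scheme" and h :: "'a => 'c" and S :: "'a set"
  assumes P: "abelian_group P" and h: "\<And>p. p \<in> S ==> h p \<in> carrier P"
begin

interpretation P: abelian_group P by (fact P)

text \<open>Coefficients outside the support vanish. A common index set is needed for sums, because
  cancellation can make the support of \<open>x + y\<close> smaller than the union of the two
  supports.\<close>

lemma frag_sum_superset:
  assumes "finite I" "Poly_Mapping.keys x \<subseteq> I" "I \<subseteq> S"
  shows "frag_sum P h x = (\<Oplus>\<^bsub>P\<^esub>p\<in>I. [Poly_Mapping.lookup x p] \<cdot>\<^bsub>P\<^esub> h p)"
  unfolding frag_sum_def
  apply (rule P.add.finprod_mono_neutral_cong_left)
  using assms h by (auto simp: lookup_notin P.add_int_pow_simps)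

lemma frag_sum_closed: "Poly_Mapping.keys x \<subseteq> S ==> frag_sum P h x \<in> carrier P"
  unfolding frag_sum_def using h by (intro P.finsum_closed) (auto simp: P.add_int_pow_simps)

lemma frag_sum_add:
  assumes "Poly_Mapping.keys x \<subseteq> S" "Poly_Mapping.keys y \<subseteq> S"
  shows "frag_sum P h (x + y) = frag_sum P h x +[P] frag_sum P h y"
proof -
  let ?I = "Poly_Mapping.keys x \<union> Poly_Mapping.keys y"
  have I: "finite ?I" "?I \<subseteq> S" using assms by auto
  have k: "Poly_Mapping.keys (x + y) \<subseteq> ?I" by (rule keys_add)
  have hI: "\<And>p. p \<in> ?I ==> h p \<in> carrier P" using I h by auto
  show ?thesis
    unfolding frag_sum_superset[OF I(1) k I(2)] frag_sum_superset[OF I(1) Un_upper1 I(2)]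
      frag_sum_superset[OF I(1) Un_upper2 I(2)]
    by (subst P.finsum_addf[symmetric])
      (use hI in \<open>auto simp: lookup_add P.add_int_pow_simps simp del: P.finsum_addf
        intro!: P.finsum_cong'\<close>)
qed

lemma frag_sum_zero: "frag_sum P h 0 = 0[P]"
  by (simp add: frag_sum_def)

lemma frag_sum_of: "p \<in> S ==> frag_sum P h (frag_of p) = h p"
  using h by (simp add: frag_sum_def keys_frag_of P.add_int_pow_simps)

lemma frag_sum_uminus:
  assumes "Poly_Mapping.keys x \<subseteq> S"
  shows "frag_sum P h (- x) = \<ominus>\<^bsub>P\<^esub> frag_sum P h x"
proof -
  have "frag_sum P h x +[P] frag_sum P h (- x) = 0[P]"
    using frag_sum_add[of x "- x"] assms by (simp add: frag_sum_zero)
  then show ?thesis using assms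
    by (metis P.minus_equality P.a_comm frag_sum_closed keys_minus)
qed

lemma frag_sum_diff:
  assumes "Poly_Mapping.keys x \<subseteq> S" "Poly_Mapping.keys y \<subseteq> S"
  shows "frag_sum P h (x - y) = frag_sum P h x \<ominus>\<^bsub>P\<^esub> frag_sum P h y"
  using frag_sum_add[of x "- y"] frag_sum_uminus[of y] assms by (simp add: a_minus_def)

end

locale two_modules = M: module R M + N: module R N
  for R :: "('r, 'y) ring_scheme" and M :: "('r, 'a) module" and N :: "('r, 'b) module"
begin

abbreviation "F \<equiv> free_Abelian_group (carrier M \<times> carrier N)"
abbreviation "T \<equiv> tensor R M N"
abbreviation "cls \<equiv> tensor_class R M N"
abbreviation "rel \<equiv> tensor_rel R M N"

abbreviation "gens \<equiv> {frag_of (m +[M] m', n) - frag_of (m, n) - frag_of (m', n) | m m' n.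
       m \<in> carrier M \<and> m' \<in> carrier M \<and> n \<in> carrier N} \<union>
    {frag_of (m, n +[N] n') - frag_of (m, n) - frag_of (m, n') | m n n'.
       m \<in> carrier M \<and> n \<in> carrier N \<and> n' \<in> carrier N} \<union>
    {frag_of (r \<cdot>[M] m, n) - frag_of (m, r \<cdot>[N] n) | r m n.
       r \<in> carrier R \<and> m \<in> carrier M \<and> n \<in> carrier N}"

lemma rel_gens: "rel = generate F gens"
  by (simp add: tensor_rel_def)

interpretation F: comm_group F by (rule abelian_free_Abelian_group)

lemma keys_diff_of:
  assumes "p \<in> S" "q \<in> S"
  shows "Poly_Mapping.keys (frag_of p - frag_of q) \<subseteq> S"
  using assms keys_diff[of "frag_of p" "frag_of q"] by (auto simp: keys_frag_of)

lemma keys_diff2_of: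
  assumes "p \<in> S" "q \<in> S" "r \<in> S"
  shows "Poly_Mapping.keys (frag_of p - frag_of q - frag_of r) \<subseteq> S"
  using assms keys_diff_of[of p S q] keys_diff[of "frag_of p - frag_of q" "frag_of r"]
  by (auto simp: keys_frag_of)

lemma rel_subgroup: "subgroup rel F"
  unfolding tensor_rel_def
  apply (rule F.generate_is_subgroup)
  unfolding subset_eq Un_iff Ball_def
  apply safe
  by (simp_all only: carrier_free_Abelian_group_iff, (rule keys_diff_of keys_diff2_of; simp)+)

lemma rel_normal: "rel \<lhd> F"
  using rel_subgroup F.normal_iff_subgroup by blast

lemma rel_subset: "x \<in> rel ==> x \<in> carrier F"
  using subgroup.subset[OF rel_subgroup] by blast

lemma cls_eq_iff:
  assumes "x \<in> carrier F" "y \<in> carrier F"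
  shows "cls x = cls y \<longleftrightarrow> x - y \<in> rel"
proof
  assume "cls x = cls y"
  then have "x \<in> cls y"
    using F.rcos_self[OF assms(1) rel_subgroup] by (simp add: tensor_class_def)
  then show "x - y \<in> rel" by (auto simp: tensor_class_def r_coset_def)
next
  assume "x - y \<in> rel"
  then have "x \<in> cls y"
    by (force simp: tensor_class_def r_coset_def)
  then show "cls x = cls y"
    using F.repr_independence[OF _ assms(2) rel_subgroup] by (simp add: tensor_class_def)
qed

lemma carrier_tensor: "carrier T = cls ` carrier F"
  by (auto simp: tensor_def tensor_group_def FactGroup_def RCOSETS_def tensor_class_def)

lemma cls_closed: "x \<in> carrier F ==> cls x \<in> carrier T"
  by (simp add: carrier_tensor del: carrier_free_Abelian_group_iff)

lemma rep_cls:
  assumes "X \<in> carrier T"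
  shows "rep X \<in> carrier F" "cls (rep X) = X"
proof -
  obtain x where x: "x \<in> carrier F" "X = cls x" using assms carrier_tensor by auto
  have "x \<in> X" using F.rcos_self[OF x(1) rel_subgroup] x(2) by (simp add: tensor_class_def)
  then have "rep X \<in> X" unfolding rep_def by (rule someI)
  then have "rep X \<in> cls x" using x by simp
  then obtain r where "r \<in> rel" "rep X = r + x" by (auto simp: tensor_class_def r_coset_def)
  then show 1: "rep X \<in> carrier F"
    using F.m_closed[OF rel_subset x(1)] by simp
  show "cls (rep X) = X"
    using x cls_eq_iff[OF 1 x(1)] \<open>r \<in> rel\<close> \<open>rep X = r + x\<close> by simp
qed

lemma add_cls: "x \<in> carrier F ==> y \<in> carrier F ==> cls x +[T] cls y = cls (x + y)"
  using normal.rcos_sum[OF rel_normal, of x y]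
  by (simp add: tensor_def tensor_group_def FactGroup_def tensor_class_def)

lemma zero_cls: "0[T] = cls 0"
  using F.coset_mult_one[of rel] subgroup.subset[OF rel_subgroup]
  by (simp add: tensor_def tensor_group_def FactGroup_def tensor_class_def)

lemma abelian_group_tensor: "abelian_group T"
proof -
  have "comm_group (tensor_group R M N)"
    unfolding tensor_group_def using F.abelian_FactGroup[OF rel_subgroup] .
  then interpret G: comm_group "tensor_group R M N" .
  have [simp]: "carrier T = carrier (tensor_group R M N)" "add T = monoid.mult (tensor_group R M N)"
    "0[T] = 1[tensor_group R M N]" by (simp_all add: tensor_def)
  show ?thesis
    by (rule abelian_groupI) (simp_all add: G.m_assoc, simp_all add: G.m_comm G.l_inv_ex)
qed

interpretation T: abelian_group T by (rule abelian_group_tensor)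

lemma ptens_closed: "m \<in> carrier M ==> n \<in> carrier N ==> ptens R M N m n \<in> carrier T"
  unfolding ptens_def by (rule cls_closed) simp

lemma cls_eqI3:
  assumes "x \<in> carrier F" "y \<in> carrier F" "z \<in> carrier F" "x - y - z \<in> rel"
  shows "cls x = cls y +[T] cls z"
proof -
  have "y + z \<in> carrier F" using F.m_closed assms by simp
  then show ?thesis unfolding add_cls[OF assms(2,3)] cls_eq_iff[OF assms(1) \<open>y + z \<in> carrier F\<close>]
    using assms(4) by (simp add: diff_diff_eq)
qed

lemma ptens_bilin: "bilin R M N T (\<lambda>(m, n). ptens R M N m n)"
proof (rule bilinI, goal_cases)
  case (1 m n) then show ?case by (simp add: ptens_closed)
next
  case (2 m m' n)
  show ?case unfolding ptens_def prod.case
    apply (rule cls_eqI3) using 2 apply (simp_all add: keys_frag_of)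
    unfolding tensor_rel_def by (rule generate.incl) blast
next
  case (3 m n n')
  show ?case unfolding ptens_def prod.case
    apply (rule cls_eqI3) using 3 apply (simp_all add: keys_frag_of)
    unfolding tensor_rel_def by (rule generate.incl) blast
next
  case (4 r m n)
  show ?case unfolding ptens_def prod.case
    apply (subst cls_eq_iff) using 4 apply (simp_all add: keys_frag_of)
    unfolding tensor_rel_def by (rule generate.incl) blast
qed

lemma cls_uminus: "x \<in> carrier F ==> cls (- x) = \<ominus>\<^bsub>T\<^esub> cls x"
proof -
  assume x: "x \<in> carrier F"
  then have "- x \<in> carrier F" by simp
  then have "cls (- x) +[T] cls x = 0[T]" using add_cls[of "- x" x] x by (simp add: zero_cls)
  then show ?thesis using cls_closed \<open>- x \<in> carrier F\<close> x by (metis T.minus_equality)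
qed

lemma ptens_uminus:
  "m \<in> carrier M ==> n \<in> carrier N ==> \<ominus>\<^bsub>T\<^esub> ptens R M N m n = ptens R M N (\<ominus>\<^bsub>M\<^esub> m) n"
proof -
  assume mn: "m \<in> carrier M" "n \<in> carrier N"
  have *: "\<And>m m'. m \<in> carrier M ==> m' \<in> carrier M ==>
     ptens R M N (m +[M] m') n = ptens R M N m n +[T] ptens R M N m' n"
    using ptens_bilin mn by (simp add: bilin_def)
  have "ptens R M N 0[M] n +[T] ptens R M N 0[M] n = ptens R M N 0[M] n"
    using *[of "0[M]" "0[M]"] by simp
  then have "ptens R M N 0[M] n = 0[T]"
    using ptens_closed[of "0[M]" n] mn by (simp add: T.add.r_cancel_one)
  then have "ptens R M N (\<ominus>\<^bsub>M\<^esub> m) n +[T] ptens R M N m n = 0[T]"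
    using *[of "\<ominus>\<^bsub>M\<^esub> m" m] mn by (simp add: M.M.l_neg)
  then show ?thesis using ptens_closed mn by (metis T.minus_equality M.M.a_inv_closed)
qed

text \<open>Sums of pure tensors suffice, with no case for negatives or zero, because the sign of a
  pure tensor can be absorbed into its first factor.\<close>

lemma tensor_induct [consumes 1, case_names pure add]:
  assumes X: "X \<in> carrier T"
    and pure: "\<And>m n. m \<in> carrier M ==> n \<in> carrier N ==> Q (ptens R M N m n)"
    and add: "\<And>X Y. X \<in> carrier T ==> Y \<in> carrier T ==> Q X ==> Q Y ==> Q (X +[T] Y)"
  shows "Q X"
proof -
  have zero: "Q 0[T]"
  proof -
    have "0[T] = ptens R M N 0[M] 0[N] +[T] ptens R M N (\<ominus>\<^bsub>M\<^esub> 0[M]) 0[N]"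
      by (subst ptens_uminus[symmetric]) (simp_all add: T.r_neg ptens_closed)
    then show ?thesis using pure add ptens_closed
      by (metis M.M.a_inv_closed M.M.zero_closed N.M.zero_closed)
  qed
  obtain x where x: "Poly_Mapping.keys x \<subseteq> carrier M \<times> carrier N" "X = cls x"
    using X carrier_tensor by (auto)
  \<comment> \<open>The induction rule of the free abelian group builds elements by differences,
    hence the claim is carried for \<open>x\<close> and \<open>- x\<close> together.\<close>
  have "Q (cls x) \<and> Q (cls (- x))"
    using x(1)
  proof (rule free_Abelian_group_induct)
    show "Q (cls 0) \<and> Q (cls (- 0))" using zero by (simp add: zero_cls)
  next
    fix x y :: "'a \<times> 'b \<Rightarrow>\<^sub>0 int"
    assume k: "Poly_Mapping.keys x \<subseteq> carrier M \<times> carrier N" "Poly_Mapping.keys y \<subseteq> carrier M \<times> carrier N"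
      and Q: "Q (cls x) \<and> Q (cls (- x))" "Q (cls y) \<and> Q (cls (- y))"
    have "cls (x - y) = cls x +[T] cls (- y)" "cls (- (x - y)) = cls y +[T] cls (- x)"
      using k by (simp_all add: add_cls)
    then show "Q (cls (x - y)) \<and> Q (cls (- (x - y)))"
      using Q k add cls_closed by (simp del: minus_diff_eq)
  next
    fix p assume p: "p \<in> carrier M \<times> carrier N"
    then obtain m n where mn: "p = (m, n)" "m \<in> carrier M" "n \<in> carrier N" by auto
    have "cls (- frag_of p) = ptens R M N (\<ominus>\<^bsub>M\<^esub> m) n"
      using mn by (simp add: cls_uminus keys_frag_of ptens_uminus[symmetric]) (simp add: ptens_def)
    then show "Q (cls (frag_of p)) \<and> Q (cls (- frag_of p))"
      using pure mn by (simp add: ptens_def)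
  qed
  then show ?thesis using x by simp
qed

context
  fixes P :: "('c, 'z) ring_scheme" and h
  assumes P: "abelian_group P" and h: "bilin R M N P h"
begin

interpretation P: abelian_group P by (fact P)

lemma diff3: "x \<in> carrier P ==> y \<in> carrier P ==> (x +[P] y) \<ominus>\<^bsub>P\<^esub> x \<ominus>\<^bsub>P\<^esub> y = 0[P]"
  using P.a_comm[of x y] P.a_assoc[of y x "\<ominus>\<^bsub>P\<^esub> x"] by (simp add: a_minus_def P.r_neg)

lemma h_closed: "p \<in> carrier M \<times> carrier N ==> h p \<in> carrier P"
  using h by (auto simp: bilin_def)

lemmas fs = frag_sum_closed[OF P, of "carrier M \<times> carrier N" h, OF h_closed]
  frag_sum_add[OF P, of "carrier M \<times> carrier N" h, OF h_closed]
  frag_sum_of[OF P, of "carrier M \<times> carrier N" h, OF h_closed]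
  frag_sum_uminus[OF P, of "carrier M \<times> carrier N" h, OF h_closed]
  frag_sum_diff[OF P, of "carrier M \<times> carrier N" h, OF h_closed]
  frag_sum_zero[OF P, of "carrier M \<times> carrier N" h, OF h_closed]

lemma frag_sum_gens: "g \<in> gens ==> frag_sum P h g = 0[P]"
proof -
  assume "g \<in> gens"
  then consider m m' n where "g = frag_of (m +[M] m', n) - frag_of (m, n) - frag_of (m', n)"
       "m \<in> carrier M" "m' \<in> carrier M" "n \<in> carrier N"
    | m n n' where "g = frag_of (m, n +[N] n') - frag_of (m, n) - frag_of (m, n')"
       "m \<in> carrier M" "n \<in> carrier N" "n' \<in> carrier N"
    | r m n where "g = frag_of (r \<cdot>[M] m, n) - frag_of (m, r \<cdot>[N] n)"
       "r \<in> carrier R" "m \<in> carrier M" "n \<in> carrier N"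
    by blast
  then show "frag_sum P h g = 0[P]"
  proof cases
    case 1
    have "frag_sum P h g = h (m +[M] m', n) \<ominus>\<^bsub>P\<^esub> h (m, n) \<ominus>\<^bsub>P\<^esub> h (m', n)"
      unfolding 1(1) using 1(2-) by (simp add: fs keys_frag_of keys_diff_of)
    also have "\<dots> = (h (m, n) +[P] h (m', n)) \<ominus>\<^bsub>P\<^esub> h (m, n) \<ominus>\<^bsub>P\<^esub> h (m', n)"
      using 1(2-) h unfolding bilin_def by simp
    also have "\<dots> = 0[P]"
      by (rule diff3) (use 1(2-) h_closed in auto)
    finally show ?thesis .
  next
    case 2
    have "frag_sum P h g = h (m, n +[N] n') \<ominus>\<^bsub>P\<^esub> h (m, n) \<ominus>\<^bsub>P\<^esub> h (m, n')"
      unfolding 2(1) using 2(2-) by (simp add: fs keys_frag_of keys_diff_of)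
    also have "\<dots> = (h (m, n) +[P] h (m, n')) \<ominus>\<^bsub>P\<^esub> h (m, n) \<ominus>\<^bsub>P\<^esub> h (m, n')"
      using 2(2-) h unfolding bilin_def by simp
    also have "\<dots> = 0[P]"
      by (rule diff3) (use 2(2-) h_closed in auto)
    finally show ?thesis .
  next
    case 3
    have "frag_sum P h g = h (r \<cdot>[M] m, n) \<ominus>\<^bsub>P\<^esub> h (m, r \<cdot>[N] n)"
      unfolding 3(1) using 3(2-) by (simp add: fs keys_frag_of)
    also have "\<dots> = h (m, r \<cdot>[N] n) \<ominus>\<^bsub>P\<^esub> h (m, r \<cdot>[N] n)"
      using 3(2-) h unfolding bilin_def by simp
    also have "\<dots> = 0[P]"
      using 3 h_closed by (auto simp: a_minus_def P.r_neg)
    finally show ?thesis .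
  qed
qed

lemma frag_sum_rel: "x \<in> rel ==> frag_sum P h x = 0[P]"
  unfolding rel_gens
proof (induction rule: generate.induct)
  case one then show ?case by (simp add: fs)
next
  case (incl g) then show ?case by (rule frag_sum_gens)
next
  case (inv g)
  then have "Poly_Mapping.keys g \<subseteq> carrier M \<times> carrier N"
    using rel_subset[of g] generate.incl[OF inv, of F] by (simp add: rel_gens)
  then show ?case using frag_sum_gens[OF inv] by (simp add: fs)
next
  case (eng h1 h2)
  then have "Poly_Mapping.keys h1 \<subseteq> carrier M \<times> carrier N" "Poly_Mapping.keys h2 \<subseteq> carrier M \<times> carrier N"
    using rel_subset by (simp_all add: rel_gens)
  then show ?case using eng by (simp add: fs)
qed

text \<open>Independence of the representative: \<open>rep (cls x) - x\<close> lies in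
  \<open>rel\<close>, and bilinearity of \<open>h\<close> makes \<open>frag_sum\<close> vanish there
  (\<open>frag_sum_rel\<close>).\<close>

lemma tensor_lift_cls: "x \<in> carrier F ==> tensor_lift P h (cls x) = frag_sum P h x"
proof -
  assume x: "x \<in> carrier F"
  have r: "rep (cls x) \<in> carrier F" "cls (rep (cls x)) = cls x" using rep_cls[OF cls_closed[OF x]] by blast+
  then have "rep (cls x) - x \<in> rel" using cls_eq_iff x by blast
  then have "frag_sum P h (rep (cls x) - x) = 0[P]" by (rule frag_sum_rel)
  then have "frag_sum P h (rep (cls x)) \<ominus>\<^bsub>P\<^esub> frag_sum P h x = 0[P]"
    using fs(5) r(1) x by simp
  then show ?thesis
    using r x fs(1) P.r_neg P.minus_equality P.minus_minus
    by (metis carrier_free_Abelian_group_iff a_minus_def P.a_inv_closed tensor_lift_frag_sum)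
qed

lemma tensor_lift_closed: "X \<in> carrier T ==> tensor_lift P h X \<in> carrier P"
  using carrier_tensor tensor_lift_cls by (auto simp: fs)

lemma tensor_lift_add:
  "X \<in> carrier T ==> Y \<in> carrier T ==>
    tensor_lift P h (X +[T] Y) = tensor_lift P h X +[P] tensor_lift P h Y"
proof -
  assume "X \<in> carrier T" "Y \<in> carrier T"
  then obtain x y where xy: "x \<in> carrier F" "X = cls x" "y \<in> carrier F" "Y = cls y"
    using carrier_tensor by auto
  moreover have "x + y \<in> carrier F" using F.m_closed xy by simp
  ultimately show ?thesis by (simp add: add_cls tensor_lift_cls fs del: carrier_free_Abelian_group_iff) (simp add: fs)
qed

lemma tensor_lift_ptens:
  "m \<in> carrier M ==> n \<in> carrier N ==> tensor_lift P h (ptens R M N m n) = h (m, n)"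
  unfolding ptens_def by (simp add: tensor_lift_cls keys_frag_of fs)

end

text \<open>Scalar multiplication, products and \<open>tensor_map\<close> are all defined by
  \<open>frag_extend\<close> on a representative followed by the class. This rewrites such an
  expression as a lift into the tensor product, so that the universal property takes over.\<close>

lemma cls_frag_extend:
  assumes "x \<in> carrier (free_Abelian_group S)" "\<And>p. p \<in> S ==> g p \<in> carrier F"
  shows "cls (frag_extend g x) = frag_sum T (\<lambda>p. cls (g p)) x \<and> frag_extend g x \<in> carrier F"
proof -
  have c: "\<And>p. p \<in> S ==> cls (g p) \<in> carrier T" using assms cls_closed by blast
  note f = frag_sum_closed[OF abelian_group_tensor, of S "\<lambda>p. cls (g p)", OF c]
    frag_sum_diff[OF abelian_group_tensor, of S "\<lambda>p. cls (g p)", OF c]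
    frag_sum_zero[OF abelian_group_tensor, of S "\<lambda>p. cls (g p)", OF c]
    frag_sum_of[OF abelian_group_tensor, of S "\<lambda>p. cls (g p)", OF c]
  have "Poly_Mapping.keys x \<subseteq> S" using assms by simp
  then show ?thesis
  proof (rule free_Abelian_group_induct)
    show "cls (frag_extend g 0) = frag_sum T (\<lambda>p. cls (g p)) 0 \<and> frag_extend g 0 \<in> carrier F"
      using f(3) by (simp add: zero_cls)
  next
    fix x y
    assume k: "Poly_Mapping.keys x \<subseteq> S" "Poly_Mapping.keys y \<subseteq> S"
      and xy: "cls (frag_extend g x) = frag_sum T (\<lambda>p. cls (g p)) x \<and> frag_extend g x \<in> carrier F"
       "cls (frag_extend g y) = frag_sum T (\<lambda>p. cls (g p)) y \<and> frag_extend g y \<in> carrier F"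
    have m: "- frag_extend g y \<in> carrier F" using xy by simp
    have eq: "frag_extend g (x - y) = frag_extend g x + - frag_extend g y" by (simp add: frag_extend_diff)
    have c: "frag_extend g x + - frag_extend g y \<in> carrier F" using F.m_closed[OF _ m] xy by simp
    have "cls (frag_extend g x + - frag_extend g y) = cls (frag_extend g x) +[T] \<ominus>\<^bsub>T\<^esub> cls (frag_extend g y)"
      using add_cls[OF _ m] cls_uminus xy by metis
    then show "cls (frag_extend g (x - y)) = frag_sum T (\<lambda>p. cls (g p)) (x - y) \<and>
      frag_extend g (x - y) \<in> carrier F"
      unfolding eq using f(2) k c xy by (simp add: a_minus_def)
  next
    fix p assume p: "p \<in> S"
    then show "cls (frag_extend g (frag_of p)) = frag_sum T (\<lambda>p. cls (g p)) (frag_of p) \<and>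
      frag_extend g (frag_of p) \<in> carrier F"
      using assms f(4)[of p] by auto
  qed
qed

lemma cls_frag_extend_rep:
  assumes "\<And>p. p \<in> S ==> g p \<in> carrier F" "rep X \<in> carrier (free_Abelian_group S)"
  shows "cls (frag_extend g (rep X)) = tensor_lift T (\<lambda>p. cls (g p)) X"
  using cls_frag_extend[OF assms(2,1)] by (simp add: tensor_lift_frag_sum)

lemma smult_eq:
  assumes "r \<in> carrier R" "X \<in> carrier T"
  shows "r \<cdot>[T] X = tensor_lift T (\<lambda>(m, n). ptens R M N (r \<cdot>[M] m) n) X"
proof -
  have "r \<cdot>[T] X = cls (frag_extend (\<lambda>p. frag_of (map_prod (smult M r) id p)) (rep X))"
    by (simp add: tensor_def tensor_map_def)
  also have "\<dots> = tensor_lift T (\<lambda>p. cls (frag_of (map_prod (smult M r) id p))) X"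
    by (rule cls_frag_extend_rep[where S = "carrier M \<times> carrier N"])
      (use assms rep_cls in \<open>auto simp: keys_frag_of\<close>)
  also have "(\<lambda>p. cls (frag_of (map_prod (smult M r) id p))) = (\<lambda>(m, n). ptens R M N (r \<cdot>[M] m) n)"
    by (auto simp: ptens_def)
  finally show ?thesis .
qed

lemma ptens_simps:
  "m \<in> carrier M ==> m' \<in> carrier M ==> n \<in> carrier N ==>
    ptens R M N (m +[M] m') n = ptens R M N m n +[T] ptens R M N m' n"
  "m \<in> carrier M ==> n \<in> carrier N ==> n' \<in> carrier N ==>
    ptens R M N m (n +[N] n') = ptens R M N m n +[T] ptens R M N m n'"
  "r \<in> carrier R ==> m \<in> carrier M ==> n \<in> carrier N ==>
    ptens R M N (r \<cdot>[M] m) n = ptens R M N m (r \<cdot>[N] n)"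
  using ptens_bilin by (auto simp: bilin_def)

lemma smult_bilin:
  "r \<in> carrier R ==> bilin R M N T (\<lambda>(m, n). ptens R M N (r \<cdot>[M] m) n)"
  by (rule bilinI) (simp_all add: ptens_closed ptens_simps M.smult_r_distr,
      simp_all add: ptens_simps[symmetric] M.smult_assoc1[symmetric] M.R.m_comm)

lemma smult_ptens:
  "r \<in> carrier R ==> m \<in> carrier M ==> n \<in> carrier N ==>
    r \<cdot>[T] ptens R M N m n = ptens R M N (r \<cdot>[M] m) n"
  by (simp add: smult_eq ptens_closed tensor_lift_ptens[OF abelian_group_tensor smult_bilin])

lemma smult_closed': "r \<in> carrier R ==> X \<in> carrier T ==> r \<cdot>[T] X \<in> carrier T"
  by (simp add: smult_eq tensor_lift_closed[OF abelian_group_tensor smult_bilin])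

lemma smult_add': "r \<in> carrier R ==> X \<in> carrier T ==> Y \<in> carrier T ==>
    r \<cdot>[T] (X +[T] Y) = r \<cdot>[T] X +[T] r \<cdot>[T] Y"
  by (simp add: smult_eq tensor_lift_add[OF abelian_group_tensor smult_bilin])

lemma module_tensor: "module R T"
proof (rule moduleI)
  show "cring R" by (rule M.R.is_cring)
  show "abelian_group T" by (rule abelian_group_tensor)
  show "r \<cdot>[T] X \<in> carrier T" if "r \<in> carrier R" "X \<in> carrier T" for r X
    using that by (rule smult_closed')
  show "r \<cdot>[T] (X +[T] Y) = r \<cdot>[T] X +[T] r \<cdot>[T] Y"
    if "r \<in> carrier R" "X \<in> carrier T" "Y \<in> carrier T" for r X Y
    using that by (rule smult_add')
  show "1[R] \<cdot>[T] X = X" if "X \<in> carrier T" for X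
    using that by (induction rule: tensor_induct) (simp_all add: smult_ptens smult_add')
  show "(r +[R] s) \<cdot>[T] X = r \<cdot>[T] X +[T] s \<cdot>[T] X"
    if "r \<in> carrier R" "s \<in> carrier R" "X \<in> carrier T" for r s X
    using that(3)
  proof (induction rule: tensor_induct)
    case (pure m n) then show ?case using that by (simp add: smult_ptens M.smult_l_distr ptens_simps)
  next
    case (add X Y) then show ?case using that by (simp add: smult_add' smult_closed' T.a_ac)
  qed
  show "(r *[R] s) \<cdot>[T] X = r \<cdot>[T] (s \<cdot>[T] X)"
    if "r \<in> carrier R" "s \<in> carrier R" "X \<in> carrier T" for r s X
    using that(3)
  proof (induction rule: tensor_induct)
    case (pure m n) then show ?case using that by (simp add: smult_ptens M.smult_assoc1)
  next
    case (add X Y) then show ?case using that by (simp add: smult_add' smult_closed')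
  qed
qed

end

text \<open>The rings \<open>R\<close> and \<open>R'\<close> may differ, as base change along
  \<open>S -> T\<close> in \<open>tensor_functor\<close> requires.\<close>

lemma tensor_map_lift:
  assumes "two_modules R M N" "two_modules R' M' N'"
    and "\<And>m n. m \<in> carrier M ==> n \<in> carrier N ==> \<phi> (m, n) \<in> carrier M' \<times> carrier N'"
    and "X \<in> carrier (tensor R M N)"
  shows "tensor_map R' M' N' \<phi> X =
    tensor_lift (tensor R' M' N') (\<lambda>p. ptens R' M' N' (fst (\<phi> p)) (snd (\<phi> p))) X"
proof -
  interpret two_modules R M N by fact
  interpret Q: two_modules R' M' N' by fact
  have "tensor_map R' M' N' \<phi> X = tensor_class R' M' N' (frag_extend (\<lambda>p. frag_of (\<phi> p)) (rep X))"
    by (simp add: tensor_map_def)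
  also have "\<dots> = tensor_lift (tensor R' M' N') (\<lambda>p. tensor_class R' M' N' (frag_of (\<phi> p))) X"
    by (rule Q.cls_frag_extend_rep[where S = "carrier M \<times> carrier N"])
      (use assms rep_cls in \<open>auto simp: keys_frag_of\<close>)
  finally show ?thesis by (simp add: ptens_def)
qed

section \<open>Tensor products of associative algebras\<close>

locale two_algebras =
  fixes R :: "('r, 'y) ring_scheme" and M :: "('r, 'a) module" and N :: "('r, 'b) module"
  assumes M: "assoc_algebra R M" and N: "assoc_algebra R N"
begin

sublocale two_modules R M N
  using M N by (auto simp: assoc_algebra_def two_modules_def)

interpretation T: module R T by (rule module_tensor)
interpretation MR: ring M using M by (simp add: assoc_algebra_def)
interpretation NR: ring N using N by (simp add: assoc_algebra_def)

lemma smult_assoc: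
  "r \<in> carrier R ==> a \<in> carrier M ==> b \<in> carrier M ==> (r \<cdot>[M] a) *[M] b = r \<cdot>[M] (a *[M] b)"
  "r \<in> carrier R ==> a \<in> carrier M ==> b \<in> carrier M ==> a *[M] (r \<cdot>[M] b) = r \<cdot>[M] (a *[M] b)"
  "r \<in> carrier R ==> c \<in> carrier N ==> d \<in> carrier N ==> (r \<cdot>[N] c) *[N] d = r \<cdot>[N] (c *[N] d)"
  "r \<in> carrier R ==> c \<in> carrier N ==> d \<in> carrier N ==> c *[N] (r \<cdot>[N] d) = r \<cdot>[N] (c *[N] d)"
  using M N by (simp_all add: assoc_algebra_def)

text \<open>Left multiplication by a pure tensor. The product is a lift in each factor in turn, and
  bilinearity of the outer lift is proved by induction on the fixed second argument
  \<open>Y\<close>.\<close>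

definition mul1 :: "'a => 'b => ('a \<times> 'b \<Rightarrow>\<^sub>0 int) set => ('a \<times> 'b \<Rightarrow>\<^sub>0 int) set" where
  "mul1 a b Y = tensor_lift T (\<lambda>(c, d). ptens R M N (a *[M] c) (b *[N] d)) Y"

lemma mul1_bilin:
  "a \<in> carrier M ==> b \<in> carrier N ==> bilin R M N T (\<lambda>(c, d). ptens R M N (a *[M] c) (b *[N] d))"
  by (rule bilinI) (simp_all add: ptens_closed ptens_simps MR.r_distr NR.r_distr smult_assoc)

lemmas mul1_simps = tensor_lift_closed[OF abelian_group_tensor mul1_bilin, folded mul1_def]
  tensor_lift_add[OF abelian_group_tensor mul1_bilin, folded mul1_def]
  tensor_lift_ptens[OF abelian_group_tensor mul1_bilin, folded mul1_def]

lemma mul1_add_left: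
  assumes "a \<in> carrier M" "a' \<in> carrier M" "b \<in> carrier N" "Y \<in> carrier T"
  shows "mul1 (a +[M] a') b Y = mul1 a b Y +[T] mul1 a' b Y"
  using assms(4)
proof (induction rule: tensor_induct)
  case (pure m n) then show ?case using assms by (simp add: mul1_simps MR.l_distr ptens_simps)
next
  case (add X Y) then show ?case using assms by (simp add: mul1_simps T.M.a_ac)
qed

lemma mul1_add_right:
  assumes "a \<in> carrier M" "b \<in> carrier N" "b' \<in> carrier N" "Y \<in> carrier T"
  shows "mul1 a (b +[N] b') Y = mul1 a b Y +[T] mul1 a b' Y"
  using assms(4)
proof (induction rule: tensor_induct)
  case (pure m n) then show ?case using assms by (simp add: mul1_simps NR.l_distr ptens_simps)
next
  case (add X Y) then show ?case using assms by (simp add: mul1_simps T.M.a_ac)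
qed

lemma mul1_smult:
  assumes "r \<in> carrier R" "a \<in> carrier M" "b \<in> carrier N" "Y \<in> carrier T"
  shows "mul1 (r \<cdot>[M] a) b Y = mul1 a (r \<cdot>[N] b) Y"
  using assms(4)
proof (induction rule: tensor_induct)
  case (pure m n) then show ?case using assms by (simp add: mul1_simps smult_assoc ptens_simps)
next
  case (add X Y) then show ?case using assms by (simp add: mul1_simps T.M.a_ac)
qed

lemma mul_bilin: "Y \<in> carrier T ==> bilin R M N T (\<lambda>(a, b). mul1 a b Y)"
  by (rule bilinI) (simp_all add: mul1_simps mul1_add_left mul1_add_right mul1_smult)

lemma mult_eq:
  assumes "X \<in> carrier T" "Y \<in> carrier T"
  shows "X *[T] Y = tensor_lift T (\<lambda>(a, b). mul1 a b Y) X"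
proof -
  have 1: "cls (frag_extend (\<lambda>(c, d). frag_of (a *[M] c, b *[N] d)) (rep Y)) = mul1 a b Y \<and>
     frag_extend (\<lambda>(c, d). frag_of (a *[M] c, b *[N] d)) (rep Y) \<in> carrier F"
    if "a \<in> carrier M" "b \<in> carrier N" for a b
  proof -
    have "rep Y \<in> carrier F" using rep_cls assms by blast
    from cls_frag_extend[OF this, of "\<lambda>(c, d). frag_of (a *[M] c, b *[N] d)"]
    show ?thesis using that
      by (auto simp: mul1_def tensor_lift_frag_sum keys_frag_of ptens_def case_prod_unfold)
  qed
  have X: "rep X \<in> carrier F" using rep_cls assms by blast
  have "X *[T] Y = cls (frag_extend (\<lambda>(a, b). frag_extend (\<lambda>(c, d).
    frag_of (a *[M] c, b *[N] d)) (rep Y)) (rep X))"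
    by (simp add: tensor_def)
  also have "\<dots> = tensor_lift T (\<lambda>p. cls (case p of (a, b) => frag_extend (\<lambda>(c, d).
    frag_of (a *[M] c, b *[N] d)) (rep Y))) X"
    by (rule cls_frag_extend_rep[OF _ X]) (use 1 in auto)
  also have "\<dots> = tensor_lift T (\<lambda>(a, b). mul1 a b Y) X"
    unfolding tensor_lift_def using X
    by (intro T.M.finsum_cong') (auto 4 3 simp: 1 mul1_simps assms intro!: T.M.add_int_pow_simps)
  finally show ?thesis .
qed

lemma mult_ptens:
  "a \<in> carrier M ==> b \<in> carrier N ==> c \<in> carrier M ==> d \<in> carrier N ==>
    ptens R M N a b *[T] ptens R M N c d = ptens R M N (a *[M] c) (b *[N] d)"
  by (simp add: mult_eq ptens_closed tensor_lift_ptens[OF abelian_group_tensor mul_bilin] mul1_simps)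

lemma one_ptens: "1[T] = ptens R M N 1[M] 1[N]"
  by (simp add: tensor_def ptens_def)

lemma mult_closed: "X \<in> carrier T ==> Y \<in> carrier T ==> X *[T] Y \<in> carrier T"
  by (simp add: mult_eq tensor_lift_closed[OF abelian_group_tensor mul_bilin])

lemma mult_add_left:
  "X \<in> carrier T ==> X' \<in> carrier T ==> Y \<in> carrier T ==>
    (X +[T] X') *[T] Y = X *[T] Y +[T] X' *[T] Y"
  by (simp add: mult_eq tensor_lift_add[OF abelian_group_tensor mul_bilin])

lemma mult_add_right:
  assumes "X \<in> carrier T" "Y \<in> carrier T" "Y' \<in> carrier T"
  shows "X *[T] (Y +[T] Y') = X *[T] Y +[T] X *[T] Y'"
  using assms(1)
proof (induction rule: tensor_induct)
  case (pure m n) then show ?case using assms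
    by (simp add: mult_eq ptens_closed tensor_lift_ptens[OF abelian_group_tensor mul_bilin] mul1_simps)
next
  case (add X X') then show ?case using assms by (simp add: mult_add_left mult_closed T.M.a_ac)
qed

lemma assoc_algebra_tensor: "assoc_algebra R T"
  unfolding assoc_algebra_def
proof (intro conjI ballI)
  show "module R T" by (rule module_tensor)
  have assoc: "X *[T] Y *[T] Z = X *[T] (Y *[T] Z)"
    if "X \<in> carrier T" "Y \<in> carrier T" "Z \<in> carrier T" for X Y Z
    using that
  proof (induction arbitrary: Y Z rule: tensor_induct)
    case (pure a b)
    show ?case using pure(3,4)
    proof (induction arbitrary: Z rule: tensor_induct)
      case (pure c d)
      have ab: "a \<in> carrier M" "b \<in> carrier N" by fact+
      show ?case using pure(3)
      proof (induction rule: tensor_induct)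
        case (pure e f) then show ?case using ab \<open>c \<in> carrier M\<close> \<open>d \<in> carrier N\<close>
          by (simp add: mult_ptens MR.m_assoc NR.m_assoc)
      next
        case (add X Y) then show ?case using ab \<open>c \<in> carrier M\<close> \<open>d \<in> carrier N\<close>
          by (simp add: mult_add_right mult_closed ptens_closed)
      qed
    next
      case (add X Y) then show ?case using \<open>a \<in> carrier M\<close> \<open>b \<in> carrier N\<close>
        by (simp add: mult_add_left mult_add_right mult_closed ptens_closed)
    qed
  next
    case (add X X') then show ?case by (simp add: mult_add_left mult_closed)
  qed
  show "ring T"
  proof (rule ringI)
    show "abelian_group T" by (rule abelian_group_tensor)
    show "monoid T"
    proof (rule monoidI)
      show "1[T] \<in> carrier T" by (simp add: one_ptens ptens_closed)
      show "1[T] *[T] X = X" if "X \<in> carrier T" for X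
        using that
        by (induction rule: tensor_induct) (simp_all add: one_ptens mult_ptens mult_add_right ptens_closed)
      show "X *[T] 1[T] = X" if "X \<in> carrier T" for X
        using that
        by (induction rule: tensor_induct) (simp_all add: one_ptens mult_ptens mult_add_left ptens_closed)
    qed (auto simp: mult_closed assoc)
  qed (simp_all add: mult_add_left mult_add_right)
  fix r X Y assume r: "r \<in> carrier R" and X: "X \<in> carrier T" and Y: "Y \<in> carrier T"
  show "(r \<cdot>[T] X) *[T] Y = r \<cdot>[T] (X *[T] Y)"
    using X
  proof (induction rule: tensor_induct)
    case (pure a b)
    show ?case using Y
    proof (induction rule: tensor_induct)
      case (pure c d) then show ?case using r \<open>a \<in> carrier M\<close> \<open>b \<in> carrier N\<close>
        by (simp add: smult_ptens mult_ptens smult_assoc)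
    next
      case (add X X') then show ?case using r \<open>a \<in> carrier M\<close> \<open>b \<in> carrier N\<close>
        by (simp add: mult_add_right mult_closed smult_closed' ptens_closed smult_add')
    qed
  next
    case (add X X') then show ?case using r Y
      by (simp add: mult_add_left mult_closed smult_closed' ptens_closed smult_add')
  qed
  show "X *[T] (r \<cdot>[T] Y) = r \<cdot>[T] (X *[T] Y)"
    using X
  proof (induction rule: tensor_induct)
    case (pure a b)
    show ?case using Y
    proof (induction rule: tensor_induct)
      case (pure c d) then show ?case using r \<open>a \<in> carrier M\<close> \<open>b \<in> carrier N\<close>
        by (simp add: smult_ptens mult_ptens smult_assoc)
    next
      case (add X X') then show ?case using r \<open>a \<in> carrier M\<close> \<open>b \<in> carrier N\<close>
        by (simp add: mult_add_right mult_closed smult_closed' ptens_closed smult_add')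
    qed
  next
    case (add X X') then show ?case using r Y
      by (simp add: mult_add_left mult_closed smult_closed' ptens_closed smult_add')
  qed
qed

lemma tensor_comm:
  assumes "cring M" "cring N" "X \<in> carrier T" "Y \<in> carrier T"
  shows "X *[T] Y = Y *[T] X"
  using assms(3,4)
proof (induction arbitrary: Y rule: tensor_induct)
  case (pure a b)
  show ?case using pure(3)
  proof (induction rule: tensor_induct)
    case (pure c d) then show ?case using \<open>a \<in> carrier M\<close> \<open>b \<in> carrier N\<close> assms(1,2)
      by (simp add: mult_ptens cring.cring_simprules(14))
  next
    case (add X X') then show ?case using \<open>a \<in> carrier M\<close> \<open>b \<in> carrier N\<close>
      by (simp add: mult_add_right mult_add_left ptens_closed)
  qed
next
  case (add X X') then show ?case by (simp add: mult_add_left mult_add_right)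
qed

end

section \<open>Homomorphisms of small algebras\<close>

text \<open>\<open>lin_hom\<close> demands extensionality; this variant admits total functions such
  as \<open>id\<close>, with which \<open>tens_map\<close> is used.\<close>

definition lin :: "('r, 'y) ring_scheme => ('r, 'a) module => ('r, 'b) module => ('a => 'b) => bool" where
  "lin R M N f \<longleftrightarrow> (\<forall>x\<in>carrier M. f x \<in> carrier N) \<and>
     (\<forall>x\<in>carrier M. \<forall>y\<in>carrier M. f (x +[M] y) = f x +[N] f y) \<and>
     (\<forall>r\<in>carrier R. \<forall>x\<in>carrier M. f (r \<cdot>[M] x) = r \<cdot>[N] f x)"

lemma linD:
  assumes "lin R M N f"
  shows "x \<in> carrier M ==> f x \<in> carrier N"
    "x \<in> carrier M ==> y \<in> carrier M ==> f (x +[M] y) = f x +[N] f y"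
    "r \<in> carrier R ==> x \<in> carrier M ==> f (r \<cdot>[M] x) = r \<cdot>[N] f x"
  using assms by (auto simp: lin_def)

lemma lin_hom_iff: "f \<in> lin_hom R M N \<longleftrightarrow> lin R M N f \<and> f \<in> extensional (carrier M)"
  by (auto simp: lin_hom_def lin_def PiE_def Pi_def)

text \<open>Zero is the only idempotent of a group. The hypotheses concern the argument zero alone,
  so that contractions and maps of tensor products can be fed in without first being recognised as
  linear.\<close>

lemma additive_zero:
  assumes "abelian_group M" "abelian_group N" "f 0[M] \<in> carrier N"
    "f (0[M] +[M] 0[M]) = f 0[M] +[N] f 0[M]"
  shows "f 0[M] = 0[N]"
proof -
  interpret M: abelian_group M by fact
  interpret N: abelian_group N by fact
  show ?thesis using assms(3,4) by (simp add: N.add.r_cancel_one)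
qed

lemma lin_zero: "lin R M N f ==> module R M ==> module R N ==> f 0[M] = 0[N]"
  by (rule additive_zero) (auto simp: linD module_def abelian_group.axioms abelian_monoid.zero_closed)

lemma lin_id: "lin R M M id" "lin R M M (\<lambda>x. x)"
  by (auto simp: lin_def)

lemma alg_homD:
  assumes "f \<in> alg_hom R A B"
  shows "x \<in> carrier A ==> f x \<in> carrier B"
    "x \<in> carrier A ==> y \<in> carrier A ==> f (x +[A] y) = f x +[B] f y"
    "x \<in> carrier A ==> y \<in> carrier A ==> f (x *[A] y) = f x *[B] f y"
    "r \<in> carrier R ==> x \<in> carrier A ==> f (r \<cdot>[A] x) = r \<cdot>[B] f x"
    "f 1[A] = 1[B]" "f \<in> extensional (carrier A)" "lin R A B f" "f \<in> ring_hom A B"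
    "f \<in> carrier A \<rightarrow> carrier B"
  using assms by (auto simp: alg_hom_def lin_hom_iff lin_def ring_hom_def)

lemma alg_homI:
  assumes "f \<in> extensional (carrier A)"
    "\<And>x. x \<in> carrier A ==> f x \<in> carrier B"
    "\<And>x y. x \<in> carrier A ==> y \<in> carrier A ==> f (x +[A] y) = f x +[B] f y"
    "\<And>x y. x \<in> carrier A ==> y \<in> carrier A ==> f (x *[A] y) = f x *[B] f y"
    "\<And>r x. r \<in> carrier R ==> x \<in> carrier A ==> f (r \<cdot>[A] x) = r \<cdot>[B] f x"
    "f 1[A] = 1[B]"
  shows "f \<in> alg_hom R A B"
  using assms by (auto simp: alg_hom_def lin_hom_iff lin_def ring_hom_def)

lemma alg_hom_eqI:
  assumes "f \<in> alg_hom R A B" "g \<in> alg_hom R A B" "\<And>x. x \<in> carrier A ==> f x = g x"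
  shows "f = g"
  using assms alg_homD(6) by (metis extensionalityI)

definition AAlg :: "'u ring => 'u alg set" where
  "AAlg K = {A. assoc_algebra K A \<and> carrier A \<prec> (UNIV :: 'u set)}"

lemma algebra_iff: "algebra R A \<longleftrightarrow> assoc_algebra R A \<and> cring A"
proof
  assume A: "algebra R A"
  then interpret algebra R A .

  have "a *[A] (r \<cdot>[A] b) = r \<cdot>[A] (a *[A] b)"
    if "r \<in> carrier R" "a \<in> carrier A" "b \<in> carrier A" for r a b
    using smult_assoc2[OF that(1,3,2)] that cring.cring_simprules(14)[OF M_cring] by simp
  then show "assoc_algebra R A \<and> cring A"
    using module cring.axioms(1)[OF M_cring] M_cring smult_assoc2 by (simp add: assoc_algebra_def)
next
  assume "assoc_algebra R A \<and> cring A"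
  then show "algebra R A"
    by (auto simp: assoc_algebra_def algebra_def algebra_axioms_def)
qed

lemma CAlg_iff: "S \<in> CAlg K \<longleftrightarrow> S \<in> AAlg K \<and> cring S"
  by (auto simp: CAlg_def AAlg_def algebra_iff)

lemma CAlg_AAlg: "S \<in> CAlg K ==> S \<in> AAlg K"
  by (simp add: CAlg_iff)

lemma AAlgD:
  fixes A :: "'u alg"
  assumes "A \<in> AAlg K"
  shows "assoc_algebra K A" "module K A" "ring A" "abelian_group A" "monoid A" "carrier A \<prec> (UNIV :: 'u set)"
  using assms by (auto simp: AAlg_def assoc_algebra_def ring_def)

lemma CAlg_cring: "S \<in> CAlg K ==> cring S"
  by (simp add: CAlg_iff)

lemmas CAlgD = AAlgD[OF CAlg_AAlg]

lemma AAlg_smult_assoc: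
  assumes "A \<in> AAlg K" "r \<in> carrier K" "a \<in> carrier A" "b \<in> carrier A"
  shows "(r \<cdot>[A] a) *[A] b = r \<cdot>[A] (a *[A] b)" "a *[A] (r \<cdot>[A] b) = r \<cdot>[A] (a *[A] b)"
  using assms by (auto simp: AAlg_def assoc_algebra_def)

lemma AAlg_closed:
  assumes "A \<in> AAlg K"
  shows "a \<in> carrier A ==> b \<in> carrier A ==> a +[A] b \<in> carrier A" (is "PROP ?A")
    "a \<in> carrier A ==> b \<in> carrier A ==> a *[A] b \<in> carrier A" (is "PROP ?B")
    "1[A] \<in> carrier A" "0[A] \<in> carrier A"
    "a \<in> carrier A ==> \<ominus>\<^bsub>A\<^esub> a \<in> carrier A" (is "PROP ?C")
    "r \<in> carrier K ==> a \<in> carrier A ==> r \<cdot>[A] a \<in> carrier A" (is "PROP ?D")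
proof -
  interpret A: ring A using assms by (rule AAlgD)
  interpret module K A using assms by (rule AAlgD)
  show "PROP ?A"
    "PROP ?B"
    "1[A] \<in> carrier A" "0[A] \<in> carrier A"
    "PROP ?C"
    "PROP ?D" by simp_all
qed

lemmas CAlg_closed = AAlg_closed[OF CAlg_AAlg]

lemma compose_alg_hom:
  assumes "f \<in> alg_hom K A B" "g \<in> alg_hom K B C" "A \<in> AAlg K"
  shows "g o[A] f \<in> alg_hom K A C"
  by (intro alg_homI)
    (auto simp: compose_def alg_homD[OF assms(1)] alg_homD[OF assms(2)] AAlg_closed[OF assms(3)])

lemma idm_alg_hom: "A \<in> AAlg K ==> idm A \<in> alg_hom K A A"
  by (rule alg_homI) (auto simp: idm_def AAlg_closed)

lemmas idm_CAlg = idm_alg_hom[OF CAlg_AAlg]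

lemma idm_apply [simp]: "x \<in> carrier A ==> idm A x = x"
  by (simp add: idm_def)

lemma compose_idm_right: "f \<in> alg_hom K A B ==> (f o[A] idm A) = f"
  unfolding compose_def idm_def using alg_homD(6)[of f K A B]
  by (auto intro!: ext simp: extensional_def)

lemma compose_idm_left: "f \<in> alg_hom K A B ==> (idm B o[A] f) = f"
  unfolding compose_def idm_def using alg_homD(1,6)[of f K A B]
  by (auto intro!: ext simp: extensional_def)

lemma compose_compose:
  "f \<in> alg_hom K A B ==> (h o[A] (g o[A] f)) =
     (h o[B] g) o[A] f"
  by (rule compose_assoc) (auto dest: alg_homD)

section \<open>Cardinalities and transported structures\<close>

text \<open>Cardinals are comparable, so strict inequality means that no injection goes back. This
  gives access to the arithmetic of \<open>ordLess\<close>.\<close>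

lemma lesspoll_iff: "A \<prec> B \<longleftrightarrow> (card_of A, card_of B) \<in> ordLess"
proof -
  have "A \<prec> B \<longleftrightarrow> \<not> B \<lesssim> A"
  proof
    assume "A \<prec> B" then show "\<not> B \<lesssim> A"
      using lepoll_antisym by (auto simp: lesspoll_def)
  next
    assume B: "\<not> B \<lesssim> A"
    then have "\<not> (card_of B, card_of A) \<in> ordLeq"
      by (auto simp: card_of_ordLeq[symmetric] lepoll_def)
    then have "(card_of A, card_of B) \<in> ordLeq"
      by (metis card_of_Well_order ordLeq_total)
    then have "A \<lesssim> B" by (auto simp: card_of_ordLeq[symmetric] lepoll_def)
    then show "A \<prec> B" using B eqpoll_sym eqpoll_imp_lepoll by (auto simp: lesspoll_def)
  qed
  also have "\<dots> \<longleftrightarrow> \<not> (card_of B, card_of A) \<in> ordLeq"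
    by (auto simp: card_of_ordLeq[symmetric] lepoll_def)
  also have "\<dots> \<longleftrightarrow> (card_of A, card_of B) \<in> ordLess"
    by (simp add: not_ordLeq_iff_ordLess)
  finally show ?thesis .
qed

lemma Times_lesspoll:
  "A \<prec> C ==> B \<prec> C ==> infinite C ==> A \<times> B \<prec> C"
  unfolding lesspoll_iff by (rule card_of_Times_ordLess_infinite)

lemma countable_lesspoll_uncountable: "countable A ==> uncountable B ==> A \<prec> B"
  unfolding lesspoll_iff using countable_lepoll[of A B]
  by (auto simp: card_of_ordLeq[symmetric] lepoll_def simp flip: not_ordLeq_iff_ordLess)

text \<open>An element is encoded by a finite list of generators with integer coefficients. Over a
  finite \<open>A\<close> these lists are countable; over an infinite \<open>A\<close> they are as
  many as \<open>A\<close> times the integers. Uncountability of the universe makes both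
  small.\<close>

lemma free_lesspoll:
  assumes A: "A \<prec> (UNIV :: 'u set)" and U: "uncountable (UNIV :: 'u set)"
  shows "carrier (free_Abelian_group A) \<prec> (UNIV :: 'u set)"
proof -
  have "carrier (free_Abelian_group A) \<lesssim> lists (A \<times> (UNIV :: int set))"
  proof -
    \<comment> \<open>A listing of the graph of \<open>x\<close> on its support. The order is
      arbitrary, but the underlying set determines all coefficients, which is what injectivity of
      \<open>e\<close> needs.\<close>
    define e where "e x = (SOME l. distinct (map fst l) \<and> set l = (\<lambda>a. (a, Poly_Mapping.lookup x a)) ` Poly_Mapping.keys x)"
      for x :: "'a \<Rightarrow>\<^sub>0 int"
    have e: "set (e x) = (\<lambda>a. (a, Poly_Mapping.lookup x a)) ` Poly_Mapping.keys x" for x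
    proof -
      obtain l where "set l = Poly_Mapping.keys x" "distinct l" using finite_distinct_list[of "Poly_Mapping.keys x"] by auto
      then have "\<exists>l. distinct (map fst l) \<and> set l = (\<lambda>a. (a, Poly_Mapping.lookup x a)) ` Poly_Mapping.keys x"
        by (intro exI[of _ "map (\<lambda>a. (a, Poly_Mapping.lookup x a)) l"]) (simp add: comp_def)
      then show ?thesis unfolding e_def by (metis (mono_tags, lifting) someI_ex)
    qed
    have "inj e"
    proof (rule injI, rule poly_mapping_eqI)
      fix x y a assume "e x = e y"
      then have *: "(\<lambda>a. (a, Poly_Mapping.lookup x a)) ` Poly_Mapping.keys x =
        (\<lambda>a. (a, Poly_Mapping.lookup y a)) ` Poly_Mapping.keys y" using e by metis
      show "Poly_Mapping.lookup x a = Poly_Mapping.lookup y a"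
      proof (cases "a \<in> Poly_Mapping.keys x \<or> a \<in> Poly_Mapping.keys y")
        case True then show ?thesis using * by (auto simp: set_eq_iff image_iff)
      qed (simp add: lookup_notin)
    qed
    moreover have "e ` carrier (free_Abelian_group A) \<subseteq> lists (A \<times> (UNIV :: int set))"
      by (auto simp: e)
    ultimately show ?thesis unfolding lepoll_def by (metis inj_on_subset subset_UNIV)
  qed
  also have "lists (A \<times> (UNIV :: int set)) \<prec> (UNIV :: 'u set)"
  proof (cases "finite A")
    case True
    then have "countable (lists (A \<times> (UNIV :: int set)))"
      by (intro countable_lists countable_SIGMA countable_finite countableI_type)
    then show ?thesis using U by (rule countable_lesspoll_uncountable)
  next
    case False
    then have inf: "infinite (A \<times> (UNIV :: int set))" by (auto simp: finite_cartesian_product_iff)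
    have "(UNIV :: int set) \<prec> (UNIV :: 'u set)"
      using U by (intro countable_lesspoll_uncountable) auto
    then have "A \<times> (UNIV :: int set) \<prec> (UNIV :: 'u set)"
      using A U by (intro Times_lesspoll uncountable_infinite)
    moreover have "lists (A \<times> (UNIV :: int set)) \<approx> A \<times> (UNIV :: int set)"
      using inf card_of_lists_infinite by (simp add: eqpoll_iff_card_of_ordIso)
    ultimately show ?thesis using eq_lesspoll_trans by blast
  qed
  finally show ?thesis .
qed

lemma enc_inj:
  assumes "carrier M \<prec> (UNIV :: 'u set)"
  shows "inj_on (enc M :: 'a => 'u) (carrier M)"
proof -
  have "\<exists>e :: 'a => 'u. inj_on e (carrier M)"
    using assms by (auto simp: lesspoll_def lepoll_def)
  then show ?thesis unfolding enc_def by (rule someI_ex)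
qed

locale small_copy =
  fixes M :: "('r, 'a) module" and C :: "('r, 'u) module"
  assumes small: "carrier M \<prec> (UNIV :: 'u set)"
  defines "C \<equiv> copy M"
begin

lemma inj: "inj_on (enc M :: 'a => 'u) (carrier M)"
  using small by (rule enc_inj)

lemma dec_enc [simp]: "x \<in> carrier M ==> dec M (enc M x :: 'u) = x"
  unfolding dec_def by (rule inv_into_f_f[OF inj])

lemma enc_closed [simp]: "x \<in> carrier M ==> enc M x \<in> carrier C"
  by (simp add: C_def copy_def)

lemma dec_closed [simp]: "y \<in> carrier C ==> dec M y \<in> carrier M"
  unfolding dec_def C_def copy_def by (auto intro: inv_into_into)

lemma enc_dec [simp]: "y \<in> carrier C ==> enc M (dec M y) = y"
  unfolding dec_def C_def copy_def by (auto intro: f_inv_into_f)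

lemma copy_simps:
  "x +[C] y = enc M (dec M x +[M] dec M y)"
  "x *[C] y = enc M (dec M x *[M] dec M y)"
  "r \<cdot>[C] x = enc M (r \<cdot>[M] dec M x)"
  "1[C] = enc M 1[M]" "0[C] = enc M 0[M]"
  by (simp_all add: C_def copy_def)

lemma copy_small: "carrier C \<prec> (UNIV :: 'u set)"
  using small inj by (simp add: C_def copy_def)

lemma copy_module:
  assumes "module R M"
  shows "module R C"
proof -
  interpret module R M by fact
  show ?thesis
  proof (rule moduleI)
    show "abelian_group C"
    proof (rule abelian_groupI)
      fix x assume x: "x \<in> carrier C"
      show "\<exists>y\<in>carrier C. y +[C] x = 0[C]"
        using x by (intro bexI[of _ "enc M (\<ominus>\<^bsub>M\<^esub> dec M x)"]) (simp_all add: copy_simps M.l_neg)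
    qed (simp_all add: copy_simps M.a_assoc, simp_all add: M.a_comm)
  qed (simp_all add: R.is_cring copy_simps smult_l_distr smult_r_distr smult_assoc1)
qed

lemma copy_assoc_algebra:
  assumes "assoc_algebra R M"
  shows "assoc_algebra R C"
proof -
  interpret module R M using assms by (simp add: assoc_algebra_def)
  interpret A: ring M using assms by (simp add: assoc_algebra_def)
  have m: "module R C" by (rule copy_module) (rule module_axioms)
  have "ring C"
  proof (rule ringI)
    show "abelian_group C" using m by (simp add: module_def)
    show "monoid C" by (rule monoidI) (simp_all add: copy_simps A.m_assoc)
  qed (simp_all add: copy_simps A.l_distr A.r_distr)
  then show ?thesis using m assms by (auto simp: assoc_algebra_def copy_simps)
qed

end

section \<open>Tensor products of small algebras\<close>

text \<open>Smallness of \<open>K\<close> makes the field itself an object of \<open>CAlg K\<close>,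
  the initial one (\<open>KA\<close>); uncountability keeps \<open>CAlg K\<close> closed under
  tensor products.\<close>

locale base =
  fixes K :: "'u ring"
  assumes K_field: "field K"
    and K_small: "carrier K \<prec> (UNIV :: 'u set)"
    and uncountable_UNIV: "uncountable (UNIV :: 'u set)"
begin

lemma infinite_UNIV: "infinite (UNIV :: 'u set)"
  using uncountable_UNIV by (rule uncountable_infinite)

interpretation K: field K by (rule K_field)

abbreviation "pt \<equiv> pure_tens K"

definition tlift :: "'u alg => 'u alg => ('c, 'z) ring_scheme => ('u \<times> 'u => 'c) => 'u => 'c" where
  "tlift A S P h z = tensor_lift P h (dec (tensor K A S) z)"

context
  fixes A S :: "'u alg"
  assumes A: "A \<in> AAlg K" and S: "S \<in> AAlg K"
begin

interpretation two_algebras K A S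
  using A S by unfold_locales (auto dest: AAlgD)

lemma tensor_small: "carrier (tensor K A S) \<prec> (UNIV :: 'u set)"
proof -
  have "carrier F \<prec> (UNIV :: 'u set)"
    using A S by (intro free_lesspoll Times_lesspoll uncountable_UNIV infinite_UNIV AAlgD)
  then show ?thesis unfolding carrier_tensor using image_lepoll lesspoll_trans1 by blast
qed

interpretation small_copy T "tens K A S"
  by unfold_locales (simp_all add: tensor_small tens_def)

lemma tens_AAlg: "tens K A S \<in> AAlg K"
  using copy_assoc_algebra assoc_algebra_tensor copy_small by (auto simp: AAlg_def)

lemma pt_enc: "pt A S a s = enc T (ptens K A S a s)"
  by (simp add: pure_tens_def ptens_def)

lemma pt_closed: "a \<in> carrier A ==> s \<in> carrier S ==> pt A S a s \<in> carrier (tens K A S)"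
  by (simp add: pt_enc ptens_closed)

lemma pt_add_left: "a \<in> carrier A ==> a' \<in> carrier A ==> s \<in> carrier S ==>
    pt A S (a +[A] a') s = pt A S a s +[tens K A S] pt A S a' s"
  by (simp add: pt_enc ptens_simps copy_simps ptens_closed)

lemma pt_add_right: "a \<in> carrier A ==> s \<in> carrier S ==> s' \<in> carrier S ==>
    pt A S a (s +[S] s') = pt A S a s +[tens K A S] pt A S a s'"
  by (simp add: pt_enc ptens_simps copy_simps ptens_closed)

lemma pt_smult: "r \<in> carrier K ==> a \<in> carrier A ==> s \<in> carrier S ==>
    r \<cdot>[tens K A S] pt A S a s = pt A S (r \<cdot>[A] a) s"
  by (simp add: pt_enc smult_ptens copy_simps ptens_closed)

lemma pt_balanced: "r \<in> carrier K ==> a \<in> carrier A ==> s \<in> carrier S ==>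
    pt A S (r \<cdot>[A] a) s = pt A S a (r \<cdot>[S] s)"
  by (simp add: pt_enc ptens_simps)

lemma pt_mult: "a \<in> carrier A ==> a' \<in> carrier A ==> s \<in> carrier S ==> s' \<in> carrier S ==>
    pt A S a s *[tens K A S] pt A S a' s' = pt A S (a *[A] a') (s *[S] s')"
  by (simp add: pt_enc mult_ptens copy_simps ptens_closed)

lemma pt_one: "1[tens K A S] = pt A S 1[A] 1[S]"
  by (simp add: pt_enc one_ptens copy_simps)

lemma tens_induct0:
  assumes z: "z \<in> carrier (tens K A S)"
    and pure: "\<And>a s. a \<in> carrier A ==> s \<in> carrier S ==> Q (pt A S a s)"
    and add: "\<And>y z. y \<in> carrier (tens K A S) ==> z \<in> carrier (tens K A S) ==> Q y ==> Q z ==>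
    Q (y +[tens K A S] z)"
  shows "Q z"
proof -
  have "Q (enc T Z)" if "Z \<in> carrier T" for Z
    using that
  proof (induction rule: tensor_induct)
    case (pure m n) then show ?case using assms(2) by (simp add: pt_enc)
  next
    case (add X Y) then show ?case using assms(3)[of "enc T X" "enc T Y"] by (simp add: copy_simps)
  qed
  from this[of "dec T z"] z show ?thesis by simp
qed

lemma tens_comm: "cring A ==> cring S ==> cring (tens K A S)"
proof -
  assume c: "cring A" "cring S"
  interpret TT: ring "tens K A S" using tens_AAlg by (rule AAlgD)
  show ?thesis
    by unfold_locales (simp add: copy_simps tensor_comm[OF c])
qed

context
  fixes P :: "('c, 'z) ring_scheme" and h
  assumes P: "abelian_group P" and h: "bilin K A S P h"
begin

lemma tlift_closed: "z \<in> carrier (tens K A S) ==> tlift A S P h z \<in> carrier P"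
  by (simp add: tlift_def tensor_lift_closed[OF P h])

lemma tlift_add: "y \<in> carrier (tens K A S) ==> z \<in> carrier (tens K A S) ==>
    tlift A S P h (y +[tens K A S] z) = tlift A S P h y +[P] tlift A S P h z"
proof -
  assume "y \<in> carrier (tens K A S)" "z \<in> carrier (tens K A S)"
  moreover have "add T (dec T y) (dec T z) \<in> carrier T"
    using calculation by (simp add: abelian_monoid.a_closed abelian_group.axioms(1)[OF abelian_group_tensor])
  ultimately show ?thesis
    by (simp add: tlift_def copy_simps tensor_lift_add[OF P h])
qed

lemma tlift_pt: "a \<in> carrier A ==> s \<in> carrier S ==> tlift A S P h (pt A S a s) = h (a, s)"
  by (simp add: tlift_def pt_enc ptens_closed tensor_lift_ptens[OF P h])

end

end

lemma tens_induct [consumes 3, case_names pure add]: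
  assumes "A \<in> AAlg K" "S \<in> AAlg K" "z \<in> carrier (tens K A S)"
    and "\<And>a s. a \<in> carrier A ==> s \<in> carrier S ==> Q (pt A S a s)"
    and "\<And>y z. y \<in> carrier (tens K A S) ==> z \<in> carrier (tens K A S) ==> Q y ==> Q z ==>
    Q (y +[tens K A S] z)"
  shows "Q z"
  using tens_induct0[OF assms] .

lemma pt_one_mult:
  assumes "A \<in> AAlg K" "S \<in> AAlg K" "a \<in> carrier A" "s \<in> carrier S"
  shows "pt A S a 1[S] *[tens K A S] pt A S 1[A] s = pt A S a s"
proof -
  interpret A: ring A using assms by (intro AAlgD)
  interpret S: ring S using assms by (intro AAlgD)
  show ?thesis using assms by (simp add: pt_mult)
qed

lemma tens_CAlg: "A \<in> CAlg K ==> S \<in> CAlg K ==> tens K A S \<in> CAlg K"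
  by (simp add: CAlg_iff tens_AAlg tens_comm)

text \<open>\<open>tens_map\<close> decodes, picks a representative and encodes again. As the lift
  of a bilinear map it is governed by additivity and by its values on pure tensors, and these are
  what later arguments use.\<close>

lemma tens_map_eq:
  assumes "A \<in> AAlg K" "S \<in> AAlg K" "A' \<in> AAlg K" "S' \<in> AAlg K" "lin K A A' h" "lin K S S' f"
    and "z \<in> carrier (tens K A S)"
  shows "bilin K A S (tens K A' S') (\<lambda>(a, s). pt A' S' (h a) (f s))" (is "PROP ?A")
    "tens_map K A S A' S' h f z = tlift A S (tens K A' S') (\<lambda>(a, s). pt A' S' (h a) (f s)) z" (is "PROP ?B")
proof -
  interpret AS: two_algebras K A S using assms by unfold_locales (auto dest: AAlgD)
  interpret AS': two_algebras K A' S' using assms by unfold_locales (auto dest: AAlgD)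
  interpret c: small_copy "tensor K A S" "tens K A S"
    using assms by unfold_locales (simp_all add: tensor_small tens_def)
  interpret c': small_copy "tensor K A' S'" "tens K A' S'"
    using assms by unfold_locales (simp_all add: tensor_small tens_def)
  note l = linD[OF assms(5)] linD[OF assms(6)]
  show b: "PROP ?A"
    by (rule bilinI) (use assms(1-4) in \<open>simp_all add: pt_closed pt_add_left pt_add_right pt_balanced l\<close>)
  have b': "bilin K A S (tensor K A' S') (\<lambda>(a, s). ptens K A' S' (h a) (f s))"
    by (rule bilinI) (use assms(1-4) in \<open>simp_all add: AS'.ptens_closed AS'.ptens_simps l\<close>)
  have ag: "abelian_group (tens K A' S')" using assms tens_AAlg by (intro AAlgD)
  have "enc (tensor K A' S') (tensor_lift (tensor K A' S') (\<lambda>(a, s). ptens K A' S' (h a) (f s)) (dec (tensor K A S) z))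
     = tlift A S (tens K A' S') (\<lambda>(a, s). pt A' S' (h a) (f s)) z"
    using assms(1,2,7)
  proof (induction rule: tens_induct)
    case (pure a s)
    then show ?case
      by (subst tlift_pt[OF assms(1,2) ag b])
        (simp_all add: pt_enc assms AS.ptens_closed AS.tensor_lift_ptens[OF AS'.abelian_group_tensor b'])
  next
    case (add y z)
    then show ?case
      using AS.tensor_lift_closed[OF AS'.abelian_group_tensor b']
      by (subst tlift_add[OF assms(1,2) ag b])
        (auto simp: c.copy_simps c'.copy_simps AS.tensor_lift_add[OF AS'.abelian_group_tensor b']
          abelian_monoid.a_closed abelian_group.axioms(1)[OF AS.abelian_group_tensor] simp flip: add(3,4))
  qed
  moreover have "tensor_map K A' S' (map_prod h f) (dec (tensor K A S) z) =
    tensor_lift (tensor K A' S') (\<lambda>p. ptens K A' S' (fst (map_prod h f p)) (snd (map_prod h f p)))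
      (dec (tensor K A S) z)"
    by (rule tensor_map_lift[OF AS.two_modules_axioms AS'.two_modules_axioms])
      (use assms(7) in \<open>auto simp: l\<close>)
  ultimately show "PROP ?B"
    by (simp add: tens_map_def case_prod_unfold)
qed

context
  fixes A S A' S' :: "'u alg" and h f
  assumes 1: "A \<in> AAlg K" "S \<in> AAlg K" "A' \<in> AAlg K" "S' \<in> AAlg K"
    and h: "lin K A A' h" and f: "lin K S S' f"
begin

lemma tens_map_closed: "z \<in> carrier (tens K A S) ==> tens_map K A S A' S' h f z \<in> carrier (tens K A' S')"
  by (simp add: tens_map_eq[OF 1 h f] tlift_closed[OF 1(1,2) AAlgD(4)[OF tens_AAlg[OF 1(3,4)]] tens_map_eq(1)[OF 1 h f]])

lemma tens_map_add: "y \<in> carrier (tens K A S) ==> z \<in> carrier (tens K A S) ==>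
    tens_map K A S A' S' h f (y +[tens K A S] z) =
    tens_map K A S A' S' h f y +[tens K A' S'] tens_map K A S A' S' h f z"
  by (simp add: tens_map_eq[OF 1 h f] AAlg_closed[OF tens_AAlg[OF 1(1,2)]]
      tlift_add[OF 1(1,2) AAlgD(4)[OF tens_AAlg[OF 1(3,4)]] tens_map_eq(1)[OF 1 h f]])

lemma tens_map_pt: "a \<in> carrier A ==> s \<in> carrier S ==>
    tens_map K A S A' S' h f (pt A S a s) = pt A' S' (h a) (f s)"
  by (simp add: tens_map_eq[OF 1 h f] pt_closed[OF 1(1,2)]
      tlift_pt[OF 1(1,2) AAlgD(4)[OF tens_AAlg[OF 1(3,4)]] tens_map_eq(1)[OF 1 h f, OF pt_closed[OF 1(1,2)]]])

lemma tens_map_ring_hom: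
  assumes "h \<in> ring_hom A A'" "f \<in> ring_hom S S'"
  shows "tens_map K A S A' S' h f \<in> ring_hom (tens K A S) (tens K A' S')"
proof -
  interpret T: ring "tens K A S" using 1 tens_AAlg by (intro AAlgD)
  interpret T': ring "tens K A' S'" using 1 tens_AAlg by (intro AAlgD)
  note c = ring_hom_closed[OF assms(1)] ring_hom_closed[OF assms(2)]
  have "tens_map K A S A' S' h f (y *[tens K A S] z) =
    tens_map K A S A' S' h f y *[tens K A' S'] tens_map K A S A' S' h f z"
    if "y \<in> carrier (tens K A S)" "z \<in> carrier (tens K A S)" for y z
    using 1(1,2) that
  proof (induction arbitrary: z rule: tens_induct)
    case (pure a s)
    have as: "a \<in> carrier A" "s \<in> carrier S" by fact+
    show ?case using 1(1,2) pure(3)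
    proof (induction rule: tens_induct)
      case (pure b t)
      then show ?case using as 1
        by (simp add: pt_mult tens_map_pt AAlg_closed c ring_hom_mult[OF assms(1)] ring_hom_mult[OF assms(2)])
    next
      case (add y z)
      then show ?case using as 1
        by (simp add: tens_map_add T.r_distr T'.r_distr tens_map_closed pt_closed)
    qed
  next
    case (add y z)
    then show ?case by (simp add: tens_map_add T.l_distr T'.l_distr tens_map_closed)
  qed
  moreover have "tens_map K A S A' S' h f 1[tens K A S] = 1[tens K A' S']"
    using 1 by (simp add: pt_one tens_map_pt AAlg_closed ring_hom_one[OF assms(1)] ring_hom_one[OF assms(2)])
  ultimately show ?thesis
    by (intro ring_hom_memI) (simp_all add: tens_map_closed tens_map_add)
qed

end

section \<open>The tensor product as coproduct of commutative algebras\<close>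

definition inl :: "'u alg => 'u alg => 'u => 'u" where
  "inl A S = (\<lambda>a\<in>carrier A. pt A S a 1[S])"

definition inr :: "'u alg => 'u alg => 'u => 'u" where
  "inr A S = (\<lambda>s\<in>carrier S. pt A S 1[A] s)"

text \<open>The copairing out of the coproduct \<open>tens K A S\<close> with injections
  \<open>inl\<close> and \<open>inr\<close>. Its multiplicativity rests on commutativity of the
  target \<open>D\<close>.\<close>

definition cop :: "'u alg => 'u alg => 'u alg => ('u => 'u) => ('u => 'u) => 'u => 'u" where
  "cop A S D f g = (\<lambda>z\<in>carrier (tens K A S). tlift A S D (\<lambda>(a, s). f a *[D] g s) z)"

lemma inl_alg_hom: "A \<in> AAlg K ==> S \<in> AAlg K ==> inl A S \<in> alg_hom K A (tens K A S)"
proof -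
  assume A: "A \<in> AAlg K" and S: "S \<in> AAlg K"
  interpret S: ring S using S by (rule AAlgD)
  show ?thesis
    using A S by (intro alg_homI)
      (auto simp: inl_def AAlg_closed pt_closed pt_add_left pt_mult pt_smult pt_one)
qed

lemma inr_alg_hom: "A \<in> AAlg K ==> S \<in> AAlg K ==> inr A S \<in> alg_hom K S (tens K A S)"
proof -
  assume A: "A \<in> AAlg K" and S: "S \<in> AAlg K"
  interpret A: ring A using A by (rule AAlgD)
  show ?thesis
    using A S by (intro alg_homI)
      (auto simp: inr_def AAlg_closed pt_closed pt_add_right pt_mult pt_smult pt_one pt_balanced)
qed

context
  fixes A S D :: "'u alg" and f g
  assumes A: "A \<in> CAlg K" and S: "S \<in> CAlg K" and D: "D \<in> CAlg K"
    and f: "f \<in> alg_hom K A D" and g: "g \<in> alg_hom K S D"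
begin

interpretation D: cring D using D by (rule CAlg_cring)
interpretation T: cring "tens K A S" using tens_CAlg[OF A S] by (rule CAlg_cring)

lemma cop_bilin: "bilin K A S D (\<lambda>(a, s). f a *[D] g s)"
  by (rule bilinI) (simp_all add: alg_homD[OF f] alg_homD[OF g] D.l_distr D.r_distr
      AAlg_smult_assoc[OF CAlg_AAlg[OF D]])

lemma cop_pt: "a \<in> carrier A ==> s \<in> carrier S ==> cop A S D f g (pt A S a s) = f a *[D] g s"
  using A S by (simp add: cop_def tlift_pt[OF CAlg_AAlg[OF A] CAlg_AAlg[OF S] D.abelian_group_axioms cop_bilin]
      pt_closed CAlg_AAlg)

lemma cop_add: "y \<in> carrier (tens K A S) ==> z \<in> carrier (tens K A S) ==>
    cop A S D f g (y +[tens K A S] z) = cop A S D f g y +[D] cop A S D f g z"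
  by (simp add: cop_def tlift_add[OF CAlg_AAlg[OF A] CAlg_AAlg[OF S] D.abelian_group_axioms cop_bilin])

lemma cop_closed: "z \<in> carrier (tens K A S) ==> cop A S D f g z \<in> carrier D"
  by (simp add: cop_def tlift_closed[OF CAlg_AAlg[OF A] CAlg_AAlg[OF S] D.abelian_group_axioms cop_bilin])

lemma cop_alg_hom: "cop A S D f g \<in> alg_hom K (tens K A S) D"
proof (rule alg_homI)
  note AS = CAlg_AAlg[OF A] CAlg_AAlg[OF S]
  note h = alg_homD[OF f] alg_homD[OF g]
  show "cop A S D f g \<in> extensional (carrier (tens K A S))" by (simp add: cop_def)
  show "cop A S D f g 1[tens K A S] = 1[D]"
    using AS by (simp add: pt_one cop_pt AAlg_closed h)
  show "cop A S D f g (r \<cdot>[tens K A S] z) = r \<cdot>[D] cop A S D f g z"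
    if "r \<in> carrier K" "z \<in> carrier (tens K A S)" for r z
    using AS that(2)
  proof (induction rule: tens_induct)
    case (pure a s)
    then show ?case using that AS
      by (simp add: pt_smult cop_pt AAlg_closed h AAlg_smult_assoc[OF CAlg_AAlg[OF D]])
  next
    case (add y z)
    interpret TM: module K "tens K A S" using AS tens_AAlg by (intro AAlgD)
    interpret DM: module K D using D by (rule CAlgD)
    show ?case using add that by (simp add: cop_add cop_closed TM.smult_r_distr DM.smult_r_distr)
  qed
  show "cop A S D f g (y *[tens K A S] z) = cop A S D f g y *[D] cop A S D f g z"
    if "y \<in> carrier (tens K A S)" "z \<in> carrier (tens K A S)" for y z
    using AS that
  proof (induction arbitrary: z rule: tens_induct)
    case (pure a s)
    have as: "a \<in> carrier A" "s \<in> carrier S" by fact+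
    show ?case using AS pure(3)
    proof (induction rule: tens_induct)
      case (pure b t)
      then show ?case using as AS
        by (simp add: pt_mult cop_pt AAlg_closed h D.m_ac)
    next
      case (add y z)
      then show ?case using as AS
        by (simp add: cop_add T.r_distr D.r_distr cop_closed pt_closed)
    qed
  next
    case (add y z)
    then show ?case by (simp add: cop_add T.l_distr D.l_distr cop_closed)
  qed
qed (simp_all add: cop_add cop_closed)

lemma cop_inl: "cop A S D f g o[A] inl A S = f"
proof (rule alg_hom_eqI[OF _ f])
  show "cop A S D f g o[A] inl A S \<in> alg_hom K A D"
    using A S cop_alg_hom by (intro compose_alg_hom[where B = "tens K A S"] inl_alg_hom CAlg_AAlg)
qed (use S in \<open>simp add: compose_def inl_def cop_pt CAlg_closed alg_homD[OF f] alg_homD[OF g]\<close>)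

lemma cop_inr: "cop A S D f g o[S] inr A S = g"
proof (rule alg_hom_eqI[OF _ g])
  show "cop A S D f g o[S] inr A S \<in> alg_hom K S D"
    using A S cop_alg_hom by (intro compose_alg_hom[where B = "tens K A S"] inr_alg_hom CAlg_AAlg)
qed (use A in \<open>simp add: compose_def inr_def cop_pt CAlg_closed alg_homD[OF f] alg_homD[OF g]\<close>)

end

text \<open>Maps out of a tensor product are compared on pure tensors. Only additivity is asked, and
  \<open>P\<close> merely supplies an addition, so the rule serves algebra homomorphisms,
  contractions and actions alike.\<close>

lemma tens_hom_eqI:
  assumes "A \<in> AAlg K" "S \<in> AAlg K" "z \<in> carrier (tens K A S)"
    and "\<And>y z. y \<in> carrier (tens K A S) ==> z \<in> carrier (tens K A S) ==>
    u (y +[tens K A S] z) = u y +[P] u z"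
    and "\<And>y z. y \<in> carrier (tens K A S) ==> z \<in> carrier (tens K A S) ==>
    v (y +[tens K A S] z) = v y +[P] v z"
    and "\<And>a s. a \<in> carrier A ==> s \<in> carrier S ==> u (pt A S a s) = v (pt A S a s)"
  shows "u z = v z"
  using assms(1-3) by (induction rule: tens_induct) (simp_all add: assms)

end

section \<open>Linear functionals over a field\<close>

context module
begin

definition add_line :: "'c set => 'c => 'c set" where
  "add_line W a = {w +[M] k \<cdot>[M] a | w k. w \<in> W \<and> k \<in> carrier R}"

lemma add_lineI: "x = w +[M] k \<cdot>[M] a ==> w \<in> W ==> k \<in> carrier R ==> x \<in> add_line W a"
  by (auto simp: add_line_def)

lemma submodule_zero: "submodule W R M ==> 0[M] \<in> W"
  using subgroup.one_closed[of W "add_monoid M"] by (simp add: submodule_def)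

lemma submodule_closed:
  assumes "submodule W R M"
  shows "w \<in> W ==> w \<in> carrier M" "w \<in> W ==> v \<in> W ==> w +[M] v \<in> W"
    "w \<in> W ==> \<ominus>\<^bsub>M\<^esub> w \<in> W" "k \<in> carrier R ==> w \<in> W ==> k \<cdot>[M] w \<in> W"
  using submoduleE[OF assms] by auto

lemma submodule_add_line:
  assumes W: "submodule W R M" and a: "a \<in> carrier M"
  shows "submodule (add_line W a) R M" "W \<subseteq> add_line W a" "a \<in> add_line W a"
proof -
  note c = submodule_closed[OF W]
  show "submodule (add_line W a) R M"
  proof (rule submoduleI)
    show "add_line W a \<subseteq> carrier M" using c a by (auto simp: add_line_def)
    show "0[M] \<in> add_line W a"
      unfolding add_line_def using submodule_zero[OF W] a
      by (intro CollectI exI[of _ "0[M]"] exI[of _ "0[R]"]) simp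
  next
    fix x assume "x \<in> add_line W a"
    then obtain w k where *: "x = w +[M] k \<cdot>[M] a" "w \<in> W" "k \<in> carrier R" by (auto simp: add_line_def)
    then have "\<ominus>\<^bsub>M\<^esub> x = \<ominus>\<^bsub>M\<^esub> w +[M] (\<ominus>\<^bsub>R\<^esub> k) \<cdot>[M] a"
      using c a by (simp add: M.minus_add smult_l_minus)
    then show "\<ominus>\<^bsub>M\<^esub> x \<in> add_line W a"
      using * c by (intro add_lineI[of _ "\<ominus>\<^bsub>M\<^esub> w" "\<ominus>\<^bsub>R\<^esub> k"]) auto
  next
    fix x y assume "x \<in> add_line W a" "y \<in> add_line W a"
    then obtain w k v l where *: "x = w +[M] k \<cdot>[M] a" "w \<in> W" "k \<in> carrier R"
      "y = v +[M] l \<cdot>[M] a" "v \<in> W" "l \<in> carrier R" by (auto simp: add_line_def)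
    then have "x +[M] y = (w +[M] v) +[M] (k +[R] l) \<cdot>[M] a"
      using c a by (simp add: smult_l_distr M.a_ac)
    then show "x +[M] y \<in> add_line W a"
      using * c by (intro add_lineI[of _ "w +[M] v" "k +[R] l"]) auto
  next
    fix r x assume r: "r \<in> carrier R" and "x \<in> add_line W a"
    then obtain w k where *: "x = w +[M] k \<cdot>[M] a" "w \<in> W" "k \<in> carrier R" by (auto simp: add_line_def)
    then have "r \<cdot>[M] x = r \<cdot>[M] w +[M] (r *[R] k) \<cdot>[M] a"
      using r c a by (simp add: smult_r_distr smult_assoc1)
    then show "r \<cdot>[M] x \<in> add_line W a"
      using * c r by (intro add_lineI[of _ "r \<cdot>[M] w" "r *[R] k"]) auto
  qed
  show "W \<subseteq> add_line W a"
  proof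
    fix w assume "w \<in> W"
    then show "w \<in> add_line W a"
      unfolding add_line_def using a c by (intro CollectI exI[of _ w] exI[of _ "0[R]"]) simp
  qed
  show "a \<in> add_line W a"
    unfolding add_line_def using a submodule_zero[OF W]
    by (intro CollectI exI[of _ "0[M]"] exI[of _ "1[R]"]) simp
qed

lemma submodule_Union_chain:
  assumes "C \<noteq> {}" "\<And>W. W \<in> C ==> submodule W R M" "\<And>U W. U \<in> C ==> W \<in> C ==> U \<subseteq> W \<or> W \<subseteq> U"
  shows "submodule (\<Union>C) R M"
proof (rule submoduleI)
  show "\<Union>C \<subseteq> carrier M" using assms(2) submodule_closed(1) by blast
  show "0[M] \<in> \<Union>C" using assms(1,2) submodule_zero by blast
  show "\<ominus>\<^bsub>M\<^esub> x \<in> \<Union>C" if "x \<in> \<Union>C" for x using that assms(2) submodule_closed(3) by blast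
  show "r \<cdot>[M] x \<in> \<Union>C" if "r \<in> carrier R" "x \<in> \<Union>C" for r x
    using that assms(2) submodule_closed(4) by blast
  show "x +[M] y \<in> \<Union>C" if xy: "x \<in> \<Union>C" "y \<in> \<Union>C" for x y
  proof -
    obtain U W where "U \<in> C" "x \<in> U" "W \<in> C" "y \<in> W" using xy by blast
    then show ?thesis using assms(3)[of U W] assms(2) submodule_closed(2) by blast
  qed
qed

definition functional :: "('c => 'a) => bool" where
  "functional e \<longleftrightarrow> (\<forall>x\<in>carrier M. e x \<in> carrier R) \<and>
     (\<forall>x\<in>carrier M. \<forall>y\<in>carrier M. e (x +[M] y) = e x +[R] e y) \<and>
     (\<forall>r\<in>carrier R. \<forall>x\<in>carrier M. e (r \<cdot>[M] x) = r *[R] e x)"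

text \<open>A subspace maximal among those containing \<open>V\<close> but not \<open>x\<close> is a complement of the line through \<open>x\<close>.\<close>

lemma functional_exists:
  assumes fld: "field R" and V: "submodule V R M" and x: "x \<in> carrier M" "x \<notin> V"
  shows "\<exists>e. functional e \<and> (\<forall>v\<in>V. e v = 0[R]) \<and> e x = 1[R]"
proof -
  interpret F: field R by fact
  let ?A = "{U. submodule U R M \<and> V \<subseteq> U \<and> x \<notin> U}"
  have "\<exists>W\<in>?A. \<forall>U\<in>?A. W \<subseteq> U --> U = W"
  proof (rule subset_Zorn_nonempty)
    show "?A \<noteq> {}" using V x by blast
    fix C assume C: "C \<noteq> {}" "subset.chain ?A C"
    have sub: "C \<subseteq> ?A" and tot: "\<And>U W. U \<in> C ==> W \<in> C ==> U \<subseteq> W \<or> W \<subseteq> U"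
      using C(2) unfolding subset_chain_def by blast+
    have "submodule (\<Union>C) R M"
      using C(1) sub tot by (intro submodule_Union_chain) blast+
    moreover have "V \<subseteq> \<Union>C" using C(1) sub by blast
    moreover have "x \<notin> \<Union>C" using sub by blast
    ultimately show "\<Union>C \<in> ?A" by simp
  qed
  then obtain W where WA: "W \<in> ?A" and WM: "\<forall>U\<in>?A. W \<subseteq> U --> U = W" by (elim bexE)
  have W: "submodule W R M" "V \<subseteq> W" "x \<notin> W" using WA by simp_all
  have max: "\<And>U. submodule U R M ==> V \<subseteq> U ==> x \<notin> U ==> W \<subseteq> U ==> U = W" using WM by simp
  note c = submodule_closed[OF W(1)]
  have unit: "\<exists>j\<in>carrier R. j *[R] k = 1[R]" if "k \<in> carrier R" "k \<noteq> 0[R]" for k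
  proof -
    have "k \<in> Units R" using that F.field_Units by blast
    then show ?thesis by (auto simp: Units_def)
  qed
  have line: "k = 0[R]" if k: "k \<in> carrier R" "k \<cdot>[M] x \<in> W" for k
  proof (rule ccontr)
    assume "k \<noteq> 0[R]"
    then obtain j where j: "j \<in> carrier R" "j *[R] k = 1[R]" using unit k by blast
    then have "j \<cdot>[M] (k \<cdot>[M] x) = x" using k x by (simp flip: smult_assoc1)
    then show False using c(4)[OF j(1) k(2)] W by simp
  qed
  \<comment> \<open>A vector \<open>m\<close> outside \<open>W\<close> enlarges \<open>W\<close>, so
    maximality forces \<open>x\<close> into \<open>W\<close> plus the line of \<open>m\<close>. The
    coefficient at \<open>m\<close> is nonzero, as \<open>x\<close> is not in \<open>W\<close>, and
    dividing by it solves for \<open>m\<close>.\<close>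
  have ex: "\<exists>k\<in>carrier R. \<exists>w\<in>W. m = w +[M] k \<cdot>[M] x" if m: "m \<in> carrier M" for m
  proof (cases "m \<in> W")
    case True
    then show ?thesis using m x by (intro bexI[of _ "0[R]"] bexI[of _ m]) simp_all
  next
    case False
    note L = submodule_add_line[OF W(1) m]
    have "x \<in> add_line W m"
      using max[OF L(1)] L W False by blast
    then obtain w k where wk: "w \<in> W" "k \<in> carrier R" "x = w +[M] k \<cdot>[M] m"
      by (auto simp: add_line_def)
    have "k \<noteq> 0[R]"
    proof
      assume "k = 0[R]"
      then have "x = w" using wk m c(1) by simp
      then show False using wk W(3) by simp
    qed
    then obtain j where j: "j \<in> carrier R" "j *[R] k = 1[R]" using unit wk by blast
    have "k \<cdot>[M] m = \<ominus>\<^bsub>M\<^esub> w +[M] x"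
      using wk m c by (simp add: M.r_neg1)
    then have "j \<cdot>[M] (k \<cdot>[M] m) = j \<cdot>[M] (\<ominus>\<^bsub>M\<^esub> w) +[M] j \<cdot>[M] x"
      using wk(1) j c x by (simp add: smult_r_distr)
    then have "m = j \<cdot>[M] (\<ominus>\<^bsub>M\<^esub> w) +[M] j \<cdot>[M] x"
      using smult_assoc1[OF j(1) wk(2) m] j m by simp
    then show ?thesis using j c wk by blast
  qed
  have uniq: "k = l" if "k \<in> carrier R" "l \<in> carrier R" "w \<in> W" "v \<in> W"
    "w +[M] k \<cdot>[M] x = v +[M] l \<cdot>[M] x" for k l w v
  proof -
    have "(k +[R] \<ominus>\<^bsub>R\<^esub> l) \<cdot>[M] x = k \<cdot>[M] x +[M] \<ominus>\<^bsub>M\<^esub> (l \<cdot>[M] x)"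
      using that x by (simp add: smult_l_distr smult_l_minus)
    also have "\<dots> = (\<ominus>\<^bsub>M\<^esub> w +[M] (w +[M] k \<cdot>[M] x)) +[M] \<ominus>\<^bsub>M\<^esub> (l \<cdot>[M] x)"
      using that(1-4) x c by (simp add: M.r_neg1)
    also have "\<dots> = \<ominus>\<^bsub>M\<^esub> w +[M] v"
      unfolding that(5) using that(1-4) x c by (simp add: M.a_assoc M.r_neg)
    finally have "(k +[R] \<ominus>\<^bsub>R\<^esub> l) \<cdot>[M] x \<in> W" using that c by simp
    then have "k +[R] \<ominus>\<^bsub>R\<^esub> l = 0[R]" using line that by simp
    then have "(k +[R] \<ominus>\<^bsub>R\<^esub> l) +[R] l = l" using that by simp
    then show ?thesis using that by (simp add: R.a_assoc R.l_neg)
  qed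
  define e where "e m = (THE k. k \<in> carrier R \<and> (\<exists>w\<in>W. m = w +[M] k \<cdot>[M] x))" for m
  have e: "e (w +[M] k \<cdot>[M] x) = k" if "w \<in> W" "k \<in> carrier R" for w k
    unfolding e_def using that uniq by (intro the_equality) blast+
  have "functional e"
    unfolding functional_def
  proof (intro conjI ballI)
    fix m assume "m \<in> carrier M"
    then show "e m \<in> carrier R" using ex[of m] e by auto
  next
    fix m n assume "m \<in> carrier M" "n \<in> carrier M"
    then obtain k l w v where *: "k \<in> carrier R" "w \<in> W" "m = w +[M] k \<cdot>[M] x"
       "l \<in> carrier R" "v \<in> W" "n = v +[M] l \<cdot>[M] x" using ex by meson
    then have "m +[M] n = (w +[M] v) +[M] (k +[R] l) \<cdot>[M] x"
      using c x by (simp add: smult_l_distr M.a_ac)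
    then show "e (m +[M] n) = e m +[R] e n" using * e c by simp
  next
    fix r m assume r: "r \<in> carrier R" and "m \<in> carrier M"
    then obtain k w where *: "k \<in> carrier R" "w \<in> W" "m = w +[M] k \<cdot>[M] x" using ex by meson
    then have "r \<cdot>[M] m = r \<cdot>[M] w +[M] (r *[R] k) \<cdot>[M] x"
      using c x r by (simp add: smult_r_distr smult_assoc1)
    then show "e (r \<cdot>[M] m) = r *[R] e m" using * e c r by simp
  qed
  moreover have "e v = 0[R]" if "v \<in> V" for v
    using e[of v "0[R]"] that W c x by (auto simp: subset_iff)
  moreover have "e x = 1[R]"
    using e[of "0[M]" "1[R]"] x submodule_zero[OF W(1)] by simp
  ultimately show ?thesis by blast
qed

lemma functionalD:
  assumes "functional e"
  shows "x \<in> carrier M ==> e x \<in> carrier R"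
    "x \<in> carrier M ==> y \<in> carrier M ==> e (x +[M] y) = e x +[R] e y"
    "r \<in> carrier R ==> x \<in> carrier M ==> e (r \<cdot>[M] x) = r *[R] e x"
  using assms by (auto simp: functional_def)

lemma zero_submodule: "submodule {0[M]} R M"
  by (rule submoduleI) auto

end

context base
begin

interpretation K: field K by (rule K_field)

section \<open>Detecting elements of tensor products by functionals\<close>

text \<open>The image of \<open>W \<otimes> S\<close> in \<open>A \<otimes> S\<close> for a subspace
  \<open>W\<close>, described inside \<open>A \<otimes> S\<close> so that no tensor product of
  \<open>W\<close> itself has to be formed.\<close>

inductive_set tspan :: "'u alg => 'u alg => 'u set => 'u set" for A S W where
  pt: "w \<in> W ==> s \<in> carrier S ==> pt A S w s \<in> tspan A S W"
| add: "y \<in> tspan A S W ==> z \<in> tspan A S W ==> y +[tens K A S] z \<in> tspan A S W"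

lemma tspan_mono: "z \<in> tspan A S W ==> W \<subseteq> U ==> z \<in> tspan A S U"
  by (induction rule: tspan.induct) (auto intro: tspan.intros)

text \<open>The slant product \<open>e \<otimes> id\<close>, contracting the first factor into
  \<open>K\<close> and leaving an element of \<open>S\<close>.\<close>

definition slant :: "'u alg => 'u alg => ('u => 'u) => 'u => 'u" where
  "slant A S e = tlift A S S (\<lambda>(a, s). e a \<cdot>[S] s)"

context
  fixes A S :: "'u alg"
  assumes A: "A \<in> AAlg K" and S: "S \<in> AAlg K"
begin

interpretation A: module K A using A by (rule AAlgD)
interpretation S: module K S using S by (rule AAlgD)
interpretation AS: module K "tens K A S" using tens_AAlg[OF A S] by (rule AAlgD)

lemma slant_bilin: "A.functional e ==> bilin K A S S (\<lambda>(a, s). e a \<cdot>[S] s)"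
  by (rule bilinI)
    (simp_all add: A.functionalD S.smult_l_distr S.smult_r_distr K.m_comm flip: S.smult_assoc1)

lemmas slant_facts = tlift_closed[OF A S S.M.abelian_group_axioms slant_bilin, folded slant_def]
  tlift_add[OF A S S.M.abelian_group_axioms slant_bilin, folded slant_def]
  tlift_pt[OF A S S.M.abelian_group_axioms slant_bilin, folded slant_def, unfolded prod.case]

lemma tspan_closed: "z \<in> tspan A S W ==> W \<subseteq> carrier A ==> z \<in> carrier (tens K A S)"
  by (induction rule: tspan.induct) (auto simp: pt_closed[OF A S])

lemma slant_tspan:
  assumes "A.functional e" "\<And>w. w \<in> W ==> e w = 0[K]" "W \<subseteq> carrier A" "z \<in> tspan A S W"
  shows "slant A S e z = 0[S]"
  using assms(4)
  by (induction rule: tspan.induct) (use assms in \<open>auto simp: slant_facts tspan_closed subset_iff\<close>)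

text \<open>In each term the multiple of \<open>a\<close> is moved across the tensor sign by
  balancedness, and all these parts collect into one coefficient of \<open>a\<close>.\<close>

lemma tspan_add_line:
  assumes W: "submodule W K A" and a: "a \<in> carrier A" and z: "z \<in> tspan A S (A.add_line W a)"
  shows "\<exists>v\<in>tspan A S W. \<exists>s\<in>carrier S. z = v +[tens K A S] pt A S a s"
  using z
proof (induction rule: tspan.induct)
  case (pt u s)
  then obtain w k where *: "u = w +[A] k \<cdot>[A] a" "w \<in> W" "k \<in> carrier K" by (auto simp: A.add_line_def)
  then have "pt A S u s = pt A S w s +[tens K A S] pt A S a (k \<cdot>[S] s)"
    using pt a A.submodule_closed[OF W] by (simp add: pt_add_left[OF A S] pt_balanced[OF A S])
  then show ?case using * pt by (meson S.smult_closed tspan.pt)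
next
  case (add y z)
  then obtain v s v' s' where *: "v \<in> tspan A S W" "s \<in> carrier S" "y = v +[tens K A S] pt A S a s"
     "v' \<in> tspan A S W" "s' \<in> carrier S" "z = v' +[tens K A S] pt A S a s'" by meson
  have "W \<subseteq> carrier A" using A.submodule_closed[OF W] by blast
  then have "y +[tens K A S] z = (v +[tens K A S] v') +[tens K A S] pt A S a (s +[S] s')"
    using * a tspan_closed by (simp add: pt_add_right[OF A S] pt_closed[OF A S] AS.M.a_ac)
  then show ?case using * by (meson S.M.a_closed tspan.add)
qed

text \<open>Functionals that extend along an injection \<open>j\<close> suffice.\<close>

lemma detect_step:
  assumes T: "T \<in> AAlg K" and j: "lin K A T j" "inj_on j (carrier A)"
    and W: "submodule W K A" and a: "a \<in> carrier A" and z: "z \<in> tspan A S (A.add_line W a)"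
    and kill: "\<And>e. module.functional K T e ==> (\<forall>w\<in>W. e (j w) = 0[K]) ==> slant A S (\<lambda>a. e (j a)) z = 0[S]"
  shows "z \<in> tspan A S W"
proof (cases "a \<in> W")
  case True
  have "A.add_line W a \<subseteq> W"
    using True A.submodule_closed[OF W] by (auto simp: A.add_line_def)
  then show ?thesis using z tspan_mono by blast
next
  case False
  interpret T: module K T using T by (rule AAlgD)
  have j0: "j 0[A] = 0[T]" using j(1) A.module_axioms T.module_axioms by (rule lin_zero)
  have jneg: "j (\<ominus>\<^bsub>A\<^esub> x) = \<ominus>\<^bsub>T\<^esub> j x" if "x \<in> carrier A" for x
  proof -
    have "j (\<ominus>\<^bsub>A\<^esub> x) +[T] j x = 0[T]" using that by (simp flip: linD(2)[OF j(1)] add: A.M.l_neg j0)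
    then show ?thesis using that linD(1)[OF j(1)] T.M.minus_equality by simp
  qed
  have "submodule (j ` W) K T"
  proof (rule T.submoduleI)
    show "j ` W \<subseteq> carrier T" using A.submodule_closed[OF W] linD[OF j(1)] by auto
    show "0[T] \<in> j ` W" using A.submodule_zero[OF W] j0 by (metis imageI)
    show "\<ominus>\<^bsub>T\<^esub> x \<in> j ` W" if "x \<in> j ` W" for x
      using that A.submodule_closed[OF W] by (auto simp flip: jneg)
    show "x +[T] y \<in> j ` W" if "x \<in> j ` W" "y \<in> j ` W" for x y
      using that A.submodule_closed[OF W] by (auto simp flip: linD(2)[OF j(1)])
    show "r \<cdot>[T] x \<in> j ` W" if "r \<in> carrier K" "x \<in> j ` W" for r x
      using that A.submodule_closed[OF W] by (auto simp flip: linD(3)[OF j(1)])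
  qed
  moreover have "j a \<notin> j ` W"
    using False j(2) a A.submodule_closed(1)[OF W] by (auto simp: inj_on_def)
  moreover have "j a \<in> carrier T" using a linD[OF j(1)] by simp
  \<comment> \<open>The functional is taken on \<open>T\<close>, not on \<open>A\<close>: it kills
    the image of \<open>W\<close> and is 1 at \<open>j a\<close>, so contracting
    \<open>z = v + a \<otimes> s\<close> leaves \<open>s\<close> alone, which \<open>kill\<close>
    makes zero.\<close>
  ultimately obtain e where e: "T.functional e" "\<forall>w\<in>W. e (j w) = 0[K]" "e (j a) = 1[K]"
    using T.functional_exists[OF K_field] by (metis imageI)
  have fe: "A.functional (\<lambda>a. e (j a))"
    using T.functionalD[OF e(1)] linD[OF j(1)] by (auto simp: A.functional_def)
  obtain v s where v: "v \<in> tspan A S W" "s \<in> carrier S" "z = v +[tens K A S] pt A S a s"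
    using tspan_add_line[OF W a z] by blast
  have Wc: "W \<subseteq> carrier A" using A.submodule_closed[OF W] by blast
  have "slant A S (\<lambda>a. e (j a)) v = 0[S]"
    using slant_tspan[OF fe _ Wc v(1)] e(2) by blast
  moreover have "slant A S (\<lambda>a. e (j a)) z = 0[S]" using kill e by blast
  ultimately have "s = 0[S]"
    using v a e tspan_closed[OF v(1) Wc] by (simp add: slant_facts[OF fe] pt_closed[OF A S])
  then have "pt A S a s = pt A S (0[K] \<cdot>[A] a) 0[S]"
    using a by (simp only: pt_balanced[OF A S] K.zero_closed S.M.zero_closed S.smult_r_null)
  then have "pt A S a s = pt A S 0[A] 0[S]" using a by simp
  then have "pt A S a s \<in> tspan A S W"
    using A.submodule_zero[OF W] by (auto intro: tspan.pt)
  then show ?thesis using v tspan.add by simp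
qed

definition add_lines :: "'u set => 'u list => 'u set" where
  "add_lines W as = foldr (\<lambda>a W. A.add_line W a) as W"

lemma add_lines_submodule:
  "submodule W K A ==> set as \<subseteq> carrier A ==> submodule (add_lines W as) K A \<and> W \<subseteq> add_lines W as"
proof (induction as)
  case (Cons a as)
  then show ?case
    using A.submodule_add_line[of "add_lines W as" a] by (simp add: add_lines_def) blast
qed (simp add: add_lines_def)

lemma add_lines_mono: "W \<subseteq> U ==> add_lines W as \<subseteq> add_lines U as"
proof (induction as)
  case (Cons a as)
  then show ?case unfolding add_lines_def by (auto simp: A.add_line_def)
qed (simp add: add_lines_def)

text \<open>A tensor involves only finitely many elements of \<open>A\<close>; this finiteness is
  what lets \<open>detect\<close> proceed line by line.\<close>

lemma tspan_add_lines_ex: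
  assumes W: "submodule W K A" and z: "z \<in> carrier (tens K A S)"
  shows "\<exists>as. set as \<subseteq> carrier A \<and> z \<in> tspan A S (add_lines W as)"
  using A S z
proof (induction rule: tens_induct)
  case (pure a s)
  have "a \<in> add_lines W [a]" using A.submodule_add_line(3)[OF W] pure by (simp add: add_lines_def)
  then show ?case using pure by (intro exI[of _ "[a]"]) (auto intro: tspan.pt)
next
  case (add y z)
  then obtain as bs where *: "set as \<subseteq> carrier A" "y \<in> tspan A S (add_lines W as)"
    "set bs \<subseteq> carrier A" "z \<in> tspan A S (add_lines W bs)" by blast
  have eq: "add_lines W (as @ bs) = add_lines (add_lines W bs) as" by (simp add: add_lines_def)
  have b: "submodule (add_lines W bs) K A" "W \<subseteq> add_lines W bs" using add_lines_submodule[OF W *(3)] by auto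
  have "add_lines W as \<subseteq> add_lines W (as @ bs)" "add_lines W bs \<subseteq> add_lines W (as @ bs)"
    unfolding eq using add_lines_mono[OF b(2)] add_lines_submodule[OF b(1) *(1)] by auto
  then have "y +[tens K A S] z \<in> tspan A S (add_lines W (as @ bs))"
    using * tspan_mono by (intro tspan.add) blast+
  then show ?case using * by (intro exI[of _ "as @ bs"]) auto
qed

text \<open>The finitely many lines are removed one at a time; a functional that kills an
  intermediate subspace also kills \<open>W\<close>, so \<open>kill\<close> applies at each stage.
  With \<open>j\<close> the identity this locates images of morphisms, with \<open>W\<close> zero it
  proves injectivity of base change.\<close>

lemma detect:
  assumes T: "T \<in> AAlg K" and j: "lin K A T j" "inj_on j (carrier A)"
    and W: "submodule W K A" and z: "z \<in> carrier (tens K A S)"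
    and kill: "\<And>e. module.functional K T e ==> (\<forall>w\<in>W. e (j w) = 0[K]) ==> slant A S (\<lambda>a. e (j a)) z = 0[S]"
  shows "z \<in> tspan A S W"
proof -
  obtain as where "set as \<subseteq> carrier A" "z \<in> tspan A S (add_lines W as)"
    using tspan_add_lines_ex[OF W z] by blast
  then show ?thesis
  proof (induction as)
    case (Cons a as)
    have sm: "submodule (add_lines W as) K A" "W \<subseteq> add_lines W as"
      using add_lines_submodule[OF W] Cons by auto
    have "z \<in> tspan A S (add_lines W as)"
    proof (rule detect_step[OF T j sm(1)])
      show "a \<in> carrier A" "z \<in> tspan A S (A.add_line (add_lines W as) a)"
        using Cons by (simp_all add: add_lines_def)
    qed (use kill sm in blast)
    then show ?case using Cons by simp
  qed (simp add: add_lines_def)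
qed

end

lemma slant_tens_map:
  assumes A: "A \<in> AAlg K" and S: "S \<in> AAlg K" and T: "T \<in> AAlg K" and j: "lin K A T j"
    and e: "module.functional K T e" and z: "z \<in> carrier (tens K A S)"
  shows "slant T S e (tens_map K A S T S j id z) = slant A S (\<lambda>a. e (j a)) z"
proof -
  interpret T: module K T using T by (rule AAlgD)
  interpret A: module K A using A by (rule AAlgD)
  have fe: "A.functional (\<lambda>a. e (j a))"
    using T.functionalD[OF e] linD[OF j] by (auto simp: A.functional_def)
  show ?thesis
    using A S z
    by (rule tens_hom_eqI)
      (use S T A j linD[OF j] in \<open>simp_all add: tens_map_add tens_map_pt tens_map_closed lin_id
        slant_facts[OF T S e] slant_facts[OF A S fe] pt_closed\<close>)
qed

text \<open>Flatness over a field without bases: a tensor killed by \<open>j \<otimes> id\<close>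
  has zero contraction with every functional pulled back along \<open>j\<close>, hence vanishes by
  \<open>detect\<close> for the zero subspace.\<close>

lemma tens_map_inj:
  assumes A: "A \<in> AAlg K" and S: "S \<in> AAlg K" and T: "T \<in> AAlg K"
    and j: "lin K A T j" "inj_on j (carrier A)"
  shows "inj_on (tens_map K A S T S j id) (carrier (tens K A S))"
proof -
  interpret T: module K T using T by (rule AAlgD)
  interpret A: module K A using A by (rule AAlgD)
  interpret S: module K S using S by (rule AAlgD)
  interpret AS: module K "tens K A S" using tens_AAlg[OF A S] by (rule AAlgD)
  interpret TS: module K "tens K T S" using tens_AAlg[OF T S] by (rule AAlgD)
  let ?m = "tens_map K A S T S j id"
  note m = tens_map_add[OF A S T S j(1) lin_id(1)] tens_map_closed[OF A S T S j(1) lin_id(1)]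
  have zero: "z = 0[tens K A S]" if z: "z \<in> carrier (tens K A S)" and mz: "?m z = 0[tens K T S]" for z
  proof -
    have "z \<in> tspan A S {0[A]}"
    proof (rule detect[OF A S T j A.zero_submodule z])
      fix e assume e: "T.functional e"
      have "slant T S e 0[tens K T S] = 0[S]"
        by (rule additive_zero) (simp_all add: slant_facts[OF T S e] TS.M.abelian_group_axioms S.M.abelian_group_axioms del: TS.M.r_zero TS.M.l_zero)
      then show "slant A S (\<lambda>a. e (j a)) z = 0[S]"
        using slant_tens_map[OF A S T j(1) e z] mz by simp
    qed
    then show ?thesis
    proof (induction rule: tspan.induct)
      case (pt w s)
      then have "pt A S w s = pt A S (0[K] \<cdot>[A] 0[A]) s" by simp
      also have "\<dots> = 0[K] \<cdot>[tens K A S] pt A S 0[A] s"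
        using pt by (simp only: pt_smult[OF A S] K.zero_closed A.M.zero_closed)
      also have "\<dots> = 0[tens K A S]" using pt by (simp add: pt_closed[OF A S])
      finally show ?case .
    qed simp
  qed
  have m0: "?m 0[tens K A S] = 0[tens K T S]"
    by (rule additive_zero) (simp_all only: m AS.M.zero_closed AS.M.abelian_group_axioms TS.M.abelian_group_axioms)
  show ?thesis
  proof (rule inj_onI)
    fix y z assume y: "y \<in> carrier (tens K A S)" and z: "z \<in> carrier (tens K A S)" and eq: "?m y = ?m z"
    have "?m (y +[tens K A S] \<ominus>\<^bsub>tens K A S\<^esub> z) = ?m (z +[tens K A S] \<ominus>\<^bsub>tens K A S\<^esub> z)"
      using y z eq by (simp only: m AS.M.a_inv_closed)
    then have "y +[tens K A S] \<ominus>\<^bsub>tens K A S\<^esub> z = 0[tens K A S]"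
      using y z zero by (simp add: AS.M.r_neg m0)
    then show "y = z" using y z by (metis AS.M.a_inv_closed AS.M.minus_equality AS.M.minus_minus)
  qed
qed

text \<open>The initial object of \<open>CAlg K\<close>. Values over \<open>KA\<close> control
  linear forms on a reflexive functor (\<open>reflexive_vanish\<close>) and determine its
  quasi-coherent quotients.\<close>

definition KA :: "'u alg" where
  "KA = \<lparr>carrier = carrier K, monoid.mult = monoid.mult K, one = one K, ring.zero = ring.zero K,
     add = add K, smult = monoid.mult K\<rparr>"

lemma KA_simps [simp]: "carrier KA = carrier K" "monoid.mult KA = monoid.mult K" "one KA = one K"
  "ring.zero KA = ring.zero K" "add KA = add K" "smult KA = monoid.mult K"
  by (simp_all add: KA_def)

lemma KA_CAlg: "KA \<in> CAlg K"
proof -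
  have "cring KA"
    by (rule cringI; (rule abelian_groupI comm_monoidI)?)
      (auto simp: K.a_assoc K.m_assoc K.l_distr intro: K.a_comm K.m_comm K.l_neg bexI[of _ "\<ominus>\<^bsub>K\<^esub> _"] K.add.l_inv_ex)
  then have "algebra K KA"
    by (intro algebraI) (simp_all add: K.is_cring K.l_distr K.r_distr K.m_assoc)
  then show ?thesis using K_small by (simp add: CAlg_def)
qed

definition unit_hom :: "'u alg => 'u => 'u" where
  "unit_hom S = (\<lambda>k\<in>carrier K. k \<cdot>[S] 1[S])"

lemma unit_hom_alg_hom: "S \<in> AAlg K ==> unit_hom S \<in> alg_hom K KA S"
proof -
  assume S: "S \<in> AAlg K"
  interpret module K S using S by (rule AAlgD)
  interpret S: ring S using S by (rule AAlgD)
  show ?thesis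
    by (rule alg_homI) (auto simp: unit_hom_def smult_l_distr smult_assoc1[symmetric] AAlg_smult_assoc[OF S] K.m_comm)
qed

lemma unit_hom_unique:
  assumes "S \<in> AAlg K" "f \<in> alg_hom K KA S"
  shows "f = unit_hom S"
proof (rule alg_hom_eqI[OF assms(2) unit_hom_alg_hom[OF assms(1)]])
  fix k assume "k \<in> carrier KA"
  then show "f k = unit_hom S k"
    using alg_homD(4)[OF assms(2), of k "1[K]"] alg_homD(5)[OF assms(2)] by (simp add: unit_hom_def)
qed

lemma compose_unit_hom:
  "S \<in> AAlg K ==> T \<in> AAlg K ==> f \<in> alg_hom K S T ==> (f o[KA] unit_hom S) = unit_hom T"
  by (intro unit_hom_unique compose_alg_hom[OF unit_hom_alg_hom _ CAlg_AAlg[OF KA_CAlg]]) auto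

end

section \<open>Functors, duals and functions\<close>

lemma SAlg_iff: "(T, f) \<in> SAlg K S \<longleftrightarrow> T \<in> CAlg K \<and> f \<in> alg_hom K S T"
  by (auto simp: SAlg_def)

lemma set_functorD:
  assumes "set_functor K X"
  shows "S \<in> CAlg K ==> T \<in> CAlg K ==> f \<in> alg_hom K S T ==> x \<in> X $ S ==>
    Ar X S T f x \<in> X $ T"
    "S \<in> CAlg K ==> x \<in> X $ S ==> Ar X S S (idm S) x = x"
    "S \<in> CAlg K ==> T \<in> CAlg K ==> V \<in> CAlg K ==> f \<in> alg_hom K S T ==> g \<in> alg_hom K T V ==>
    x \<in> X $ S ==> Ar X S V (g o[S] f) x = Ar X T V g (Ar X S T f x)"
  using assms by (auto simp: set_functor_def)

lemma mod_functorD: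
  assumes "mod_functor K M"
  shows "set_functor K M" "S \<in> CAlg K ==> module S (Ob M S)"
    "S \<in> CAlg K ==> T \<in> CAlg K ==> f \<in> alg_hom K S T ==> x \<in> M $ S ==> y \<in> M $ S ==>
    Ar M S T f (x +[Ob M S] y) = Ar M S T f x +[Ob M T] Ar M S T f y"
    "S \<in> CAlg K ==> T \<in> CAlg K ==> f \<in> alg_hom K S T ==> x \<in> M $ S ==> s \<in> carrier S ==>
    Ar M S T f (s \<cdot>[Ob M S] x) = f s \<cdot>[Ob M T] Ar M S T f x"
  using assms by (auto simp: mod_functor_def)

lemma alg_functorD:
  assumes "alg_functor K A"
  shows "mod_functor K A" "set_functor K A" "S \<in> CAlg K ==> assoc_algebra S (Ob A S)"
    "S \<in> CAlg K ==> ring (Ob A S)"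
    "S \<in> CAlg K ==> T \<in> CAlg K ==> f \<in> alg_hom K S T ==> Ar A S T f \<in> ring_hom (Ob A S) (Ob A T)"
  using assms by (auto simp: alg_functor_def mod_functor_def assoc_algebra_def)

lemma mod_functor_closed:
  assumes "mod_functor K M" "S \<in> CAlg K"
  shows "x \<in> M $ S ==> y \<in> M $ S ==> x +[Ob M S] y \<in> M $ S" (is "PROP ?A")
    "s \<in> carrier S ==> x \<in> M $ S ==> s \<cdot>[Ob M S] x \<in> M $ S" (is "PROP ?B")
    "0[Ob M S] \<in> M $ S"
proof -
  interpret module S "Ob M S" using assms by (rule mod_functorD)
  show "PROP ?A"
    "PROP ?B"
    "0[Ob M S] \<in> M $ S" by simp_all
qed

lemma MorD:
  assumes "\<phi> \<in> Mor K F G"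
  shows "S \<in> CAlg K ==> x \<in> F $ S ==> \<phi> S x \<in> G $ S"
    "S \<in> CAlg K ==> T \<in> CAlg K ==> f \<in> alg_hom K S T ==> x \<in> F $ S ==>
    \<phi> T (Ar F S T f x) = Ar G S T f (\<phi> S x)"
    "S \<in> CAlg K ==> \<phi> S \<in> extensional (F $ S)" "\<phi> \<in> extensional (CAlg K)"
  using assms by (auto simp: Mor_def PiE_def Pi_def)

lemma MorI:
  assumes "\<And>S x. S \<in> CAlg K ==> x \<in> F $ S ==> \<phi> S x \<in> G $ S"
    and "\<And>S T f x. S \<in> CAlg K ==> T \<in> CAlg K ==> f \<in> alg_hom K S T ==> x \<in> F $ S ==>
    Ar F S T f x \<in> F $ T ==> \<phi> T (Ar F S T f x) = Ar G S T f (\<phi> S x)"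
    and "set_functor K F"
  shows "(\<lambda>S\<in>CAlg K. \<lambda>x\<in>F $ S. \<phi> S x) \<in> Mor K F G"
  using assms set_functorD(1)[OF assms(3)] by (auto simp: Mor_def PiE_def Pi_def)

lemma Mor_eqI:
  assumes "\<phi> \<in> Mor K F G" "\<psi> \<in> Mor K F G'"
    and "\<And>S x. S \<in> CAlg K ==> x \<in> F $ S ==> \<phi> S x = \<psi> S x"
  shows "\<phi> = \<psi>"
proof (rule extensionalityI[OF MorD(4)[OF assms(1)] MorD(4)[OF assms(2)]])
  fix S assume "S \<in> CAlg K"
  then show "\<phi> S = \<psi> S"
    using assms(3) by (intro extensionalityI[OF MorD(3)[OF assms(1)] MorD(3)[OF assms(2)]]) auto
qed

lemma Mod_morD:
  assumes "\<phi> \<in> Mod_mor K M N"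
  shows "\<phi> \<in> Mor K M N"
    "S \<in> CAlg K ==> x \<in> M $ S ==> \<phi> S x \<in> N $ S"
    "S \<in> CAlg K ==> x \<in> M $ S ==> y \<in> M $ S ==>
    \<phi> S (x +[Ob M S] y) = \<phi> S x +[Ob N S] \<phi> S y"
    "S \<in> CAlg K ==> s \<in> carrier S ==> x \<in> M $ S ==>
    \<phi> S (s \<cdot>[Ob M S] x) = s \<cdot>[Ob N S] \<phi> S x"
    "S \<in> CAlg K ==> T \<in> CAlg K ==> f \<in> alg_hom K S T ==> x \<in> M $ S ==>
    \<phi> T (Ar M S T f x) = Ar N S T f (\<phi> S x)"
  using assms MorD(1,2)[of \<phi> K M N] by (auto simp: Mod_mor_def lin_hom_iff lin_def)

lemma Mod_morI:
  assumes "\<phi> \<in> Mor K M N"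
    and "\<And>S x y. S \<in> CAlg K ==> x \<in> M $ S ==> y \<in> M $ S ==>
    \<phi> S (x +[Ob M S] y) = \<phi> S x +[Ob N S] \<phi> S y"
    and "\<And>S s x. S \<in> CAlg K ==> s \<in> carrier S ==> x \<in> M $ S ==>
    \<phi> S (s \<cdot>[Ob M S] x) = s \<cdot>[Ob N S] \<phi> S x"
  shows "\<phi> \<in> Mod_mor K M N"
  using assms MorD(1,3)[of \<phi> K M N] by (auto simp: Mod_mor_def lin_hom_iff lin_def)

lemma Alg_morD:
  assumes "\<phi> \<in> Alg_mor K A B"
  shows "\<phi> \<in> Mod_mor K A B" "S \<in> CAlg K ==> \<phi> S \<in> ring_hom (Ob A S) (Ob B S)"
    "S \<in> CAlg K ==> x \<in> A $ S ==> y \<in> A $ S ==>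
    \<phi> S (x *[Ob A S] y) = \<phi> S x *[Ob B S] \<phi> S y"
    "S \<in> CAlg K ==> \<phi> S 1[Ob A S] = 1[Ob B S]"
  using assms by (auto simp: Alg_mor_def ring_hom_def)

lemma Alg_morI:
  assumes "\<phi> \<in> Mod_mor K A B"
    and "\<And>S x y. S \<in> CAlg K ==> x \<in> A $ S ==> y \<in> A $ S ==>
    \<phi> S (x *[Ob A S] y) = \<phi> S x *[Ob B S] \<phi> S y"
    and "\<And>S. S \<in> CAlg K ==> \<phi> S 1[Ob A S] = 1[Ob B S]"
  shows "\<phi> \<in> Alg_mor K A B"
  using assms Mod_morD[OF assms(1)] by (auto simp: Alg_mor_def intro!: ring_hom_memI)

lemma fun_onD:
  assumes "\<theta> \<in> fun_on K X S"
  shows "T \<in> CAlg K ==> f \<in> alg_hom K S T ==> x \<in> X $ T ==> \<theta> (T, f) x \<in> carrier T" (is "PROP ?A")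
    "T \<in> CAlg K ==> f \<in> alg_hom K S T ==> V \<in> CAlg K ==> g \<in> alg_hom K T V ==> x \<in> X $ T ==>
    \<theta> (V, g o[S] f) (Ar X T V g x) = g (\<theta> (T, f) x)" (is "PROP ?B")
proof -
  show "PROP ?A"
    using assms by (auto simp: fun_on_def SAlg_iff PiE_def Pi_def)
  have "\<forall>(T, f)\<in>SAlg K S. \<forall>T'\<in>CAlg K. \<forall>g\<in>alg_hom K T T'. \<forall>x\<in>X $ T.
     \<theta> (T', g o[S] f) (Ar X T T' g x) = g (\<theta> (T, f) x)"
    using assms by (simp add: fun_on_def)
  from bspec[OF this, of "(T, f)"]
  show "PROP ?B"
    by (simp add: SAlg_iff)
qed

lemma fun_on_eqI:
  assumes "\<theta> \<in> fun_on K X S" "\<eta> \<in> fun_on K X S"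
    and "\<And>T f x. T \<in> CAlg K ==> f \<in> alg_hom K S T ==> x \<in> X $ T ==> \<theta> (T, f) x = \<eta> (T, f) x"
  shows "\<theta> = \<eta>"
proof -
  have e: "\<theta> \<in> extensional (SAlg K S)" "\<eta> \<in> extensional (SAlg K S)"
    using assms(1,2) by (auto simp: fun_on_def PiE_def)
  have e': "\<theta> p \<in> extensional (X $ (fst p))" "\<eta> p \<in> extensional (X $ (fst p))"
    if "p \<in> SAlg K S" for p
    using assms(1,2) that by (auto simp: fun_on_def PiE_def)
  show ?thesis
  proof (rule extensionalityI[OF e])
    fix p assume p: "p \<in> SAlg K S"
    then show "\<theta> p = \<eta> p"
      using assms(3) by (intro extensionalityI[OF e']) (auto simp: SAlg_def)
  qed
qed

lemma nt_restrict_apply [simp]: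
  "T \<in> CAlg K ==> f \<in> alg_hom K S T ==> x \<in> X $ T ==> nt_restrict K X S h (T, f) x = h T f x"
  by (simp add: nt_restrict_def SAlg_iff)

lemma nt_restrict_fun_on:
  assumes "set_functor K X" "S \<in> CAlg K"
    and "\<And>T f x. T \<in> CAlg K ==> f \<in> alg_hom K S T ==> x \<in> X $ T ==> h T f x \<in> carrier T"
    and "\<And>T f V g x. T \<in> CAlg K ==> f \<in> alg_hom K S T ==> V \<in> CAlg K ==> g \<in> alg_hom K T V ==>
    (g o[S] f) \<in> alg_hom K S V ==> Ar X T V g x \<in> X $ V ==>
    x \<in> X $ T ==> h V (g o[S] f) (Ar X T V g x) = g (h T f x)"
  shows "nt_restrict K X S h \<in> fun_on K X S"
proof -
  have "g o[S] f \<in> alg_hom K S V"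
    if "T \<in> CAlg K" "f \<in> alg_hom K S T" "V \<in> CAlg K" "g \<in> alg_hom K T V" for T f V g
    using that assms(2) by (intro compose_alg_hom CAlg_AAlg)
  then show ?thesis
    using assms set_functorD(1)[OF assms(1)]
    by (auto simp: fun_on_def nt_restrict_def SAlg_iff split: prod.splits)
qed

text \<open>A name for the carrier of the dual, into which the simp rule \<open>carrier_dual\<close>
  folds; iterated duals then stay readable and are not unfolded.\<close>

definition dual_on :: "'u ring => ('u, 'a) mfunc => 'u alg => ('u, 'a) nt set" where
  "dual_on K M S = dual K M $ S"

lemma carrier_dual [simp]: "dual K M $ S = dual_on K M S"
  by (simp add: dual_on_def)

lemma Rfun_simps [simp]: "Rfun $ T = carrier T" "add (Ob Rfun T) = add T"
  "smult (Ob Rfun T) = monoid.mult T" "monoid.mult (Ob Rfun T) = monoid.mult T" "one (Ob Rfun T) = one T"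
  "ring.zero (Ob Rfun T) = ring.zero T" "Ar Rfun S T f = f"
  by (simp_all add: Rfun_def)

lemma dual_onD:
  assumes "\<theta> \<in> dual_on K M S"
  shows "\<theta> \<in> fun_on K M S"
    "T \<in> CAlg K ==> f \<in> alg_hom K S T ==> x \<in> M $ T ==> \<theta> (T, f) x \<in> carrier T" (is "PROP ?A")
    "T \<in> CAlg K ==> f \<in> alg_hom K S T ==> x \<in> M $ T ==> y \<in> M $ T ==>
     \<theta> (T, f) (x +[Ob M T] y) = \<theta> (T, f) x +[T] \<theta> (T, f) y" (is "PROP ?B")
    "T \<in> CAlg K ==> f \<in> alg_hom K S T ==> x \<in> M $ T ==> t \<in> carrier T ==>
     \<theta> (T, f) (t \<cdot>[Ob M T] x) = t *[T] \<theta> (T, f) x" (is "PROP ?C")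
    "T \<in> CAlg K ==> f \<in> alg_hom K S T ==> V \<in> CAlg K ==> g \<in> alg_hom K T V ==> x \<in> M $ T ==>
    \<theta> (V, g o[S] f) (Ar M T V g x) = g (\<theta> (T, f) x)" (is "PROP ?D")
proof -
  have *: "\<theta> \<in> fun_on K M S \<and> (\<forall>(T, f)\<in>SAlg K S. \<theta> (T, f) \<in> lin_hom T (Ob M T) (Ob Rfun T))"
    using assms by (simp add: dual_on_def dual_def fun_functor_def)
  then show "\<theta> \<in> fun_on K M S" by simp
  have l: "lin T (Ob M T) (Ob Rfun T) (\<theta> (T, f))" if "T \<in> CAlg K" "f \<in> alg_hom K S T" for T f
    using * that by (auto simp: lin_hom_iff SAlg_iff)
  show "PROP ?A"
    "PROP ?B"
    "PROP ?C"
    using linD[OF l[of T f]] by auto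
  show "PROP ?D"
    using * by (intro fun_onD(2)) auto
qed

lemma dual_onI:
  assumes "\<theta> \<in> fun_on K M S"
    and "\<And>T f x y. T \<in> CAlg K ==> f \<in> alg_hom K S T ==> x \<in> M $ T ==> y \<in> M $ T ==>
     \<theta> (T, f) (x +[Ob M T] y) = \<theta> (T, f) x +[T] \<theta> (T, f) y"
    and "\<And>T f x t. T \<in> CAlg K ==> f \<in> alg_hom K S T ==> x \<in> M $ T ==> t \<in> carrier T ==>
     \<theta> (T, f) (t \<cdot>[Ob M T] x) = t *[T] \<theta> (T, f) x"
  shows "\<theta> \<in> dual_on K M S"
proof -
  have "\<theta> (T, f) \<in> extensional (M $ T)" if "T \<in> CAlg K" "f \<in> alg_hom K S T" for T f
    using assms(1) that by (force simp: fun_on_def PiE_def SAlg_iff Pi_def)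
  then show ?thesis
    using assms fun_onD(1)[OF assms(1)]
    by (auto simp: dual_on_def dual_def fun_functor_def lin_hom_iff lin_def SAlg_iff)
qed

text \<open>The naturality premise hands over that the composite is a homomorphism and that the
  transported element lies in \<open>M\<close>, so that these facts are not rederived at every
  use.\<close>

lemma nt_restrict_dual_on:
  assumes "mod_functor K M" "S \<in> CAlg K"
    and "\<And>T f x. T \<in> CAlg K ==> f \<in> alg_hom K S T ==> x \<in> M $ T ==> h T f x \<in> carrier T"
    and "\<And>T f V g x. T \<in> CAlg K ==> f \<in> alg_hom K S T ==> V \<in> CAlg K ==> g \<in> alg_hom K T V ==>
    (g o[S] f) \<in> alg_hom K S V ==> Ar M T V g x \<in> M $ V ==>
    x \<in> M $ T ==> h V (g o[S] f) (Ar M T V g x) = g (h T f x)"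
    and "\<And>T f x y. T \<in> CAlg K ==> f \<in> alg_hom K S T ==> x \<in> M $ T ==> y \<in> M $ T ==>
     h T f (x +[Ob M T] y) = h T f x +[T] h T f y"
    and "\<And>T f x t. T \<in> CAlg K ==> f \<in> alg_hom K S T ==> x \<in> M $ T ==> t \<in> carrier T ==>
     h T f (t \<cdot>[Ob M T] x) = t *[T] h T f x"
  shows "nt_restrict K M S h \<in> dual_on K M S"
proof (rule dual_onI)
  show "nt_restrict K M S h \<in> fun_on K M S"
    using mod_functorD(1)[OF assms(1)] assms(2-4) by (rule nt_restrict_fun_on)
qed (use assms mod_functor_closed[OF assms(1)] in auto)

lemma fun_functor_simps:
  "fun_functor K X $ S = fun_on K X S"
  "\<theta> +[Ob (fun_functor K X) S] \<eta> = nt_restrict K X S (\<lambda>T f x. \<theta> (T, f) x +[T] \<eta> (T, f) x)"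
  "\<theta> *[Ob (fun_functor K X) S] \<eta> = nt_restrict K X S (\<lambda>T f x. \<theta> (T, f) x *[T] \<eta> (T, f) x)"
  "1[Ob (fun_functor K X) S] = nt_restrict K X S (\<lambda>T f x. 1[T])"
  "0[Ob (fun_functor K X) S] = nt_restrict K X S (\<lambda>T f x. 0[T])"
  "s \<cdot>[Ob (fun_functor K X) S] \<theta> = nt_restrict K X S (\<lambda>T f x. f s *[T] \<theta> (T, f) x)"
  "Ar (fun_functor K X) S S' h \<theta> = nt_restrict K X S' (\<lambda>T f. \<theta> (T, f o[S] h))"
  by (simp_all add: fun_functor_def)

lemma dual_simps:
  "\<theta> +[Ob (dual K M) S] \<eta> = nt_restrict K M S (\<lambda>T f x. \<theta> (T, f) x +[T] \<eta> (T, f) x)"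
  "0[Ob (dual K M) S] = nt_restrict K M S (\<lambda>T f x. 0[T])"
  "s \<cdot>[Ob (dual K M) S] \<theta> = nt_restrict K M S (\<lambda>T f x. f s *[T] \<theta> (T, f) x)"
  "Ar (dual K M) S S' h \<theta> = nt_restrict K M S' (\<lambda>T f. \<theta> (T, f o[S] h))"
  by (simp_all add: dual_def fun_functor_def)

lemma alg_hom_zero: "f \<in> alg_hom K S T ==> S \<in> AAlg K ==> T \<in> AAlg K ==> f 0[S] = 0[T]"
  by (rule lin_zero[of K]) (auto dest: alg_homD AAlgD)

context
  fixes K :: "'u ring" and X :: "('u, 'a, ('a, 'z) partial_object_scheme) func" and S :: "'u alg"
  assumes X: "set_functor K X" and S: "S \<in> CAlg K"
begin

lemma fun_on_add:
  "\<theta> \<in> fun_on K X S ==> \<eta> \<in> fun_on K X S ==>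
    nt_restrict K X S (\<lambda>T f x. \<theta> (T, f) x +[T] \<eta> (T, f) x) \<in> fun_on K X S"
  by (rule nt_restrict_fun_on[OF X S]) (simp_all add: fun_onD CAlg_closed alg_homD)

lemma fun_on_mult:
  "\<theta> \<in> fun_on K X S ==> \<eta> \<in> fun_on K X S ==>
    nt_restrict K X S (\<lambda>T f x. \<theta> (T, f) x *[T] \<eta> (T, f) x) \<in> fun_on K X S"
  by (rule nt_restrict_fun_on[OF X S]) (simp_all add: fun_onD CAlg_closed alg_homD)

lemma fun_on_one: "nt_restrict K X S (\<lambda>T f x. 1[T]) \<in> fun_on K X S"
  by (rule nt_restrict_fun_on[OF X S]) (simp_all add: CAlg_closed alg_homD)

lemma fun_on_zero: "nt_restrict K X S (\<lambda>T f x. 0[T]) \<in> fun_on K X S"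
  by (rule nt_restrict_fun_on[OF X S]) (simp_all add: CAlg_closed alg_hom_zero CAlg_AAlg)

lemma fun_on_smult:
  "\<theta> \<in> fun_on K X S ==> s \<in> carrier S ==>
    nt_restrict K X S (\<lambda>T f x. f s *[T] \<theta> (T, f) x) \<in> fun_on K X S"
  by (rule nt_restrict_fun_on[OF X S]) (simp_all add: fun_onD CAlg_closed alg_homD compose_eq)

lemmas fun_on_closed = fun_on_add fun_on_mult fun_on_one fun_on_zero fun_on_smult

lemma fun_on_Ar:
  assumes "S' \<in> CAlg K" "h \<in> alg_hom K S S'" "\<theta> \<in> fun_on K X S"
  shows "nt_restrict K X S' (\<lambda>T f. \<theta> (T, f o[S] h)) \<in> fun_on K X S'"
proof -
  note c = compose_alg_hom[OF assms(2) _ CAlg_AAlg[OF S]]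
  show ?thesis
    by (rule nt_restrict_fun_on[OF X assms(1)])
      (simp_all add: fun_onD[OF assms(3)] c flip: compose_compose[OF assms(2)])
qed

text \<open>One proof for all functions and for the linear ones: the operations are the same and
  pointwise, and only the carrier \<open>C\<close> varies. Hence closure of \<open>C\<close> is
  assumed just for zero, sums and scalars.\<close>

lemma fun_module:
  assumes C: "C \<subseteq> fun_on K X S" "nt_restrict K X S (\<lambda>T f x. 0[T]) \<in> C"
    "\<And>\<theta> \<eta>. \<theta> \<in> C ==> \<eta> \<in> C ==> nt_restrict K X S (\<lambda>T f x. \<theta> (T, f) x +[T] \<eta> (T, f) x) \<in> C"
    "\<And>\<theta> s. \<theta> \<in> C ==> s \<in> carrier S ==> nt_restrict K X S (\<lambda>T f x. f s *[T] \<theta> (T, f) x) \<in> C"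
    and M: "carrier M = C"
    "\<And>\<theta> \<eta>. \<theta> +[M] \<eta> = nt_restrict K X S (\<lambda>T f x. \<theta> (T, f) x +[T] \<eta> (T, f) x)"
    "0[M] = nt_restrict K X S (\<lambda>T f x. 0[T])"
    "\<And>s \<theta>. s \<cdot>[M] \<theta> = nt_restrict K X S (\<lambda>T f x. f s *[T] \<theta> (T, f) x)"
  shows "module S M"
proof -
  interpret S: cring S using S by (rule CAlg_cring)
  have eq: "\<theta> = \<eta>" if "\<theta> \<in> C" "\<eta> \<in> C"
    "\<And>T f x. T \<in> CAlg K ==> cring T ==> f \<in> alg_hom K S T ==> x \<in> X $ T ==> \<theta> (T, f) x = \<eta> (T, f) x" for \<theta> \<eta>
    by (rule fun_on_eqI[of \<theta> K X S \<eta>]) (use that C(1) CAlg_cring in blast)+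
  have v: "\<theta> (T, f) x \<in> carrier T" if "\<theta> \<in> C" "T \<in> CAlg K" "f \<in> alg_hom K S T" "x \<in> X $ T" for \<theta> T f x
    using fun_onD(1)[OF subsetD[OF C(1) that(1)]] that by simp
  note r = cring.cring_simprules 
  show ?thesis
  proof (rule moduleI)
    show "cring S" ..
    show "abelian_group M"
    proof (rule abelian_groupI, unfold M)
      fix \<theta> assume \<theta>: "\<theta> \<in> C"
      show "\<exists>\<eta>\<in>C. nt_restrict K X S (\<lambda>T f x. \<eta> (T, f) x +[T] \<theta> (T, f) x) = nt_restrict K X S (\<lambda>T f x. 0[T])"
      proof
        \<comment> \<open>Negation is multiplication by the scalar \<open>- 1\<close> of
          \<open>S\<close>, because closure of \<open>C\<close> is only known for sums and
          scalars.\<close>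
        let ?\<eta> = "nt_restrict K X S (\<lambda>T f x. f (\<ominus>\<^bsub>S\<^esub> 1[S]) *[T] \<theta> (T, f) x)"
        show e: "?\<eta> \<in> C" using \<theta> by (intro C) auto
        show "nt_restrict K X S (\<lambda>T f x. ?\<eta> (T, f) x +[T] \<theta> (T, f) x) = nt_restrict K X S (\<lambda>T f x. 0[T])"
        proof (rule eq)
          fix T f x assume T: "T \<in> CAlg K" "cring T" and f: "f \<in> alg_hom K S T" and x: "x \<in> X $ T"
          interpret T: cring T by fact
          have "f (\<ominus>\<^bsub>S\<^esub> 1[S]) +[T] 1[T] = 0[T]"
            using alg_homD(2)[OF f, of "\<ominus>\<^bsub>S\<^esub> 1[S]" "1[S]"] alg_homD(5)[OF f]
              alg_hom_zero[OF f] S T by (simp add: S.l_neg CAlg_AAlg)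
          moreover have vc: "\<theta> (T, f) x \<in> carrier T" by (rule v[OF \<theta> T(1) f x])
          moreover have fc: "f (\<ominus>\<^bsub>S\<^esub> 1[S]) \<in> carrier T" using alg_homD(1)[OF f] by simp
          ultimately have "f (\<ominus>\<^bsub>S\<^esub> 1[S]) *[T] \<theta> (T, f) x +[T] \<theta> (T, f) x = 0[T]"
            by (metis T.l_distr T.l_null T.l_one T.one_closed)
          note vcz = this
          show "nt_restrict K X S (\<lambda>T f x. ?\<eta> (T, f) x +[T] \<theta> (T, f) x) (T, f) x = nt_restrict K X S (\<lambda>T f x. 0[T]) (T, f) x"
            by (simp only: nt_restrict_apply[OF T(1) f x] vcz)
        qed (rule C(3)[OF e \<theta>], rule C(2))
      qed
    next
      fix \<theta> \<eta> \<zeta> assume h: "\<theta> \<in> C" "\<eta> \<in> C" "\<zeta> \<in> C"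
      note c = C(3)[OF h(1,2)] C(3)[OF h(2,3)] C(3)[OF h(2,1)]
      note vs = v[OF h(1)] v[OF h(2)] v[OF h(3)]
      show "nt_restrict K X S (\<lambda>T f x. nt_restrict K X S (\<lambda>T f x. \<theta> (T, f) x +[T] \<eta> (T, f) x) (T, f) x +[T] \<zeta> (T, f) x) =
      nt_restrict K X S (\<lambda>T f x. \<theta> (T, f) x +[T] nt_restrict K X S (\<lambda>T f x. \<eta> (T, f) x +[T] \<zeta> (T, f) x) (T, f) x)"
        by (rule eq[OF C(3)[OF c(1) h(3)] C(3)[OF h(1) c(2)]]) (simp add: vs r)
    next
      fix \<theta> \<eta> assume h: "\<theta> \<in> C" "\<eta> \<in> C"
      note c = C(3)[OF h] C(3)[OF h] C(3)[OF h(2,1)]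
      note vs = v[OF h(1)] v[OF h(2)]
      show "nt_restrict K X S (\<lambda>T f x. \<theta> (T, f) x +[T] \<eta> (T, f) x) = nt_restrict K X S (\<lambda>T f x. \<eta> (T, f) x +[T] \<theta> (T, f) x)"
        by (rule eq[OF c(1) c(3)]) (simp add: vs r)
    next
      fix \<theta> assume h: "\<theta> \<in> C"
      show "nt_restrict K X S (\<lambda>T f x. nt_restrict K X S (\<lambda>T f x. 0[T]) (T, f) x +[T] \<theta> (T, f) x) = \<theta>"
        by (rule eq[OF C(3)[OF C(2) h] h]) (simp add: v[OF h] r)
    qed (intro C(2) C(3); assumption)+
  next
    fix a \<theta> assume h: "a \<in> carrier S" and \<theta>: "\<theta> \<in> carrier M"
    note \<theta>' = \<theta>[unfolded M]
    note c = C(4)[OF \<theta>' h]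
    note vs = v[OF \<theta>']
    show "a \<cdot>[M] \<theta> \<in> carrier M" unfolding M by (rule c)
    show "(a +[S] b) \<cdot>[M] \<theta> = a \<cdot>[M] \<theta> +[M] b \<cdot>[M] \<theta>" if b: "b \<in> carrier S" for b
      unfolding M by (rule eq[OF C(4)[OF \<theta>' S.a_closed[OF h b]] C(3)[OF c C(4)[OF \<theta>' b]]])
        (simp add: vs r alg_homD h b)
    show "(a *[S] b) \<cdot>[M] \<theta> = a \<cdot>[M] (b \<cdot>[M] \<theta>)" if b: "b \<in> carrier S" for b
      unfolding M by (rule eq[OF C(4)[OF \<theta>' S.m_closed[OF h b]] C(4)[OF C(4)[OF \<theta>' b] h]])
        (simp add: vs r alg_homD h b)
    show "a \<cdot>[M] (\<theta> +[M] \<eta>) = a \<cdot>[M] \<theta> +[M] a \<cdot>[M] \<eta>" if "\<eta> \<in> carrier M" for \<eta>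
    proof -
      note \<eta> = that[unfolded M]
      show ?thesis
        unfolding M by (rule eq[OF C(4)[OF C(3)[OF \<theta>' \<eta>] h] C(3)[OF c C(4)[OF \<eta> h]]])
          (simp add: vs v[OF \<eta>] r alg_homD h)
    qed
  next
    fix \<theta> assume \<theta>: "\<theta> \<in> carrier M"
    note \<theta>' = \<theta>[unfolded M]
    show "1[S] \<cdot>[M] \<theta> = \<theta>"
      unfolding M by (rule eq[OF C(4)[OF \<theta>' S.one_closed] \<theta>']) (simp add: v[OF \<theta>'] r alg_homD)
  qed
qed

end

lemma mod_functor_dual:
  fixes K :: "'u ring"
  assumes M: "mod_functor K M"
  shows "mod_functor K (dual K M)"
proof -
  note sf = mod_functorD(1)[OF M]
  have add: "nt_restrict K M S (\<lambda>T f x. \<theta> (T, f) x +[T] \<eta> (T, f) x) \<in> dual_on K M S"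
    if S: "S \<in> CAlg K" and "\<theta> \<in> dual_on K M S" "\<eta> \<in> dual_on K M S" for S \<theta> \<eta>
    using that(2,3)
    by (intro nt_restrict_dual_on[OF M S])
      (simp_all add: dual_onD CAlg_closed alg_homD cring.cring_simprules CAlg_cring)
  have zero: "nt_restrict K M S (\<lambda>T f x. 0[T]) \<in> dual_on K M S" if S: "S \<in> CAlg K" for S
    by (intro nt_restrict_dual_on[OF M S])
      (simp_all add: CAlg_closed alg_hom_zero CAlg_AAlg cring.cring_simprules CAlg_cring)
  have smult: "nt_restrict K M S (\<lambda>T f x. f s *[T] \<theta> (T, f) x) \<in> dual_on K M S"
    if S: "S \<in> CAlg K" and "\<theta> \<in> dual_on K M S" "s \<in> carrier S" for S \<theta> s
    using that(2,3)
    by (intro nt_restrict_dual_on[OF M S])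
      (simp_all add: dual_onD CAlg_closed alg_homD compose_eq cring.cring_simprules CAlg_cring)
  have Ar: "nt_restrict K M S' (\<lambda>T f. \<theta> (T, f o[S] h)) \<in> dual_on K M S'"
    if S: "S \<in> CAlg K" "S' \<in> CAlg K" and h: "h \<in> alg_hom K S S'" and \<theta>: "\<theta> \<in> dual_on K M S" for S S' h \<theta>
    by (rule nt_restrict_dual_on[OF M S(2)])
      (simp_all add: dual_onD[OF \<theta>] compose_alg_hom[OF h _ CAlg_AAlg[OF S(1)]] flip: compose_compose[OF h])
  have eq: "\<theta> = \<eta>" if "\<theta> \<in> dual_on K M S" "\<eta> \<in> dual_on K M S"
    "\<And>T f x. T \<in> CAlg K ==> f \<in> alg_hom K S T ==> x \<in> M $ T ==> \<theta> (T, f) x = \<eta> (T, f) x" for S \<theta> \<eta>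
    by (rule fun_on_eqI) (use that dual_onD(1) in blast)+
  note c = compose_alg_hom[OF _ _ CAlg_AAlg]
  show ?thesis
    unfolding mod_functor_def set_functor_def
  proof (intro conjI ballI, unfold carrier_dual)
    fix S assume S: "S \<in> CAlg K"
    show "module S (Ob (dual K M) S)"
      by (rule fun_module[OF sf S, of "dual_on K M S"])
        (auto simp: dual_simps intro: add[OF S] zero[OF S] smult[OF S] dest: dual_onD)
    fix \<theta> assume \<theta>: "\<theta> \<in> dual_on K M S"
    show "Ar (dual K M) S S (idm S) \<theta> = \<theta>"
      unfolding dual_simps
      by (rule eq[OF Ar[OF S S idm_CAlg[OF S] \<theta>] \<theta>]) (simp add: compose_idm_right)
  next
    fix S T f assume S: "S \<in> CAlg K" and T: "T \<in> CAlg K" and f: "f \<in> alg_hom K S T"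
    show "Ar (dual K M) S T f \<in> dual_on K M S \<rightarrow> dual_on K M T"
      unfolding dual_simps using Ar[OF S T f] by auto
    fix \<theta> assume \<theta>: "\<theta> \<in> dual_on K M S"
    {
      fix \<eta> assume \<eta>: "\<eta> \<in> dual_on K M S"
      show "Ar (dual K M) S T f (\<theta> +[Ob (dual K M) S] \<eta>) =
        Ar (dual K M) S T f \<theta> +[Ob (dual K M) T] Ar (dual K M) S T f \<eta>"
        unfolding dual_simps
        by (rule eq[OF Ar[OF S T f add[OF S \<theta> \<eta>]] add[OF T Ar[OF S T f \<theta>] Ar[OF S T f \<eta>]]])
          (simp add: c[OF f _ S])
    }
    fix s assume s: "s \<in> carrier S"
    then have "f s \<in> carrier T" using f by (simp add: alg_homD)
    then show "Ar (dual K M) S T f (s \<cdot>[Ob (dual K M) S] \<theta>) =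
        f s \<cdot>[Ob (dual K M) T] Ar (dual K M) S T f \<theta>"
      unfolding dual_simps
      by (intro eq[OF Ar[OF S T f smult[OF S \<theta> s]] smult[OF T Ar[OF S T f \<theta>]]])
        (use s in \<open>simp_all add: c[OF f _ S] compose_eq\<close>)
  next
    fix S T V f g \<theta> assume S: "S \<in> CAlg K" and T: "T \<in> CAlg K" and V: "V \<in> CAlg K"
      and f: "f \<in> alg_hom K S T" and g: "g \<in> alg_hom K T V" and \<theta>: "\<theta> \<in> dual_on K M S"
    show "Ar (dual K M) S V (g o[S] f) \<theta> = Ar (dual K M) T V g (Ar (dual K M) S T f \<theta>)"
      unfolding dual_simps
      by (rule eq[OF Ar[OF S V c[OF f g S] \<theta>] Ar[OF T V g Ar[OF S T f \<theta>]]])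
        (simp add: c[OF g _ T] compose_compose[OF f])
  qed
qed

lemma alg_functor_fun:
  fixes K :: "'u ring"
  assumes X: "set_functor K X"
  shows "alg_functor K (fun_functor K X)"
proof -
  have eq: "\<theta> = \<eta>" if "\<theta> \<in> fun_on K X S" "\<eta> \<in> fun_on K X S"
    "\<And>T f x. T \<in> CAlg K ==> cring T ==> f \<in> alg_hom K S T ==> x \<in> X $ T ==> \<theta> (T, f) x = \<eta> (T, f) x" for S \<theta> \<eta>
    by (rule fun_on_eqI[of \<theta> K X S \<eta>]) (use that CAlg_cring in blast)+
  note r = cring.cring_simprules
  note cl = fun_on_closed[OF X]
  note c = compose_alg_hom[OF _ _ CAlg_AAlg]
  have mod: "module S (Ob (fun_functor K X) S)" if S: "S \<in> CAlg K" for S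
    by (rule fun_module[OF X S, of "fun_on K X S"]) (auto simp: fun_functor_simps intro: cl[OF S])
  have ring: "ring (Ob (fun_functor K X) S)" if S: "S \<in> CAlg K" for S
  proof (rule ringI)
    show "abelian_group (Ob (fun_functor K X) S)" using mod[OF S] by (simp add: module_def)
    show "Group.monoid (Ob (fun_functor K X) S)"
      by (rule monoidI; unfold fun_functor_simps)
        ((rule eq[where S = S])?; (intro cl[OF S])?; simp add: cl[OF S] fun_onD r)+
  qed (unfold fun_functor_simps, ((rule eq[where S = S])?; (intro cl[OF S])?; simp add: cl[OF S] fun_onD r)+)
  have alg: "assoc_algebra S (Ob (fun_functor K X) S)" if S: "S \<in> CAlg K" for S
    unfolding assoc_algebra_def
    by (intro conjI ballI mod[OF S] ring[OF S]; unfold fun_functor_simps)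
      ((rule eq[where S = S])?; (intro cl[OF S])?; simp add: cl[OF S] fun_onD r alg_homD)+
  note Ar = fun_on_Ar[OF X]
  show ?thesis
    unfolding alg_functor_def mod_functor_def set_functor_def
  proof (intro conjI ballI mod alg)
    fix S assume S: "S \<in> CAlg K"
    fix \<theta> assume \<theta>: "\<theta> \<in> fun_functor K X $ S"
    then show "Ar (fun_functor K X) S S (idm S) \<theta> = \<theta>"
      unfolding fun_functor_simps
      by (intro eq[OF Ar[OF S S idm_CAlg[OF S]]]) (simp_all add: compose_idm_right)
  next
    fix S T f assume S: "S \<in> CAlg K" and T: "T \<in> CAlg K" and f: "f \<in> alg_hom K S T"
    show cA: "Ar (fun_functor K X) S T f \<in> fun_functor K X $ S \<rightarrow> (fun_functor K X) $ T"
      unfolding fun_functor_simps using Ar[OF S T f] by auto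
    have A1: "Ar (fun_functor K X) S T f 1[Ob (fun_functor K X) S] = 1[Ob (fun_functor K X) T]"
      unfolding fun_functor_simps
      by (rule eq[OF Ar[OF S T f cl(3)[OF S]] cl(3)[OF T]]) (simp add: c[OF f _ S])
    have A2: "Ar (fun_functor K X) S T f (\<theta> +[Ob (fun_functor K X) S] \<eta>) =
        Ar (fun_functor K X) S T f \<theta> +[Ob (fun_functor K X) T] Ar (fun_functor K X) S T f \<eta>"
      if \<theta>: "\<theta> \<in> fun_functor K X $ S" and \<eta>: "\<eta> \<in> fun_functor K X $ S" for \<theta> \<eta>
      using \<theta> \<eta> unfolding fun_functor_simps
      by (intro eq[OF Ar[OF S T f cl(1)[OF S]] cl(1)[OF T Ar[OF S T f] Ar[OF S T f]]])
          (simp_all add: c[OF f _ S])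
    have A3: "Ar (fun_functor K X) S T f (\<theta> *[Ob (fun_functor K X) S] \<eta>) =
        Ar (fun_functor K X) S T f \<theta> *[Ob (fun_functor K X) T] Ar (fun_functor K X) S T f \<eta>"
      if \<theta>: "\<theta> \<in> fun_functor K X $ S" and \<eta>: "\<eta> \<in> fun_functor K X $ S" for \<theta> \<eta>
      using \<theta> \<eta> unfolding fun_functor_simps
      by (intro eq[OF Ar[OF S T f cl(2)[OF S]] cl(2)[OF T Ar[OF S T f] Ar[OF S T f]]])
          (simp_all add: c[OF f _ S])
    show "Ar (fun_functor K X) S T f \<in> ring_hom (Ob (fun_functor K X) S) (Ob (fun_functor K X) T)"
      using cA A1 A2 A3 by (intro ring_hom_memI) auto
    fix \<theta> assume \<theta>: "\<theta> \<in> fun_functor K X $ S"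
    show "Ar (fun_functor K X) S T f (\<theta> +[Ob (fun_functor K X) S] \<eta>) =
        Ar (fun_functor K X) S T f \<theta> +[Ob (fun_functor K X) T] Ar (fun_functor K X) S T f \<eta>"
      if "\<eta> \<in> fun_functor K X $ S" for \<eta> using A2[OF \<theta> that] .
    fix s assume s: "s \<in> carrier S"
    then have "f s \<in> carrier T" using f by (simp add: alg_homD)
    then show "Ar (fun_functor K X) S T f (s \<cdot>[Ob (fun_functor K X) S] \<theta>) =
        f s \<cdot>[Ob (fun_functor K X) T] Ar (fun_functor K X) S T f \<theta>"
      using \<theta> s unfolding fun_functor_simps
      by (intro eq[OF Ar[OF S T f cl(5)[OF S]] cl(5)[OF T Ar[OF S T f]]])
        (simp_all add: c[OF f _ S] compose_eq)
  next
    fix S T V f g \<theta> assume S: "S \<in> CAlg K" and T: "T \<in> CAlg K" and V: "V \<in> CAlg K"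
      and f: "f \<in> alg_hom K S T" and g: "g \<in> alg_hom K T V" and \<theta>: "\<theta> \<in> fun_functor K X $ S"
    show "Ar (fun_functor K X) S V (g o[S] f) \<theta> =
      Ar (fun_functor K X) T V g (Ar (fun_functor K X) S T f \<theta>)"
      using \<theta> unfolding fun_functor_simps
      by (intro eq[OF Ar[OF S V c[OF f g S]] Ar[OF T V g Ar[OF S T f]]])
        (simp_all add: c[OF g _ T] compose_compose[OF f])
  qed
qed

section \<open>Dual morphisms and reflexivity\<close>

lemma dual_on_eqI:
  assumes "\<theta> \<in> dual_on K M S" "\<eta> \<in> dual_on K M S"
    and "\<And>T f x. T \<in> CAlg K ==> f \<in> alg_hom K S T ==> x \<in> M $ T ==> \<theta> (T, f) x = \<eta> (T, f) x"
  shows "\<theta> = \<eta>"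
  by (rule fun_on_eqI) (use assms dual_onD(1) in blast)+

lemma dual_on_Ar:
  "mod_functor K M ==> S \<in> CAlg K ==> T \<in> CAlg K ==> f \<in> alg_hom K S T ==> \<theta> \<in> dual_on K M S ==>
    Ar (dual K M) S T f \<theta> \<in> dual_on K M T"
  using set_functorD(1)[OF mod_functorD(1)[OF mod_functor_dual]] by simp

lemma dual_on_ops:
  assumes "mod_functor K M" "S \<in> CAlg K"
  shows "\<theta> \<in> dual_on K M S ==> \<eta> \<in> dual_on K M S ==> \<theta> +[Ob (dual K M) S] \<eta> \<in> dual_on K M S"
    "s \<in> carrier S ==> \<theta> \<in> dual_on K M S ==> s \<cdot>[Ob (dual K M) S] \<theta> \<in> dual_on K M S"
  using mod_functor_closed[OF mod_functor_dual[OF assms(1)] assms(2)] by simp_all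

lemma dual_apply:
  assumes "T \<in> CAlg K" "f \<in> alg_hom K S T" "x \<in> M $ T"
  shows "(\<theta> +[Ob (dual K M) S] \<eta>) (T, f) x = \<theta> (T, f) x +[T] \<eta> (T, f) x"
    "(s \<cdot>[Ob (dual K M) S] \<theta>) (T, f) x = f s *[T] \<theta> (T, f) x"
    "Ar (dual K M) S' S h \<theta> (T, f) x = \<theta> (T, f o[S'] h) x"
  using assms by (simp_all add: dual_simps)

lemma dual_map_apply:
  assumes "S \<in> CAlg K" "\<theta> \<in> dual_on K N S" "T \<in> CAlg K" "f \<in> alg_hom K S T" "x \<in> M $ T"
  shows "dual_map K M N \<phi> S \<theta> (T, f) x = \<theta> (T, f) (\<phi> T x)"
  using assms by (simp add: dual_map_def)

lemma dual_map_dual_on: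
  assumes "mod_functor K M" "\<phi> \<in> Mod_mor K M N" "S \<in> CAlg K" "\<theta> \<in> dual_on K N S"
  shows "dual_map K M N \<phi> S \<theta> \<in> dual_on K M S"
proof -
  note m = Mod_morD[OF assms(2)]
  have "nt_restrict K M S (\<lambda>T f x. \<theta> (T, f) (\<phi> T x)) \<in> dual_on K M S"
    by (rule nt_restrict_dual_on[OF assms(1,3)]) (simp_all add: dual_onD[OF assms(4)] m)
  then show ?thesis using assms by (simp add: dual_map_def)
qed

lemma dual_map_Mod_mor:
  fixes K :: "'u ring"
  assumes M: "mod_functor K M" and N: "mod_functor K N" and \<phi>: "\<phi> \<in> Mod_mor K M N"
  shows "dual_map K M N \<phi> \<in> Mod_mor K (dual K N) (dual K M)"
proof (rule Mod_morI)
  note d = dual_map_dual_on[OF M \<phi>]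
  note m = Mod_morD[OF \<phi>]
  show "dual_map K M N \<phi> \<in> Mor K (dual K N) (dual K M)"
    unfolding dual_map_def
  proof (rule MorI)
    fix S \<theta> assume S: "S \<in> CAlg K" and \<theta>: "\<theta> \<in> dual K N $ S"
    then show "nt_restrict K M S (\<lambda>T f x. \<theta> (T, f) (\<phi> T x)) \<in> dual K M $ S"
      using d[OF S] by (simp add: dual_map_def)
  next
    fix S T f \<theta> assume S: "S \<in> CAlg K" and T: "T \<in> CAlg K" and f: "f \<in> alg_hom K S T"
      and \<theta>: "\<theta> \<in> dual K N $ S"
    have c: "\<And>V g. g \<in> alg_hom K T V ==> (g o[S] f) \<in> alg_hom K S V"
      using compose_alg_hom[OF f _ CAlg_AAlg[OF S]] .
    have \<theta>': "\<theta> \<in> dual_on K N S" using \<theta> by simp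
    note a = dual_on_Ar[OF N S T f \<theta>']
    show "nt_restrict K M T (\<lambda>V g x. Ar (dual K N) S T f \<theta> (V, g) (\<phi> V x)) =
      Ar (dual K M) S T f (nt_restrict K M S (\<lambda>V g x. \<theta> (V, g) (\<phi> V x)))"
    proof (rule dual_on_eqI)
      show "nt_restrict K M T (\<lambda>V g x. Ar (dual K N) S T f \<theta> (V, g) (\<phi> V x)) \<in> dual_on K M T"
        using d[OF T a] a T by (simp add: dual_map_def)
      show "Ar (dual K M) S T f (nt_restrict K M S (\<lambda>V g x. \<theta> (V, g) (\<phi> V x))) \<in> dual_on K M T"
        using dual_on_Ar[OF M S T f d[OF S \<theta>']] \<theta> S by (simp add: dual_map_def)
    qed (simp add: dual_apply m c)
  qed (use mod_functor_dual[OF N] in \<open>simp add: mod_functorD\<close>)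
  fix S \<theta> assume S: "S \<in> CAlg K" and \<theta>: "\<theta> \<in> dual K N $ S"
  have \<theta>': "\<theta> \<in> dual_on K N S" using \<theta> by simp
  {
    fix \<eta> assume "\<eta> \<in> dual K N $ S"
    then have \<eta>: "\<eta> \<in> dual_on K N S" by simp
    note a = dual_on_ops(1)[OF N S \<theta>' \<eta>]
    show "dual_map K M N \<phi> S (\<theta> +[Ob (dual K N) S] \<eta>) =
      dual_map K M N \<phi> S \<theta> +[Ob (dual K M) S] dual_map K M N \<phi> S \<eta>"
      by (rule dual_on_eqI[OF d[OF S a] dual_on_ops(1)[OF M S d[OF S \<theta>'] d[OF S \<eta>]]])
        (simp add: dual_map_apply[OF S] \<theta>' \<eta> a dual_apply m)
  }
  fix s assume s: "s \<in> carrier S"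
  note a = dual_on_ops(2)[OF N S s \<theta>']
  show "dual_map K M N \<phi> S (s \<cdot>[Ob (dual K N) S] \<theta>) = s \<cdot>[Ob (dual K M) S] dual_map K M N \<phi> S \<theta>"
    by (rule dual_on_eqI[OF d[OF S a] dual_on_ops(2)[OF M S s d[OF S \<theta>']]])
      (simp add: dual_map_apply[OF S] \<theta>' a dual_apply m)
qed

context
  fixes K :: "'u ring" and M :: "('u, 'a) mfunc"
  assumes M: "mod_functor K M"
begin

lemma bidual_apply:
  "S \<in> CAlg K ==> T \<in> CAlg K ==> f \<in> alg_hom K S T ==> \<alpha> \<in> dual_on K M T ==>
    bidual K M S m (T, f) \<alpha> = \<alpha> (T, idm T) (Ar M S T f m)"
  by (simp add: bidual_def)

lemma dual_on_idm_Ar: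
  "\<alpha> \<in> dual_on K M S ==> S \<in> CAlg K ==> T \<in> CAlg K ==> f \<in> alg_hom K S T ==> x \<in> M $ T ==>
    Ar (dual K M) S T f \<alpha> (T, idm T) x = \<alpha> (T, f) x"
  by (simp add: dual_apply idm_alg_hom CAlg_AAlg compose_idm_left)

lemma bidual_dual_on:
  assumes S: "S \<in> CAlg K" and m: "m \<in> M $ S"
  shows "bidual K M S m \<in> dual_on K (dual K M) S"
  unfolding bidual_def
proof (rule nt_restrict_dual_on[OF mod_functor_dual[OF M] S], unfold carrier_dual)
  note sf = set_functorD[OF mod_functorD(1)[OF M]]
  fix T f \<alpha> assume T: "T \<in> CAlg K" and f: "f \<in> alg_hom K S T" and \<alpha>: "\<alpha> \<in> dual_on K M T"
  note i = idm_CAlg[OF T] and fm = sf(1)[OF S T f m]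
  show "\<alpha> (T, idm T) (Ar M S T f m) \<in> carrier T"
    using dual_onD(2)[OF \<alpha> T i fm] .
  show "(t \<cdot>[Ob (dual K M) T] \<alpha>) (T, idm T) (Ar M S T f m) = t *[T] \<alpha> (T, idm T) (Ar M S T f m)"
    if "t \<in> carrier T" for t using that by (simp add: dual_apply T i fm)
  show "(\<alpha> +[Ob (dual K M) T] \<beta>) (T, idm T) (Ar M S T f m) =
    \<alpha> (T, idm T) (Ar M S T f m) +[T] \<beta> (T, idm T) (Ar M S T f m)" for \<beta>
    by (simp add: dual_apply T i fm)
  fix V g assume V: "V \<in> CAlg K" and g: "g \<in> alg_hom K T V" and gf: "g o[S] f \<in> alg_hom K S V"
  have "Ar (dual K M) T V g \<alpha> (V, idm V) (Ar M S V (g o[S] f) m) =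
    \<alpha> (V, g) (Ar M T V g (Ar M S T f m))"
    using dual_on_idm_Ar[OF \<alpha> T V g] sf(1)[OF S V gf m] sf(3)[OF S T V f g m] by simp
  also have "\<dots> = g (\<alpha> (T, idm T) (Ar M S T f m))"
    using dual_onD(5)[OF \<alpha> T i V g fm] by (simp add: compose_idm_right[OF g])
  finally show "Ar (dual K M) T V g \<alpha> (V, idm V) (Ar M S V (g o[S] f) m) =
    g (\<alpha> (T, idm T) (Ar M S T f m))" .
qed

text \<open>Surjectivity of the natural map to the bidual, stated pointwise. It is the source of
  elements of \<open>M\<close>: any natural linear form on the dual is evaluation at one.\<close>

lemma reflexive_ex:
  assumes "reflexive K M" "S \<in> CAlg K" "\<Omega> \<in> dual_on K (dual K M) S"
  shows "\<exists>m\<in>M $ S. \<forall>T f \<alpha>. T \<in> CAlg K --> f \<in> alg_hom K S T --> \<alpha> \<in> dual_on K M T -->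
    \<Omega> (T, f) \<alpha> = \<alpha> (T, idm T) (Ar M S T f m)"
proof -
  have "bidual K M S ` (M $ S) = dual_on K (dual K M) S"
    using assms(1,2) by (auto simp: reflexive_def bij_betw_def)
  then obtain m where "m \<in> M $ S" "\<Omega> = bidual K M S m" using assms(3) by blast
  then show ?thesis using assms(2) by (intro bexI[of _ m]) (simp_all add: bidual_apply)
qed

lemma reflexive_sep:
  assumes "reflexive K M" "S \<in> CAlg K" "m \<in> M $ S" "m' \<in> M $ S"
    and "\<And>T f \<alpha>. T \<in> CAlg K ==> f \<in> alg_hom K S T ==> \<alpha> \<in> dual_on K M T ==>
    \<alpha> (T, idm T) (Ar M S T f m) = \<alpha> (T, idm T) (Ar M S T f m')"
  shows "m = m'"
proof -
  have "inj_on (bidual K M S) (M $ S)"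
    using assms(1,2) by (auto simp: reflexive_def bij_betw_def)
  moreover have "bidual K M S m = bidual K M S m'"
    using bidual_dual_on assms by (intro dual_on_eqI[of _ K "dual K M" S]) (simp_all add: bidual_apply)
  ultimately show ?thesis using assms by (auto simp: inj_on_def)
qed

lemma reflexiveI:
  assumes "small_functor K M" "small_functor K (dual K M)"
    and "\<And>S \<Omega>. S \<in> CAlg K ==> \<Omega> \<in> dual_on K (dual K M) S ==>
    \<exists>m\<in>M $ S. \<forall>T f \<alpha>. T \<in> CAlg K --> f \<in> alg_hom K S T --> \<alpha> \<in> dual_on K M T -->
      \<Omega> (T, f) \<alpha> = \<alpha> (T, idm T) (Ar M S T f m)"
    and "\<And>S m m'. S \<in> CAlg K ==> m \<in> M $ S ==> m' \<in> M $ S ==>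
    (\<And>T f \<alpha>. T \<in> CAlg K ==> f \<in> alg_hom K S T ==> \<alpha> \<in> dual_on K M T ==>
      \<alpha> (T, idm T) (Ar M S T f m) = \<alpha> (T, idm T) (Ar M S T f m')) ==> m = m'"
  shows "reflexive K M"
  unfolding reflexive_def bij_betw_def
proof (intro conjI ballI M assms(1,2) inj_onI)
  fix S m m' assume S: "S \<in> CAlg K" and m: "m \<in> M $ S" "m' \<in> M $ S"
    and eq: "bidual K M S m = bidual K M S m'"
  show "m = m'"
  proof (rule assms(4)[OF S m])
    fix T f \<alpha> assume "T \<in> CAlg K" "f \<in> alg_hom K S T" "\<alpha> \<in> dual_on K M T"
    then show "\<alpha> (T, idm T) (Ar M S T f m) = \<alpha> (T, idm T) (Ar M S T f m')"
      using bidual_apply[OF S, of T f \<alpha> m] bidual_apply[OF S, of T f \<alpha> m'] eq by simp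
  qed
next
  fix S assume S: "S \<in> CAlg K"
  show "bidual K M S ` (M $ S) = (dual K (dual K M)) $ S"
  proof (intro equalityI subsetI)
    fix \<Omega> assume "\<Omega> \<in> (dual K (dual K M)) $ S"
    then have \<Omega>: "\<Omega> \<in> dual_on K (dual K M) S" by simp
    then obtain m where m: "m \<in> M $ S" "\<forall>T f \<alpha>. T \<in> CAlg K --> f \<in> alg_hom K S T --> \<alpha> \<in> dual_on K M T -->
      \<Omega> (T, f) \<alpha> = \<alpha> (T, idm T) (Ar M S T f m)" using assms(3)[OF S] by blast
    have "\<Omega> = bidual K M S m"
      using m S by (intro dual_on_eqI[OF \<Omega> bidual_dual_on]) (simp_all add: bidual_apply)
    then show "\<Omega> \<in> bidual K M S ` (M $ S)" using m by blast
  qed (use bidual_dual_on[OF S] in auto)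
qed

end

text \<open>An explicit transport, since \<open>M\<close> and \<open>N\<close> may have different
  types. With \<open>k\<close> inverse to \<open>i\<close>, a form on the dual of \<open>N\<close>
  is pulled back along the dual of \<open>k\<close>, represented by an element of \<open>M\<close>,
  and that element is sent to \<open>N\<close>.\<close>

lemma reflexive_iso:
  fixes K :: "'u ring" and M :: "('u, 'a) mfunc" and N :: "('u, 'b) mfunc"
  assumes N: "mod_functor K N" and i: "i \<in> Mod_mor K M N"
    and bij: "\<And>S. S \<in> CAlg K ==> bij_betw (i S) (M $ S) (N $ S)"
    and rM: "reflexive K M"
  shows "reflexive K N"
proof -
  have M: "mod_functor K M" using rM by (simp add: reflexive_def)
  define k where "k = (\<lambda>S\<in>CAlg K. \<lambda>n\<in>N $ S. inv_into (M $ S) (i S) n)"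
  have k: "k S n \<in> M $ S" "i S (k S n) = n" if "S \<in> CAlg K" "n \<in> N $ S" for S n
    using that bij[OF that(1)] inv_into_into[of n "i S"] f_inv_into_f[of n "i S"]
    by (auto simp: k_def bij_betw_def)
  have ki: "m = m'" if "S \<in> CAlg K" "m \<in> M $ S" "m' \<in> M $ S" "i S m = i S m'" for S m m'
    using that bij[OF that(1)] by (auto simp: bij_betw_def inj_on_def)
  note m = Mod_morD[OF i]
  note cM = mod_functor_closed[OF M] and cN = mod_functor_closed[OF N]
  note sM = set_functorD[OF mod_functorD(1)[OF M]] and sN = set_functorD[OF mod_functorD(1)[OF N]]
  have kmor: "k \<in> Mod_mor K N M"
  proof (rule Mod_morI)
    have "(\<lambda>S\<in>CAlg K. \<lambda>x\<in>N $ S. k S x) \<in> Mor K N M"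
    proof (rule MorI)
      show "k T (Ar N S T f x) = Ar M S T f (k S x)"
        if "S \<in> CAlg K" "T \<in> CAlg K" "f \<in> alg_hom K S T" "x \<in> N $ S" for S T f x
        using that by (intro ki[of T]) (simp_all add: k m sM sN)
    qed (simp_all add: k mod_functorD[OF N])
    moreover have "(\<lambda>S\<in>CAlg K. \<lambda>x\<in>N $ S. k S x) = k"
      by (auto simp: k_def fun_eq_iff)
    ultimately show "k \<in> Mor K N M" by simp
    show "k S (x +[Ob N S] y) = k S x +[Ob M S] k S y"
      if "S \<in> CAlg K" "x \<in> N $ S" "y \<in> N $ S" for S x y
      using that by (intro ki[of S]) (simp_all add: k m cM cN)
    show "k S (s \<cdot>[Ob N S] x) = s \<cdot>[Ob M S] k S x"
      if "S \<in> CAlg K" "s \<in> carrier S" "x \<in> N $ S" for S s x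
      using that by (intro ki[of S]) (simp_all add: k m cM cN)
  qed
  note di = dual_map_dual_on[OF M i] and dk = dual_map_dual_on[OF N kmor]
  have dd: "dual_map K N M k S (dual_map K M N i S \<beta>) = \<beta>" if S: "S \<in> CAlg K" and \<beta>: "\<beta> \<in> dual_on K N S" for S \<beta>
    by (rule dual_on_eqI[OF dk[OF S di[OF S \<beta>]] \<beta>]) (simp add: dual_map_apply[OF S] di[OF S] \<beta> k)
  show ?thesis
  proof (rule reflexiveI[OF N])
    show "small_functor K N"
      unfolding small_functor_def
    proof
      fix S assume S: "S \<in> CAlg K"
      have "N $ S \<approx> (M $ S)"
        using bij[OF S] eqpoll_sym by (auto simp: eqpoll_def)
      then show "N $ S \<prec> (UNIV :: 'u set)"
        using rM S eq_lesspoll_trans by (auto simp: reflexive_def small_functor_def)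
    qed
    show "small_functor K (dual K N)"
      unfolding small_functor_def
    proof
      fix S assume S: "S \<in> CAlg K"
      have "inj_on (dual_map K M N i S) (dual_on K N S)" using dd[OF S] by (metis inj_onI)
      moreover have "dual_map K M N i S ` dual_on K N S \<subseteq> dual_on K M S" using di[OF S] by blast
      ultimately have "dual_on K N S \<lesssim> dual_on K M S" by (auto simp: lepoll_def)
      moreover have "dual_on K M S \<prec> (UNIV :: 'u set)"
        using rM S by (simp add: reflexive_def small_functor_def)
      ultimately show "dual K N $ S \<prec> (UNIV :: 'u set)"
        using lesspoll_trans1 by (simp only: carrier_dual)
    qed
  next
    fix S \<Omega> assume S: "S \<in> CAlg K" and \<Omega>: "\<Omega> \<in> dual_on K (dual K N) S"
    define \<Omega>' where "\<Omega>' = dual_map K (dual K M) (dual K N) (dual_map K N M k) S \<Omega>"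
    have "\<Omega>' \<in> dual_on K (dual K M) S"
      unfolding \<Omega>'_def
      by (rule dual_map_dual_on[OF mod_functor_dual[OF M] dual_map_Mod_mor[OF N M kmor] S \<Omega>])
    then obtain n where n: "n \<in> M $ S" "\<forall>T f \<alpha>. T \<in> CAlg K --> f \<in> alg_hom K S T --> \<alpha> \<in> dual_on K M T -->
      \<Omega>' (T, f) \<alpha> = \<alpha> (T, idm T) (Ar M S T f n)" using reflexive_ex[OF M rM S] by blast
    show "\<exists>m\<in>N $ S. \<forall>T f \<alpha>. T \<in> CAlg K --> f \<in> alg_hom K S T --> \<alpha> \<in> dual_on K N T -->
      \<Omega> (T, f) \<alpha> = \<alpha> (T, idm T) (Ar N S T f m)"
    proof (intro bexI[of _ "i S n"] allI impI)
      fix T f \<beta> assume T: "T \<in> CAlg K" and f: "f \<in> alg_hom K S T" and \<beta>: "\<beta> \<in> dual_on K N T"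
      have "\<Omega> (T, f) \<beta> = \<Omega>' (T, f) (dual_map K M N i T \<beta>)"
        unfolding \<Omega>'_def using dual_map_apply[OF S \<Omega> T f, of "dual_map K M N i T \<beta>" "dual K M"] di[OF T \<beta>] dd[OF T \<beta>]
        by simp
      also have "\<dots> = dual_map K M N i T \<beta> (T, idm T) (Ar M S T f n)" using n T f di[OF T \<beta>] by blast
      also have "\<dots> = \<beta> (T, idm T) (Ar N S T f (i S n))"
        using n sM(1)[OF S T f n(1)] idm_CAlg[OF T]
        by (simp add: dual_map_apply[OF T \<beta> T] m S T f)
      finally show "\<Omega> (T, f) \<beta> = \<beta> (T, idm T) (Ar N S T f (i S n))" .
    qed (use m n S in auto)
  next
    fix S n n' assume S: "S \<in> CAlg K" and n: "n \<in> N $ S" "n' \<in> N $ S"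
      and eq: "\<And>T f \<alpha>. T \<in> CAlg K ==> f \<in> alg_hom K S T ==> \<alpha> \<in> dual_on K N T ==>
      \<alpha> (T, idm T) (Ar N S T f n) = \<alpha> (T, idm T) (Ar N S T f n')"
    have "k S n = k S n'"
    proof (rule reflexive_sep[OF M rM S])
      fix T f \<alpha> assume T: "T \<in> CAlg K" and f: "f \<in> alg_hom K S T" and \<alpha>: "\<alpha> \<in> dual_on K M T"
      note i' = idm_CAlg[OF T]
      have *: "\<alpha> (T, idm T) (Ar M S T f (k S x)) = dual_map K N M k T \<alpha> (T, idm T) (Ar N S T f x)"
        if "x \<in> N $ S" for x
        using that sN(1)[OF S T f] i' by (simp add: dual_map_apply[OF T \<alpha> T] Mod_morD(5)[OF kmor] S T f)
      show "\<alpha> (T, idm T) (Ar M S T f (k S n)) = \<alpha> (T, idm T) (Ar M S T f (k S n'))"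
        using eq[OF T f dk[OF T \<alpha>]] by (simp add: * n)
    qed (use k n S in auto)
    then show "n = n'" using k(2)[OF S] n by metis
  qed
qed

section \<open>Quasi-coherent algebras\<close>

text \<open>Algebra morphisms from \<open>A\<close> to the structure functor, over
  \<open>S\<close>-algebras. They are kept as elements of the dual, so that the multiplication of
  the dual can be applied to points.\<close>

definition chars :: "'u ring => ('u, 'a) mfunc => 'u alg => ('u, 'a) nt set" where
  "chars K A S = {\<chi> \<in> dual_on K A S. \<forall>T\<in>CAlg K. \<forall>f\<in>alg_hom K S T. \<chi> (T, f) \<in> ring_hom (Ob A T) T}"

lemma charsD:
  assumes "\<chi> \<in> chars K A S"
  shows "\<chi> \<in> dual_on K A S"
    "T \<in> CAlg K ==> f \<in> alg_hom K S T ==> \<chi> (T, f) \<in> ring_hom (Ob A T) T"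
    "T \<in> CAlg K ==> f \<in> alg_hom K S T ==> x \<in> A $ T ==> y \<in> A $ T ==>
    \<chi> (T, f) (x *[Ob A T] y) = \<chi> (T, f) x *[T] \<chi> (T, f) y"
    "T \<in> CAlg K ==> f \<in> alg_hom K S T ==> \<chi> (T, f) 1[Ob A T] = 1[T]"
  using assms by (auto simp: chars_def ring_hom_def)

lemma charsI:
  assumes "\<chi> \<in> dual_on K A S"
    and "\<And>T f x y. T \<in> CAlg K ==> f \<in> alg_hom K S T ==> x \<in> A $ T ==> y \<in> A $ T ==>
    \<chi> (T, f) (x *[Ob A T] y) = \<chi> (T, f) x *[T] \<chi> (T, f) y"
    and "\<And>T f. T \<in> CAlg K ==> f \<in> alg_hom K S T ==> \<chi> (T, f) 1[Ob A T] = 1[T]"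
  shows "\<chi> \<in> chars K A S"
  using assms dual_onD(2,3)[OF assms(1)] by (auto simp: chars_def intro!: ring_hom_memI)

context base
begin

interpretation K: field K by (rule K_field)

lemma tens_map_id_pt:
  assumes "A \<in> AAlg K" "S \<in> AAlg K" "S' \<in> AAlg K" "lin K S S' f" "a \<in> carrier A" "s \<in> carrier S"
  shows "tens_map K A S A S' id f (pt A S a s) = pt A S' a (f s)"
  using tens_map_pt[OF assms(1,2,1,3) lin_id(1) assms(4-6)] by simp

lemma qc_simps [simp]:
  "qc K A $ S = carrier (tens K A S)" "add (Ob (qc K A) S) = add (tens K A S)"
  "monoid.mult (Ob (qc K A) S) = monoid.mult (tens K A S)" "one (Ob (qc K A) S) = one (tens K A S)"
  "ring.zero (Ob (qc K A) S) = ring.zero (tens K A S)"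
  "s \<cdot>[Ob (qc K A) S] x = pt A S 1[A] s *[tens K A S] x"
  "Ar (qc K A) S T f = tens_map K A S A T id f"
  by (simp_all add: qc_def)

lemma id_ring_hom: "id \<in> ring_hom A A"
  by (auto simp: ring_hom_def)

lemma alg_functor_qc:
  assumes A: "A \<in> AAlg K"
  shows "alg_functor K (qc K A)"
proof -
  interpret A: ring A using A by (rule AAlgD)
  have assoc: "assoc_algebra S (Ob (qc K A) S)" if S: "S \<in> CAlg K" for S
  proof -
    note S' = CAlg_AAlg[OF S]
    interpret S: cring S using S by (rule CAlg_cring)
    interpret T: ring "tens K A S" using tens_AAlg[OF A S'] by (rule AAlgD)
    note p = pt_closed[OF A S' A.one_closed]
    have ag: "abelian_group (Ob (qc K A) S)"
    proof (rule abelian_groupI)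
      fix x assume "x \<in> qc K A $ S"
      then show "\<exists>y\<in>(qc K A) $ S. y +[Ob (qc K A) S] x = 0[Ob (qc K A) S]"
        using T.l_neg T.a_inv_closed by (simp only: qc_simps) blast
    qed (simp_all only: qc_simps T.a_closed T.zero_closed T.a_assoc T.l_zero, simp only: T.a_comm)
    have "ring (Ob (qc K A) S)"
    proof (rule ringI[OF ag])
      show "Group.monoid (Ob (qc K A) S)" by (rule monoidI) (auto simp: T.m_assoc)
    qed (auto simp: T.l_distr T.r_distr)
    moreover have "module S (Ob (qc K A) S)"
      by (rule moduleI[OF S.is_cring ag])
        (use p in \<open>simp_all add: T.l_distr T.r_distr pt_add_right[OF A S'] T.m_assoc[symmetric]
          pt_mult[OF A S'] pt_one[OF A S', symmetric]\<close>)
    moreover have "pt A S 1[A] s *[tens K A S] x = x *[tens K A S] pt A S 1[A] s"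
      if s: "s \<in> carrier S" and x: "x \<in> carrier (tens K A S)" for s x
      using A S' x
    proof (induction rule: tens_induct)
      case (pure a t) then show ?case using s by (simp add: pt_mult[OF A S'] S.m_comm)
    next
      case (add y z) then show ?case using p s by (simp add: T.l_distr T.r_distr)
    qed
    ultimately show ?thesis
      using p T.m_assoc by (simp add: assoc_algebra_def)
  qed
  have rh: "tens_map K A S A T id f \<in> ring_hom (tens K A S) (tens K A T)"
    if "S \<in> CAlg K" "T \<in> CAlg K" "f \<in> alg_hom K S T" for S T f
    by (rule tens_map_ring_hom[OF A CAlg_AAlg[OF that(1)] A CAlg_AAlg[OF that(2)] lin_id(1)
          alg_homD(7)[OF that(3)] id_ring_hom alg_homD(8)[OF that(3)]])
  show ?thesis
    unfolding alg_functor_def mod_functor_def set_functor_def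
  proof (intro conjI ballI assoc)
    fix S T f assume S: "S \<in> CAlg K" and T: "T \<in> CAlg K" and f: "f \<in> alg_hom K S T"
    note m = tens_map_add[OF A CAlg_AAlg[OF S] A CAlg_AAlg[OF T] lin_id(1) alg_homD(7)[OF f]]
      tens_map_id_pt[OF A CAlg_AAlg[OF S] CAlg_AAlg[OF T] alg_homD(7)[OF f]]
      tens_map_closed[OF A CAlg_AAlg[OF S] A CAlg_AAlg[OF T] lin_id(1) alg_homD(7)[OF f]]
    show "Ar (qc K A) S T f \<in> qc K A $ S \<rightarrow> (qc K A) $ T" using m by auto
    show "Ar (qc K A) S T f \<in> ring_hom (Ob (qc K A) S) (Ob (qc K A) T)"
      using rh[OF S T f] by (simp add: ring_hom_def)
    fix x assume x: "x \<in> qc K A $ S"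
    show "Ar (qc K A) S T f (x +[Ob (qc K A) S] y) = Ar (qc K A) S T f x +[Ob (qc K A) T] Ar (qc K A) S T f y"
      if "y \<in> qc K A $ S" for y using x that m by simp
    show "Ar (qc K A) S T f (s \<cdot>[Ob (qc K A) S] x) = f s \<cdot>[Ob (qc K A) T] Ar (qc K A) S T f x"
      if "s \<in> carrier S" for s
      using x that m ring_hom_mult[OF rh[OF S T f]] pt_closed[OF A CAlg_AAlg[OF S]] by simp
  next
    fix S x assume S: "S \<in> CAlg K" and x: "x \<in> qc K A $ S"
    note S' = CAlg_AAlg[OF S]
    note i = alg_homD(7)[OF idm_alg_hom[OF S']]
    have "tens_map K A S A S id (idm S) x = x"
      using A S' x[unfolded qc_simps]
    proof (induction rule: tens_induct)
      case (pure a s) then show ?case by (simp only: tens_map_id_pt[OF A S' S' i] idm_apply)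
    next
      case (add y z) then show ?case by (simp only: tens_map_add[OF A S' A S' lin_id(1) i])
    qed
    then show "Ar (qc K A) S S (idm S) x = x" by simp
  next
    fix S T V f g x assume S: "S \<in> CAlg K" and T: "T \<in> CAlg K" and V: "V \<in> CAlg K"
      and f: "f \<in> alg_hom K S T" and g: "g \<in> alg_hom K T V" and x: "x \<in> qc K A $ S"
    note S' = CAlg_AAlg[OF S] and T' = CAlg_AAlg[OF T] and V' = CAlg_AAlg[OF V]
    note gf = alg_homD(7)[OF compose_alg_hom[OF f g S']] and f' = alg_homD(7)[OF f] and g' = alg_homD(7)[OF g]
    note i = lin_id(1)
    note ms = tens_map_add[OF A S' A V' i gf] tens_map_id_pt[OF A S' V' gf] tens_map_closed[OF A S' A T' i f']
      tens_map_add[OF A S' A T' i f'] tens_map_id_pt[OF A S' T' f'] tens_map_add[OF A T' A V' i g'] tens_map_id_pt[OF A T' V' g']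
    have "tens_map K A S A V id (g o[S] f) x = tens_map K A T A V id g (tens_map K A S A T id f x)"
      by (rule tens_hom_eqI[OF A S' x[unfolded qc_simps], where P = "tens K A V"])
        (simp_all only: ms compose_eq alg_homD(1)[OF f])
    then show "Ar (qc K A) S V (g o[S] f) x = Ar (qc K A) T V g (Ar (qc K A) S T f x)" by simp
  qed (use assoc in \<open>auto simp: assoc_algebra_def\<close>)
qed

lemma mod_functor_qc: "A \<in> AAlg K ==> mod_functor K (qc K A)"
  using alg_functor_qc alg_functorD by blast

lemma inl_apply: "a \<in> carrier A ==> inl A S a = pt A S a 1[S]"
  by (simp add: inl_def)

lemma inr_apply: "s \<in> carrier S ==> inr A S s = pt A S 1[A] s"
  by (simp add: inr_def)

text \<open>The multiplication \<open>s \<otimes> t |-> f s t\<close>, which carries the value of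
  \<open>qc K S\<close> at \<open>T\<close> to \<open>T\<close> itself once \<open>T\<close> is an
  \<open>S\<close>-algebra by \<open>f\<close>.\<close>

definition act :: "'u alg => 'u alg => ('u => 'u) => 'u => 'u" where
  "act S T f = cop S T T f (idm T)"

context
  fixes S T :: "'u alg" and f
  assumes S: "S \<in> CAlg K" and T: "T \<in> CAlg K" and f: "f \<in> alg_hom K S T"
begin

interpretation T: cring T using T by (rule CAlg_cring)

lemmas idT = idm_CAlg[OF T]

lemma act_alg_hom: "act S T f \<in> alg_hom K (tens K S T) T"
  unfolding act_def by (rule cop_alg_hom[OF S T T f idT])

lemma act_pt: "s \<in> carrier S ==> t \<in> carrier T ==> act S T f (pt S T s t) = f s *[T] t"
  unfolding act_def by (simp add: cop_pt[OF S T T f idT])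

lemma act_inl: "act S T f o[S] inl S T = f"
  unfolding act_def by (rule cop_inl[OF S T T f idT])

lemma act_inr: "act S T f o[T] inr S T = idm T"
  unfolding act_def by (rule cop_inr[OF S T T f idT])

lemma act_smult:
  assumes "t \<in> carrier T" "z \<in> carrier (tens K S T)"
  shows "act S T f (pt S T 1[S] t *[tens K S T] z) = t *[T] act S T f z"
  using assms alg_homD(3)[OF act_alg_hom, of "pt S T 1[S] t" z] pt_closed[OF CAlg_AAlg[OF S] CAlg_AAlg[OF T]] CAlg_closed(3)[OF S]
  by (simp add: act_pt alg_homD(5)[OF f])

lemma act_nat:
  assumes V: "V \<in> CAlg K" and g: "g \<in> alg_hom K T V" and z: "z \<in> carrier (tens K S T)"
  shows "act S V (g o[S] f) (tens_map K S T S V id g z) = g (act S T f z)"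
proof -
  note S' = CAlg_AAlg[OF S] and T' = CAlg_AAlg[OF T] and V' = CAlg_AAlg[OF V]
  note gf = compose_alg_hom[OF f g S']
  have aV: "cop S V V (g o[S] f) (idm V) \<in> alg_hom K (tens K S V) V"
    by (rule cop_alg_hom[OF S V V gf idm_alg_hom[OF V']])
  note m = tens_map_add[OF S' T' S' V' lin_id(1) alg_homD(7)[OF g]]
    tens_map_id_pt[OF S' T' V' alg_homD(7)[OF g]] tens_map_closed[OF S' T' S' V' lin_id(1) alg_homD(7)[OF g]]
  show ?thesis
    by (rule tens_hom_eqI[OF S' T' z, where P = V])
      (simp_all only: m alg_homD(2)[OF act_alg_hom] alg_homD(2)[OF g] act_def[of S V] alg_homD(2)[OF aV] alg_homD(1)[OF act_alg_hom],
        simp_all add: act_pt alg_homD[OF f] alg_homD[OF g] cop_pt[OF S V V gf idm_alg_hom[OF V']] compose_eq)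
qed

end

text \<open>Functoriality of \<open>qc K S\<close> is application of a map of algebras out of the
  coproduct; in this form naturality of a character can be invoked along it.\<close>

lemma tens_map_cop:
  assumes S: "S \<in> CAlg K" and R: "R \<in> CAlg K" and R': "R' \<in> CAlg K" and h: "h \<in> alg_hom K R R'"
    and z: "z \<in> carrier (tens K S R)"
  shows "tens_map K S R S R' id h z = cop S R (tens K S R') (inl S R') (inr S R' o[R] h) z"
proof -
  note S' = CAlg_AAlg[OF S] and T' = CAlg_AAlg[OF R] and V' = CAlg_AAlg[OF R']
  note D = tens_CAlg[OF S R']
  note ih = inl_alg_hom[OF S' V'] compose_alg_hom[OF h inr_alg_hom[OF S' V'] T']
  show ?thesis
    by (rule tens_hom_eqI[OF S' T' z, where P = "tens K S R'"])
      (simp_all only: tens_map_add[OF S' T' S' V' lin_id(1) alg_homD(7)[OF h]]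
        tens_map_id_pt[OF S' T' V' alg_homD(7)[OF h]] cop_add[OF S R D ih] cop_pt[OF S R D ih]
        inl_apply inr_apply compose_eq alg_homD(1)[OF h] pt_one_mult[OF S' V'])
qed

text \<open>A triangle identity between base change to \<open>S\<close> and restriction to
  \<open>S\<close>-algebras; it makes characters and morphisms to \<open>qc K S\<close>
  correspond.\<close>

lemma act_inl_inr:
  assumes S: "S \<in> CAlg K" and R: "R \<in> CAlg K" and z: "z \<in> carrier (tens K S R)"
  shows "act S (tens K S R) (inl S R) (tens_map K S R S (tens K S R) id (inr S R) z) = z"
proof -
  note S' = CAlg_AAlg[OF S] and R' = CAlg_AAlg[OF R] and D = tens_CAlg[OF S R]
  note l = inl_alg_hom[OF S' R'] and r = alg_homD(7)[OF inr_alg_hom[OF S' R']]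
  note a = act_alg_hom[OF S D l]
  note m = tens_map_add[OF S' R' S' CAlg_AAlg[OF D] lin_id(1) r]
      tens_map_id_pt[OF S' R' CAlg_AAlg[OF D] r] tens_map_closed[OF S' R' S' CAlg_AAlg[OF D] lin_id(1) r]
  have "act S (tens K S R) (inl S R) (tens_map K S R S (tens K S R) id (inr S R) z) = id z"
    by (rule tens_hom_eqI[OF S' R' z, where P = "tens K S R"])
      (simp_all only: m alg_homD(2)[OF a] act_pt[OF S D l] alg_homD(1)[OF inr_alg_hom[OF S' R']]
        inl_apply inr_apply pt_one_mult[OF S' R'], simp_all add: act_pt[OF S D l] alg_homD(1)[OF inr_alg_hom[OF S' R']]
        inl_apply inr_apply[symmetric] pt_one_mult[OF S' R'], simp_all add: inr_apply pt_one_mult[OF S' R'])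
  then show ?thesis by simp
qed

section \<open>Characters are morphisms to quasi-coherent algebras\<close>

context
  fixes A :: "('u, 'a) mfunc" and S :: "'u alg"
  assumes A: "alg_functor K A" and S: "S \<in> CAlg K"
begin

lemmas modA = alg_functorD(1)[OF A] and sfA = set_functorD[OF alg_functorD(2)[OF A]]

text \<open>Base change is adjoint to restriction: an element over \<open>R\<close> is moved to
  \<open>S \<otimes> R\<close>, which is an \<open>S\<close>-algebra by \<open>inl\<close>, and
  there the character can be applied.\<close>

lemma char_mor_Alg_mor:
  assumes \<chi>: "\<chi> \<in> chars K A S"
  shows "(\<lambda>R\<in>CAlg K. \<lambda>a\<in>A $ R. \<chi> (tens K S R, inl S R) (Ar A R (tens K S R) (inr S R) a))
    \<in> Alg_mor K A (qc K S)"
proof -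
  note c = charsD[OF \<chi>] and d = dual_onD[OF charsD(1)[OF \<chi>]]
  note S' = CAlg_AAlg[OF S]
  have t: "tens K S R \<in> CAlg K" "inl S R \<in> alg_hom K S (tens K S R)" "inr S R \<in> alg_hom K R (tens K S R)"
    if "R \<in> CAlg K" for R
    using that S S' by (simp_all add: tens_CAlg inl_alg_hom inr_alg_hom CAlg_AAlg)
  note rh = alg_functorD(5)[OF A]
  show ?thesis
  proof (intro Alg_morI Mod_morI MorI)
    fix R R' h a assume R: "R \<in> CAlg K" and R': "R' \<in> CAlg K" and h: "h \<in> alg_hom K R R'"
      and a: "a \<in> A $ R"
    \<comment> \<open>The map \<open>id \<otimes> h\<close> from \<open>S \<otimes> R\<close> to
      \<open>S \<otimes> R'\<close>, as a copairing.\<close>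
    let ?g = "cop S R (tens K S R') (inl S R') (inr S R' o[R] h)"
    note hc = compose_alg_hom[OF h t(3)[OF R'] CAlg_AAlg[OF R]]
    note g = cop_alg_hom[OF S R t(1)[OF R'] t(2)[OF R'] hc]
      cop_inl[OF S R t(1)[OF R'] t(2)[OF R'] hc] cop_inr[OF S R t(1)[OF R'] t(2)[OF R'] hc]
    have ia: "Ar A R (tens K S R) (inr S R) a \<in> A $ (tens K S R)"
      using sfA(1)[OF R t(1,3)[OF R] a] .
    have "Ar A R' (tens K S R') (inr S R') (Ar A R R' h a) =
      Ar A (tens K S R) (tens K S R') ?g (Ar A R (tens K S R) (inr S R) a)"
      using sfA(3)[OF R R' t(1)[OF R'] h t(3)[OF R'] a] sfA(3)[OF R t(1)[OF R] t(1)[OF R'] t(3)[OF R] g(1) a]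
      by (simp add: g)
    then have "\<chi> (tens K S R', inl S R') (Ar A R' (tens K S R') (inr S R') (Ar A R R' h a)) =
      ?g (\<chi> (tens K S R, inl S R) (Ar A R (tens K S R) (inr S R) a))"
      using d(5)[OF t(1,2)[OF R] t(1)[OF R'] g(1) ia] by (simp add: g(2))
    also have "\<dots> = Ar (qc K S) R R' h (\<chi> (tens K S R, inl S R) (Ar A R (tens K S R) (inr S R) a))"
      using tens_map_cop[OF S R R' h d(2)[OF t(1,2)[OF R] ia]] by simp
    finally show "\<chi> (tens K S R', inl S R') (Ar A R' (tens K S R') (inr S R') (Ar A R R' h a)) =
    Ar (qc K S) R R' h (\<chi> (tens K S R, inl S R) (Ar A R (tens K S R) (inr S R) a))" .
  qed (use alg_functorD(2)[OF A] in \<open>simp_all add: t c d sfA mod_functorD[OF modA] mod_functor_closed[OF modA]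
      ring.ring_simprules alg_functorD(4)[OF A] ring_hom_mult[OF rh] ring_hom_one[OF rh] alg_homD(1)[OF t(3)] inr_apply[symmetric]\<close>)
qed

text \<open>The inverse passage: a value in \<open>S \<otimes> T\<close> is multiplied down to
  \<open>T\<close>. That the two passages are inverse to each other is \<open>mor_char_mor\<close>
  and \<open>char_mor_char\<close>.\<close>

lemma mor_char:
  assumes \<phi>: "\<phi> \<in> Alg_mor K A (qc K S)"
  shows "nt_restrict K A S (\<lambda>T f a. act S T f (\<phi> T a)) \<in> chars K A S"
proof -
  note m = Mod_morD[OF Alg_morD(1)[OF \<phi>]] Alg_morD(3,4)[OF \<phi>]
  note a = alg_homD[OF act_alg_hom[OF S]]
  have mc: "\<phi> T x \<in> carrier (tens K S T)" if "T \<in> CAlg K" "x \<in> A $ T" for T x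
    using m(2)[OF that] by simp
  show ?thesis
  proof (rule charsI)
    show "nt_restrict K A S (\<lambda>T f a. act S T f (\<phi> T a)) \<in> dual_on K A S"
      by (rule nt_restrict_dual_on[OF modA S]) (simp_all add: m(3-) mc a act_nat[OF S] act_smult[OF S])
  qed (simp_all add: m a mc mod_functor_closed[OF modA] ring.ring_simprules alg_functorD(4)[OF A])
qed

lemma mor_char_mor:
  assumes \<phi>: "\<phi> \<in> Alg_mor K A (qc K S)" and R: "R \<in> CAlg K" and a: "a \<in> A $ R"
  shows "act S (tens K S R) (inl S R) (\<phi> (tens K S R) (Ar A R (tens K S R) (inr S R) a)) = \<phi> R a"
proof -
  note m = Mod_morD[OF Alg_morD(1)[OF \<phi>]]
  have mc: "\<phi> R a \<in> carrier (tens K S R)" using m(2)[OF R a] by simp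
  show ?thesis
    using m(5)[OF R tens_CAlg[OF S R] inr_alg_hom[OF CAlg_AAlg[OF S] CAlg_AAlg[OF R]] a] act_inl_inr[OF S R mc]
    by simp
qed

lemma char_mor_char:
  assumes \<chi>: "\<chi> \<in> dual_on K A S" and T: "T \<in> CAlg K" and f: "f \<in> alg_hom K S T" and a: "a \<in> A $ T"
  shows "act S T f (\<chi> (tens K S T, inl S T) (Ar A T (tens K S T) (inr S T) a)) = \<chi> (T, f) a"
proof -
  note d = dual_onD[OF \<chi>]
  note D = tens_CAlg[OF S T] and l = inl_alg_hom[OF CAlg_AAlg[OF S] CAlg_AAlg[OF T]]
    and r = inr_alg_hom[OF CAlg_AAlg[OF S] CAlg_AAlg[OF T]]
  note ac = act_alg_hom[OF S T f]
  have ra: "Ar A T (tens K S T) (inr S T) a \<in> A $ (tens K S T)" using sfA(1)[OF T D r a] .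
  have "Ar A (tens K S T) T (act S T f) (Ar A T (tens K S T) (inr S T) a) = a"
    using sfA(3)[OF T D T r ac a] sfA(2)[OF T a] act_inr[OF S T f] by simp
  then show ?thesis using d(5)[OF D l T ac ra] act_inl[OF S T f] by simp
qed

end

end

section \<open>Values over the base field and quasi-coherent images\<close>

context base
begin

interpretation K: field K by (rule K_field)

lemmas KA_AAlg = CAlg_AAlg[OF KA_CAlg]

lemma functional_slant:
  assumes S: "S \<in> AAlg K" and T: "T \<in> AAlg K" and e: "module.functional K S e"
  shows "z \<in> carrier (tens K S T) ==> slant S T e z \<in> carrier T"
    "y \<in> carrier (tens K S T) ==> z \<in> carrier (tens K S T) ==>
     slant S T e (y +[tens K S T] z) = slant S T e y +[T] slant S T e z"
    "s \<in> carrier S ==> t \<in> carrier T ==> slant S T e (pt S T s t) = e s \<cdot>[T] t"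
  by (rule slant_facts[OF S T e]; assumption)+

text \<open>The functional is defined over \<open>K\<close> and acts on the left factor only, so
  contraction commutes with base change of the right one. This is what turns contractions into
  natural forms.\<close>

lemma slant_nat:
  assumes S: "S \<in> CAlg K" and T: "T \<in> CAlg K" and V: "V \<in> CAlg K" and g: "g \<in> alg_hom K T V"
    and e: "module.functional K S e" and z: "z \<in> carrier (tens K S T)"
  shows "slant S V e (tens_map K S T S V id g z) = g (slant S T e z)"
proof -
  note S' = CAlg_AAlg[OF S] and T' = CAlg_AAlg[OF T] and V' = CAlg_AAlg[OF V]
  interpret S: module K S using S by (rule CAlgD)
  note m = tens_map_add[OF S' T' S' V' lin_id(1) alg_homD(7)[OF g]]
    tens_map_id_pt[OF S' T' V' alg_homD(7)[OF g]] tens_map_closed[OF S' T' S' V' lin_id(1) alg_homD(7)[OF g]]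
  show ?thesis
    by (rule tens_hom_eqI[OF S' T' z, where P = V])
      (simp_all only: m functional_slant[OF S' V' e] functional_slant[OF S' T' e] alg_homD(1,2)[OF g],
       simp_all add: functional_slant[OF S' V' e] alg_homD[OF g] S.functionalD[OF e])
qed

lemma slant_pt_mult:
  assumes S: "S \<in> CAlg K" and T: "T \<in> CAlg K" and e: "module.functional K S e"
    and t: "t \<in> carrier T" and z: "z \<in> carrier (tens K S T)"
  shows "slant S T e (pt S T 1[S] t *[tens K S T] z) = t *[T] slant S T e z"
proof -
  note S' = CAlg_AAlg[OF S] and T' = CAlg_AAlg[OF T]
  interpret S: cring S using S by (rule CAlg_cring)
  interpret SM: module K S using S by (rule CAlgD)
  interpret T: cring T using T by (rule CAlg_cring)
  interpret TT: cring "tens K S T" using tens_CAlg[OF S T] by (rule CAlg_cring)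
  show ?thesis
    by (rule tens_hom_eqI[OF S' T' z, where P = T])
      (use t in \<open>simp_all add: TT.r_distr T.r_distr functional_slant[OF S' T' e] pt_closed[OF S' T'] pt_mult[OF S' T']
         SM.functionalD[OF e] AAlg_smult_assoc[OF T']\<close>)
qed

text \<open>An element \<open>\<lambda>\<close> of the dual of \<open>S\<close> turns \<open>a \<in> M(S)\<close> into an element of the bidual over \<open>K\<close>,
  hence of \<open>M(K)\<close>, on which \<open>w\<close> takes the value \<open>\<lambda> (w a)\<close>.\<close>

lemma reflexive_vanish:
  fixes M :: "('u, 'a) mfunc"
  assumes rM: "reflexive K M" and w: "w \<in> dual_on K M KA"
    and van: "\<And>b. b \<in> M $ KA ==> w (KA, idm KA) b = 0[K]"
    and S: "S \<in> CAlg K" and a: "a \<in> M $ S"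
  shows "w (S, unit_hom S) a = 0[S]"
proof (rule ccontr)
  have M: "mod_functor K M" using rM by (simp add: reflexive_def)
  note sM = set_functorD[OF mod_functorD(1)[OF M]]
  note S' = CAlg_AAlg[OF S]
  note u = unit_hom_alg_hom[OF S']
  let ?s = "w (S, unit_hom S) a"
  assume ne: "?s \<noteq> 0[S]"
  interpret S: module K S using S by (rule CAlgD)
  have s: "?s \<in> carrier S" using dual_onD(2)[OF w S u a] .
  \<comment> \<open>If \<open>w a\<close> were nonzero, some functional on \<open>S\<close> would be
    1 on it; it plays the role of \<lambda>.\<close>
  obtain e where e: "S.functional e" "e ?s = 1[K]"
    using S.functional_exists[OF K_field S.zero_submodule s] ne by blast
  have t: "tens K S T \<in> CAlg K" "inl S T \<in> alg_hom K S (tens K S T)" "inr S T \<in> alg_hom K T (tens K S T)"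
      "Ar M S (tens K S T) (inl S T) a \<in> M $ (tens K S T)" (is "PROP ?A")
    if "T \<in> CAlg K" for T
  proof -
    show t: "tens K S T \<in> CAlg K" "inl S T \<in> alg_hom K S (tens K S T)" "inr S T \<in> alg_hom K T (tens K S T)"
      using that S by (simp_all add: tens_CAlg inl_alg_hom inr_alg_hom CAlg_AAlg)
    show "PROP ?A" by (rule sM(1)[OF S t(1,2) a])
  qed
  \<comment> \<open>A form \<phi> over \<open>T\<close> meets \<open>a\<close> only over
    \<open>S \<otimes> T\<close>; contracting the factor \<open>S\<close> with \<open>e\<close>
    brings the value back to \<open>T\<close>. This is natural in \<open>T\<close>, so it defines a
    form on the dual over \<open>K\<close>.\<close>
  define \<Omega> where "\<Omega> = nt_restrict K (dual K M) KA
    (\<lambda>T f \<phi>. slant S T e (\<phi> (tens K S T, inr S T) (Ar M S (tens K S T) (inl S T) a)))"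
  note sl = functional_slant[OF S' CAlg_AAlg e(1)]
  have "\<Omega> \<in> dual_on K (dual K M) KA"
    unfolding \<Omega>_def
  proof (rule nt_restrict_dual_on[OF mod_functor_dual[OF M] KA_CAlg], unfold carrier_dual)
    fix T f \<phi> assume T: "T \<in> CAlg K" and f: "f \<in> alg_hom K KA T" and \<phi>: "\<phi> \<in> dual_on K M T"
    note tT = t[OF T]
    have v: "\<phi> (tens K S T, inr S T) (Ar M S (tens K S T) (inl S T) a) \<in> carrier (tens K S T)"
      by (rule dual_onD(2)[OF \<phi> tT(1,3,4)])
    show "slant S T e (\<phi> (tens K S T, inr S T) (Ar M S (tens K S T) (inl S T) a)) \<in> carrier T"
      by (rule sl(1)[OF T v])
    show "slant S T e ((\<phi> +[Ob (dual K M) T] \<psi>) (tens K S T, inr S T) (Ar M S (tens K S T) (inl S T) a)) =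
      slant S T e (\<phi> (tens K S T, inr S T) (Ar M S (tens K S T) (inl S T) a)) +[T]
      slant S T e (\<psi> (tens K S T, inr S T) (Ar M S (tens K S T) (inl S T) a))" if \<psi>: "\<psi> \<in> dual_on K M T" for \<psi>
      using dual_onD(2)[OF \<psi> tT(1,3,4)] v by (simp add: dual_apply[OF tT(1,3,4)] sl[OF T])
    show "slant S T e ((r \<cdot>[Ob (dual K M) T] \<phi>) (tens K S T, inr S T) (Ar M S (tens K S T) (inl S T) a)) =
      r *[T] slant S T e (\<phi> (tens K S T, inr S T) (Ar M S (tens K S T) (inl S T) a))" if r: "r \<in> carrier T" for r
      using r v by (simp add: dual_apply[OF tT(1,3,4)] inr_apply slant_pt_mult[OF S T e(1)])
    fix V g assume V: "V \<in> CAlg K" and g: "g \<in> alg_hom K T V"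
    note tV = t[OF V]
    note T' = CAlg_AAlg[OF T]
    note hc = compose_alg_hom[OF g tV(3) T']
    let ?g = "cop S T (tens K S V) (inl S V) (inr S V o[T] g)"
    note gg = cop_alg_hom[OF S T tV(1) tV(2) hc] cop_inl[OF S T tV(1) tV(2) hc] cop_inr[OF S T tV(1) tV(2) hc]
    have "Ar (dual K M) T V g \<phi> (tens K S V, inr S V) (Ar M S (tens K S V) (inl S V) a) =
      \<phi> (tens K S V, ?g o[T] inr S T) (Ar M (tens K S T) (tens K S V) ?g (Ar M S (tens K S T) (inl S T) a))"
      unfolding dual_apply(3)[OF tV(1,3,4)] using sM(3)[OF S tT(1) tV(1) tT(2) gg(1) a] by (simp add: gg(2,3))
    also have "\<dots> = ?g (\<phi> (tens K S T, inr S T) (Ar M S (tens K S T) (inl S T) a))"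
      by (rule dual_onD(5)[OF \<phi> tT(1,3) tV(1) gg(1) tT(4)])
    also have "\<dots> = tens_map K S T S V id g (\<phi> (tens K S T, inr S T) (Ar M S (tens K S T) (inl S T) a))"
      by (rule tens_map_cop[OF S T V g v, symmetric])
    finally show "slant S V e (Ar (dual K M) T V g \<phi> (tens K S V, inr S V) (Ar M S (tens K S V) (inl S V) a)) =
      g (slant S T e (\<phi> (tens K S T, inr S T) (Ar M S (tens K S T) (inl S T) a)))"
      using slant_nat[OF S T V g e(1) v] by simp
  qed
  \<comment> \<open>Reflexivity makes \<Omega> the evaluation at some \<open>b\<close> over
    \<open>K\<close>, so \<Omega> is zero at \<open>w\<close> by hypothesis; the remaining lines
    compute the same value as \<open>e\<close> of \<open>w a\<close>, which is 1.\<close>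
  then obtain b where b: "b \<in> M $ KA" "\<forall>T f \<alpha>. T \<in> CAlg K --> f \<in> alg_hom K KA T --> \<alpha> \<in> dual_on K M T -->
    \<Omega> (T, f) \<alpha> = \<alpha> (T, idm T) (Ar M KA T f b)"
    using reflexive_ex[OF M rM KA_CAlg] by blast
  note iK = idm_alg_hom[OF KA_AAlg] and tK = t[OF KA_CAlg]
  have "\<Omega> (KA, idm KA) w = 0[K]"
    using b van KA_CAlg iK w sM(2)[OF KA_CAlg b(1)] by simp
  then have 0: "slant S KA e (w (tens K S KA, inr S KA) (Ar M S (tens K S KA) (inl S KA) a)) = 0[K]"
    using KA_CAlg iK w by (simp add: \<Omega>_def)
  \<comment> \<open>As \<open>KA\<close> is initial, the structure map \<open>inr S KA\<close>
    factors through \<open>S\<close>, and naturality of \<open>w\<close> along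
    \<open>inl S KA\<close> applies.\<close>
  have "inr S KA = inl S KA o[KA] unit_hom S"
    using compose_unit_hom[OF S' CAlg_AAlg[OF tK(1)] tK(2)] unit_hom_unique[OF CAlg_AAlg[OF tK(1)] tK(3)] by simp
  then have "w (tens K S KA, inr S KA) (Ar M S (tens K S KA) (inl S KA) a) = inl S KA ?s"
    using dual_onD(5)[OF w S u tK(1,2) a] by (simp only:)
  then have "slant S KA e (inl S KA ?s) = 0[K]" using 0 by simp
  then show False
    using s e by (simp add: inl_apply functional_slant[OF S' KA_AAlg e(1)])
qed

lemma tens_KA:
  assumes T: "T \<in> AAlg K" and z: "z \<in> carrier (tens K T KA)"
  shows "\<exists>t\<in>carrier T. z = inl T KA t"
  using T KA_AAlg z
proof (induction rule: tens_induct)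
  case (pure a s)
  have s: "s \<in> carrier K" using pure by simp
  have "pt T KA a s = pt T KA a (s \<cdot>[KA] 1[KA])" using s by simp
  also have "\<dots> = pt T KA (s \<cdot>[T] a) 1[KA]"
    by (rule pt_balanced[OF T KA_AAlg, symmetric]) (use s pure in simp_all)
  finally have "pt T KA a s = inl T KA (s \<cdot>[T] a)"
    using s pure AAlg_closed[OF T] by (simp add: inl_apply)
  then show ?case using AAlg_closed(6)[OF T s pure(1)] by blast
next
  case (add y z)
  then show ?case using alg_homD(2)[OF inl_alg_hom[OF T KA_AAlg]] AAlg_closed(1)[OF T] by metis
qed

lemma inl_KA_inj: "T \<in> AAlg K ==> inj_on (inl T KA) (carrier T)"
proof (rule inj_onI)
  fix x y assume T: "T \<in> AAlg K" and x: "x \<in> carrier T" and y: "y \<in> carrier T" and eq: "inl T KA x = inl T KA y"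
  interpret module K T using T by (rule AAlgD)
  have b: "bilin K T KA T (\<lambda>(a, k). k \<cdot>[T] a)"
    by (rule bilinI) (simp_all add: smult_l_distr smult_r_distr smult_assoc1[symmetric] K.m_comm)
  note l = tlift_pt[OF T KA_AAlg M.abelian_group_axioms b]
  have "tlift T KA T (\<lambda>(a, k). k \<cdot>[T] a) (inl T KA z) = z" if "z \<in> carrier T" for z
    using that by (simp add: inl_apply l)
  then show "x = y" using eq x y by metis
qed

text \<open>The image of a morphism from a reflexive functor to a quasi-coherent algebra is quasi-coherent,
  because functionals vanishing on its values over \<open>K\<close> vanish on all of it.\<close>

lemma image_quotient:
  fixes B :: "('u, 'a) mfunc"
  assumes rB: "reflexive K B" and B: "alg_functor K B" and T: "T \<in> CAlg K" and \<phi>: "\<phi> \<in> Alg_mor K B (qc K T)"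
  shows "\<exists>A p j. (A, p) \<in> qc_quotients K B \<and> A \<in> CAlg K \<and> j \<in> alg_hom K A T \<and> inj_on j (carrier A) \<and>
    (\<forall>R\<in>CAlg K. \<forall>b\<in>B $ R. \<phi> R b = tens_map K A R T R j id (p R b))"
proof -
  note m = Mod_morD[OF Alg_morD(1)[OF \<phi>]] Alg_morD(3,4)[OF \<phi>]
  note modB = alg_functorD(1)[OF B] and sB = set_functorD[OF alg_functorD(2)[OF B]]
  note T' = CAlg_AAlg[OF T]
  interpret T: cring T using T by (rule CAlg_cring)
  interpret TM: module K T using T by (rule CAlgD)
  interpret TK: cring "tens K T KA" using tens_CAlg[OF T KA_CAlg] by (rule CAlg_cring)
  have mc: "\<phi> R x \<in> carrier (tens K T R)" if "R \<in> CAlg K" "x \<in> B $ R" for R x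
    using m(2)[OF that] by simp
  \<comment> \<open>The values of \<phi> over the base field, viewed in \<open>T\<close> through the
    identification of \<open>T\<close> with \<open>T \<otimes> K\<close>. This subalgebra is the
    candidate for the image.\<close>
  define W where "W = {t \<in> carrier T. inl T KA t \<in> \<phi> KA ` (B $ KA)}"
  note l = alg_homD[OF inl_alg_hom[OF T' KA_AAlg]]
  note cB = mod_functor_closed[OF modB]
  interpret BK: ring "Ob B KA" by (rule alg_functorD(4)[OF B KA_CAlg])
  have WI: "t \<in> W" if "t \<in> carrier T" "b \<in> B $ KA" "inl T KA t = \<phi> KA b" for t b
    using that by (auto simp: W_def)
  have WE: "\<exists>b\<in>B $ KA. inl T KA t = \<phi> KA b" if "t \<in> W" for t using that by (auto simp: W_def)
  have Wc: "t \<in> carrier T" if "t \<in> W" for t using that by (simp add: W_def)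
  have Wadd: "x +[T] y \<in> W" if x: "x \<in> W" and y: "y \<in> W" for x y
  proof -
    obtain b b' where b: "b \<in> B $ KA" "inl T KA x = \<phi> KA b" "b' \<in> B $ KA" "inl T KA y = \<phi> KA b'"
      using WE x y by meson
    then show ?thesis using Wc x y
      by (intro WI[of _ "b +[Ob B KA] b'"]) (simp_all add: l m(3)[OF KA_CAlg])
  qed
  have Wmult: "x *[T] y \<in> W" if x: "x \<in> W" and y: "y \<in> W" for x y
  proof -
    obtain b b' where b: "b \<in> B $ KA" "inl T KA x = \<phi> KA b" "b' \<in> B $ KA" "inl T KA y = \<phi> KA b'"
      using WE x y by meson
    then show ?thesis using Wc x y
      by (intro WI[of _ "b *[Ob B KA] b'"]) (simp_all add: l m(6)[OF KA_CAlg])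
  qed
  have Wone: "1[T] \<in> W"
    by (rule WI[of _ "1[Ob B KA]"]) (simp_all add: l m(7)[OF KA_CAlg])
  have Wsmult: "k \<cdot>[T] x \<in> W" if k: "k \<in> carrier K" and x: "x \<in> W" for k x
  proof -
    obtain b where b: "b \<in> B $ KA" "inl T KA x = \<phi> KA b" using WE x by blast
    have "inl T KA (k \<cdot>[T] x) = pt T KA 1[T] k *[tens K T KA] pt T KA x 1[K]"
      using k Wc[OF x] pt_balanced[OF T' KA_AAlg k Wc[OF x], of "1[K]"] by (simp add: inl_apply pt_mult[OF T' KA_AAlg])
    also have "\<dots> = \<phi> KA (k \<cdot>[Ob B KA] b)"
      using m(4)[OF KA_CAlg, of k b] k b Wc[OF x] by (simp add: inl_apply)
    finally show ?thesis using k b Wc[OF x] cB[OF KA_CAlg] by (intro WI[of _ "k \<cdot>[Ob B KA] b"]) simp_all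
  qed
  have Wzero: "0[T] \<in> W" using Wsmult[OF K.zero_closed Wone] by simp
  have Wneg: "\<ominus>\<^bsub>T\<^esub> x \<in> W" if "x \<in> W" for x
    using Wsmult[of "\<ominus>\<^bsub>K\<^esub> 1[K]" x] that Wc[OF that] by (simp add: TM.smult_l_minus)
  have Wsub: "submodule W K T"
    using Wc Wadd Wzero Wneg Wsmult by (intro TM.submoduleI) auto
  define A where "A = T\<lparr>carrier := W\<rparr>"
  have As: "carrier A = W" "add A = add T" "monoid.mult A = monoid.mult T" "one A = one T" "ring.zero A = ring.zero T"
    "smult A = smult T" by (simp_all add: A_def)
  have "cring A"
  proof (rule cringI)
    show "abelian_group A"
    proof (rule abelian_groupI)
      fix x assume "x \<in> carrier A"
      then show "\<exists>y\<in>carrier A. y +[A] x = 0[A]"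
        using Wneg Wc by (intro bexI[of _ "\<ominus>\<^bsub>T\<^esub> x"]) (simp_all add: As T.l_neg)
    qed (simp_all add: As Wadd Wzero Wc T.a_assoc, simp_all add: Wc T.a_comm)
    show "comm_monoid A"
      by (rule comm_monoidI) (simp_all add: As Wmult Wone Wc T.m_assoc, simp_all add: Wc T.m_comm)
  qed (simp_all add: As Wc T.l_distr)
  then have "algebra K A"
    by (intro algebraI) (simp_all add: As K.is_cring Wsmult Wc TM.smult_l_distr TM.smult_r_distr TM.smult_assoc1 AAlg_smult_assoc[OF T'])
  moreover have "carrier A \<prec> (UNIV :: 'u set)"
    using AAlgD(6)[OF T'] Wc lesspoll_trans1[OF subset_imp_lepoll] by (metis As(1) subsetI)
  ultimately have A: "A \<in> CAlg K" by (simp add: CAlg_def)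
  note A' = CAlg_AAlg[OF A]
  define j where "j = (\<lambda>x\<in>W. x)"
  have j: "j \<in> alg_hom K A T"
    by (rule alg_homI) (auto simp: j_def As Wc Wadd Wmult Wone Wsmult)
  have jinj: "inj_on j (carrier A)" by (auto simp: j_def As inj_on_def)
  note jl = alg_homD(7)[OF j]
  define J where "J R = tens_map K A R T R j id" for R
  have Jf: "J R z \<in> carrier (tens K T R)" if "R \<in> CAlg K" "z \<in> carrier (tens K A R)" for R z
    unfolding J_def by (rule tens_map_closed[OF A' CAlg_AAlg[OF that(1)] T' CAlg_AAlg[OF that(1)] jl lin_id(1) that(2)])
  have Jadd: "J R (y +[tens K A R] z) = J R y +[tens K T R] J R z"
    if "R \<in> CAlg K" "y \<in> carrier (tens K A R)" "z \<in> carrier (tens K A R)" for R y z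
    unfolding J_def by (rule tens_map_add[OF A' CAlg_AAlg[OF that(1)] T' CAlg_AAlg[OF that(1)] jl lin_id(1) that(2,3)])
  have Jpt: "J R (pt A R a r) = pt T R a r" if "R \<in> CAlg K" "a \<in> W" "r \<in> carrier R" for R a r
    unfolding J_def using that tens_map_pt[OF A' CAlg_AAlg[OF that(1)] T' CAlg_AAlg[OF that(1)] jl lin_id(1), of a r]
    by (simp add: As j_def)
  have Jrh: "J R \<in> ring_hom (tens K A R) (tens K T R)" if "R \<in> CAlg K" for R
    unfolding J_def
    by (rule tens_map_ring_hom[OF A' CAlg_AAlg[OF that(1)] T' CAlg_AAlg[OF that(1)] jl lin_id(1) alg_homD(8)[OF j] id_ring_hom])
  have Jinj: "y = z" if "R \<in> CAlg K" "y \<in> carrier (tens K A R)" "z \<in> carrier (tens K A R)" "J R y = J R z" for R y z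
    using tens_map_inj[OF A' CAlg_AAlg[OF that(1)] T' jl jinj] that unfolding J_def by (auto simp: inj_on_def)
  \<comment> \<open>All values of \<phi> lie in \<open>W \<otimes> R\<close>: contracting \<phi>
    with a functional that kills \<open>W\<close> gives a form on \<open>B\<close> that is zero over
    \<open>K\<close>, hence zero everywhere by \<open>reflexive_vanish\<close>.\<close>
  have tsp: "\<phi> R b \<in> tspan T R W" if R: "R \<in> CAlg K" and b: "b \<in> B $ R" for R b
  proof (rule detect[OF T' CAlg_AAlg[OF R] T' lin_id(2) _ Wsub mc[OF R b]])
    show "inj_on (\<lambda>x. x) (carrier T)" by simp
    fix e assume e: "TM.functional e" and eW: "\<forall>w\<in>W. e w = 0[K]"
    define w where "w = nt_restrict K B KA (\<lambda>R f b. slant T R e (\<phi> R b))"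
    have w: "w \<in> dual_on K B KA"
      unfolding w_def
      by (rule nt_restrict_dual_on[OF modB KA_CAlg])
        (simp_all add: m(3-5) mc functional_slant[OF T' CAlg_AAlg e] slant_nat[OF T _ _ _ e] slant_pt_mult[OF T _ e])
    have "w (KA, idm KA) b = 0[K]" if b: "b \<in> B $ KA" for b
    proof -
      obtain t where t: "t \<in> carrier T" "\<phi> KA b = inl T KA t" using tens_KA[OF T' mc[OF KA_CAlg b]] by blast
      then have "t \<in> W" using WI b by metis
      then show ?thesis
        using t eW b idm_alg_hom[OF KA_AAlg] KA_CAlg
        by (simp add: w_def inl_apply functional_slant[OF T' KA_AAlg e])
    qed
    from reflexive_vanish[OF rB w this R b] R b unit_hom_alg_hom[OF CAlg_AAlg[OF R]]
    show "slant T R (\<lambda>x. e x) (\<phi> R b) = 0[R]" by (simp add: w_def)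
  qed
  have Jsurj: "\<exists>y\<in>carrier (tens K A R). z = J R y" if R: "R \<in> CAlg K" and z: "z \<in> tspan T R W" for R z
    using z
  proof (induction rule: tspan.induct)
    case (pt w s)
    then show ?case using R pt_closed[OF A' CAlg_AAlg[OF R]] Jpt[OF R] by (metis As(1))
  next
    case (add y z)
    then show ?case using R Jadd[OF R] AAlg_closed(1)[OF tens_AAlg[OF A' CAlg_AAlg[OF R]]] by metis
  qed
  \<comment> \<open>The factorisation of \<phi> through \<open>J\<close>. Since \<open>J\<close> is
    injective by \<open>tens_map_inj\<close>, every identity for \<open>p\<close> is inherited from
    \<phi>.\<close>
  define p where "p = (\<lambda>R\<in>CAlg K. \<lambda>b\<in>B $ R. SOME y. y \<in> carrier (tens K A R) \<and> \<phi> R b = J R y)"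
  have p: "p R b \<in> carrier (tens K A R)" "J R (p R b) = \<phi> R b" if R: "R \<in> CAlg K" and b: "b \<in> B $ R" for R b
  proof -
    have "\<exists>y. y \<in> carrier (tens K A R) \<and> \<phi> R b = J R y" using Jsurj[OF R tsp[OF R b]] by blast
    from someI_ex[OF this] R b show "p R b \<in> carrier (tens K A R)" "J R (p R b) = \<phi> R b" by (simp_all add: p_def)
  qed
  note tcl = AAlg_closed[OF tens_AAlg[OF A' CAlg_AAlg]]
  have rB: "ring (Ob B R)" if "R \<in> CAlg K" for R by (rule alg_functorD(4)[OF B that])
  have p1: "p R 1[Ob B R] = 1[tens K A R]" if R: "R \<in> CAlg K" for R
  proof -
    have 1: "1[Ob B R] \<in> B $ R" by (rule ring.ring_simprules(6)[OF rB[OF R]])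
    show ?thesis
      by (rule Jinj[OF R p(1)[OF R 1] tcl(3)[OF R]])
        (simp only: p(2)[OF R 1] m(7)[OF R] ring_hom_one[OF Jrh[OF R]] qc_simps)
  qed
  have padd: "p R (x +[Ob B R] y) = p R x +[tens K A R] p R y"
    if R: "R \<in> CAlg K" and x: "x \<in> B $ R" and y: "y \<in> B $ R" for R x y
  proof -
    note xy = cB(1)[OF R x y]
    show ?thesis
      by (rule Jinj[OF R p(1)[OF R xy] tcl(1)[OF R p(1)[OF R x] p(1)[OF R y]]])
        (simp only: p(2)[OF R xy] m(3)[OF R x y] Jadd[OF R p(1)[OF R x] p(1)[OF R y]] p(2)[OF R x] p(2)[OF R y] qc_simps)
  qed
  have pmult: "p R (x *[Ob B R] y) = p R x *[tens K A R] p R y"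
    if R: "R \<in> CAlg K" and x: "x \<in> B $ R" and y: "y \<in> B $ R" for R x y
  proof -
    note xy = ring.ring_simprules(5)[OF rB[OF R] x y]
    show ?thesis
      by (rule Jinj[OF R p(1)[OF R xy] tcl(2)[OF R p(1)[OF R x] p(1)[OF R y]]])
        (simp only: p(2)[OF R xy] m(6)[OF R x y] ring_hom_mult[OF Jrh[OF R] p(1)[OF R x] p(1)[OF R y]]
          p(2)[OF R x] p(2)[OF R y] qc_simps)
  qed
  have psmult: "p R (r \<cdot>[Ob B R] x) = pt A R 1[A] r *[tens K A R] p R x"
    if R: "R \<in> CAlg K" and x: "x \<in> B $ R" and r: "r \<in> carrier R" for R x r
  proof -
    note rx = cB(2)[OF R r x] and c = pt_closed[OF A' CAlg_AAlg[OF R] AAlg_closed(3)[OF A'] r]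
    show ?thesis
      by (rule Jinj[OF R p(1)[OF R rx] tcl(2)[OF R c p(1)[OF R x]]])
        (simp only: p(2)[OF R rx] m(4)[OF R r x] ring_hom_mult[OF Jrh[OF R] c[unfolded As(4)] p(1)[OF R x]] As(4) Jpt[OF R Wone r]
          p(2)[OF R x] qc_simps)
  qed
  have Jnat: "J R' (tens_map K A R A R' id h z) = tens_map K T R T R' id h (J R z)"
    if R: "R \<in> CAlg K" and R': "R' \<in> CAlg K" and h: "h \<in> alg_hom K R R'" and z: "z \<in> carrier (tens K A R)" for R R' h z
  proof -
    note hl = alg_homD(7)[OF h] and r = CAlg_AAlg[OF R] CAlg_AAlg[OF R']
    note i = lin_id(1)
    note mA = tens_map_add[OF A' r(1) A' r(2) i hl] tens_map_id_pt[OF A' r(1) r(2) hl] tens_map_closed[OF A' r(1) A' r(2) i hl]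
    note mT = tens_map_add[OF T' r(1) T' r(2) i hl] tens_map_id_pt[OF T' r(1) r(2) hl]
    show ?thesis
    proof (rule tens_hom_eqI[OF A' r(1) z, where P = "tens K T R'"])
      fix a s assume as: "a \<in> carrier A" "s \<in> carrier R"
      have aW: "a \<in> W" "a \<in> carrier T" using as Wc by (simp_all add: As)
      have "J R' (tens_map K A R A R' id h (pt A R a s)) = J R' (pt A R' a (h s))"
        by (simp only: mA(2)[OF as])
      also have "\<dots> = pt T R' a (h s)" using aW as alg_homD(1)[OF h] by (simp add: Jpt[OF R'])
      also have "\<dots> = tens_map K T R T R' id h (pt T R a s)" by (simp only: mT(2)[OF aW(2) as(2)])
      also have "\<dots> = tens_map K T R T R' id h (J R (pt A R a s))" using aW as by (simp only: Jpt[OF R])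
      finally show "J R' (tens_map K A R A R' id h (pt A R a s)) = tens_map K T R T R' id h (J R (pt A R a s))" .
    qed (simp_all only: mA mT Jadd[OF R] Jadd[OF R'] Jf[OF R])
  qed
  have pnat: "p R' (Ar B R R' h x) = tens_map K A R A R' id h (p R x)"
    if R: "R \<in> CAlg K" and R': "R' \<in> CAlg K" and h: "h \<in> alg_hom K R R'" and x: "x \<in> B $ R" for R R' h x
  proof (rule Jinj[OF R'])
    have hx: "Ar B R R' h x \<in> B $ R'" by (rule sB(1)[OF R R' h x])
    show "p R' (Ar B R R' h x) \<in> carrier (tens K A R')" using p(1)[OF R' hx] .
    show "tens_map K A R A R' id h (p R x) \<in> carrier (tens K A R')"
      by (rule tens_map_closed[OF A' CAlg_AAlg[OF R] A' CAlg_AAlg[OF R'] lin_id(1) alg_homD(7)[OF h] p(1)[OF R x]])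
    show "J R' (p R' (Ar B R R' h x)) = J R' (tens_map K A R A R' id h (p R x))"
      using m(5)[OF R R' h x] unfolding p(2)[OF R' hx] Jnat[OF R R' h p(1)[OF R x]] p(2)[OF R x] by simp
  qed
  have pAlg: "p \<in> Alg_mor K B (qc K A)"
  proof (intro Alg_morI Mod_morI)
    have "(\<lambda>S\<in>CAlg K. \<lambda>x\<in>B $ S. p S x) \<in> Mor K B (qc K A)"
      by (rule MorI) (simp_all only: qc_simps p pnat alg_functorD(2)[OF B])
    moreover have "(\<lambda>S\<in>CAlg K. \<lambda>x\<in>B $ S. p S x) = p" by (auto simp: p_def fun_eq_iff)
    ultimately show "p \<in> Mor K B (qc K A)" by simp
  qed (simp_all add: padd psmult pmult p1)
  \<comment> \<open>Over \<open>KA\<close> every element of \<open>W\<close> is attained by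
    construction; a pure tensor over \<open>R\<close> is the base change of such an element, times a
    scalar of \<open>R\<close>.\<close>
  have psurj: "\<exists>b\<in>B $ R. p R b = z" if R: "R \<in> CAlg K" and z: "z \<in> carrier (tens K A R)" for R z
    using A' CAlg_AAlg[OF R] z
  proof (induction rule: tens_induct)
    case (pure a r)
    then obtain b where b: "b \<in> B $ KA" "inl T KA a = \<phi> KA b" using WE by (auto simp: As)
    have aT: "a \<in> carrier T" "a \<in> W" using pure Wc by (simp_all add: As)
    note R' = CAlg_AAlg[OF R]
    note u = unit_hom_alg_hom[OF R']
    interpret R: ring R using R by (rule CAlgD)
    have ub: "Ar B KA R (unit_hom R) b \<in> B $ R" by (rule sB(1)[OF KA_CAlg R u b(1)])
    have "\<phi> R (Ar B KA R (unit_hom R) b) = tens_map K T KA T R id (unit_hom R) (pt T KA a 1[K])"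
      using m(5)[OF KA_CAlg R u b(1)] b(2) aT by (simp add: inl_apply)
    also have "\<dots> = pt T R a 1[R]"
      using tens_map_id_pt[OF T' KA_AAlg R' alg_homD(7)[OF u] aT(1), of "1[K]"] alg_homD(5)[OF u]
      by simp
    finally have "\<phi> R (r \<cdot>[Ob B R] Ar B KA R (unit_hom R) b) = pt T R a r"
      using m(4)[OF R pure(2) ub] aT pure(2) by (simp add: pt_mult[OF T' R'])
    then have "p R (r \<cdot>[Ob B R] Ar B KA R (unit_hom R) b) = pt A R a r"
      by (intro Jinj[OF R p(1)[OF R cB(2)[OF R pure(2) ub]] pt_closed[OF A' R' pure(1,2)]])
        (simp only: p(2)[OF R cB(2)[OF R pure(2) ub]] Jpt[OF R aT(2) pure(2)])
    then show ?case using cB(2)[OF R pure(2) ub] by blast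
  next
    case (add y z)
    then obtain b b' where "b \<in> B $ R" "p R b = y" "b' \<in> B $ R" "p R b' = z" by blast
    then show ?case using padd[OF R, of b b'] cB(1)[OF R, of b b'] by (intro bexI[of _ "b +[Ob B R] b'"]) simp_all
  qed
  have "p R ` (B $ R) = carrier (tens K A R)" if R: "R \<in> CAlg K" for R
    using p(1)[OF R] psurj[OF R] by blast
  then have "(A, p) \<in> qc_quotients K B"
    using pAlg AAlgD(6)[OF A'] AAlgD(1)[OF A'] by (simp add: qc_quotients_def)
  moreover have "\<phi> R b = tens_map K A R T R j id (p R b)" if "R \<in> CAlg K" "b \<in> B $ R" for R b
    using p(2)[OF that] by (simp only: J_def)
  ultimately show ?thesis using A j jinj by blast
qed

end

section \<open>Changing either factor of a tensor product\<close>

context base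
begin

interpretation K: field K by (rule K_field)

definition tml :: "'u alg => 'u alg => 'u alg => ('u => 'u) => 'u => 'u" where
  "tml A S A' j = tens_map K A S A' S j id"

definition tmr :: "'u alg => 'u alg => 'u alg => ('u => 'u) => 'u => 'u" where
  "tmr A S T f = tens_map K A S A T id f"

lemma tml_facts:
  assumes "A \<in> AAlg K" "S \<in> AAlg K" "A' \<in> AAlg K" "j \<in> alg_hom K A A'"
  shows "z \<in> carrier (tens K A S) ==> tml A S A' j z \<in> carrier (tens K A' S)"
    "y \<in> carrier (tens K A S) ==> z \<in> carrier (tens K A S) ==>
    tml A S A' j (y +[tens K A S] z) = tml A S A' j y +[tens K A' S] tml A S A' j z"
    "a \<in> carrier A ==> s \<in> carrier S ==> tml A S A' j (pt A S a s) = pt A' S (j a) s"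
    "tml A S A' j \<in> ring_hom (tens K A S) (tens K A' S)"
  unfolding tml_def using tens_map_pt[OF assms(1,2,3,2) alg_homD(7)[OF assms(4)] lin_id(1)]
    tens_map_closed[OF assms(1,2,3,2) alg_homD(7)[OF assms(4)] lin_id(1)]
    tens_map_add[OF assms(1,2,3,2) alg_homD(7)[OF assms(4)] lin_id(1)]
    tens_map_ring_hom[OF assms(1,2,3,2) alg_homD(7)[OF assms(4)] lin_id(1) alg_homD(8)[OF assms(4)] id_ring_hom]
  by simp_all

lemma tmr_facts:
  assumes "A \<in> AAlg K" "S \<in> AAlg K" "T \<in> AAlg K" "f \<in> alg_hom K S T"
  shows "z \<in> carrier (tens K A S) ==> tmr A S T f z \<in> carrier (tens K A T)"
    "y \<in> carrier (tens K A S) ==> z \<in> carrier (tens K A S) ==>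
    tmr A S T f (y +[tens K A S] z) = tmr A S T f y +[tens K A T] tmr A S T f z"
    "a \<in> carrier A ==> s \<in> carrier S ==> tmr A S T f (pt A S a s) = pt A T a (f s)"
    "tmr A S T f \<in> ring_hom (tens K A S) (tens K A T)"
  unfolding tmr_def using tens_map_id_pt[OF assms(1-3) alg_homD(7)[OF assms(4)]]
    tens_map_closed[OF assms(1,2,1,3) lin_id(1) alg_homD(7)[OF assms(4)]]
    tens_map_add[OF assms(1,2,1,3) lin_id(1) alg_homD(7)[OF assms(4)]]
    tens_map_ring_hom[OF assms(1,2,1,3) lin_id(1) alg_homD(7)[OF assms(4)] id_ring_hom alg_homD(8)[OF assms(4)]]
  by simp_all

lemma cop_facts:
  assumes "A \<in> CAlg K" "S \<in> CAlg K" "D \<in> CAlg K" "f \<in> alg_hom K A D" "g \<in> alg_hom K S D"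
  shows "cop A S D f g \<in> alg_hom K (tens K A S) D"
    "z \<in> carrier (tens K A S) ==> cop A S D f g z \<in> carrier D"
    "y \<in> carrier (tens K A S) ==> z \<in> carrier (tens K A S) ==>
    cop A S D f g (y +[tens K A S] z) = cop A S D f g y +[D] cop A S D f g z"
    "a \<in> carrier A ==> s \<in> carrier S ==> cop A S D f g (pt A S a s) = f a *[D] g s"
    "cop A S D f g o[A] inl A S = f"
    "cop A S D f g o[S] inr A S = g"
  using cop_alg_hom[OF assms] cop_pt[OF assms] cop_closed[OF assms] cop_add[OF assms] cop_inl[OF assms] cop_inr[OF assms]
  by simp_all

lemma act_facts:
  assumes "S \<in> CAlg K" "T \<in> CAlg K" "f \<in> alg_hom K S T"
  shows "act S T f \<in> alg_hom K (tens K S T) T"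
    "z \<in> carrier (tens K S T) ==> act S T f z \<in> carrier T"
    "y \<in> carrier (tens K S T) ==> z \<in> carrier (tens K S T) ==>
    act S T f (y +[tens K S T] z) = act S T f y +[T] act S T f z"
    "s \<in> carrier S ==> t \<in> carrier T ==> act S T f (pt S T s t) = f s *[T] t"
  using alg_homD[OF act_alg_hom[OF assms]] act_pt[OF assms] act_alg_hom[OF assms] by simp_all

lemma inlr:
  assumes "A \<in> CAlg K" "S \<in> CAlg K"
  shows "tens K A S \<in> CAlg K" "inl A S \<in> alg_hom K A (tens K A S)" "inr A S \<in> alg_hom K S (tens K A S)"
  using assms by (simp_all add: tens_CAlg inl_alg_hom inr_alg_hom CAlg_AAlg)

lemma compose_CAlg:
  "A \<in> CAlg K ==> f \<in> alg_hom K A B ==> g \<in> alg_hom K B C ==> (g o[A] f) \<in> alg_hom K A C"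
  by (rule compose_alg_hom[OF _ _ CAlg_AAlg])

lemma act_tml:
  assumes A: "A \<in> CAlg K" and T: "T \<in> CAlg K" and V: "V \<in> CAlg K" and j: "j \<in> alg_hom K A T" and f: "f \<in> alg_hom K T V"
    and z: "z \<in> carrier (tens K A V)"
  shows "act T V f (tml A V T j z) = act A V (f o[A] j) z"
  by (rule tens_hom_eqI[OF CAlg_AAlg[OF A] CAlg_AAlg[OF V] z, where P = V])
    (simp_all add: tml_facts[OF CAlg_AAlg[OF A] CAlg_AAlg[OF V] CAlg_AAlg[OF T] j] act_facts[OF T V f]
      act_facts[OF A V compose_CAlg[OF A j f]] alg_homD[OF j] compose_eq)

lemma act_tmr:
  assumes A: "A \<in> CAlg K" and S: "S \<in> CAlg K" and T: "T \<in> CAlg K" and j: "j \<in> alg_hom K A T" and f: "f \<in> alg_hom K S T"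
    and z: "z \<in> carrier (tens K A S)"
  shows "act A T j (tmr A S T f z) = cop A S T j f z"
  by (rule tens_hom_eqI[OF CAlg_AAlg[OF A] CAlg_AAlg[OF S] z, where P = T])
    (simp_all add: tmr_facts[OF CAlg_AAlg[OF A] CAlg_AAlg[OF S] CAlg_AAlg[OF T] f] act_facts[OF A T j]
      cop_facts[OF A S T j f] alg_homD[OF f])

lemma act_inl_tmr_inr:
  assumes A: "A \<in> CAlg K" and T: "T \<in> CAlg K" and R: "R \<in> CAlg K" and j: "j \<in> alg_hom K A T"
    and z: "z \<in> carrier (tens K A R)"
  shows "act A (tens K T R) (inl T R o[A] j) (tmr A R (tens K T R) (inr T R) z) = tml A R T j z"
proof -
  note i = inlr[OF T R]
  note A' = CAlg_AAlg[OF A] and T' = CAlg_AAlg[OF T] and R' = CAlg_AAlg[OF R]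
  note ij = compose_CAlg[OF A j i(2)]
  show ?thesis
    by (rule tens_hom_eqI[OF A' R' z, where P = "tens K T R"])
      (simp_all add: tmr_facts[OF A' R' CAlg_AAlg[OF i(1)] i(3)] tml_facts[OF A' R' T' j]
        act_facts[OF A i(1) ij] alg_homD[OF i(3)] alg_homD[OF j] compose_eq,
       simp add: inl_apply inr_apply alg_homD[OF j] pt_one_mult[OF T' R'])
qed

lemma cop_inl_inr:
  assumes A: "A \<in> CAlg K" and S: "S \<in> CAlg K" and z: "z \<in> carrier (tens K A S)"
  shows "cop A S (tens K A S) (inl A S) (inr A S) z = z"
proof -
  note i = inlr[OF A S]
  have "cop A S (tens K A S) (inl A S) (inr A S) z = (\<lambda>z. z) z"
    by (rule tens_hom_eqI[OF CAlg_AAlg[OF A] CAlg_AAlg[OF S] z, where P = "tens K A S"])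
      (simp_all add: cop_facts[OF A S i] inl_apply inr_apply pt_one_mult[OF CAlg_AAlg[OF A] CAlg_AAlg[OF S]])
  then show ?thesis .
qed

lemma cop_tml:
  assumes A: "A \<in> CAlg K" and S: "S \<in> CAlg K" and A': "A' \<in> CAlg K" and T: "T \<in> CAlg K" and h: "h \<in> alg_hom K A A'"
    and j: "j \<in> alg_hom K A' T" and f: "f \<in> alg_hom K S T" and z: "z \<in> carrier (tens K A S)"
  shows "cop A' S T j f (tml A S A' h z) = cop A S T (j o[A] h) f z"
  by (rule tens_hom_eqI[OF CAlg_AAlg[OF A] CAlg_AAlg[OF S] z, where P = T])
    (simp_all add: tml_facts[OF CAlg_AAlg[OF A] CAlg_AAlg[OF S] CAlg_AAlg[OF A'] h] cop_facts[OF A' S T j f]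
      cop_facts[OF A S T compose_CAlg[OF A h j] f] alg_homD[OF h] compose_eq)

lemma cop_compose:
  assumes A: "A \<in> CAlg K" and S: "S \<in> CAlg K" and T: "T \<in> CAlg K" and V: "V \<in> CAlg K" and j: "j \<in> alg_hom K A T"
    and f: "f \<in> alg_hom K S T" and g: "g \<in> alg_hom K T V" and z: "z \<in> carrier (tens K A S)"
  shows "cop A S V (g o[A] j) (g o[S] f) z = g (cop A S T j f z)"
  by (rule tens_hom_eqI[OF CAlg_AAlg[OF A] CAlg_AAlg[OF S] z, where P = V])
    (simp_all add: cop_facts[OF A S T j f] cop_facts[OF A S V compose_CAlg[OF A j g] compose_CAlg[OF S f g]]
      alg_homD[OF j] alg_homD[OF f] alg_homD[OF g] compose_eq)

lemma tml_inj:
  assumes "A \<in> CAlg K" "S \<in> CAlg K" "T \<in> CAlg K" "j \<in> alg_hom K A T" "inj_on j (carrier A)"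
  shows "inj_on (tml A S T j) (carrier (tens K A S))"
  unfolding tml_def using assms by (intro tens_map_inj CAlg_AAlg) (auto dest: alg_homD)

lemma qc_Alg_mor:
  assumes A: "A \<in> CAlg K" and A': "A' \<in> CAlg K" and h: "h \<in> alg_hom K A A'"
  shows "(\<lambda>T\<in>CAlg K. \<lambda>z\<in>(qc K A) $ T. tml A T A' h z) \<in> Alg_mor K (qc K A) (qc K A')"
proof -
  note AA = CAlg_AAlg[OF A] and AA' = CAlg_AAlg[OF A']
  note t = tml_facts[OF AA CAlg_AAlg AA' h]
  show ?thesis
  proof (intro Alg_morI Mod_morI MorI)
    fix S T f z assume S: "S \<in> CAlg K" and T: "T \<in> CAlg K" and f: "f \<in> alg_hom K S T" and z: "z \<in> qc K A $ S"
    note r = tmr_facts[OF AA CAlg_AAlg[OF S] CAlg_AAlg[OF T] f] tmr_facts[OF AA' CAlg_AAlg[OF S] CAlg_AAlg[OF T] f]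
    have "tml A T A' h (tmr A S T f z) = tmr A' S T f (tml A S A' h z)"
      by (rule tens_hom_eqI[OF AA CAlg_AAlg[OF S] z[unfolded qc_simps], where P = "tens K A' T"])
        (simp_all add: t[OF S] t[OF T] r alg_homD[OF f] alg_homD[OF h])
    then show "tml A T A' h (Ar (qc K A) S T f z) = Ar (qc K A') S T f (tml A S A' h z)" by (simp only: qc_simps tmr_def)
  next
    show "set_functor K (qc K A)" by (rule mod_functorD(1)[OF mod_functor_qc[OF AA]])
    fix S assume S: "S \<in> CAlg K"
    note ring_simps = AAlg_closed[OF tens_AAlg[OF AA CAlg_AAlg[OF S]]]
    fix z assume z: "z \<in> qc K A $ S"
    show "tml A S A' h z \<in> qc K A' $ S" using t[OF S] z by simp
    show "(\<lambda>T\<in>CAlg K. \<lambda>z\<in>(qc K A) $ T. tml A T A' h z) S (s \<cdot>[Ob (qc K A) S] z) =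
    s \<cdot>[Ob (qc K A') S] (\<lambda>T\<in>CAlg K. \<lambda>z\<in>(qc K A) $ T. tml A T A' h z) S z" if s: "s \<in> carrier S" for s
      using S z s ring_simps pt_closed[OF AA CAlg_AAlg[OF S] AAlg_closed(3)[OF AA] s] ring_hom_mult[OF t(4)[OF S]]
      by (simp add: t[OF S] AAlg_closed[OF AA] alg_homD(5)[OF h])
  qed (use AAlg_closed[OF tens_AAlg[OF AA CAlg_AAlg]] in \<open>simp_all add: t ring_hom_mult[OF t(4)] ring_hom_one[OF t(4)]\<close>)
qed

end

section \<open>Points and characters\<close>

text \<open>A common interface for a functor of points and an algebra of functions. The last two
  assumptions say that \<open>X\<close> is the functor of characters of \<open>B\<close>; that
  \<open>B\<close> is all functions on \<open>X\<close> is added in \<open>pairing\<close>. Separate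
  types for points and functions allow both instantiations.\<close>

locale char_pairing = base K for K :: "'u ring" +
  fixes X :: "('u, 'x, ('x, 'z) partial_object_scheme) func" and B :: "('u, 'b) mfunc"
    and ev :: "'u alg => 'x => 'b => 'u"
  assumes X: "set_functor K X" and B: "alg_functor K B" and rB: "reflexive K B"
    and B_comm: "\<And>S. S \<in> CAlg K ==> cring (Ob B S)"
    and ev_closed: "\<And>S x b. S \<in> CAlg K ==> x \<in> X $ S ==> b \<in> B $ S ==> ev S x b \<in> carrier S"
    and ev_add: "\<And>S x b c. S \<in> CAlg K ==> x \<in> X $ S ==> b \<in> B $ S ==> c \<in> B $ S ==>
    ev S x (b +[Ob B S] c) = ev S x b +[S] ev S x c"
    and ev_mult: "\<And>S x b c. S \<in> CAlg K ==> x \<in> X $ S ==> b \<in> B $ S ==> c \<in> B $ S ==>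
    ev S x (b *[Ob B S] c) = ev S x b *[S] ev S x c"
    and ev_smult: "\<And>S x b s. S \<in> CAlg K ==> x \<in> X $ S ==> b \<in> B $ S ==> s \<in> carrier S ==>
    ev S x (s \<cdot>[Ob B S] b) = s *[S] ev S x b"
    and ev_one: "\<And>S x. S \<in> CAlg K ==> x \<in> X $ S ==> ev S x 1[Ob B S] = 1[S]"
    and ev_nat: "\<And>S T f x b. S \<in> CAlg K ==> T \<in> CAlg K ==> f \<in> alg_hom K S T ==> x \<in> X $ S ==>
    b \<in> B $ S ==> ev T (Ar X S T f x) (Ar B S T f b) = f (ev S x b)"
    and char_complete: "\<And>S \<chi>. S \<in> CAlg K ==> \<chi> \<in> chars K B S ==> \<exists>x\<in>X $ S.
    \<forall>T f b. T \<in> CAlg K --> f \<in> alg_hom K S T --> b \<in> B $ T --> \<chi> (T, f) b = ev T (Ar X S T f x) b"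
    and char_sep: "\<And>S x y. S \<in> CAlg K ==> x \<in> X $ S ==> y \<in> X $ S ==>
    (\<And>T f b. T \<in> CAlg K ==> f \<in> alg_hom K S T ==> b \<in> B $ T ==>
      ev T (Ar X S T f x) b = ev T (Ar X S T f y) b) ==> x = y"
begin

interpretation K: field K by (rule K_field)

lemmas modB = alg_functorD(1)[OF B] and sX = set_functorD[OF X] and sB = set_functorD[OF alg_functorD(2)[OF B]]
lemmas ringB = alg_functorD(4)[OF B]
lemmas clB = mod_functor_closed[OF modB]

lemma multB_closed:
  "S \<in> CAlg K ==> b \<in> B $ S ==> c \<in> B $ S ==> b *[Ob B S] c \<in> B $ S"
  "S \<in> CAlg K ==> 1[Ob B S] \<in> B $ S"
  using ring.ring_simprules(5,6)[OF ringB] by auto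

text \<open>Points as elements of the dual of \<open>B\<close>: the Dirac functionals.\<close>

definition hat :: "'u alg => 'x => ('u, 'b) nt" where
  "hat S x = nt_restrict K B S (\<lambda>T f b. ev T (Ar X S T f x) b)"

lemma hat_apply:
  "T \<in> CAlg K ==> f \<in> alg_hom K S T ==> b \<in> B $ T ==> hat S x (T, f) b = ev T (Ar X S T f x) b"
  by (simp add: hat_def)

lemma hat_idm:
  "S \<in> CAlg K ==> x \<in> X $ S ==> b \<in> B $ S ==> hat S x (S, idm S) b = ev S x b"
  by (simp add: hat_apply idm_alg_hom CAlg_AAlg sX)

lemma hat_chars:
  assumes S: "S \<in> CAlg K" and x: "x \<in> X $ S"
  shows "hat S x \<in> chars K B S"
proof (rule charsI)
  show "hat S x \<in> dual_on K B S"
    unfolding hat_def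
  proof (rule nt_restrict_dual_on[OF modB S])
    fix T f V g b assume *: "T \<in> CAlg K" "f \<in> alg_hom K S T" "V \<in> CAlg K" "g \<in> alg_hom K T V" "b \<in> B $ T"
    show "ev V (Ar X S V (g o[S] f) x) (Ar B T V g b) = g (ev T (Ar X S T f x) b)"
      unfolding sX(3)[OF S *(1,3,2,4) x] by (rule ev_nat[OF *(1,3,4) sX(1)[OF S *(1,2) x] *(5)])
  qed (simp_all add: sX(1)[OF S _ _ x] ev_closed ev_add ev_smult)
qed (simp_all add: hat_apply multB_closed sX(1)[OF S _ _ x] ev_mult ev_one)

lemmas hat_dual = charsD(1)[OF hat_chars]

lemma hat_inj: "S \<in> CAlg K ==> x \<in> X $ S ==> y \<in> X $ S ==> hat S x = hat S y ==> x = y"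
  by (rule char_sep[of S]) (assumption | metis hat_apply)+

lemma hat_Ar:
  assumes S: "S \<in> CAlg K" and T: "T \<in> CAlg K" and f: "f \<in> alg_hom K S T" and x: "x \<in> X $ S"
  shows "Ar (dual K B) S T f (hat S x) = hat T (Ar X S T f x)"
  by (rule dual_on_eqI[OF dual_on_Ar[OF modB S T f hat_dual[OF S x]] hat_dual[OF T sX(1)[OF S T f x]]])
    (simp add: dual_apply hat_apply compose_CAlg[OF S f] sX(3)[OF S T _ f _ x])

lemma chars_hat:
  assumes S: "S \<in> CAlg K" and \<chi>: "\<chi> \<in> chars K B S"
  shows "\<exists>x\<in>X $ S. \<chi> = hat S x"
proof -
  obtain x where x: "x \<in> X $ S" "\<forall>T f b. T \<in> CAlg K --> f \<in> alg_hom K S T --> b \<in> B $ T -->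
     \<chi> (T, f) b = ev T (Ar X S T f x) b" using char_complete[OF S \<chi>] by blast
  have "\<chi> = hat S x"
    by (rule dual_on_eqI[OF charsD(1)[OF \<chi>] hat_dual[OF S x(1)]]) (simp add: x hat_apply)
  then show ?thesis using x by blast
qed

text \<open>Two identifications are composed: morphisms to \<open>qc K S\<close> are characters over
  \<open>S\<close>, and characters are points.\<close>

lemma mor_point:
  assumes S: "S \<in> CAlg K" and \<phi>: "\<phi> \<in> Alg_mor K B (qc K S)"
  shows "\<exists>x\<in>X $ S. \<forall>R b. R \<in> CAlg K --> b \<in> B $ R -->
    \<phi> R b = ev (tens K S R) (Ar X S (tens K S R) (inl S R) x) (Ar B R (tens K S R) (inr S R) b)"
proof -
  obtain x where x: "x \<in> X $ S" "nt_restrict K B S (\<lambda>T f a. act S T f (\<phi> T a)) = hat S x"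
    using chars_hat[OF S mor_char[OF B S \<phi>]] by blast
  show ?thesis
  proof (intro bexI[OF _ x(1)] allI impI)
    fix R b assume R: "R \<in> CAlg K" and b: "b \<in> B $ R"
    note i = inlr[OF S R]
    have b': "Ar B R (tens K S R) (inr S R) b \<in> B $ (tens K S R)" by (rule sB(1)[OF R i(1,3) b])
    show "\<phi> R b = ev (tens K S R) (Ar X S (tens K S R) (inl S R) x) (Ar B R (tens K S R) (inr S R) b)"
      unfolding hat_apply[OF i(1,2) b', symmetric] x(2)[symmetric] nt_restrict_apply[OF i(1,2) b']
      by (rule mor_char_mor[OF B S \<phi> R b, symmetric])
  qed
qed

text \<open>The algebra of a quotient is recovered from its values over \<open>KA\<close>, where it
  is an image of the commutative ring \<open>B(K)\<close>; injectivity of \<open>inl A KA\<close>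
  brings commutativity back to \<open>A\<close>.\<close>

lemma quotient_CAlg:
  assumes q: "(A, p) \<in> qc_quotients K B"
  shows "A \<in> CAlg K"
proof -
  have A: "A \<in> AAlg K" and p: "p \<in> Alg_mor K B (qc K A)"
    and surj: "p KA ` (B $ KA) = carrier (tens K A KA)"
    using q KA_CAlg by (auto simp: qc_quotients_def AAlg_def)
  note l = inl_alg_hom[OF A KA_AAlg]
  interpret A: ring A using A by (rule AAlgD)
  interpret BK: cring "Ob B KA" using B_comm KA_CAlg by simp
  have "a *[A] a' = a' *[A] a" if a: "a \<in> carrier A" "a' \<in> carrier A" for a a'
  proof (rule inj_onD[OF inl_KA_inj[OF A]])
    have "inl A KA a \<in> carrier (tens K A KA)" "inl A KA a' \<in> carrier (tens K A KA)"
      using a alg_homD(1)[OF l] by auto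
    then obtain b b' where b: "b \<in> B $ KA" "inl A KA a = p KA b" "b' \<in> B $ KA" "inl A KA a' = p KA b'"
      unfolding surj[symmetric] by blast
    show "inl A KA (a *[A] a') = inl A KA (a' *[A] a)"
      using Alg_morD(3)[OF p KA_CAlg b(1,3)] Alg_morD(3)[OF p KA_CAlg b(3,1)] BK.m_comm[OF b(1,3)] a
      by (simp add: alg_homD(3)[OF l] b)
  qed (use a in simp_all)
  then have "cring A" by unfold_locales
  then show ?thesis using A by (simp add: CAlg_iff)
qed

lemma quotient_mor: "(A, p) \<in> qc_quotients K B ==> p \<in> Alg_mor K B (qc K A)"
  by (auto simp: qc_quotients_def)

text \<open>The universal point over \<open>A\<close> of the quotient \<open>p\<close>, that is, the
  morphism \<open>p\<close> itself read as a point by \<open>mor_point\<close>.\<close>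

definition qpt :: "'u alg => ('u alg => 'b => 'u) => 'x" where
  "qpt A p = (SOME x. x \<in> X $ A \<and> (\<forall>R b. R \<in> CAlg K --> b \<in> B $ R -->
    p R b = ev (tens K A R) (Ar X A (tens K A R) (inl A R) x) (Ar B R (tens K A R) (inr A R) b)))"

lemma qpt:
  assumes q: "(A, p) \<in> qc_quotients K B"
  shows "qpt A p \<in> X $ A"
    "R \<in> CAlg K ==> b \<in> B $ R ==>
    p R b = ev (tens K A R) (Ar X A (tens K A R) (inl A R) (qpt A p)) (Ar B R (tens K A R) (inr A R) b)" (is "PROP ?A")
proof -
  have "\<exists>x. x \<in> X $ A \<and> (\<forall>R b. R \<in> CAlg K --> b \<in> B $ R -->
    p R b = ev (tens K A R) (Ar X A (tens K A R) (inl A R) x) (Ar B R (tens K A R) (inr A R) b))"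
    using mor_point[OF quotient_CAlg[OF q] quotient_mor[OF q]] by blast
  from someI_ex[OF this, folded qpt_def]
  show "qpt A p \<in> X $ A"
    "PROP ?A"
    by blast+
qed

lemma quotient_closed:
  "(A, p) \<in> qc_quotients K B ==> R \<in> CAlg K ==> b \<in> B $ R ==> p R b \<in> carrier (tens K A R)"
  using Mod_morD(2)[OF Alg_morD(1)[OF quotient_mor]] by fastforce

lemma quotient_nat:
  "(A, p) \<in> qc_quotients K B ==> R \<in> CAlg K ==> R' \<in> CAlg K ==> h \<in> alg_hom K R R' ==> b \<in> B $ R ==>
    p R' (Ar B R R' h b) = tmr A R R' h (p R b)"
  using Mod_morD(5)[OF Alg_morD(1)[OF quotient_mor]] by (simp add: tmr_def)

text \<open>The point and the element are both pushed forward from \<open>A \<otimes> V\<close>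
  along \<open>act A V j\<close>, so naturality of \<open>ev\<close> reduces to the universal point,
  where evaluation is \<open>p\<close>.\<close>

lemma ev_qpt:
  assumes q: "(A, p) \<in> qc_quotients K B" and V: "V \<in> CAlg K" and j: "j \<in> alg_hom K A V" and b: "b \<in> B $ V"
  shows "ev V (Ar X A V j (qpt A p)) b = act A V j (p V b)"
proof -
  note A = quotient_CAlg[OF q]
  note i = inlr[OF A V] and a = act_facts(1)[OF A V j]
  have X1: "Ar X A V j (qpt A p) = Ar X (tens K A V) V (act A V j) (Ar X A (tens K A V) (inl A V) (qpt A p))"
    using sX(3)[OF A i(1) V i(2) a qpt(1)[OF q]] act_inl[OF A V j] by simp
  have B1: "b = Ar B (tens K A V) V (act A V j) (Ar B V (tens K A V) (inr A V) b)"
    using sB(3)[OF V i(1) V i(3) a b] act_inr[OF A V j] sB(2)[OF V b] by simp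
  have "ev V (Ar X A V j (qpt A p)) b = ev V (Ar X (tens K A V) V (act A V j) (Ar X A (tens K A V) (inl A V) (qpt A p)))
    (Ar B (tens K A V) V (act A V j) (Ar B V (tens K A V) (inr A V) b))"
    using X1 B1 by simp
  also have "\<dots> = act A V j (p V b)"
    unfolding qpt(2)[OF q V b]
    by (rule ev_nat[OF i(1) V a sX(1)[OF A i(1,2) qpt(1)[OF q]] sB(1)[OF V i(1,3) b]])
  finally show ?thesis .
qed

lemma ev_qpt_tml:
  assumes q: "(A, p) \<in> qc_quotients K B" and T: "T \<in> CAlg K" and j: "j \<in> alg_hom K A T" and R: "R \<in> CAlg K"
    and b: "b \<in> B $ R"
  shows "ev (tens K T R) (Ar X T (tens K T R) (inl T R) (Ar X A T j (qpt A p))) (Ar B R (tens K T R) (inr T R) b)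
    = tml A R T j (p R b)"
proof -
  note A = quotient_CAlg[OF q]
  note i = inlr[OF T R]
  have "ev (tens K T R) (Ar X T (tens K T R) (inl T R) (Ar X A T j (qpt A p))) (Ar B R (tens K T R) (inr T R) b) =
    act A (tens K T R) (inl T R o[A] j) (p (tens K T R) (Ar B R (tens K T R) (inr T R) b))"
    using ev_qpt[OF q i(1) compose_CAlg[OF A j i(2)] sB(1)[OF R i(1,3) b]] sX(3)[OF A T i(1) j i(2) qpt(1)[OF q]] by simp
  also have "\<dots> = tml A R T j (p R b)"
    using act_inl_tmr_inr[OF A T R j quotient_closed[OF q R b]] quotient_nat[OF q R i(1,3) b] by simp
  finally show ?thesis .
qed

text \<open>\<open>image_quotient\<close> is applied to the morphism \<open>B -> qc K T\<close> of
  the point. From here on, statements about all points are tested on the universal points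
  \<open>qpt A p\<close>.\<close>

lemma factor:
  assumes T: "T \<in> CAlg K" and x: "x \<in> X $ T"
  shows "\<exists>A p j. (A, p) \<in> qc_quotients K B \<and> j \<in> alg_hom K A T \<and> inj_on j (carrier A) \<and> x = Ar X A T j (qpt A p)"
proof -
  define \<phi> where "\<phi> = (\<lambda>R\<in>CAlg K. \<lambda>b\<in>B $ R. hat T x (tens K T R, inl T R) (Ar B R (tens K T R) (inr T R) b))"
  have "\<phi> \<in> Alg_mor K B (qc K T)"
    unfolding \<phi>_def by (rule char_mor_Alg_mor[OF B T hat_chars[OF T x]])
  from image_quotient[OF rB B T this]
  obtain A p j where q: "(A, p) \<in> qc_quotients K B" and j: "j \<in> alg_hom K A T" "inj_on j (carrier A)"
    and \<phi>: "\<And>R b. R \<in> CAlg K ==> b \<in> B $ R ==> \<phi> R b = tml A R T j (p R b)"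
    unfolding tml_def by blast
  note A = quotient_CAlg[OF q]
  have "x = Ar X A T j (qpt A p)"
  proof (rule char_sep[OF T x sX(1)[OF A T j(1) qpt(1)[OF q]]])
    fix V f b assume V: "V \<in> CAlg K" and f: "f \<in> alg_hom K T V" and b: "b \<in> B $ V"
    have "ev V (Ar X T V f x) b = hat T x (V, f) b" by (simp add: hat_apply V f b)
    also have "\<dots> = act T V f (\<phi> V b)"
      using char_mor_char[OF B T hat_dual[OF T x] V f b] V b by (simp add: \<phi>_def)
    also have "\<dots> = act A V (f o[A] j) (p V b)"
      unfolding \<phi>[OF V b] by (rule act_tml[OF A T V j(1) f quotient_closed[OF q V b]])
    also have "\<dots> = ev V (Ar X A V (f o[A] j) (qpt A p)) b"
      by (rule ev_qpt[OF q V compose_CAlg[OF A j(1) f] b, symmetric])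
    finally show "ev V (Ar X T V f x) b = ev V (Ar X T V f (Ar X A T j (qpt A p))) b"
      by (simp add: sX(3)[OF A T V j(1) f qpt(1)[OF q]])
  qed
  then show ?thesis using q j by blast
qed

text \<open>An element of \<open>A\<close> lifts to a function defined over \<open>K\<close>; at the
  point of \<open>j\<close> this function takes the value \<open>j a\<close>, so \<open>j\<close>
  can be read off from the point.\<close>

lemma quotient_KA:
  assumes q: "(A, p) \<in> qc_quotients K B" and a: "a \<in> carrier A" and b: "b \<in> B $ KA"
    and eq: "p KA b = inl A KA a" and T: "T \<in> CAlg K" and j: "j \<in> alg_hom K A T"
  shows "ev T (Ar X A T j (qpt A p)) (Ar B KA T (unit_hom T) b) = j a"
proof -
  note A = quotient_CAlg[OF q] and u = unit_hom_alg_hom[OF CAlg_AAlg[OF T]]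
  interpret T: cring T using T by (rule CAlg_cring)
  have "ev T (Ar X A T j (qpt A p)) (Ar B KA T (unit_hom T) b) = act A T j (p T (Ar B KA T (unit_hom T) b))"
    by (rule ev_qpt[OF q T j sB(1)[OF KA_CAlg T u b]])
  also have "\<dots> = act A T j (tmr A KA T (unit_hom T) (pt A KA a 1[K]))"
    using quotient_nat[OF q KA_CAlg T u b] eq a by (simp add: inl_apply)
  also have "\<dots> = j a"
    using a alg_homD(5)[OF u] alg_homD(1)[OF j]
    by (simp add: tmr_facts[OF CAlg_AAlg[OF A] KA_AAlg CAlg_AAlg[OF T] u] act_facts[OF A T j])
  finally show ?thesis .
qed

lemma quotient_KA_ex:
  assumes q: "(A, p) \<in> qc_quotients K B" and a: "a \<in> carrier A"
  shows "\<exists>b\<in>B $ KA. p KA b = inl A KA a"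
proof -
  have "p KA ` (B $ KA) = carrier (tens K A KA)" using q KA_CAlg by (auto simp: qc_quotients_def)
  moreover have "inl A KA a \<in> carrier (tens K A KA)"
    using a alg_homD(1)[OF inlr(2)[OF quotient_CAlg[OF q] KA_CAlg]] by simp
  ultimately show ?thesis by (metis imageE)
qed

text \<open>The image of \<open>j\<close> consists of the values at the point of the functions over
  \<open>K\<close>, and these also lie in the image of \<open>j'\<close>. An injective factorisation
  of a point is thus minimal: every other factorisation passes through it.\<close>

lemma quotient_hom:
  assumes q: "(A, p) \<in> qc_quotients K B" and q': "(A', p') \<in> qc_quotients K B" and T: "T \<in> CAlg K"
    and j: "j \<in> alg_hom K A T" and j': "j' \<in> alg_hom K A' T" "inj_on j' (carrier A')"
    and eq: "Ar X A T j (qpt A p) = Ar X A' T j' (qpt A' p')"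
  shows "\<exists>h\<in>alg_hom K A A'. (j' o[A] h) = j \<and>
    (\<forall>R b. R \<in> CAlg K --> b \<in> B $ R --> p' R b = tml A R A' h (p R b))"
proof -
  note A = quotient_CAlg[OF q] and A' = quotient_CAlg[OF q']
  have im: "\<exists>a'. a' \<in> carrier A' \<and> j' a' = j a" if a: "a \<in> carrier A" for a
  proof -
    obtain b where b: "b \<in> B $ KA" "p KA b = inl A KA a" using quotient_KA_ex[OF q a] by blast
    obtain a' where a': "a' \<in> carrier A'" "p' KA b = inl A' KA a'"
      using tens_KA[OF CAlg_AAlg[OF A'] quotient_closed[OF q' KA_CAlg b(1)]] by blast
    show ?thesis using quotient_KA[OF q a b T j] quotient_KA[OF q' a'(1) b(1) a'(2) T j'(1)] eq a' by metis
  qed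
  define h where "h = (\<lambda>a\<in>carrier A. SOME a'. a' \<in> carrier A' \<and> j' a' = j a)"
  have h: "h a \<in> carrier A'" "j' (h a) = j a" if "a \<in> carrier A" for a
    using someI_ex[OF im[OF that]] that by (simp_all add: h_def)
  have inj: "a = a'" if "a \<in> carrier A'" "a' \<in> carrier A'" "j' a = j' a'" for a a'
    using j'(2) that by (auto simp: inj_on_def)
  note cA = CAlg_closed[OF A] and cA' = CAlg_closed[OF A']
  have hh: "h \<in> alg_hom K A A'"
    by (rule alg_homI; (rule inj)?) (simp_all add: h cA cA' alg_homD[OF j] alg_homD[OF j'(1)], simp add: h_def)
  have ch: "j' o[A] h = j"
    by (rule alg_hom_eqI[OF compose_CAlg[OF A hh j'(1)] j]) (simp add: compose_eq h)
  have "p' R b = tml A R A' h (p R b)" if R: "R \<in> CAlg K" and b: "b \<in> B $ R" for R b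
  proof (rule inj_onD[OF tml_inj[OF A' R T j']])
    note pc = quotient_closed[OF q R b]
    note AA = CAlg_AAlg[OF A] CAlg_AAlg[OF A'] CAlg_AAlg[OF R] CAlg_AAlg[OF T]
    have "tml A' R T j' (p' R b) = tml A R T j (p R b)"
      using ev_qpt_tml[OF q T j R b] ev_qpt_tml[OF q' T j'(1) R b] eq by simp
    also have "\<dots> = tml A' R T j' (tml A R A' h (p R b))"
      by (rule tens_hom_eqI[OF AA(1,3) pc, where P = "tens K T R"])
        (simp_all add: tml_facts[OF AA(1,3,4) j] tml_facts[OF AA(1,3,2) hh] tml_facts[OF AA(2,3,4) j'(1)] h)
    finally show "tml A' R T j' (p' R b) = tml A' R T j' (tml A R A' h (p R b))" .
    show "p' R b \<in> carrier (tens K A' R)" by (rule quotient_closed[OF q' R b])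
    show "tml A R A' h (p R b) \<in> carrier (tens K A' R)" by (rule tml_facts(1)[OF AA(1,3,2) hh pc])
  qed
  then show ?thesis using hh ch by blast
qed

text \<open>The component of \<open>b\<close> at a quotient is the value of \<open>b\<close> at its
  universal point. Hence equal functions have equal components, and a function \<theta> gives a
  family of components, by its values at universal points. Pro-quasicoherence turns this family into
  an element, which agrees with \<theta> at all points by \<open>factor\<close>.\<close>

lemma pro_qc_functions:
  assumes pq: "pro_quasicoherent K B" and S: "S \<in> CAlg K"
  shows "b \<in> B $ S ==> c \<in> B $ S ==>
    (\<And>T f x. T \<in> CAlg K ==> f \<in> alg_hom K S T ==> x \<in> X $ T ==>
      ev T x (Ar B S T f b) = ev T x (Ar B S T f c)) ==> b = c"
    "\<theta> \<in> fun_on K X S ==> \<exists>b\<in>B $ S. \<forall>T f x. T \<in> CAlg K --> f \<in> alg_hom K S T --> x \<in> X $ T -->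
    ev T x (Ar B S T f b) = \<theta> (T, f) x"
proof -
  have bij: "bij_betw (\<lambda>b. \<lambda>(A, p)\<in>qc_quotients K B. p S b) (B $ S) (qc_limit K B S)"
    using pq S by (simp add: pro_quasicoherent_def)
  {
    fix b c assume b: "b \<in> B $ S" and c: "c \<in> B $ S"
      and eq: "\<And>T f x. T \<in> CAlg K ==> f \<in> alg_hom K S T ==> x \<in> X $ T ==>
      ev T x (Ar B S T f b) = ev T x (Ar B S T f c)"
    have "p S b = p S c" if q: "(A, p) \<in> qc_quotients K B" for A p
    proof -
      note i = inlr[OF quotient_CAlg[OF q] S]
      show ?thesis
        unfolding qpt(2)[OF q S b] qpt(2)[OF q S c]
        by (rule eq[OF i(1,3) sX(1)[OF quotient_CAlg[OF q] i(1,2) qpt(1)[OF q]]])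
    qed
    then have "(\<lambda>(A, p)\<in>qc_quotients K B. p S b) = (\<lambda>(A, p)\<in>qc_quotients K B. p S c)"
      by (intro restrict_ext) auto
    then show "b = c" using bij b c by (auto simp: bij_betw_def inj_on_def)
  next
    fix \<theta> assume \<theta>: "\<theta> \<in> fun_on K X S"
    note th = fun_onD[OF \<theta>]
    define v where "v A p = \<theta> (tens K A S, inr A S) (Ar X A (tens K A S) (inl A S) (qpt A p))" for A p
    have vc: "v A p \<in> carrier (tens K A S)" if q: "(A, p) \<in> qc_quotients K B" for A p
    proof -
      note A = quotient_CAlg[OF q]
      note i = inlr[OF A S]
      show ?thesis unfolding v_def by (rule th(1)[OF i(1,3) sX(1)[OF A i(1,2) qpt(1)[OF q]]])
    qed
    have "(\<lambda>(A, p)\<in>qc_quotients K B. v A p) \<in> qc_limit K B S"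
      unfolding qc_limit_def mem_Collect_eq
    proof (intro conjI)
      show "(\<lambda>(A, p)\<in>qc_quotients K B. v A p) \<in> (\<Pi>\<^sub>E i\<in>qc_quotients K B. ((qc K (fst i)) $ S))"
        using vc by auto
      have "\<psi> S (v A p) = v A' p'"
        if q: "(A, p) \<in> qc_quotients K B" and q': "(A', p') \<in> qc_quotients K B" and \<psi>: "\<psi> \<in> Alg_mor K (qc K A) (qc K A')"
          and comp: "\<And>T b. T \<in> CAlg K ==> b \<in> B $ T ==> \<psi> T (p T b) = p' T b" for A p A' p' \<psi>
      proof -
        note A = quotient_CAlg[OF q] and A' = quotient_CAlg[OF q']
        note AA = CAlg_AAlg[OF A] CAlg_AAlg[OF A'] CAlg_AAlg[OF S]
        note i = inlr[OF A S] and i' = inlr[OF A' S]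
        note m = Mod_morD[OF Alg_morD(1)[OF \<psi>], unfolded qc_simps] Alg_morD(3,4)[OF \<psi>, unfolded qc_simps]
        interpret S: cring S using S by (rule CAlg_cring)
        interpret SM: module K S using S by (rule CAlgD)
        interpret A: cring A using A by (rule CAlg_cring)
        interpret A': cring A' using A' by (rule CAlg_cring)
        interpret T: cring "tens K A S" using i(1) by (rule CAlg_cring)
        interpret T': cring "tens K A' S" using i'(1) by (rule CAlg_cring)
        \<comment> \<open>\<psi> is linear over \<open>S\<close>; rewriting scalars of
          \<open>K\<close> through \<open>S\<close> makes \<psi> at \<open>S\<close> a map of
          \<open>K\<close>-algebras, along which \<theta> is natural.\<close>
        have ks: "k \<cdot>[tens K C S] z = pt C S 1[C] (k \<cdot>[S] 1[S]) *[tens K C S] z"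
          if C: "C \<in> CAlg K" and k: "k \<in> carrier K" and z: "z \<in> carrier (tens K C S)" for C k z
        proof -
          note C' = CAlg_AAlg[OF C]
          interpret C: cring C using C by (rule CAlg_cring)
          interpret TM: module K "tens K C S" using inlr(1)[OF C S] by (rule CAlgD)
          interpret TC: cring "tens K C S" using inlr(1)[OF C S] by (rule CAlg_cring)
          show ?thesis
            by (rule tens_hom_eqI[OF C' AA(3) z, where P = "tens K C S"])
              (use k in \<open>simp_all add: TM.smult_r_distr TC.r_distr pt_closed[OF C' AA(3)] pt_mult[OF C' AA(3)]
                pt_smult[OF C' AA(3)] pt_balanced[OF C' AA(3)] AAlg_smult_assoc[OF AA(3)]\<close>)
        qed
        have u: "\<psi> S \<in> alg_hom K (tens K A S) (tens K A' S)"
        proof (rule alg_homI)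
          show "\<psi> S \<in> extensional (carrier (tens K A S))" using MorD(3)[OF m(1) S] by simp
          show "\<psi> S (r \<cdot>[tens K A S] z) = r \<cdot>[tens K A' S] \<psi> S z"
            if "r \<in> carrier K" "z \<in> carrier (tens K A S)" for r z
            using that m(2)[OF S] m(4)[OF S] by (simp add: ks A A')
        qed (simp_all add: m(2,3,6,7)[OF S])
        have ur: "\<psi> S o[S] inr A S = inr A' S"
        proof (rule alg_hom_eqI[OF compose_CAlg[OF S i(3) u] i'(3)])
          fix s assume s: "s \<in> carrier S"
          then have "\<psi> S (pt A S 1[A] s *[tens K A S] 1[tens K A S]) = pt A' S 1[A'] s *[tens K A' S] \<psi> S 1[tens K A S]"
            by (intro m(4)[OF S]) simp_all
          then show "(\<psi> S o[S] inr A S) s = inr A' S s"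
            using s m(7)[OF S] by (simp add: compose_eq inr_apply pt_closed[OF AA(1,3)] pt_closed[OF AA(2,3)])
        qed
        have ul: "\<psi> S o[A] inl A S \<in> alg_hom K A (tens K A' S)" by (rule compose_CAlg[OF A i(2) u])
        \<comment> \<open>This algebra map carries the universal point of \<open>A\<close> to that
          of \<open>A'\<close>, because \<psi> composed with \<open>p\<close> is \<open>p'\<close>.
          Naturality of \<theta> along it is then the compatibility of the family.\<close>
        have pts: "Ar X A (tens K A' S) (\<psi> S o[A] inl A S) (qpt A p) = Ar X A' (tens K A' S) (inl A' S) (qpt A' p')"
        proof (rule char_sep[OF i'(1) sX(1)[OF A i'(1) ul qpt(1)[OF q]] sX(1)[OF A' i'(1,2) qpt(1)[OF q']]])
          fix V f b assume V: "V \<in> CAlg K" and f: "f \<in> alg_hom K (tens K A' S) V" and b: "b \<in> B $ V"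
          note V' = CAlg_AAlg[OF V]
          note fl = compose_CAlg[OF A' i'(2) f] and fr = compose_CAlg[OF S i'(3) f] and ful = compose_CAlg[OF A ul f]
          interpret V: cring V using V by (rule CAlg_cring)
          have *: "act A V (f o[A] (\<psi> S o[A] inl A S)) z =
            act A' V (f o[A'] inl A' S) (\<psi> V z)" if z: "z \<in> carrier (tens K A V)" for z
          proof (rule tens_hom_eqI[OF AA(1) V' z, where P = V])
            fix a s assume a: "a \<in> carrier A" and s: "s \<in> carrier V"
            have a1: "pt A S a 1[S] \<in> carrier (tens K A S)" using a by (simp add: pt_closed[OF AA(1,3)])
            have a2: "pt A V a 1[V] \<in> carrier (tens K A V)" using a by (simp add: pt_closed[OF AA(1) V'])
            have w: "\<psi> S (pt A S a 1[S]) \<in> carrier (tens K A' S)" by (rule m(2)[OF S a1])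
            have "pt A V a 1[V] = tmr A S V (f o[S] inr A' S) (pt A S a 1[S])"
              using a alg_homD(5)[OF fr] by (simp add: tmr_facts[OF AA(1,3) V' fr])
            then have p1: "\<psi> V (pt A V a 1[V]) = tmr A' S V (f o[S] inr A' S) (\<psi> S (pt A S a 1[S]))"
              using m(5)[OF S V fr a1] by (simp add: tmr_def)
            have fw: "act A' V (f o[A'] inl A' S) (\<psi> V (pt A V a 1[V])) = f (\<psi> S (pt A S a 1[S]))"
              unfolding p1 act_tmr[OF A' S V fl fr w] cop_compose[OF A' S i'(1) V i'(2,3) f w] cop_inl_inr[OF A' S w] ..
            have "pt A V a s = pt A V 1[A] s *[tens K A V] pt A V a 1[V]"
              using a s by (simp add: pt_mult[OF AA(1) V'])
            then have "\<psi> V (pt A V a s) = pt A' V 1[A'] s *[tens K A' V] \<psi> V (pt A V a 1[V])"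
              using m(4)[OF V s a2] by simp
            then have "act A' V (f o[A'] inl A' S) (\<psi> V (pt A V a s)) = s *[V] f (\<psi> S (pt A S a 1[S]))"
              using act_smult[OF A' V fl s m(2)[OF V a2]] fw by simp
            moreover have "act A V (f o[A] (\<psi> S o[A] inl A S)) (pt A V a s) = f (\<psi> S (pt A S a 1[S])) *[V] s"
              using a s by (simp add: act_facts[OF A V ful] compose_eq inl_apply)
            ultimately show "act A V (f o[A] (\<psi> S o[A] inl A S)) (pt A V a s) =
              act A' V (f o[A'] inl A' S) (\<psi> V (pt A V a s))"
              using s alg_homD(1)[OF f w] by (simp add: V.m_comm)
          qed (simp_all add: act_facts[OF A V ful] act_facts[OF A' V fl] m(2,3)[OF V])
          show "ev V (Ar X (tens K A' S) V f (Ar X A (tens K A' S) (\<psi> S o[A] inl A S) (qpt A p))) b =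
            ev V (Ar X (tens K A' S) V f (Ar X A' (tens K A' S) (inl A' S) (qpt A' p'))) b"
            unfolding sX(3)[OF A i'(1) V ul f qpt(1)[OF q], symmetric] sX(3)[OF A' i'(1) V i'(2) f qpt(1)[OF q'], symmetric]
              ev_qpt[OF q V ful b] ev_qpt[OF q' V fl b] *[OF quotient_closed[OF q V b]] comp[OF V b] ..
        qed
        have "\<psi> S (v A p) = \<theta> (tens K A' S, \<psi> S o[S] inr A S)
          (Ar X (tens K A S) (tens K A' S) (\<psi> S) (Ar X A (tens K A S) (inl A S) (qpt A p)))"
          unfolding v_def by (rule th(2)[OF i(1,3) i'(1) u sX(1)[OF A i(1,2) qpt(1)[OF q]], symmetric])
        also have "\<dots> = v A' p'"
          unfolding v_def ur sX(3)[OF A i(1) i'(1) i(2) u qpt(1)[OF q], symmetric] pts ..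
        finally show ?thesis .
      qed
      then show "\<forall>(A, p)\<in>qc_quotients K B. \<forall>(A', p')\<in>qc_quotients K B. \<forall>\<psi>\<in>Alg_mor K (qc K A) (qc K A').
        (\<forall>T\<in>CAlg K. \<forall>b\<in>B $ T. \<psi> T (p T b) = p' T b) -->
        \<psi> S ((\<lambda>(A, p)\<in>qc_quotients K B. v A p) (A, p)) = (\<lambda>(A, p)\<in>qc_quotients K B. v A p) (A', p')"
        by auto
    qed
    then obtain b where b: "b \<in> B $ S"
      and bv: "(\<lambda>(A, p)\<in>qc_quotients K B. v A p) = (\<lambda>(A, p)\<in>qc_quotients K B. p S b)"
      using bij by (auto simp: bij_betw_def)
    show "\<exists>b\<in>B $ S. \<forall>T f x. T \<in> CAlg K --> f \<in> alg_hom K S T --> x \<in> X $ T -->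
    ev T x (Ar B S T f b) = \<theta> (T, f) x"
    proof (intro bexI[OF _ b] allI impI)
      fix T f x assume T: "T \<in> CAlg K" and f: "f \<in> alg_hom K S T" and x: "x \<in> X $ T"
      obtain A p j where q: "(A, p) \<in> qc_quotients K B" and j: "j \<in> alg_hom K A T" and xj: "x = Ar X A T j (qpt A p)"
        using factor[OF T x] by blast
      note A = quotient_CAlg[OF q]
      note i = inlr[OF A S]
      note c = cop_facts[OF A S T j f]
      have pv: "p S b = v A p" using fun_cong[OF bv, of "(A, p)"] q by simp
      have "ev T x (Ar B S T f b) = cop A S T j f (p S b)"
        unfolding xj ev_qpt[OF q T j sB(1)[OF S T f b]] quotient_nat[OF q S T f b]
        by (rule act_tmr[OF A S T j f quotient_closed[OF q S b]])
      also have "\<dots> = \<theta> (T, f) x"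
        unfolding pv v_def th(2)[OF i(1,3) T c(1) sX(1)[OF A i(1,2) qpt(1)[OF q]], symmetric]
          sX(3)[OF A i(1) T i(2) c(1) qpt(1)[OF q], symmetric] c(5,6) xj ..
      finally show "ev T x (Ar B S T f b) = \<theta> (T, f) x" .
    qed
  }
qed

end

text \<open>The other half of the duality: \<open>B\<close> is the algebra of all functions on
  \<open>X\<close>. By \<open>pro_qc_functions\<close> this follows from pro-quasicoherence, and
  \<open>pro_quasicoherent\<close> is the converse.\<close>

locale pairing = char_pairing K X B ev
  for K :: "'u ring" and X :: "('u, 'x, ('x, 'z) partial_object_scheme) func" and B :: "('u, 'b) mfunc" and ev +
  assumes fun_complete: "\<And>S \<theta>. S \<in> CAlg K ==> \<theta> \<in> fun_on K X S ==> \<exists>b\<in>B $ S.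
    \<forall>T f x. T \<in> CAlg K --> f \<in> alg_hom K S T --> x \<in> X $ T --> ev T x (Ar B S T f b) = \<theta> (T, f) x"
    and fun_sep: "\<And>S b c. S \<in> CAlg K ==> b \<in> B $ S ==> c \<in> B $ S ==>
    (\<And>T f x. T \<in> CAlg K ==> f \<in> alg_hom K S T ==> x \<in> X $ T ==>
      ev T x (Ar B S T f b) = ev T x (Ar B S T f c)) ==> b = c"
begin

text \<open>A compatible family \<open>y\<close> has to be turned into a function on
  \<open>X\<close>: at a point factored through a quotient \<open>A\<close>, its value is the image
  of \<open>y (A, p)\<close> under the copairing of the two maps to \<open>T\<close>.\<close>

lemma pro_quasicoherent: "pro_quasicoherent K B"
  unfolding pro_quasicoherent_def bij_betw_def
proof (intro conjI B ballI inj_onI)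
  fix S b c assume S: "S \<in> CAlg K" and b: "b \<in> B $ S" and c: "c \<in> B $ S"
    and eq: "(\<lambda>(A, p)\<in>qc_quotients K B. p S b) = (\<lambda>(A, p)\<in>qc_quotients K B. p S c)"
  show "b = c"
  proof (rule fun_sep[OF S b c])
    fix T f x assume T: "T \<in> CAlg K" and f: "f \<in> alg_hom K S T" and x: "x \<in> X $ T"
    obtain A p j where q: "(A, p) \<in> qc_quotients K B" and j: "j \<in> alg_hom K A T" and xj: "x = Ar X A T j (qpt A p)"
      using factor[OF T x] by blast
    have "p S b = p S c" using fun_cong[OF eq, of "(A, p)"] q by simp
    then show "ev T x (Ar B S T f b) = ev T x (Ar B S T f c)"
      unfolding xj ev_qpt[OF q T j sB(1)[OF S T f b]] quotient_nat[OF q S T f b]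
        ev_qpt[OF q T j sB(1)[OF S T f c]] quotient_nat[OF q S T f c] by simp
  qed
next
  fix S assume S: "S \<in> CAlg K"
  show "(\<lambda>b. \<lambda>(A, p)\<in>qc_quotients K B. p S b) ` (B $ S) = qc_limit K B S"
  proof (intro equalityI subsetI)
    fix y assume "y \<in> (\<lambda>b. \<lambda>(A, p)\<in>qc_quotients K B. p S b) ` (B $ S)"
    then obtain b where b: "b \<in> B $ S" "y = (\<lambda>(A, p)\<in>qc_quotients K B. p S b)" by blast
    then show "y \<in> qc_limit K B S"
      using S quotient_closed by (auto simp: qc_limit_def)
  next
    fix y assume y: "y \<in> qc_limit K B S"
    have yc: "y (A, p) \<in> carrier (tens K A S)" if "(A, p) \<in> qc_quotients K B" for A p
      using y that by (auto simp: qc_limit_def PiE_def Pi_def)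
    have ylim: "\<psi> S (y (A, p)) = y (A', p')" if "(A, p) \<in> qc_quotients K B" "(A', p') \<in> qc_quotients K B"
      "\<psi> \<in> Alg_mor K (qc K A) (qc K A')" "\<And>T b. T \<in> CAlg K ==> b \<in> B $ T ==> \<psi> T (p T b) = p' T b" for A p A' p' \<psi>
    proof -
      have "\<forall>(A, p)\<in>qc_quotients K B. \<forall>(A', p')\<in>qc_quotients K B. \<forall>\<psi>\<in>Alg_mor K (qc K A) (qc K A').
     (\<forall>T\<in>CAlg K. \<forall>b\<in>B $ T. \<psi> T (p T b) = p' T b) --> \<psi> S (y (A, p)) = y (A', p')"
        using y by (simp add: qc_limit_def)
      from bspec[OF bspec[OF this that(1), unfolded prod.case] that(2), unfolded prod.case] that(3,4) show ?thesis by blast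
    qed
    define fac where "fac T x = (SOME (A, p, j). (A, p) \<in> qc_quotients K B \<and> j \<in> alg_hom K A T \<and> inj_on j (carrier A) \<and>
    x = Ar X A T j (qpt A p))" for T x
    define v where "v T f x = (case fac T x of (A, p, j) => cop A S T j f (y (A, p)))" for T f x
    \<comment> \<open>Independence of the factorisation chosen by \<open>fac\<close>:
      \<open>quotient_hom\<close> relates any other one to it by a map of quotients, under which
      \<open>y\<close> is compatible.\<close>
    have v: "v T f (Ar X A T j (qpt A p)) = cop A S T j f (y (A, p))"
      if T: "T \<in> CAlg K" and f: "f \<in> alg_hom K S T" and q: "(A, p) \<in> qc_quotients K B" and j: "j \<in> alg_hom K A T" for T f A p j
    proof -
      note A = quotient_CAlg[OF q]
      let ?x = "Ar X A T j (qpt A p)"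
      obtain A' p' j' where fac: "fac T ?x = (A', p', j')" by (cases "fac T ?x")
      have "\<exists>t. case t of (A, p, j) => (A, p) \<in> qc_quotients K B \<and> j \<in> alg_hom K A T \<and> inj_on j (carrier A) \<and>
        ?x = Ar X A T j (qpt A p)"
        using factor[OF T sX(1)[OF A T j qpt(1)[OF q]]] by auto
      from someI_ex[OF this, folded fac_def] fac
      have q': "(A', p') \<in> qc_quotients K B" and j': "j' \<in> alg_hom K A' T" "inj_on j' (carrier A')"
        and eq: "?x = Ar X A' T j' (qpt A' p')" by auto
      note A' = quotient_CAlg[OF q']
      obtain h where h: "h \<in> alg_hom K A A'" "j' o[A] h = j"
        "\<And>R b. R \<in> CAlg K ==> b \<in> B $ R ==> p' R b = tml A R A' h (p R b)"
        using quotient_hom[OF q q' T j j' eq] by blast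
      have "(\<lambda>T\<in>CAlg K. \<lambda>z\<in>(qc K A) $ T. tml A T A' h z) S (y (A, p)) = y (A', p')"
        by (rule ylim[OF q q' qc_Alg_mor[OF A A' h(1)]]) (simp add: h(3) quotient_closed[OF q])
      then have "y (A', p') = tml A S A' h (y (A, p))" using S yc[OF q] by simp
      then show ?thesis
        using cop_tml[OF A S A' T h(1) j'(1) f yc[OF q]] by (simp add: v_def fac h(2))
    qed
    define \<theta> where "\<theta> = nt_restrict K X S v"
    have "\<theta> \<in> fun_on K X S"
      unfolding \<theta>_def
    proof (rule nt_restrict_fun_on[OF X S])
      fix T f x assume T: "T \<in> CAlg K" and f: "f \<in> alg_hom K S T" and x: "x \<in> X $ T"
      obtain A p j where q: "(A, p) \<in> qc_quotients K B" and j: "j \<in> alg_hom K A T" and xj: "x = Ar X A T j (qpt A p)"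
        using factor[OF T x] by blast
      note A = quotient_CAlg[OF q]
      show "v T f x \<in> carrier T" unfolding xj v[OF T f q j] by (rule cop_facts(2)[OF A S T j f yc[OF q]])
      fix V g assume V: "V \<in> CAlg K" and g: "g \<in> alg_hom K T V" and gf: "g o[S] f \<in> alg_hom K S V"
      show "v V (g o[S] f) (Ar X T V g x) = g (v T f x)"
        unfolding xj v[OF T f q j] sX(3)[OF A T V j g qpt(1)[OF q], symmetric] v[OF V gf q compose_CAlg[OF A j g]]
        by (rule cop_compose[OF A S T V j f g yc[OF q]])
    qed
    then obtain b where b: "b \<in> B $ S"
      and bt: "\<forall>T f x. T \<in> CAlg K --> f \<in> alg_hom K S T --> x \<in> X $ T --> ev T x (Ar B S T f b) = \<theta> (T, f) x"
      using fun_complete[OF S] by blast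
    have "p S b = y (A, p)" if q: "(A, p) \<in> qc_quotients K B" for A p
    proof -
      note A = quotient_CAlg[OF q]
      note i = inlr[OF A S]
      have x: "Ar X A (tens K A S) (inl A S) (qpt A p) \<in> X $ (tens K A S)"
        by (rule sX(1)[OF A i(1,2) qpt(1)[OF q]])
      have "p S b = \<theta> (tens K A S, inr A S) (Ar X A (tens K A S) (inl A S) (qpt A p))"
        unfolding qpt(2)[OF q S b] using bt i x by blast
      also have "\<dots> = cop A S (tens K A S) (inl A S) (inr A S) (y (A, p))"
        unfolding \<theta>_def nt_restrict_apply[OF i(1,3) x] by (rule v[OF i(1,3) q i(2)])
      also have "\<dots> = y (A, p)" by (rule cop_inl_inr[OF A S yc[OF q]])
      finally show ?thesis .
    qed
    then have "y = (\<lambda>(A, p)\<in>qc_quotients K B. p S b)"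
      using y by (intro extensionalityI[of _ "qc_quotients K B"]) (auto simp: qc_limit_def PiE_def)
    then show "y \<in> (\<lambda>b. \<lambda>(A, p)\<in>qc_quotients K B. p S b) ` (B $ S)" using b by blast
  qed
qed

end

section \<open>Functions and affine functors\<close>

context pairing
begin

interpretation K: field K by (rule K_field)

definition fun_of :: "'u alg => 'b => ('u, 'x) nt" where
  "fun_of S b = nt_restrict K X S (\<lambda>T f x. ev T x (Ar B S T f b))"

lemma fun_of_apply:
  "T \<in> CAlg K ==> f \<in> alg_hom K S T ==> x \<in> X $ T ==> fun_of S b (T, f) x = ev T x (Ar B S T f b)"
  by (simp add: fun_of_def)

lemma fun_of_fun_on:
  assumes S: "S \<in> CAlg K" and b: "b \<in> B $ S"
  shows "fun_of S b \<in> fun_on K X S"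
  unfolding fun_of_def
proof (rule nt_restrict_fun_on[OF X S])
  fix T f V g x assume *: "T \<in> CAlg K" "f \<in> alg_hom K S T" "V \<in> CAlg K" "g \<in> alg_hom K T V" "x \<in> X $ T"
  show "ev V (Ar X T V g x) (Ar B S V (g o[S] f) b) = g (ev T x (Ar B S T f b))"
    unfolding sB(3)[OF S *(1,3,2,4) b] by (rule ev_nat[OF *(1,3,4,5) sB(1)[OF S *(1,2) b]])
qed (rule ev_closed[OF _ _ sB(1)[OF S _ _ b]])

lemma fun_of_bij:
  assumes S: "S \<in> CAlg K"
  shows "bij_betw (fun_of S) (B $ S) (fun_on K X S)"
  unfolding bij_betw_def
proof (intro conjI inj_onI equalityI subsetI)
  fix b c assume b: "b \<in> B $ S" and c: "c \<in> B $ S" and eq: "fun_of S b = fun_of S c"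
  show "b = c" by (rule fun_sep[OF S b c]) (use eq fun_of_apply in metis)
next
  fix \<theta> assume \<theta>: "\<theta> \<in> fun_on K X S"
  then obtain b where b: "b \<in> B $ S" "\<forall>T f x. T \<in> CAlg K --> f \<in> alg_hom K S T --> x \<in> X $ T -->
    ev T x (Ar B S T f b) = \<theta> (T, f) x" using fun_complete[OF S] by blast
  then have "\<theta> = fun_of S b"
    by (intro fun_on_eqI[OF \<theta> fun_of_fun_on[OF S]]) (simp_all add: fun_of_apply)
  then show "\<theta> \<in> fun_of S ` (B $ S)" using b by blast
qed (use fun_of_fun_on[OF S] in auto)

definition fun_iso :: "'u alg => 'b => ('u, 'x) nt" where
  "fun_iso = (\<lambda>S\<in>CAlg K. \<lambda>b\<in>B $ S. fun_of S b)"

lemma fun_iso_apply: "S \<in> CAlg K ==> b \<in> B $ S ==> fun_iso S b = fun_of S b"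
  by (simp add: fun_iso_def)

lemma fun_iso_Alg_mor: "fun_iso \<in> Alg_mor K B (fun_functor K X)"
proof -
  have cF: "\<theta> +[Ob (fun_functor K X) S] \<eta> \<in> fun_on K X S" "\<theta> *[Ob (fun_functor K X) S] \<eta> \<in> fun_on K X S"
    if "S \<in> CAlg K" "\<theta> \<in> fun_on K X S" "\<eta> \<in> fun_on K X S" for S \<theta> \<eta>
    using that fun_on_closed[OF X that(1)] by (simp_all add: fun_functor_simps)
  show ?thesis
    unfolding fun_iso_def
  proof (intro Alg_morI Mod_morI MorI alg_functorD(2)[OF B])
    fix S b assume S: "S \<in> CAlg K" and b: "b \<in> B $ S"
    show "fun_of S b \<in> fun_functor K X $ S" using fun_of_fun_on[OF S b] by (simp add: fun_functor_simps)
    fix T f assume T: "T \<in> CAlg K" and f: "f \<in> alg_hom K S T"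
    show "fun_of T (Ar B S T f b) = Ar (fun_functor K X) S T f (fun_of S b)"
      unfolding fun_functor_simps
      by (rule fun_on_eqI[OF fun_of_fun_on[OF T sB(1)[OF S T f b]] fun_on_Ar[OF X S T f fun_of_fun_on[OF S b]]])
        (simp add: fun_of_apply compose_CAlg[OF S f] sB(3)[OF S T _ f _ b])
  next
    fix S assume S: "S \<in> CAlg K"
    let ?i = "(\<lambda>S\<in>CAlg K. \<lambda>b\<in>B $ S. fun_of S b) S"
    have i: "?i b = fun_of S b" if "b \<in> B $ S" for b using S that by simp
    show "?i 1[Ob B S] = 1[Ob (fun_functor K X) S]"
      unfolding i[OF multB_closed(2)[OF S]] fun_functor_simps
      by (rule fun_on_eqI[OF fun_of_fun_on[OF S multB_closed(2)[OF S]] fun_on_closed(3)[OF X S]])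
        (simp add: fun_of_apply ring_hom_one[OF alg_functorD(5)[OF B S]] ev_one)
    fix b assume b: "b \<in> B $ S"
    {
      fix c assume c: "c \<in> B $ S"
      show "?i (b +[Ob B S] c) = ?i b +[Ob (fun_functor K X) S] ?i c"
        unfolding i[OF clB(1)[OF S b c]] i[OF b] i[OF c]
        by (rule fun_on_eqI[OF fun_of_fun_on[OF S clB(1)[OF S b c]] cF(1)[OF S fun_of_fun_on[OF S b] fun_of_fun_on[OF S c]]])
          (simp add: fun_functor_simps fun_of_apply mod_functorD(3)[OF modB S _ _ b c] ev_add sB(1)[OF S _ _ b] sB(1)[OF S _ _ c])
      show "?i (b *[Ob B S] c) = ?i b *[Ob (fun_functor K X) S] ?i c"
        unfolding i[OF multB_closed(1)[OF S b c]] i[OF b] i[OF c]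
        by (rule fun_on_eqI[OF fun_of_fun_on[OF S multB_closed(1)[OF S b c]] cF(2)[OF S fun_of_fun_on[OF S b] fun_of_fun_on[OF S c]]])
          (simp add: fun_functor_simps fun_of_apply ring_hom_mult[OF alg_functorD(5)[OF B S] b c] ev_mult sB(1)[OF S _ _ b] sB(1)[OF S _ _ c])
    }
    fix s assume s: "s \<in> carrier S"
    have "fun_of S (s \<cdot>[Ob B S] b) = s \<cdot>[Ob (fun_functor K X) S] fun_of S b"
      unfolding fun_functor_simps
      by (rule fun_on_eqI[OF fun_of_fun_on[OF S clB(2)[OF S s b]] fun_on_closed(5)[OF X S fun_of_fun_on[OF S b] s]])
        (simp add: fun_of_apply mod_functorD(4)[OF modB S _ _ b s] ev_smult sB(1)[OF S _ _ b] alg_homD(1)[OF _ s])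
    then show "?i (s \<cdot>[Ob B S] b) = s \<cdot>[Ob (fun_functor K X) S] ?i b"
      unfolding i[OF clB(2)[OF S s b]] i[OF b] .
  qed
qed

text \<open>Reflexivity passes from \<open>B\<close> to the functions along \<open>fun_iso\<close>.
  A morphism from the functions to \<open>qc K S\<close> is, through \<open>fun_iso\<close>, a
  morphism from \<open>B\<close>, hence a point.\<close>

lemma affine:
  assumes small: "small_functor K X"
  shows "affine K X"
  unfolding affine_def
proof (intro conjI ballI X small)
  note FX = alg_functor_fun[OF X]
  note iA = fun_iso_Alg_mor
  have ib: "bij_betw (fun_iso S) (B $ S) (fun_functor K X $ S)" if S: "S \<in> CAlg K" for S
  proof -
    have "bij_betw (fun_iso S) (B $ S) (fun_on K X S)"
      using fun_of_bij[OF S] by (rule bij_betw_cong[THEN iffD1, rotated]) (simp add: fun_iso_apply[OF S])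
    then show ?thesis by (simp add: fun_functor_simps)
  qed
  show "reflexive K (fun_functor K X)"
    by (rule reflexive_iso[OF alg_functorD(1)[OF FX] Alg_morD(1)[OF iA] ib rB])
  fix S assume S: "S \<in> CAlg K"
  have sp: "to_Spec K X S x R (fun_of R b) = ev (tens K S R) (Ar X S (tens K S R) (inl S R) x) (Ar B R (tens K S R) (inr S R) b)"
    if x: "x \<in> X $ S" and R: "R \<in> CAlg K" and b: "b \<in> B $ R" for x R b
  proof -
    note i = inlr[OF S R]
    show ?thesis
      using R fun_of_fun_on[OF R b] fun_of_apply[OF i(1,3) sX(1)[OF S i(1,2) x], of b]
      by (simp add: to_Spec_def fun_functor_simps inl_def[symmetric] inr_def[symmetric])
  qed
  have comp: "to_Spec K X S x = \<phi>"
    if x: "x \<in> X $ S" and \<phi>: "\<phi> \<in> Alg_mor K (fun_functor K X) (qc K S)"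
      and eq: "\<And>R b. R \<in> CAlg K ==> b \<in> B $ R ==> to_Spec K X S x R (fun_of R b) = \<phi> R (fun_of R b)" for x \<phi>
  proof (rule extensionalityI[of _ "CAlg K"])
    show "to_Spec K X S x \<in> extensional (CAlg K)" by (simp add: to_Spec_def)
    show "\<phi> \<in> extensional (CAlg K)" by (rule MorD(4)[OF Mod_morD(1)[OF Alg_morD(1)[OF \<phi>]]])
    fix R assume R: "R \<in> CAlg K"
    show "to_Spec K X S x R = \<phi> R"
    proof (rule extensionalityI[of _ "fun_on K X R"])
      show "to_Spec K X S x R \<in> extensional (fun_on K X R)" using R by (simp add: to_Spec_def fun_functor_simps)
      show "\<phi> R \<in> extensional (fun_on K X R)"
        using MorD(3)[OF Mod_morD(1)[OF Alg_morD(1)[OF \<phi>]] R] by (simp add: fun_functor_simps)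
      fix \<theta> assume "\<theta> \<in> fun_on K X R"
      then obtain b where "b \<in> B $ R" "\<theta> = fun_of R b" using fun_of_bij[OF R] by (auto simp: bij_betw_def)
      then show "to_Spec K X S x R \<theta> = \<phi> R \<theta>" using eq[OF R] by simp
    qed
  qed
  show "bij_betw (to_Spec K X S) (X $ S) ((Spec K (fun_functor K X)) $ S)"
    unfolding bij_betw_def
  proof (intro conjI inj_onI equalityI subsetI)
    fix x y assume x: "x \<in> X $ S" and y: "y \<in> X $ S" and eq: "to_Spec K X S x = to_Spec K X S y"
    show "x = y"
    proof (rule char_sep[OF S x y])
      fix T f b assume T: "T \<in> CAlg K" and f: "f \<in> alg_hom K S T" and b: "b \<in> B $ T"
      have "ev T (Ar X S T f z) b = act S T f (to_Spec K X S z T (fun_of T b))" if z: "z \<in> X $ S" for z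
        using char_mor_char[OF B S hat_dual[OF S z] T f b] inlr[OF S T] sB(1)[OF T inlr(1,3)[OF S T] b]
        by (simp add: sp[OF z T b] hat_apply T f b)
      then show "ev T (Ar X S T f x) b = ev T (Ar X S T f y) b" using x y eq by simp
    qed
  next
    fix \<phi> assume "\<phi> \<in> (Spec K (fun_functor K X)) $ S"
    then have \<phi>: "\<phi> \<in> Alg_mor K (fun_functor K X) (qc K S)" by (simp add: Spec_def)
    note pm = Mod_morD[OF Alg_morD(1)[OF \<phi>]] Alg_morD(3,4)[OF \<phi>] and im = Mod_morD[OF Alg_morD(1)[OF iA]] Alg_morD(3,4)[OF iA]
    have "(\<lambda>R\<in>CAlg K. \<lambda>b\<in>B $ R. \<phi> R (fun_iso R b)) \<in> Alg_mor K B (qc K S)"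
      by (intro Alg_morI Mod_morI MorI alg_functorD(2)[OF B])
        (simp_all add: im(2-) pm(2-) clB multB_closed del: qc_simps)
    from mor_point[OF S this] obtain x where x: "x \<in> X $ S"
      "\<And>R b. R \<in> CAlg K ==> b \<in> B $ R ==> \<phi> R (fun_of R b) =
      ev (tens K S R) (Ar X S (tens K S R) (inl S R) x) (Ar B R (tens K S R) (inr S R) b)"
      by (auto simp: fun_iso_apply)
    then have "to_Spec K X S x = \<phi>" by (intro comp[OF x(1) \<phi>]) (simp add: sp)
    then show "\<phi> \<in> to_Spec K X S ` (X $ S)" using x by blast
  next
    fix \<phi> assume "\<phi> \<in> to_Spec K X S ` (X $ S)"
    then obtain x where x: "x \<in> X $ S" "\<phi> = to_Spec K X S x" by blast
    \<comment> \<open>That \<open>to_Spec\<close> takes values in algebra morphisms: evaluation at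
      \<open>x\<close> is recognised as a character of the functions, and its adjoint morphism is
      \<open>to_Spec K X S x\<close>.\<close>
    have "nt_restrict K (fun_functor K X) S (\<lambda>T f \<theta>. \<theta> (T, idm T) (Ar X S T f x)) \<in> chars K (fun_functor K X) S"
    proof (rule charsI)
      show "nt_restrict K (fun_functor K X) S (\<lambda>T f \<theta>. \<theta> (T, idm T) (Ar X S T f x)) \<in> dual_on K (fun_functor K X) S"
      proof (rule nt_restrict_dual_on[OF alg_functorD(1)[OF FX] S], unfold fun_functor_simps(1))
        fix T f V g \<theta> assume *: "T \<in> CAlg K" "f \<in> alg_hom K S T" "V \<in> CAlg K" "g \<in> alg_hom K T V" "\<theta> \<in> fun_on K X T"
        note xT = sX(1)[OF S *(1,2) x(1)] and iV = idm_CAlg[OF *(3)] and iT = idm_CAlg[OF *(1)]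
        show "Ar (fun_functor K X) T V g \<theta> (V, idm V) (Ar X S V (g o[S] f) x) = g (\<theta> (T, idm T) (Ar X S T f x))"
          using fun_onD(2)[OF *(5) *(1) iT *(3,4) xT] sX(1)[OF *(1,3,4) xT]
          by (simp add: fun_functor_simps sX(3)[OF S *(1,3,2,4) x(1)] *(3) iV compose_idm_left[OF *(4)] compose_idm_right[OF *(4)])
      qed (simp_all add: fun_functor_simps idm_alg_hom CAlg_AAlg sX(1)[OF S _ _ x(1)] fun_onD(1))
    qed (simp_all add: alg_functorD[OF FX] ring.ring_simprules, simp_all add: fun_functor_simps idm_alg_hom CAlg_AAlg sX(1)[OF S _ _ x(1)]
          fun_on_closed[OF X])
    from char_mor_Alg_mor[OF FX S this]
    have "(\<lambda>R\<in>CAlg K. \<lambda>\<theta>\<in>fun_on K X R. nt_restrict K (fun_functor K X) S (\<lambda>T f \<theta>. \<theta> (T, idm T) (Ar X S T f x))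
      (tens K S R, inl S R) (Ar (fun_functor K X) R (tens K S R) (inr S R) \<theta>)) \<in> Alg_mor K (fun_functor K X) (qc K S)"
      (is "?\<psi> \<in> _") by (simp add: fun_functor_simps(1))
    moreover have "to_Spec K X S x = ?\<psi>"
    proof (rule comp[OF x(1) calculation])
      fix R b assume R: "R \<in> CAlg K" and b: "b \<in> B $ R"
      note i = inlr[OF S R] and fb = fun_of_fun_on[OF R b]
      note ii = idm_CAlg[OF i(1)]
      have c: "Ar (fun_functor K X) R (tens K S R) (inr S R) (fun_of R b) \<in> fun_on K X (tens K S R)"
        using fun_on_Ar[OF X R i(1,3) fb] by (simp add: fun_functor_simps)
      show "to_Spec K X S x R (fun_of R b) = ?\<psi> R (fun_of R b)"
        using R fb c i(1,2) ii sX(1)[OF S i(1,2) x(1)]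
        by (simp add: sp[OF x(1) R b] fun_functor_simps(1))
          (simp add: fun_functor_simps fun_of_apply[OF i(1,3)] compose_idm_left[OF i(3)])
    qed
    ultimately show "\<phi> \<in> (Spec K (fun_functor K X)) $ S" by (simp add: x Spec_def)
  qed
qed

text \<open>The element of \<open>B\<close> with prescribed values at points; by
  \<open>fun_complete\<close> every natural prescription has one.\<close>

definition repr :: "'u alg => ('u alg => ('u => 'u) => 'x => 'u) => 'b" where
  "repr S h = inv_into (B $ S) (fun_of S) (nt_restrict K X S h)"

lemma repr:
  assumes S: "S \<in> CAlg K"
    and "\<And>T f x. T \<in> CAlg K ==> f \<in> alg_hom K S T ==> x \<in> X $ T ==> h T f x \<in> carrier T"
    and "\<And>T f V g x. T \<in> CAlg K ==> f \<in> alg_hom K S T ==> V \<in> CAlg K ==> g \<in> alg_hom K T V ==>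
    (g o[S] f) \<in> alg_hom K S V ==> Ar X T V g x \<in> X $ V ==>
    x \<in> X $ T ==> h V (g o[S] f) (Ar X T V g x) = g (h T f x)"
  shows "repr S h \<in> B $ S"
    "T \<in> CAlg K ==> f \<in> alg_hom K S T ==> x \<in> X $ T ==> ev T x (Ar B S T f (repr S h)) = h T f x"
proof -
  have "nt_restrict K X S h \<in> fun_on K X S" by (rule nt_restrict_fun_on[OF X assms])
  then have im: "nt_restrict K X S h \<in> fun_of S ` (B $ S)" using fun_of_bij[OF S] by (simp only: bij_betw_def)
  have 1: "repr S h \<in> B $ S" "fun_of S (repr S h) = nt_restrict K X S h"
    unfolding repr_def by (rule inv_into_into[OF im], rule f_inv_into_f[OF im])
  show "repr S h \<in> B $ S" by (rule 1)
  assume T: "T \<in> CAlg K" and f: "f \<in> alg_hom K S T" and x: "x \<in> X $ T"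
  show "ev T x (Ar B S T f (repr S h)) = h T f x"
    unfolding fun_of_apply[OF T f x, symmetric] 1(2) by (rule nt_restrict_apply[OF T f x])
qed

text \<open>By reflexivity both forms are evaluations at elements of \<open>B\<close>, whose values
  at points are the values of the forms on \<open>hat\<close>; equal functions are equal
  elements.\<close>

lemma dual_density:
  assumes S: "S \<in> CAlg K" and \<Omega>: "\<Omega> \<in> dual_on K (dual K B) S" "\<Omega>' \<in> dual_on K (dual K B) S"
    and eq: "\<And>T f x. T \<in> CAlg K ==> f \<in> alg_hom K S T ==> x \<in> X $ T ==> \<Omega> (T, f) (hat T x) = \<Omega>' (T, f) (hat T x)"
  shows "\<Omega> = \<Omega>'"
proof -
  obtain m where m: "m \<in> B $ S" "\<forall>T f \<alpha>. T \<in> CAlg K --> f \<in> alg_hom K S T --> \<alpha> \<in> dual_on K B T -->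
    \<Omega> (T, f) \<alpha> = \<alpha> (T, idm T) (Ar B S T f m)" using reflexive_ex[OF modB rB S \<Omega>(1)] by blast
  obtain n where n: "n \<in> B $ S" "\<forall>T f \<alpha>. T \<in> CAlg K --> f \<in> alg_hom K S T --> \<alpha> \<in> dual_on K B T -->
    \<Omega>' (T, f) \<alpha> = \<alpha> (T, idm T) (Ar B S T f n)" using reflexive_ex[OF modB rB S \<Omega>(2)] by blast
  have "m = n"
  proof (rule fun_sep[OF S m(1) n(1)])
    fix T f x assume *: "T \<in> CAlg K" "f \<in> alg_hom K S T" "x \<in> X $ T"
    then show "ev T x (Ar B S T f m) = ev T x (Ar B S T f n)"
      using eq[OF *] m n hat_dual[OF *(1,3)] hat_idm[OF *(1,3) sB(1)[OF S *(1,2) m(1)]] hat_idm[OF *(1,3) sB(1)[OF S *(1,2) n(1)]]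
      by simp
  qed
  then show ?thesis using m n by (intro dual_on_eqI[OF \<Omega>]) simp
qed

end

section \<open>Bilinear families\<close>

text \<open>A linear form over \<open>S\<close> on \<open>P \<otimes> Q\<close>, unpacked through
  the universal property over each \<open>S\<close>-algebra; \<open>dual_of\<close> packs it
  again.\<close>

definition binat :: "'u ring => ('u, 'a) mfunc => ('u, 'b) mfunc => 'u alg =>
    ('u alg => ('u => 'u) => 'a => 'b => 'u) => bool" where
  "binat K P Q S w \<longleftrightarrow> (\<forall>T\<in>CAlg K. \<forall>f\<in>alg_hom K S T. \<forall>\<alpha>\<in>P $ T. \<forall>\<beta>\<in>Q $ T.
     w T f \<alpha> \<beta> \<in> carrier T \<and>
     (\<forall>\<gamma>\<in>P $ T. w T f (\<alpha> +[Ob P T] \<gamma>) \<beta> = w T f \<alpha> \<beta> +[T] w T f \<gamma> \<beta>) \<and>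
     (\<forall>\<gamma>\<in>Q $ T. w T f \<alpha> (\<beta> +[Ob Q T] \<gamma>) = w T f \<alpha> \<beta> +[T] w T f \<alpha> \<gamma>) \<and>
     (\<forall>t\<in>carrier T. w T f (t \<cdot>[Ob P T] \<alpha>) \<beta> = t *[T] w T f \<alpha> \<beta> \<and> w T f \<alpha> (t \<cdot>[Ob Q T] \<beta>) = t *[T] w T f \<alpha> \<beta>) \<and>
     (\<forall>V\<in>CAlg K. \<forall>g\<in>alg_hom K T V. w V (g o[S] f) (Ar P T V g \<alpha>) (Ar Q T V g \<beta>) = g (w T f \<alpha> \<beta>)))"

lemma binatD:
  assumes "binat K P Q S w" "T \<in> CAlg K" "f \<in> alg_hom K S T" "\<alpha> \<in> P $ T" "\<beta> \<in> Q $ T"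
  shows "w T f \<alpha> \<beta> \<in> carrier T"
    "\<gamma> \<in> P $ T ==> w T f (\<alpha> +[Ob P T] \<gamma>) \<beta> = w T f \<alpha> \<beta> +[T] w T f \<gamma> \<beta>"
    "\<delta> \<in> Q $ T ==> w T f \<alpha> (\<beta> +[Ob Q T] \<delta>) = w T f \<alpha> \<beta> +[T] w T f \<alpha> \<delta>"
    "t \<in> carrier T ==> w T f (t \<cdot>[Ob P T] \<alpha>) \<beta> = t *[T] w T f \<alpha> \<beta>"
    "t \<in> carrier T ==> w T f \<alpha> (t \<cdot>[Ob Q T] \<beta>) = t *[T] w T f \<alpha> \<beta>"
    "V \<in> CAlg K ==> g \<in> alg_hom K T V ==>
    w V (g o[S] f) (Ar P T V g \<alpha>) (Ar Q T V g \<beta>) = g (w T f \<alpha> \<beta>)"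
  using assms by (simp_all add: binat_def)

lemma tensor_functor_simps [simp]:
  "Ob (tensor_functor P Q) S = tensor S (Ob P S) (Ob Q S)"
  "Ar (tensor_functor P Q) S T f = tensor_map T (Ob P T) (Ob Q T) (map_prod (Ar P S T f) (Ar Q S T f))"
  by (simp_all add: tensor_functor_def)

context
  fixes K :: "'u ring" and P :: "('u, 'a) mfunc" and Q :: "('u, 'b) mfunc"
  assumes P: "mod_functor K P" and Q: "mod_functor K Q"
begin

lemma two_mod: "T \<in> CAlg K ==> two_modules T (Ob P T) (Ob Q T)"
  using mod_functorD(2)[OF P] mod_functorD(2)[OF Q] by (simp add: two_modules_def)

lemmas sP = set_functorD[OF mod_functorD(1)[OF P]] and sQ = set_functorD[OF mod_functorD(1)[OF Q]]
lemmas mP = mod_functorD(3,4)[OF P] and mQ = mod_functorD(3,4)[OF Q]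
lemmas cP = mod_functor_closed[OF P] and cQ = mod_functor_closed[OF Q]

abbreviation "PQ \<equiv> tensor_functor P Q"

lemma tens_Ar:
  assumes S: "S \<in> CAlg K" and T: "T \<in> CAlg K" and f: "f \<in> alg_hom K S T"
  shows "z \<in> PQ $ S ==> Ar PQ S T f z \<in> PQ $ T"
    "y \<in> PQ $ S ==> z \<in> PQ $ S ==> Ar PQ S T f (y +[Ob PQ S] z) = Ar PQ S T f y +[Ob PQ T] Ar PQ S T f z" (is "PROP ?A")
    "\<alpha> \<in> P $ S ==> \<beta> \<in> Q $ S ==> Ar PQ S T f (ptens S (Ob P S) (Ob Q S) \<alpha> \<beta>) =
    ptens T (Ob P T) (Ob Q T) (Ar P S T f \<alpha>) (Ar Q S T f \<beta>)" (is "PROP ?B")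
proof -
  interpret S: two_modules S "Ob P S" "Ob Q S" by (rule two_mod[OF S])
  interpret T: two_modules T "Ob P T" "Ob Q T" by (rule two_mod[OF T])
  note a = sP(1)[OF S T f] sQ(1)[OF S T f]
  have e: "Ar PQ S T f z = tensor_lift (Ob PQ T) (\<lambda>p. ptens T (Ob P T) (Ob Q T) (Ar P S T f (fst p)) (Ar Q S T f (snd p))) z"
    if "z \<in> PQ $ S" for z
    using tensor_map_lift[OF S.two_modules_axioms T.two_modules_axioms, of "map_prod (Ar P S T f) (Ar Q S T f)" z] that a
    by (simp add: case_prod_unfold)
  have b: "bilin S (Ob P S) (Ob Q S) (Ob PQ T) (\<lambda>p. ptens T (Ob P T) (Ob Q T) (Ar P S T f (fst p)) (Ar Q S T f (snd p)))"
    by (rule bilinI) (simp_all add: a T.ptens_closed mP[OF S T f] mQ[OF S T f] T.ptens_simps alg_homD(1)[OF f])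
  have ag: "abelian_group (Ob PQ T)" using T.abelian_group_tensor by simp
  note l = S.tensor_lift_closed[OF ag b] S.tensor_lift_add[OF ag b] S.tensor_lift_ptens[OF ag b]
  have c: "y +[Ob PQ S] z \<in> PQ $ S" if "y \<in> PQ $ S" "z \<in> PQ $ S" for y z
    using that abelian_monoid.a_closed[OF abelian_group.axioms(1)[OF S.abelian_group_tensor]] by simp
  show "z \<in> PQ $ S ==> Ar PQ S T f z \<in> PQ $ T"
    unfolding e using l by simp
  show "PROP ?A"
    using e[OF c] e l by simp
  show "PROP ?B"
    using e[of "ptens S (Ob P S) (Ob Q S) \<alpha> \<beta>"] l by (simp add: S.ptens_closed)
qed

lemma tens_ops:
  assumes T: "T \<in> CAlg K"
  shows "y \<in> PQ $ T ==> z \<in> PQ $ T ==> y +[Ob PQ T] z \<in> PQ $ T" (is "PROP ?A")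
    "t \<in> carrier T ==> z \<in> PQ $ T ==> t \<cdot>[Ob PQ T] z \<in> PQ $ T" (is "PROP ?B")
    "t \<in> carrier T ==> y \<in> PQ $ T ==> z \<in> PQ $ T ==>
    t \<cdot>[Ob PQ T] (y +[Ob PQ T] z) = t \<cdot>[Ob PQ T] y +[Ob PQ T] t \<cdot>[Ob PQ T] z" (is "PROP ?C")
    "t \<in> carrier T ==> \<alpha> \<in> P $ T ==> \<beta> \<in> Q $ T ==>
    t \<cdot>[Ob PQ T] ptens T (Ob P T) (Ob Q T) \<alpha> \<beta> = ptens T (Ob P T) (Ob Q T) (t \<cdot>[Ob P T] \<alpha>) \<beta>" (is "PROP ?D")
    "\<alpha> \<in> P $ T ==> \<beta> \<in> Q $ T ==> ptens T (Ob P T) (Ob Q T) \<alpha> \<beta> \<in> PQ $ T" (is "PROP ?E")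
proof -
  interpret T: two_modules T "Ob P T" "Ob Q T" by (rule two_mod[OF T])
  interpret TM: module T T.T by (rule T.module_tensor)
  show "PROP ?A"
    "PROP ?B"
    "PROP ?C"
    "PROP ?D"
    "PROP ?E"
    by (simp_all add: TM.smult_r_distr T.smult_ptens T.ptens_closed)
qed

lemma tens_eqI:
  assumes T: "T \<in> CAlg K" and z: "z \<in> PQ $ T"
    and "\<And>y z. y \<in> PQ $ T ==> z \<in> PQ $ T ==> u (y +[Ob PQ T] z) = u y +[D] u z"
    and "\<And>y z. y \<in> PQ $ T ==> z \<in> PQ $ T ==> v (y +[Ob PQ T] z) = v y +[D] v z"
    and "\<And>\<alpha> \<beta>. \<alpha> \<in> P $ T ==> \<beta> \<in> Q $ T ==>
    u (ptens T (Ob P T) (Ob Q T) \<alpha> \<beta>) = v (ptens T (Ob P T) (Ob Q T) \<alpha> \<beta>)"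
  shows "u z = v z"
proof -
  interpret T: two_modules T "Ob P T" "Ob Q T" by (rule two_mod[OF T])
  have "z \<in> carrier T.T" using z by simp
  then show ?thesis
    by (induction rule: T.tensor_induct) (use assms(3-5) in simp_all)
qed

lemma mod_functor_tensor: "mod_functor K PQ"
  unfolding mod_functor_def set_functor_def
proof (intro conjI ballI)
  fix S assume S: "S \<in> CAlg K"
  interpret S: two_modules S "Ob P S" "Ob Q S" by (rule two_mod[OF S])
  show "module S (Ob PQ S)" using S.module_tensor by simp
  fix z assume z: "z \<in> PQ $ S"
  note A = tens_Ar[OF S S idm_CAlg[OF S]]
  have "Ar PQ S S (idm S) z = (\<lambda>z. z) z"
    by (rule tens_eqI[OF S z, where D = "Ob PQ S"]) (simp_all only: A sP(2)[OF S] sQ(2)[OF S])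
  then show "Ar PQ S S (idm S) z = z" .
next
  fix S T f assume S: "S \<in> CAlg K" and T: "T \<in> CAlg K" and f: "f \<in> alg_hom K S T"
  note A = tens_Ar[OF S T f]
  show "Ar PQ S T f \<in> PQ $ S \<rightarrow> PQ $ T" using A(1) by blast
  fix z assume z: "z \<in> PQ $ S"
  show "Ar PQ S T f (z +[Ob PQ S] y) = Ar PQ S T f z +[Ob PQ T] Ar PQ S T f y" if "y \<in> PQ $ S" for y
    using A(2) z that by blast
  fix s assume s: "s \<in> carrier S"
  note fs = alg_homD(1)[OF f s]
  show "Ar PQ S T f (s \<cdot>[Ob PQ S] z) = f s \<cdot>[Ob PQ T] Ar PQ S T f z"
    by (rule tens_eqI[OF S z, where D = "Ob PQ T"])
      (simp_all only: tens_ops[OF S] tens_ops[OF T] A s fs sP(1)[OF S T f] sQ(1)[OF S T f] cP(2)[OF S s] mP(2)[OF S T f])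
next
  fix S T V f g z assume S: "S \<in> CAlg K" and T: "T \<in> CAlg K" and V: "V \<in> CAlg K"
    and f: "f \<in> alg_hom K S T" and g: "g \<in> alg_hom K T V" and z: "z \<in> PQ $ S"
  note gf = compose_alg_hom[OF f g CAlg_AAlg[OF S]]
  show "Ar PQ S V (g o[S] f) z = Ar PQ T V g (Ar PQ S T f z)"
    by (rule tens_eqI[OF S z, where D = "Ob PQ V"])
      (simp_all only: tens_Ar[OF S T f] tens_Ar[OF T V g] tens_Ar[OF S V gf] sP(1)[OF S T f] sQ(1)[OF S T f]
        sP(3)[OF S T V f g] sQ(3)[OF S T V f g])
qed

lemma binat_of_dual:
  assumes S: "S \<in> CAlg K" and \<omega>: "\<omega> \<in> dual_on K PQ S"
  shows "binat K P Q S (\<lambda>T f \<alpha> \<beta>. \<omega> (T, f) (ptens T (Ob P T) (Ob Q T) \<alpha> \<beta>))"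
  unfolding binat_def
proof (intro ballI conjI)
  fix T f \<alpha> \<beta> assume T: "T \<in> CAlg K" and f: "f \<in> alg_hom K S T" and a: "\<alpha> \<in> P $ T" and b: "\<beta> \<in> Q $ T"
  interpret T: two_modules T "Ob P T" "Ob Q T" by (rule two_mod[OF T])
  note d = dual_onD[OF \<omega>] and o = tens_ops[OF T]
  note p = o(5)[OF a b]
  show "\<omega> (T, f) (ptens T (Ob P T) (Ob Q T) \<alpha> \<beta>) \<in> carrier T" by (rule d(2)[OF T f p])
  show "\<omega> (T, f) (ptens T (Ob P T) (Ob Q T) (\<alpha> +[Ob P T] \<gamma>) \<beta>) =
    \<omega> (T, f) (ptens T (Ob P T) (Ob Q T) \<alpha> \<beta>) +[T] \<omega> (T, f) (ptens T (Ob P T) (Ob Q T) \<gamma> \<beta>)"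
    if c: "\<gamma> \<in> P $ T" for \<gamma>
    using d(3)[OF T f p o(5)[OF c b]] a b c by (simp add: T.ptens_simps)
  show "\<omega> (T, f) (ptens T (Ob P T) (Ob Q T) \<alpha> (\<beta> +[Ob Q T] \<gamma>)) =
    \<omega> (T, f) (ptens T (Ob P T) (Ob Q T) \<alpha> \<beta>) +[T] \<omega> (T, f) (ptens T (Ob P T) (Ob Q T) \<alpha> \<gamma>)"
    if c: "\<gamma> \<in> Q $ T" for \<gamma>
    using d(3)[OF T f p o(5)[OF a c]] a b c by (simp add: T.ptens_simps)
  {
    fix t assume t: "t \<in> carrier T"
    show 1: "\<omega> (T, f) (ptens T (Ob P T) (Ob Q T) (t \<cdot>[Ob P T] \<alpha>) \<beta>) = t *[T] \<omega> (T, f) (ptens T (Ob P T) (Ob Q T) \<alpha> \<beta>)"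
      unfolding o(4)[OF t a b, symmetric] by (rule d(4)[OF T f p t])
    then show "\<omega> (T, f) (ptens T (Ob P T) (Ob Q T) \<alpha> (t \<cdot>[Ob Q T] \<beta>)) = t *[T] \<omega> (T, f) (ptens T (Ob P T) (Ob Q T) \<alpha> \<beta>)"
      unfolding T.ptens_simps(3)[OF t a b] .
  }
  fix V g assume V: "V \<in> CAlg K" and g: "g \<in> alg_hom K T V"
  show "\<omega> (V, g o[S] f) (ptens V (Ob P V) (Ob Q V) (Ar P T V g \<alpha>) (Ar Q T V g \<beta>)) =
    g (\<omega> (T, f) (ptens T (Ob P T) (Ob Q T) \<alpha> \<beta>))"
    unfolding tens_Ar(3)[OF T V g a b, symmetric] by (rule d(5)[OF T f V g p])
qed

lemma dual_tens_eqI: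
  assumes \<omega>: "\<omega> \<in> dual_on K PQ S" "\<omega>' \<in> dual_on K PQ S"
    and eq: "\<And>T f \<alpha> \<beta>. T \<in> CAlg K ==> f \<in> alg_hom K S T ==> \<alpha> \<in> P $ T ==> \<beta> \<in> Q $ T ==>
    \<omega> (T, f) (ptens T (Ob P T) (Ob Q T) \<alpha> \<beta>) = \<omega>' (T, f) (ptens T (Ob P T) (Ob Q T) \<alpha> \<beta>)"
  shows "\<omega> = \<omega>'"
proof (rule dual_on_eqI[OF \<omega>])
  fix T f z assume T: "T \<in> CAlg K" and f: "f \<in> alg_hom K S T" and z: "z \<in> PQ $ T"
  show "\<omega> (T, f) z = \<omega>' (T, f) z"
    by (rule tens_eqI[OF T z, where D = T]) (simp_all only: dual_onD[OF \<omega>(1)] dual_onD[OF \<omega>(2)] T f eq)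
qed

definition dual_of :: "'u alg => ('u alg => ('u => 'u) => 'a => 'b => 'u) => ('u, ('a \<times> 'b \<Rightarrow>\<^sub>0 int) set) nt" where
  "dual_of S w = nt_restrict K PQ S (\<lambda>T f. tensor_lift T (\<lambda>(\<alpha>, \<beta>). w T f \<alpha> \<beta>))"

lemma dual_of:
  assumes S: "S \<in> CAlg K" and w: "binat K P Q S w"
  shows "dual_of S w \<in> dual_on K PQ S"
    "T \<in> CAlg K ==> f \<in> alg_hom K S T ==> \<alpha> \<in> P $ T ==> \<beta> \<in> Q $ T ==>
    dual_of S w (T, f) (ptens T (Ob P T) (Ob Q T) \<alpha> \<beta>) = w T f \<alpha> \<beta>"
proof -
  have l: "z \<in> PQ $ T ==> tensor_lift T (\<lambda>(\<alpha>, \<beta>). w T f \<alpha> \<beta>) z \<in> carrier T" (is "PROP ?A")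
     "y \<in> PQ $ T ==> z \<in> PQ $ T ==> tensor_lift T (\<lambda>(\<alpha>, \<beta>). w T f \<alpha> \<beta>) (y +[Ob PQ T] z) =
     tensor_lift T (\<lambda>(\<alpha>, \<beta>). w T f \<alpha> \<beta>) y +[T] tensor_lift T (\<lambda>(\<alpha>, \<beta>). w T f \<alpha> \<beta>) z" (is "PROP ?B")
     "\<alpha> \<in> P $ T ==> \<beta> \<in> Q $ T ==> tensor_lift T (\<lambda>(\<alpha>, \<beta>). w T f \<alpha> \<beta>) (ptens T (Ob P T) (Ob Q T) \<alpha> \<beta>) = w T f \<alpha> \<beta>" (is "PROP ?C")
    if T: "T \<in> CAlg K" and f: "f \<in> alg_hom K S T" for T f y z \<alpha> \<beta>
  proof -
    interpret T: two_modules T "Ob P T" "Ob Q T" by (rule two_mod[OF T])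
    have b: "bilin T (Ob P T) (Ob Q T) T (\<lambda>(\<alpha>, \<beta>). w T f \<alpha> \<beta>)"
      by (rule bilinI) (simp_all add: binatD[OF w T f])
    note l = T.tensor_lift_closed[OF CAlgD(4)[OF T] b] T.tensor_lift_add[OF CAlgD(4)[OF T] b]
      T.tensor_lift_ptens[OF CAlgD(4)[OF T] b]
    show "PROP ?A"
     "PROP ?B"
     "PROP ?C"
      using l by simp_all
  qed
  show "dual_of S w \<in> dual_on K PQ S"
    unfolding dual_of_def
  proof (rule nt_restrict_dual_on[OF mod_functor_tensor S])
    fix T f z assume T: "T \<in> CAlg K" and f: "f \<in> alg_hom K S T" and z: "z \<in> PQ $ T"
    interpret TT: cring T using T by (rule CAlg_cring)
    note o = tens_ops[OF T] and lT = l[OF T f]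
    show "tensor_lift T (\<lambda>(\<alpha>, \<beta>). w T f \<alpha> \<beta>) z \<in> carrier T" by (rule lT(1)[OF z])
    show "tensor_lift T (\<lambda>(\<alpha>, \<beta>). w T f \<alpha> \<beta>) (z +[Ob PQ T] y) =
     tensor_lift T (\<lambda>(\<alpha>, \<beta>). w T f \<alpha> \<beta>) z +[T] tensor_lift T (\<lambda>(\<alpha>, \<beta>). w T f \<alpha> \<beta>) y" if "y \<in> PQ $ T" for y
      by (rule lT(2)[OF z that])
    show "tensor_lift T (\<lambda>(\<alpha>, \<beta>). w T f \<alpha> \<beta>) (t \<cdot>[Ob PQ T] z) = t *[T] tensor_lift T (\<lambda>(\<alpha>, \<beta>). w T f \<alpha> \<beta>) z"
      if t: "t \<in> carrier T" for t
      by (rule tens_eqI[OF T z, where D = T])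
        (simp_all only: o t lT cP(2)[OF T t] binatD[OF w T f] TT.r_distr)
    fix V g assume V: "V \<in> CAlg K" and g: "g \<in> alg_hom K T V" and gf: "g o[S] f \<in> alg_hom K S V"
    show "tensor_lift V (\<lambda>(\<alpha>, \<beta>). w V (g o[S] f) \<alpha> \<beta>) (Ar PQ T V g z) = g (tensor_lift T (\<lambda>(\<alpha>, \<beta>). w T f \<alpha> \<beta>) z)"
      by (rule tens_eqI[OF T z, where D = V])
        (simp_all only: tens_Ar[OF T V g] lT l[OF V gf] sP(1)[OF T V g] sQ(1)[OF T V g] binatD[OF w T f] alg_homD(2)[OF g] V g)
  qed
  show "dual_of S w (T, f) (ptens T (Ob P T) (Ob Q T) \<alpha> \<beta>) = w T f \<alpha> \<beta>"
    if "T \<in> CAlg K" "f \<in> alg_hom K S T" "\<alpha> \<in> P $ T" "\<beta> \<in> Q $ T"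
    unfolding dual_of_def nt_restrict_apply[OF that(1,2) tens_ops(5)[OF that(1,3,4)]] by (rule l(3)[OF that])
qed

end

lemma nt_restrict_cong:
  "(\<And>T f x. T \<in> CAlg K ==> f \<in> alg_hom K S T ==> x \<in> X $ T ==> h T f x = h' T f x) ==>
    nt_restrict K X S h = nt_restrict K X S h'"
  by (auto simp: nt_restrict_def SAlg_iff fun_eq_iff restrict_def)

lemma tensor_map_facts:
  assumes MN: "two_modules R M N" and MN': "two_modules R M' N'" and u: "lin R M M' u" and v: "lin R N N' v"
  shows "X \<in> carrier (tensor R M N) ==> tensor_map R M' N' (map_prod u v) X \<in> carrier (tensor R M' N')" (is "PROP ?A")
    "X \<in> carrier (tensor R M N) ==> Y \<in> carrier (tensor R M N) ==>
    tensor_map R M' N' (map_prod u v) (X +[tensor R M N] Y) =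
    tensor_map R M' N' (map_prod u v) X +[tensor R M' N'] tensor_map R M' N' (map_prod u v) Y" (is "PROP ?B")
    "m \<in> carrier M ==> n \<in> carrier N ==>
    tensor_map R M' N' (map_prod u v) (ptens R M N m n) = ptens R M' N' (u m) (v n)" (is "PROP ?C")
proof -
  interpret P: two_modules R M N by (rule MN)
  interpret Q: two_modules R M' N' by (rule MN')
  have e: "tensor_map R M' N' (map_prod u v) X = tensor_lift (tensor R M' N') (\<lambda>p. ptens R M' N' (u (fst p)) (v (snd p))) X"
    if "X \<in> carrier (tensor R M N)" for X
    using tensor_map_lift[OF MN MN', of "map_prod u v" X] that linD(1)[OF u] linD(1)[OF v] by simp
  have b: "bilin R M N (tensor R M' N') (\<lambda>p. ptens R M' N' (u (fst p)) (v (snd p)))"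
    by (rule bilinI) (simp_all add: linD[OF u] linD[OF v] Q.ptens_closed Q.ptens_simps)
  note l = P.tensor_lift_closed[OF Q.abelian_group_tensor b] P.tensor_lift_add[OF Q.abelian_group_tensor b]
    P.tensor_lift_ptens[OF Q.abelian_group_tensor b]
  have c: "X +[tensor R M N] Y \<in> carrier (tensor R M N)" if "X \<in> carrier (tensor R M N)" "Y \<in> carrier (tensor R M N)" for X Y
    by (rule abelian_monoid.a_closed[OF abelian_group.axioms(1)[OF P.abelian_group_tensor] that])
  show "PROP ?A"
    using e l(1) by simp
  show "PROP ?B"
    using e c l(2) by simp
  show "PROP ?C"
    using e[OF P.ptens_closed] l(3) by simp
qed

section \<open>The completed tensor product consists of the functions on \<open>X \<times> X\<close>\<close>

context pairing
begin

interpretation K: field K by (rule K_field)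

abbreviation "DB \<equiv> dual K B"
abbreviation "BB \<equiv> tensor_functor DB DB"

lemmas modDB = mod_functor_dual[OF modB]

definition ptd :: "'u alg => ('u, 'b) nt => ('u, 'b) nt => (('u, 'b) nt \<times> ('u, 'b) nt \<Rightarrow>\<^sub>0 int) set" where
  "ptd T \<alpha> \<beta> = ptens T (Ob DB T) (Ob DB T) \<alpha> \<beta>"

text \<open>The function on \<open>X \<times> X\<close> given by an element of the completed tensor
  product. By \<open>on_pts_inj\<close> and \<open>on_pts_ex\<close> this is a bijection onto the
  natural functions.\<close>

definition on_pts :: "('u, (('u, 'b) nt \<times> ('u, 'b) nt \<Rightarrow>\<^sub>0 int) set) nt => 'u alg => ('u => 'u) => 'x => 'x => 'u" where
  "on_pts \<omega> T f x y = \<omega> (T, f) (ptd T (hat T x) (hat T y))"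

text \<open>With the second argument fixed, a bilinear family is a form on the dual of
  \<open>B\<close> over \<open>T\<close>, so reflexivity represents it by an element
  \<open>L\<close> of \<open>B\<close>.\<close>

lemma binat_left:
  assumes S: "S \<in> CAlg K" and w: "binat K DB DB S w" and T: "T \<in> CAlg K" and f: "f \<in> alg_hom K S T" and \<beta>: "\<beta> \<in> dual_on K B T"
  defines "\<Omega> \<equiv> nt_restrict K DB T (\<lambda>V g \<alpha>. w V (g o[S] f) \<alpha> (Ar DB T V g \<beta>))"
  shows "\<Omega> \<in> dual_on K DB T"
    "\<exists>L\<in>B $ T. \<forall>V g \<alpha>. V \<in> CAlg K --> g \<in> alg_hom K T V --> \<alpha> \<in> dual_on K B V -->
    w V (g o[S] f) \<alpha> (Ar DB T V g \<beta>) = \<alpha> (V, idm V) (Ar B T V g L)" (is "PROP ?A")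
proof -
  note a = dual_on_Ar[OF modB T _ _ \<beta>] and sD = set_functorD[OF mod_functorD(1)[OF modDB]]
  show \<Omega>: "\<Omega> \<in> dual_on K DB T"
    unfolding \<Omega>_def
  proof (rule nt_restrict_dual_on[OF modDB T], unfold carrier_dual)
    fix V g U h \<alpha> assume *: "V \<in> CAlg K" "g \<in> alg_hom K T V" "U \<in> CAlg K" "h \<in> alg_hom K V U" "\<alpha> \<in> dual_on K B V"
    show "w U ((h o[T] g) o[S] f) (Ar DB V U h \<alpha>) (Ar DB T U (h o[T] g) \<beta>) =
      h (w V (g o[S] f) \<alpha> (Ar DB T V g \<beta>))"
      using binatD(6)[OF w *(1) compose_CAlg[OF S f *(2)] _ _ *(3,4), of \<alpha> "Ar DB T V g \<beta>"] *(5) a[OF *(1,2)] \<beta>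
        sD(3)[OF T *(1,3,2,4), of \<beta>] by (simp add: compose_compose[OF f])
  qed (use binatD[OF w _ compose_CAlg[OF S f]] a in simp_all)
  from reflexive_ex[OF modB rB T \<Omega>]
  show "PROP ?A"
    unfolding \<Omega>_def by simp
qed

lemma binat_swap: "binat K DB DB S w ==> binat K DB DB S (\<lambda>T f \<alpha> \<beta>. w T f \<beta> \<alpha>)"
  unfolding binat_def by blast

lemma idm_compose_left: "T \<in> CAlg K ==> \<beta> \<in> dual_on K B T ==> Ar DB T T (idm T) \<beta> = \<beta>"
  using set_functorD(2)[OF mod_functorD(1)[OF modDB]] by simp

text \<open>\<open>dual_density\<close> is used in one variable at a time: first one argument
  becomes a point, then, after \<open>binat_swap\<close>, the other. The base changes on the way
  send points to points by \<open>hat_Ar\<close>.\<close>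

lemma binat_density:
  assumes S: "S \<in> CAlg K" and w: "binat K DB DB S w" and w': "binat K DB DB S w'"
    and eq: "\<And>T f x y. T \<in> CAlg K ==> f \<in> alg_hom K S T ==> x \<in> X $ T ==> y \<in> X $ T ==>
    w T f (hat T x) (hat T y) = w' T f (hat T x) (hat T y)"
    and T: "T \<in> CAlg K" and f: "f \<in> alg_hom K S T" and \<alpha>: "\<alpha> \<in> dual_on K B T" and \<beta>: "\<beta> \<in> dual_on K B T"
  shows "w T f \<alpha> \<beta> = w' T f \<alpha> \<beta>"
proof -
  have step: "v T f \<alpha> \<beta> = v' T f \<alpha> \<beta>"
    if v: "binat K DB DB S v" "binat K DB DB S v'" and T: "T \<in> CAlg K" and f: "f \<in> alg_hom K S T"
      and \<alpha>: "\<alpha> \<in> dual_on K B T" and \<beta>: "\<beta> \<in> dual_on K B T"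
      and eq: "\<And>V g x. V \<in> CAlg K ==> g \<in> alg_hom K T V ==> x \<in> X $ V ==>
      v V (g o[S] f) (hat V x) (Ar DB T V g \<beta>) = v' V (g o[S] f) (hat V x) (Ar DB T V g \<beta>)"
    for v v' T f \<alpha> \<beta>
  proof -
    note i = idm_CAlg[OF T]
    have "nt_restrict K DB T (\<lambda>V g \<alpha>. v V (g o[S] f) \<alpha> (Ar DB T V g \<beta>)) =
      nt_restrict K DB T (\<lambda>V g \<alpha>. v' V (g o[S] f) \<alpha> (Ar DB T V g \<beta>))"
      by (rule dual_density[OF T binat_left(1)[OF S v(1) T f \<beta>] binat_left(1)[OF S v(2) T f \<beta>]]) (simp add: hat_dual eq)
    from fun_cong[OF fun_cong[OF this, of "(T, idm T)"], of \<alpha>] show ?thesis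
      using T i \<alpha> \<beta> by (simp add: compose_idm_left[OF f] idm_compose_left)
  qed
  show ?thesis
  proof (rule step[OF w w' T f \<alpha> \<beta>])
    fix V g x assume V: "V \<in> CAlg K" and g: "g \<in> alg_hom K T V" and x: "x \<in> X $ V"
    show "w V (g o[S] f) (hat V x) (Ar DB T V g \<beta>) = w' V (g o[S] f) (hat V x) (Ar DB T V g \<beta>)"
    proof (rule step[OF binat_swap[OF w] binat_swap[OF w'] V compose_CAlg[OF S f g] dual_on_Ar[OF modB T V g \<beta>] hat_dual[OF V x]])
      fix U h y assume U: "U \<in> CAlg K" and h: "h \<in> alg_hom K V U" and y: "y \<in> X $ U"
      show "w U (h o[S] (g o[S] f)) (Ar DB V U h (hat V x)) (hat U y) =
        w' U (h o[S] (g o[S] f)) (Ar DB V U h (hat V x)) (hat U y)"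
        unfolding hat_Ar[OF V U h x]
        by (rule eq[OF U compose_CAlg[OF S compose_CAlg[OF S f g] h] sX(1)[OF V U h x] y])
    qed
  qed
qed

text \<open>A function on \<open>X \<times> X\<close> is integrated successively in its two variables.\<close>

lemma binat_ex:
  assumes S: "S \<in> CAlg K"
    and c: "\<And>T f x y. T \<in> CAlg K ==> f \<in> alg_hom K S T ==> x \<in> X $ T ==> y \<in> X $ T ==> F T f x y \<in> carrier T"
    and n: "\<And>T f V g x y. T \<in> CAlg K ==> f \<in> alg_hom K S T ==> V \<in> CAlg K ==> g \<in> alg_hom K T V ==>
    x \<in> X $ T ==> y \<in> X $ T ==>
    F V (g o[S] f) (Ar X T V g x) (Ar X T V g y) = g (F T f x y)"
  shows "\<exists>w. binat K DB DB S w \<and> (\<forall>T f x y. T \<in> CAlg K --> f \<in> alg_hom K S T --> x \<in> X $ T -->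
    y \<in> X $ T --> w T f (hat T x) (hat T y) = F T f x y)"
proof -
  note cm = compose_CAlg
  \<comment> \<open>With \<open>x\<close> fixed, the partial function \<open>y |-> F (x, y)\<close>
    as an element of \<open>B\<close>.\<close>
  define C where "C T f x = repr T (\<lambda>V g y. F V (g o[S] f) (Ar X T V g x) y)" for T f x
  have C: "C T f x \<in> B $ T"
    "\<And>V g y. V \<in> CAlg K ==> g \<in> alg_hom K T V ==> y \<in> X $ V ==>
    ev V y (Ar B T V g (C T f x)) = F V (g o[S] f) (Ar X T V g x) y"
    if T: "T \<in> CAlg K" and f: "f \<in> alg_hom K S T" and x: "x \<in> X $ T" for T f x
    unfolding C_def
    by (rule repr[OF T]; simp add: c cm[OF S f] sX(1)[OF T _ _ x] sX(3)[OF T _ _ _ _ x] compose_compose[OF f, symmetric] n)+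
  have CAr: "Ar B T V g (C T f x) = C V (g o[S] f) (Ar X T V g x)"
    if T: "T \<in> CAlg K" and f: "f \<in> alg_hom K S T" and x: "x \<in> X $ T" and V: "V \<in> CAlg K" and g: "g \<in> alg_hom K T V"
    for T f x V g
  proof -
    note gf = cm[OF S f g] and gx = sX(1)[OF T V g x]
    show ?thesis
      by (rule fun_sep[OF V sB(1)[OF T V g C(1)[OF T f x]] C(1)[OF V gf gx]])
        (simp add: sB(3)[OF T V _ g _ C(1)[OF T f x], symmetric] C(2)[OF T f x] C(2)[OF V gf gx] cm[OF T g]
          sX(3)[OF T V _ g _ x] compose_compose[OF f])
  qed
  \<comment> \<open>Pairing the partial functions with \<beta> leaves a function of
    \<open>x\<close>, again an element of \<open>B\<close>; applying \<alpha> to it gives the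
    bilinear family \<open>w\<close>.\<close>
  define G where "G T f \<beta> = repr T (\<lambda>V g x. \<beta> (V, g) (C V (g o[S] f) x))" for T f and \<beta> :: "('u, 'b) nt"
  have G: "G T f \<beta> \<in> B $ T"
    "\<And>V g x. V \<in> CAlg K ==> g \<in> alg_hom K T V ==> x \<in> X $ V ==>
    ev V x (Ar B T V g (G T f \<beta>)) = \<beta> (V, g) (C V (g o[S] f) x)"
    if T: "T \<in> CAlg K" and f: "f \<in> alg_hom K S T" and \<beta>: "\<beta> \<in> dual_on K B T" for T f \<beta>
    unfolding G_def
    by (rule repr[OF T]; simp add: dual_onD[OF \<beta>] C(1) cm[OF S f] compose_compose[OF f, symmetric] CAr[OF _ cm[OF S f], symmetric])+
  have Geq: "b = G T f \<beta>" if T: "T \<in> CAlg K" and f: "f \<in> alg_hom K S T" and \<beta>: "\<beta> \<in> dual_on K B T" and b: "b \<in> B $ T"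
    and e: "\<And>V g x. V \<in> CAlg K ==> g \<in> alg_hom K T V ==> x \<in> X $ V ==>
    ev V x (Ar B T V g b) = \<beta> (V, g) (C V (g o[S] f) x)" for T f \<beta> b
    by (rule fun_sep[OF T b G(1)[OF T f \<beta>]]) (simp add: e G(2)[OF T f \<beta>])
  define w where "w T f \<alpha> \<beta> = \<alpha> (T, idm T) (G T f \<beta>)" for T f and \<alpha> \<beta> :: "('u, 'b) nt"
  have "binat K DB DB S w"
    unfolding binat_def carrier_dual w_def
  proof (intro ballI conjI)
    fix T f \<alpha> \<beta> assume T: "T \<in> CAlg K" and f: "f \<in> alg_hom K S T" and \<alpha>: "\<alpha> \<in> dual_on K B T" and \<beta>: "\<beta> \<in> dual_on K B T"
    note i = idm_CAlg[OF T] and g = G(1)[OF T f \<beta>]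
    show "\<alpha> (T, idm T) (G T f \<beta>) \<in> carrier T" by (rule dual_onD(2)[OF \<alpha> T i g])
    show "(\<alpha> +[Ob DB T] \<gamma>) (T, idm T) (G T f \<beta>) = \<alpha> (T, idm T) (G T f \<beta>) +[T] \<gamma> (T, idm T) (G T f \<beta>)" for \<gamma>
      by (rule dual_apply(1)[OF T i g])
    show "\<alpha> (T, idm T) (G T f (\<beta> +[Ob DB T] \<gamma>)) = \<alpha> (T, idm T) (G T f \<beta>) +[T] \<alpha> (T, idm T) (G T f \<gamma>)"
      if \<gamma>: "\<gamma> \<in> dual_on K B T" for \<gamma>
    proof -
      note g' = G(1)[OF T f \<gamma>]
      have "G T f \<beta> +[Ob B T] G T f \<gamma> = G T f (\<beta> +[Ob DB T] \<gamma>)"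
        by (rule Geq[OF T f dual_on_ops(1)[OF modB T \<beta> \<gamma>] clB(1)[OF T g g']])
          (simp add: mod_functorD(3)[OF modB T _ _ g g'] ev_add sB(1)[OF T _ _ g] sB(1)[OF T _ _ g'] G(2)[OF T f \<beta>] G(2)[OF T f \<gamma>]
            dual_apply C(1) cm[OF S f])
      then show ?thesis using dual_onD(3)[OF \<alpha> T i g g'] by simp
    qed
    fix t assume t: "t \<in> carrier T"
    show "(t \<cdot>[Ob DB T] \<alpha>) (T, idm T) (G T f \<beta>) = t *[T] \<alpha> (T, idm T) (G T f \<beta>)"
      using dual_apply(2)[OF T i g] t by simp
    have "t \<cdot>[Ob B T] G T f \<beta> = G T f (t \<cdot>[Ob DB T] \<beta>)"
      by (rule Geq[OF T f dual_on_ops(2)[OF modB T t \<beta>] clB(2)[OF T t g]])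
        (simp add: mod_functorD(4)[OF modB T _ _ g t] ev_smult sB(1)[OF T _ _ g] G(2)[OF T f \<beta>] alg_homD(1)[OF _ t]
          dual_apply C(1) cm[OF S f])
    then show "\<alpha> (T, idm T) (G T f (t \<cdot>[Ob DB T] \<beta>)) = t *[T] \<alpha> (T, idm T) (G T f \<beta>)"
      using dual_onD(4)[OF \<alpha> T i g t] by simp
  next
    fix T f \<alpha> \<beta> V g assume T: "T \<in> CAlg K" and f: "f \<in> alg_hom K S T" and \<alpha>: "\<alpha> \<in> dual_on K B T" and \<beta>: "\<beta> \<in> dual_on K B T"
      and V: "V \<in> CAlg K" and g: "g \<in> alg_hom K T V"
    note i = idm_CAlg[OF T] and Gb = G(1)[OF T f \<beta>]
    have "Ar B T V g (G T f \<beta>) = G V (g o[S] f) (Ar DB T V g \<beta>)"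
      by (rule Geq[OF V cm[OF S f g] dual_on_Ar[OF modB T V g \<beta>] sB(1)[OF T V g Gb]])
        (simp add: sB(3)[OF T V _ g _ Gb, symmetric] G(2)[OF T f \<beta>] cm[OF T g] dual_apply C(1) cm[OF S] cm[OF S f] f g
          compose_compose[OF f])
    then show "Ar DB T V g \<alpha> (V, idm V) (G V (g o[S] f) (Ar DB T V g \<beta>)) = g (\<alpha> (T, idm T) (G T f \<beta>))"
      using dual_on_idm_Ar[OF modB \<alpha> T V g sB(1)[OF T V g Gb]] dual_onD(5)[OF \<alpha> T i V g Gb]
      by (simp add: compose_idm_right[OF g])
  qed
  moreover have "w T f (hat T x) (hat T y) = F T f x y"
    if T: "T \<in> CAlg K" and f: "f \<in> alg_hom K S T" and x: "x \<in> X $ T" and y: "y \<in> X $ T" for T f x y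
  proof -
    note i = idm_CAlg[OF T] and hy = hat_dual[OF T y]
    note g = G(1)[OF T f hy]
    have "ev T x (G T f (hat T y)) = ev T y (C T f x)"
      using G(2)[OF T f hy T i x] C(1)[OF T f x] by (simp add: sB(2)[OF T g] compose_idm_left[OF f] hat_idm[OF T y])
    also have "\<dots> = F T f x y"
      using C(2)[OF T f x T i y] by (simp add: sB(2)[OF T C(1)[OF T f x]] compose_idm_left[OF f] sX(2)[OF T x])
    finally show ?thesis by (simp add: w_def hat_idm[OF T x g])
  qed
  ultimately show ?thesis by blast
qed

lemma on_pts_closed:
  "S \<in> CAlg K ==> \<omega> \<in> dual_on K BB S ==> T \<in> CAlg K ==> f \<in> alg_hom K S T ==> x \<in> X $ T ==> y \<in> X $ T ==>
    on_pts \<omega> T f x y \<in> carrier T"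
  using binatD(1)[OF binat_of_dual[OF modDB modDB]] hat_dual by (simp add: on_pts_def ptd_def)

lemma on_pts_nat:
  assumes S: "S \<in> CAlg K" and \<omega>: "\<omega> \<in> dual_on K BB S" and T: "T \<in> CAlg K" and f: "f \<in> alg_hom K S T"
    and x: "x \<in> X $ T" and y: "y \<in> X $ T" and V: "V \<in> CAlg K" and g: "g \<in> alg_hom K T V"
  shows "on_pts \<omega> V (g o[S] f) (Ar X T V g x) (Ar X T V g y) = g (on_pts \<omega> T f x y)"
  using binatD(6)[OF binat_of_dual[OF modDB modDB S \<omega>] T f _ _ V g, of "hat T x" "hat T y"] hat_dual[OF T x] hat_dual[OF T y]
  by (simp add: on_pts_def ptd_def hat_Ar[OF T V g x] hat_Ar[OF T V g y])

lemma on_pts_inj: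
  assumes S: "S \<in> CAlg K" and \<omega>: "\<omega> \<in> dual_on K BB S" and \<omega>': "\<omega>' \<in> dual_on K BB S"
    and eq: "\<And>T f x y. T \<in> CAlg K ==> f \<in> alg_hom K S T ==> x \<in> X $ T ==> y \<in> X $ T ==>
    on_pts \<omega> T f x y = on_pts \<omega>' T f x y"
  shows "\<omega> = \<omega>'"
proof (rule dual_tens_eqI[OF modDB modDB \<omega> \<omega>'], unfold carrier_dual)
  fix T f \<alpha> \<beta> assume *: "T \<in> CAlg K" "f \<in> alg_hom K S T" "\<alpha> \<in> dual_on K B T" "\<beta> \<in> dual_on K B T"
  show "\<omega> (T, f) (ptens T (Ob DB T) (Ob DB T) \<alpha> \<beta>) = \<omega>' (T, f) (ptens T (Ob DB T) (Ob DB T) \<alpha> \<beta>)"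
    by (rule binat_density[OF S binat_of_dual[OF modDB modDB S \<omega>] binat_of_dual[OF modDB modDB S \<omega>'] _ *])
      (rule eq[unfolded on_pts_def ptd_def])
qed

lemma on_pts_ex:
  assumes S: "S \<in> CAlg K"
    and c: "\<And>T f x y. T \<in> CAlg K ==> f \<in> alg_hom K S T ==> x \<in> X $ T ==> y \<in> X $ T ==> F T f x y \<in> carrier T"
    and n: "\<And>T f V g x y. T \<in> CAlg K ==> f \<in> alg_hom K S T ==> V \<in> CAlg K ==> g \<in> alg_hom K T V ==>
    x \<in> X $ T ==> y \<in> X $ T ==>
    F V (g o[S] f) (Ar X T V g x) (Ar X T V g y) = g (F T f x y)"
  shows "\<exists>\<omega>\<in>dual_on K BB S. \<forall>T f x y. T \<in> CAlg K --> f \<in> alg_hom K S T --> x \<in> X $ T -->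
    y \<in> X $ T --> on_pts \<omega> T f x y = F T f x y"
proof -
  obtain w where w: "binat K DB DB S w" "\<forall>T f x y. T \<in> CAlg K --> f \<in> alg_hom K S T --> x \<in> X $ T -->
    y \<in> X $ T --> w T f (hat T x) (hat T y) = F T f x y" using binat_ex[where F=F, OF S c n] by blast
  show ?thesis
    using dual_of[OF modDB modDB S w(1)] w(2) hat_dual
    by (intro bexI[of _ "dual_of K DB DB S w"]) (simp_all add: on_pts_def ptd_def)
qed

section \<open>Projections of the completed tensor product to products of quotients\<close>

definition qchar :: "'u alg => 'u alg => ('u => 'u) => ('u, 'u) nt" where
  "qchar A V j = nt_restrict K (qc K A) V (\<lambda>U h z. act A U (h o[A] j) z)"

lemma qchar_dual:
  assumes A: "A \<in> CAlg K" and V: "V \<in> CAlg K" and j: "j \<in> alg_hom K A V"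
  shows "qchar A V j \<in> dual_on K (qc K A) V"
  unfolding qchar_def
  by (rule nt_restrict_dual_on[OF mod_functor_qc[OF CAlg_AAlg[OF A]] V])
    (simp_all only: qc_simps act_facts[OF A _ compose_CAlg[OF A j]] act_smult[OF A _ compose_CAlg[OF A j]]
      act_nat[OF A _ compose_CAlg[OF A j]] compose_compose[OF j, symmetric])

text \<open>Characters of a quotient, pulled back to \<open>B\<close>, are the points in the form in
  which \<open>factor\<close> describes all of \<open>X\<close>; pairings with such characters
  therefore reach every pair of points.\<close>

lemma qchar_pullback:
  assumes q: "(A, p) \<in> qc_quotients K B" and V: "V \<in> CAlg K" and j: "j \<in> alg_hom K A V"
  shows "dual_map K B (qc K A) p V (qchar A V j) = hat V (Ar X A V j (qpt A p))"
proof -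
  note A = quotient_CAlg[OF q]
  note d = qchar_dual[OF A V j] and x = sX(1)[OF A V j qpt(1)[OF q]]
  show ?thesis
  proof (rule dual_on_eqI[OF dual_map_dual_on[OF modB Alg_morD(1)[OF quotient_mor[OF q]] V d] hat_dual[OF V x]])
    fix U h b assume U: "U \<in> CAlg K" and h: "h \<in> alg_hom K V U" and b: "b \<in> B $ U"
    show "dual_map K B (qc K A) p V (qchar A V j) (U, h) b = hat V (Ar X A V j (qpt A p)) (U, h) b"
      unfolding dual_map_apply[OF V d U h b]
      using ev_qpt[OF q U compose_CAlg[OF A j h] b] quotient_closed[OF q U b]
      by (simp add: qchar_def U h hat_apply[OF U h b] sX(3)[OF A V U j h qpt(1)[OF q]])
  qed
qed

context
  fixes A p A' q S
  assumes p: "(A, p) \<in> qc_quotients K B" and q: "(A', q) \<in> qc_quotients K B" and S: "S \<in> CAlg K"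
begin

lemmas A = quotient_CAlg[OF p] and A' = quotient_CAlg[OF q]
lemmas AS = inlr[OF A S]
lemmas D = inlr[OF A' AS(1)]

abbreviation "TS \<equiv> Ob (tensor_functor (qc K A) (qc K A')) S"
abbreviation "tq T \<equiv> ptens T (Ob (qc K A) T) (Ob (qc K A') T)"
abbreviation "DD \<equiv> tens K A' (tens K A S)"
abbreviation "d1 \<equiv> ((inr A' (tens K A S)) o[A] inl A S)"
abbreviation "dS \<equiv> ((inr A' (tens K A S)) o[S] inr A S)"

lemmas d1 = compose_CAlg[OF A AS(2) D(3)] and dS = compose_CAlg[OF S AS(3) D(3)]
lemmas qcA = mod_functor_qc[OF CAlg_AAlg[OF A]] and qcA' = mod_functor_qc[OF CAlg_AAlg[OF A']]
lemmas AA = CAlg_AAlg[OF A] CAlg_AAlg[OF A'] CAlg_AAlg[OF S] CAlg_AAlg[OF AS(1)]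

text \<open>The value at the pair of universal points of \<open>A\<close> and \<open>A'\<close>,
  both moved to \<open>DD = A' \<otimes> (A \<otimes> S)\<close>, where they coexist over
  \<open>S\<close>.\<close>

definition val :: "('u, (('u, 'b) nt \<times> ('u, 'b) nt \<Rightarrow>\<^sub>0 int) set) nt => 'u" where
  "val \<omega> = on_pts \<omega> DD dS (Ar X A DD d1 (qpt A p)) (Ar X A' DD (inl A' (tens K A S)) (qpt A' q))"

text \<open>The identification of \<open>DD\<close> with the product over \<open>S\<close> of
  \<open>A \<otimes> S\<close> and \<open>A' \<otimes> S\<close>; the two factors are
  exchanged.\<close>

definition psi :: "'u => ('u \<times> 'u \<Rightarrow>\<^sub>0 int) set" where
  "psi = tlift A' (tens K A S) TS (\<lambda>(a, u). tq S u (pt A' S a 1[S]))"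

interpretation TQ: two_algebras S "Ob (qc K A) S" "Ob (qc K A') S"
  using alg_functorD(3)[OF alg_functor_qc[OF AA(1)] S] alg_functorD(3)[OF alg_functor_qc[OF AA(2)] S] by unfold_locales

interpretation Sr: cring S using S by (rule CAlg_cring)
interpretation Ar: cring A using A by (rule CAlg_cring)
interpretation A'r: cring A' using A' by (rule CAlg_cring)

lemma scal:
  assumes C: "C \<in> CAlg K" and k: "k \<in> carrier K" and z: "z \<in> carrier (tens K C S)"
  shows "k \<cdot>[tens K C S] z = pt C S 1[C] (k \<cdot>[S] 1[S]) *[tens K C S] z"
proof -
  note C' = CAlg_AAlg[OF C] and S' = CAlg_AAlg[OF S]
  interpret SM: module K S using S by (rule CAlgD)
  interpret C: cring C using C by (rule CAlg_cring)
  interpret TM: module K "tens K C S" using inlr(1)[OF C S] by (rule CAlgD)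
  interpret TC: cring "tens K C S" using inlr(1)[OF C S] by (rule CAlg_cring)
  show ?thesis
    by (rule tens_hom_eqI[OF C' S' z, where P = "tens K C S"])
      (use k in \<open>simp_all add: TM.smult_r_distr TC.r_distr pt_closed[OF C' S'] pt_mult[OF C' S']
        pt_smult[OF C' S'] pt_balanced[OF C' S'] AAlg_smult_assoc[OF S']\<close>)
qed

lemma psi_bilin: "bilin K A' (tens K A S) TS (\<lambda>(a, u). tq S u (pt A' S a 1[S]))"
proof (rule bilinI, unfold prod.case)
  interpret SM: module K S using S by (rule CAlgD)
  fix r a u assume r: "r \<in> carrier K" and a: "a \<in> carrier A'" and u: "u \<in> carrier (tens K A S)"
  have rs: "r \<cdot>[S] 1[S] \<in> carrier S" using r by simp
  have v: "pt A' S a 1[S] \<in> carrier (tens K A' S)" using a by (simp add: pt_closed[OF AA(2,3)])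
  have "tq S (r \<cdot>[tens K A S] u) (pt A' S a 1[S]) = tq S ((r \<cdot>[S] 1[S]) \<cdot>[Ob (qc K A) S] u) (pt A' S a 1[S])"
    using scal[OF A r u] by simp
  also have "\<dots> = tq S u ((r \<cdot>[S] 1[S]) \<cdot>[Ob (qc K A') S] pt A' S a 1[S])"
    by (rule TQ.ptens_simps(3)) (use rs u v in simp_all)
  also have "\<dots> = tq S u (pt A' S (r \<cdot>[A'] a) 1[S])"
    using a r by (simp add: pt_mult[OF AA(2,3)] pt_balanced[OF AA(2,3)])
  finally show "tq S u (pt A' S (r \<cdot>[A'] a) 1[S]) = tq S (r \<cdot>[tens K A S] u) (pt A' S a 1[S])" by simp
qed (use TQ.ptens_simps TQ.ptens_closed in \<open>simp_all add: pt_closed[OF AA(2,3)] pt_add_left[OF AA(2,3)]\<close>)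

lemmas agTS = TQ.abelian_group_tensor[folded tensor_functor_simps(1)[of "qc K A" "qc K A'" S]]
lemmas psi_facts = tlift_closed[OF AA(2,4) agTS psi_bilin, folded psi_def] tlift_add[OF AA(2,4) agTS psi_bilin, folded psi_def]
  tlift_pt[OF AA(2,4) agTS psi_bilin, folded psi_def, unfolded prod.case]

lemma psi_ring_hom: "psi \<in> ring_hom DD TS"
proof (rule ring_hom_memI)
  interpret DR: cring DD using D(1) by (rule CAlg_cring)
  interpret TR: ring TS using TQ.assoc_algebra_tensor by (simp add: assoc_algebra_def)
  interpret ASr: cring "tens K A S" using AS(1) by (rule CAlg_cring)
  note p1 = pt_closed[OF AA(2,3) _ CAlg_closed(3)[OF S]]
  show "psi (y *[DD] z) = psi y *[TS] psi z" if y: "y \<in> carrier DD" and z: "z \<in> carrier DD" for y z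
  proof (rule tens_hom_eqI[OF AA(2,4) y, where P = TS])
    fix a u assume au: "a \<in> carrier A'" "u \<in> carrier (tens K A S)"
    show "psi (pt A' (tens K A S) a u *[DD] z) = psi (pt A' (tens K A S) a u) *[TS] psi z"
    proof (rule tens_hom_eqI[OF AA(2,4) z, where P = TS])
      fix b v assume bv: "b \<in> carrier A'" "v \<in> carrier (tens K A S)"
      show "psi (pt A' (tens K A S) a u *[DD] pt A' (tens K A S) b v) = psi (pt A' (tens K A S) a u) *[TS] psi (pt A' (tens K A S) b v)"
        using au bv TQ.mult_ptens[of u "pt A' S a 1[S]" v "pt A' S b 1[S]"]
        by (simp add: pt_mult[OF AA(2,4)] pt_mult[OF AA(2,3)] psi_facts p1)
    qed (use au in \<open>simp_all only: psi_facts(1,2) DR.r_distr TR.r_distr pt_closed[OF AA(2,4)] DR.m_closed\<close>)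
  qed (use z in \<open>simp_all only: psi_facts(1,2) DR.l_distr TR.l_distr DR.m_closed\<close>)
  show "psi 1[DD] = 1[TS]"
    using TQ.one_ptens by (simp add: pt_one[OF AA(2,4)] pt_one[OF AA(2,3)] psi_facts)
qed (simp_all only: psi_facts)

text \<open>The inner lift of \<open>tensor_eval\<close>, with \<alpha> and \<beta> fixed.\<close>

definition pairq :: "'u alg => ('u, 'u) nt => ('u, 'u) nt => ('u \<times> 'u \<Rightarrow>\<^sub>0 int) set => 'u" where
  "pairq T \<alpha> \<beta> = tensor_lift T (\<lambda>(m, n). \<alpha> (T, idm T) m *[T] \<beta> (T, idm T) n)"

abbreviation "QQ \<equiv> tensor_functor (qc K A) (qc K A')"
abbreviation "DQ \<equiv> dual K (qc K A)"
abbreviation "DQ' \<equiv> dual K (qc K A')"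

lemma pairq:
  assumes T: "T \<in> CAlg K" and \<alpha>: "\<alpha> \<in> dual_on K (qc K A) T" and \<beta>: "\<beta> \<in> dual_on K (qc K A') T"
  shows "u \<in> QQ $ T ==> pairq T \<alpha> \<beta> u \<in> carrier T" (is "PROP ?A")
    "u \<in> QQ $ T ==> v \<in> QQ $ T ==> pairq T \<alpha> \<beta> (u +[Ob QQ T] v) = pairq T \<alpha> \<beta> u +[T] pairq T \<alpha> \<beta> v" (is "PROP ?B")
    "m \<in> carrier (tens K A T) ==> n \<in> carrier (tens K A' T) ==>
    pairq T \<alpha> \<beta> (tq T m n) = \<alpha> (T, idm T) m *[T] \<beta> (T, idm T) n" (is "PROP ?C")
proof -
  interpret Q: two_modules T "Ob (qc K A) T" "Ob (qc K A') T" by (rule two_mod[OF qcA qcA' T])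
  note i = idm_CAlg[OF T]
  have b: "bilin T (Ob (qc K A) T) (Ob (qc K A') T) T (\<lambda>(m, n). \<alpha> (T, idm T) m *[T] \<beta> (T, idm T) n)"
    by (rule bilinI, unfold prod.case)
      (simp_all only: dual_onD(2-4)[OF \<alpha> T i] dual_onD(2-4)[OF \<beta> T i] cring.cring_simprules[OF CAlg_cring[OF T]])
  note l = Q.tensor_lift_closed[OF CAlgD(4)[OF T] b, folded pairq_def] Q.tensor_lift_add[OF CAlgD(4)[OF T] b, folded pairq_def]
    Q.tensor_lift_ptens[OF CAlgD(4)[OF T] b, folded pairq_def]
  show "PROP ?A"
    "PROP ?B"
    "PROP ?C"
    using l by simp_all
qed

lemma tq_Ar:
  assumes T: "T \<in> CAlg K" and V: "V \<in> CAlg K" and f: "f \<in> alg_hom K T V"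
    and m: "m \<in> carrier (tens K A T)" and n: "n \<in> carrier (tens K A' T)"
  shows "Ar QQ T V f (tq T m n) = tq V (tmr A T V f m) (tmr A' T V f n)"
  using tens_Ar(3)[OF qcA qcA' T V f, of m n] m n by (simp only: qc_simps tmr_def)

lemma pairq_binat:
  assumes t: "t \<in> carrier TS"
  shows "binat K DQ DQ' S (\<lambda>T f \<alpha> \<beta>. pairq T \<alpha> \<beta> (Ar QQ S T f t))"
  unfolding binat_def carrier_dual
proof (intro ballI conjI)
  fix T f \<alpha> \<beta> assume T: "T \<in> CAlg K" and f: "f \<in> alg_hom K S T" and \<alpha>: "\<alpha> \<in> dual_on K (qc K A) T" and \<beta>: "\<beta> \<in> dual_on K (qc K A') T"
  note i = idm_CAlg[OF T] and z = tens_Ar(1)[OF qcA qcA' S T f t]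
  note d = dual_onD(2-4)[OF \<alpha> T i, unfolded qc_simps] dual_onD(2-4)[OF \<beta> T i, unfolded qc_simps]
    dual_apply(1,2)[OF T i, where M = "qc K A", unfolded qc_simps] dual_apply(1,2)[OF T i, where M = "qc K A'", unfolded qc_simps]
  interpret T: cring T using T by (rule CAlg_cring)
  show "pairq T \<alpha> \<beta> (Ar QQ S T f t) \<in> carrier T" by (rule pairq(1)[OF T \<alpha> \<beta> z])
  show "pairq T (\<alpha> +[Ob DQ T] \<gamma>) \<beta> (Ar QQ S T f t) = pairq T \<alpha> \<beta> (Ar QQ S T f t) +[T] pairq T \<gamma> \<beta> (Ar QQ S T f t)"
    if \<gamma>: "\<gamma> \<in> dual_on K (qc K A) T" for \<gamma>
    by (rule tens_eqI[OF qcA qcA' T z, where D = T], unfold qc_simps)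
      (simp_all add: pairq[OF T \<alpha> \<beta>, simplified] pairq[OF T \<gamma> \<beta>, simplified] pairq[OF T dual_on_ops(1)[OF qcA T \<alpha> \<gamma>] \<beta>, simplified]
         d dual_onD(2-4)[OF \<gamma> T i, unfolded qc_simps] T.l_distr T.a_ac)
  show "pairq T \<alpha> (\<beta> +[Ob DQ' T] \<gamma>) (Ar QQ S T f t) = pairq T \<alpha> \<beta> (Ar QQ S T f t) +[T] pairq T \<alpha> \<gamma> (Ar QQ S T f t)"
    if \<gamma>: "\<gamma> \<in> dual_on K (qc K A') T" for \<gamma>
    by (rule tens_eqI[OF qcA qcA' T z, where D = T], unfold qc_simps)
      (simp_all add: pairq[OF T \<alpha> \<beta>, simplified] pairq[OF T \<alpha> \<gamma>, simplified] pairq[OF T \<alpha> dual_on_ops(1)[OF qcA' T \<beta> \<gamma>], simplified]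
         d dual_onD(2-4)[OF \<gamma> T i, unfolded qc_simps] T.r_distr T.a_ac)
  {
  fix s assume s: "s \<in> carrier T"
  show "pairq T (s \<cdot>[Ob DQ T] \<alpha>) \<beta> (Ar QQ S T f t) = s *[T] pairq T \<alpha> \<beta> (Ar QQ S T f t)"
    by (rule tens_eqI[OF qcA qcA' T z, where D = T], unfold qc_simps)
      (simp_all add: pairq[OF T \<alpha> \<beta>, simplified] pairq[OF T dual_on_ops(2)[OF qcA T s \<alpha>] \<beta>, simplified] s d T.m_assoc T.r_distr)
  show "pairq T \<alpha> (s \<cdot>[Ob DQ' T] \<beta>) (Ar QQ S T f t) = s *[T] pairq T \<alpha> \<beta> (Ar QQ S T f t)"
    by (rule tens_eqI[OF qcA qcA' T z, where D = T], unfold qc_simps)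
      (simp_all add: pairq[OF T \<alpha> \<beta>, simplified] pairq[OF T \<alpha> dual_on_ops(2)[OF qcA' T s \<beta>], simplified] s d T.m_lcomm T.r_distr)
  }
  fix V g assume V: "V \<in> CAlg K" and g: "g \<in> alg_hom K T V"
  note a' = dual_on_Ar[OF qcA T V g \<alpha>] and b' = dual_on_Ar[OF qcA' T V g \<beta>]
  have "pairq V (Ar DQ T V g \<alpha>) (Ar DQ' T V g \<beta>) (Ar QQ T V g z) = g (pairq T \<alpha> \<beta> z)" if z: "z \<in> QQ $ T" for z
  proof (rule tens_eqI[OF qcA qcA' T z, where D = V], unfold qc_simps)
    fix m n assume m: "m \<in> carrier (tens K A T)" and n: "n \<in> carrier (tens K A' T)"
    note c = tmr_facts(1)[OF AA(1) CAlg_AAlg[OF T] CAlg_AAlg[OF V] g m] tmr_facts(1)[OF AA(2) CAlg_AAlg[OF T] CAlg_AAlg[OF V] g n]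
    have "Ar DQ T V g \<alpha> (V, idm V) (tmr A T V g m) = g (\<alpha> (T, idm T) m)" "Ar DQ' T V g \<beta> (V, idm V) (tmr A' T V g n) = g (\<beta> (T, idm T) n)"
      using dual_onD(5)[OF \<alpha> T i V g, of m] dual_onD(5)[OF \<beta> T i V g, of n] dual_on_idm_Ar[OF qcA \<alpha> T V g, of "tmr A T V g m"]
        dual_on_idm_Ar[OF qcA' \<beta> T V g, of "tmr A' T V g n"] m n c by (simp_all add: compose_idm_right[OF g] tmr_def)
    then show "pairq V (Ar DQ T V g \<alpha>) (Ar DQ' T V g \<beta>) (Ar QQ T V g (tq T m n)) = g (pairq T \<alpha> \<beta> (tq T m n))"
      unfolding tq_Ar[OF T V g m n] pairq(3)[OF V a' b' c] pairq(3)[OF T \<alpha> \<beta> m n] using d m n by (simp add: alg_homD(3)[OF g])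
  qed (simp_all only: tens_Ar[OF qcA qcA' T V g] pairq[OF T \<alpha> \<beta>] pairq[OF V a' b'] alg_homD(2)[OF g])
  from this[OF z]
  show "pairq V (Ar DQ T V g \<alpha>) (Ar DQ' T V g \<beta>) (Ar QQ S V (g o[S] f) t) = g (pairq T \<alpha> \<beta> (Ar QQ S T f t))"
    by (simp only: set_functorD(3)[OF mod_functorD(1)[OF mod_functor_tensor[OF qcA qcA']] S T V f g t])
qed

lemma tensor_eval_eq: "tensor_eval K (qc K A) (qc K A') S t = dual_of K DQ DQ' S (\<lambda>T f \<alpha> \<beta>. pairq T \<alpha> \<beta> (Ar QQ S T f t))"
  by (simp add: tensor_eval_def dual_of_def[OF mod_functor_dual[OF qcA] mod_functor_dual[OF qcA']] pairq_def)

lemmas dof = dual_of[OF mod_functor_dual[OF qcA] mod_functor_dual[OF qcA'] S]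

lemma tensor_eval_apply:
  assumes t: "t \<in> carrier TS" and T: "T \<in> CAlg K" and f: "f \<in> alg_hom K S T" and \<alpha>: "\<alpha> \<in> dual_on K (qc K A) T" and \<beta>: "\<beta> \<in> dual_on K (qc K A') T"
  shows "tensor_eval K (qc K A) (qc K A') S t (T, f) (ptens T (Ob DQ T) (Ob DQ' T) \<alpha> \<beta>) = pairq T \<alpha> \<beta> (Ar QQ S T f t)"
  unfolding tensor_eval_eq by (rule dof(2)[OF pairq_binat[OF t] T f]) (simp_all add: \<alpha> \<beta>)

text \<open>Evaluation at the universal characters of \<open>A\<close> and \<open>A'\<close> recovers \<open>t\<close>.\<close>

lemma psi_eval:
  assumes t: "t \<in> carrier TS"
  shows "psi (pairq DD (qchar A DD d1) (qchar A' DD (inl A' (tens K A S))) (Ar QQ S DD dS t)) = t"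
proof -
  note qd = qchar_dual[OF A D(1) d1] qchar_dual[OF A' D(1,2)]
  note i = idm_CAlg[OF D(1)]
  interpret DR: cring DD using D(1) by (rule CAlg_cring)
  interpret ASr: cring "tens K A S" using AS(1) by (rule CAlg_cring)
  note tA = tens_Ar[OF qcA qcA' S D(1) dS]
  have "psi (pairq DD (qchar A DD d1) (qchar A' DD (inl A' (tens K A S))) (Ar QQ S DD dS t)) = (\<lambda>t. t) t"
  proof (rule tens_eqI[OF qcA qcA' S t, where D = TS], unfold qc_simps)
    fix m n assume m: "m \<in> carrier (tens K A S)" and n: "n \<in> carrier (tens K A' S)"
    note c = tmr_facts(1)[OF AA(1,3) CAlg_AAlg[OF D(1)] dS m] tmr_facts(1)[OF AA(2,3) CAlg_AAlg[OF D(1)] dS n]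
    have e1: "qchar A DD d1 (DD, idm DD) (tmr A S DD dS m) = inr A' (tens K A S) m"
      using act_tmr[OF A S D(1) d1 dS m] c i D(1) cop_compose[OF A S AS(1) D(1) AS(2,3) D(3) m] cop_inl_inr[OF A S m]
      by (simp add: qchar_def compose_idm_left[OF d1])
    have e2: "qchar A' DD (inl A' (tens K A S)) (DD, idm DD) (tmr A' S DD dS n) = cop A' S DD (inl A' (tens K A S)) dS n"
      using act_tmr[OF A' S D(1,2) dS n] c i D(1) by (simp add: qchar_def compose_idm_left[OF D(2)])
    have "psi (inr A' (tens K A S) m *[DD] cop A' S DD (inl A' (tens K A S)) dS n) = tq S m n"
    proof (rule tens_hom_eqI[OF AA(2,3) n, where P = TS])
      fix a s assume a: "a \<in> carrier A'" and s: "s \<in> carrier S"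
      have ps: "pt A S 1[A] s \<in> carrier (tens K A S)" using s by (simp add: pt_closed[OF AA(1,3)])
      have pa: "pt A' S a 1[S] \<in> carrier (tens K A' S)" using a by (simp add: pt_closed[OF AA(2,3)])
      have "inr A' (tens K A S) m *[DD] cop A' S DD (inl A' (tens K A S)) dS (pt A' S a s) =
        pt A' (tens K A S) a (pt A S 1[A] s *[tens K A S] m)"
        using a s m ps by (simp add: cop_facts[OF A' S D(1,2) dS] compose_eq inl_apply inr_apply pt_mult[OF AA(2,4)] ASr.m_comm)
      then have "psi (inr A' (tens K A S) m *[DD] cop A' S DD (inl A' (tens K A S)) dS (pt A' S a s)) =
        tq S (s \<cdot>[Ob (qc K A) S] m) (pt A' S a 1[S])"
        using a m ps by (simp add: psi_facts)
      also have "\<dots> = tq S m (s \<cdot>[Ob (qc K A') S] pt A' S a 1[S])"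
        by (rule TQ.ptens_simps(3)) (use s m pa in simp_all)
      also have "\<dots> = tq S m (pt A' S a s)" using a s by (simp add: pt_mult[OF AA(2,3)])
      finally show "psi (inr A' (tens K A S) m *[DD] cop A' S DD (inl A' (tens K A S)) dS (pt A' S a s)) = tq S m (pt A' S a s)" .
    qed (use m TQ.ptens_simps(2) in \<open>simp_all add: cop_facts[OF A' S D(1,2) dS] alg_homD(1)[OF D(3)] DR.r_distr psi_facts\<close>)
    then show "psi (pairq DD (qchar A DD d1) (qchar A' DD (inl A' (tens K A S))) (Ar QQ S DD dS (tq S m n))) = tq S m n"
      unfolding tq_Ar[OF S D(1) dS m n] pairq(3)[OF D(1) qd c] e1 e2 .
  qed (simp_all only: tA pairq[OF D(1) qd] psi_facts)
  then show ?thesis .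
qed

text \<open>\<open>psi_eval\<close> recovers \<open>t\<close> from its evaluation at one pair of
  characters. Injectivity gives the \<open>inv_into\<close> in \<open>ttensor_proj\<close> its
  meaning.\<close>

lemma tensor_eval_inj: "inj_on (tensor_eval K (qc K A) (qc K A') S) (carrier TS)"
proof (rule inj_onI)
  fix t u assume t: "t \<in> carrier TS" and u: "u \<in> carrier TS" and eq: "tensor_eval K (qc K A) (qc K A') S t = tensor_eval K (qc K A) (qc K A') S u"
  note qd = qchar_dual[OF A D(1) d1] qchar_dual[OF A' D(1,2)]
  show "t = u"
    using psi_eval[OF t] psi_eval[OF u] tensor_eval_apply[OF t D(1) dS qd] tensor_eval_apply[OF u D(1) dS qd] eq by simp
qed

text \<open>Contracting first with \<beta> over \<open>A \<otimes> T\<close> and then with \<alpha>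
  over \<open>T\<close> is the simultaneous contraction. \<open>?d\<close> is the map from
  \<open>DD\<close> to \<open>A' \<otimes> (A \<otimes> T)\<close> induced by
  \<open>f\<close>.\<close>

lemma pairq_psi:
  assumes T: "T \<in> CAlg K" and f: "f \<in> alg_hom K S T" and \<alpha>: "\<alpha> \<in> dual_on K (qc K A) T" and \<beta>: "\<beta> \<in> dual_on K (qc K A') T"
    and z: "z \<in> carrier DD"
  shows "\<alpha> (T, idm T) (\<beta> (tens K A T, inr A T) (cop A' (tens K A S) (tens K A' (tens K A T)) (inl A' (tens K A T))
    ((inr A' (tens K A T)) o[tens K A S] (cop A S (tens K A T) (inl A T) (inr A T o[S] f))) z)) =
    pairq T \<alpha> \<beta> (Ar QQ S T f (psi z))" (is "\<alpha> _ (\<beta> _ (?d z)) = _")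
proof -
  note E = inlr[OF A T]
  note D2 = inlr[OF A' E(1)]
  note rf = compose_CAlg[OF S f E(3)]
  note c = cop_facts[OF A S E(1,2) rf]
  note rc = compose_CAlg[OF AS(1) c(1) D2(3)]
  note d = cop_facts[OF A' AS(1) D2(1,2) rc]
  note i = idm_CAlg[OF T] and T' = CAlg_AAlg[OF T] and E' = CAlg_AAlg[OF E(1)]
  note a = dual_onD(2-4)[OF \<alpha> T i, unfolded qc_simps] and b = dual_onD(2-4)[OF \<beta> E(1,3), unfolded qc_simps]
  interpret E: cring "tens K A T" using E(1) by (rule CAlg_cring)
  interpret Tr: cring T using T by (rule CAlg_cring)
  show ?thesis
  proof (rule tens_hom_eqI[OF AA(2,4) z, where P = T])
    fix a' u assume a': "a' \<in> carrier A'" and u: "u \<in> carrier (tens K A S)"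
    define v where "v = cop A S (tens K A T) (inl A T) (inr A T o[S] f) u"
    have v: "v \<in> carrier (tens K A T)" unfolding v_def by (rule c(2)[OF u])
    have v_eq: "v = tmr A S T f u"
      unfolding v_def
      by (rule tens_hom_eqI[OF AA(1,3) u, where P = "tens K A T"])
        (simp_all add: c tmr_facts[OF AA(1,3) T' f] compose_eq inl_apply inr_apply alg_homD(1)[OF f] pt_one_mult[OF AA(1) T'])
    define m where "m = pt A' T a' 1[T]"
    have m: "m \<in> carrier (tens K A' T)" using a' by (simp add: m_def pt_closed[OF AA(2) T'])
    have bm: "\<beta> (T, idm T) m \<in> carrier T" using dual_onD(2)[OF \<beta> T i] m by simp
    have p1: "pt A' (tens K A T) a' 1[tens K A T] \<in> carrier (tens K A' (tens K A T))" using a' by (simp add: pt_closed[OF AA(2) E'])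
    have m1: "tmr A' T (tens K A T) (inr A T) m = pt A' (tens K A T) a' 1[tens K A T]"
      unfolding m_def using a' by (simp add: tmr_facts(3)[OF AA(2) T' E' E(3)] alg_homD(5)[OF E(3)])
    have b1: "\<beta> (tens K A T, inr A T) (pt A' (tens K A T) a' 1[tens K A T]) = inr A T (\<beta> (T, idm T) m)"
      using dual_onD(5)[OF \<beta> T i E(1,3), of m] m by (simp add: compose_idm_right[OF E(3)] m1[unfolded tmr_def])
    have "?d (pt A' (tens K A S) a' u) = pt A' (tens K A T) 1[A'] v *[tens K A' (tens K A T)] pt A' (tens K A T) a' 1[tens K A T]"
      using a' u v by (simp add: d(4) compose_eq v_def[symmetric] inl_apply inr_apply pt_mult[OF AA(2) E'])
    then have "\<beta> (tens K A T, inr A T) (?d (pt A' (tens K A S) a' u)) = v *[tens K A T] inr A T (\<beta> (T, idm T) m)"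
      using b(3)[OF p1 v] b1 by simp
    also have "\<dots> = pt A T 1[A] (\<beta> (T, idm T) m) *[tens K A T] v"
      using v bm by (simp add: inr_apply E.m_comm pt_closed[OF AA(1) T'])
    finally have 1: "\<alpha> (T, idm T) (\<beta> (tens K A T, inr A T) (?d (pt A' (tens K A S) a' u))) = \<beta> (T, idm T) m *[T] \<alpha> (T, idm T) v"
      using a(3)[OF v bm] by simp
    have m2: "pt A' S a' 1[S] \<in> carrier (tens K A' S)" "tmr A' S T f (pt A' S a' 1[S]) = m"
      using a' by (simp_all add: pt_closed[OF AA(2,3)] tmr_facts(3)[OF AA(2,3) T' f] alg_homD(5)[OF f] m_def)
    have "pairq T \<alpha> \<beta> (Ar QQ S T f (psi (pt A' (tens K A S) a' u))) = \<alpha> (T, idm T) v *[T] \<beta> (T, idm T) m"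
      unfolding psi_facts(3)[OF a' u] tq_Ar[OF S T f u m2(1)] m2(2) v_eq[symmetric] by (rule pairq(3)[OF T \<alpha> \<beta> v m])
    then show "\<alpha> (T, idm T) (\<beta> (tens K A T, inr A T) (?d (pt A' (tens K A S) a' u))) = pairq T \<alpha> \<beta> (Ar QQ S T f (psi (pt A' (tens K A S) a' u)))"
      using 1 a(1)[OF v] bm by (simp add: Tr.m_comm)
  qed (simp_all only: d a b psi_facts(1,2) tens_Ar(1,2)[OF qcA qcA' S T f] pairq(1,2)[OF T \<alpha> \<beta>])
qed

lemma dual_pq:
  assumes T: "T \<in> CAlg K"
  shows "\<alpha> \<in> dual_on K (qc K A) T ==> dual_map K B (qc K A) p T \<alpha> \<in> dual_on K B T"
    "\<beta> \<in> dual_on K (qc K A') T ==> dual_map K B (qc K A') q T \<beta> \<in> dual_on K B T"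
  by (rule dual_map_dual_on[OF modB Alg_morD(1)[OF quotient_mor[OF p]] T], assumption,
      rule dual_map_dual_on[OF modB Alg_morD(1)[OF quotient_mor[OF q]] T])

text \<open>The two arguments are eliminated in turn. Each time, \<omega> with one argument fixed is
  an element of \<open>B\<close>, by \<open>binat_left\<close>, and the projection of this element
  to a quotient is its value at the universal point. What remains is \<omega> at both universal
  points, which is \<open>val\<close> up to base change.\<close>

lemma pullback_psi:
  assumes \<omega>: "\<omega> \<in> dual_on K BB S" and T: "T \<in> CAlg K" and f: "f \<in> alg_hom K S T"
    and \<alpha>: "\<alpha> \<in> dual_on K (qc K A) T" and \<beta>: "\<beta> \<in> dual_on K (qc K A') T"
  shows "\<omega> (T, f) (ptd T (dual_map K B (qc K A) p T \<alpha>) (dual_map K B (qc K A') q T \<beta>)) =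
    pairq T \<alpha> \<beta> (Ar QQ S T f (psi (val \<omega>)))"
proof -
  define w where "w T f \<alpha> \<beta> = \<omega> (T, f) (ptd T \<alpha> \<beta>)" for T f \<alpha> \<beta>
  have w: "binat K DB DB S w" using binat_of_dual[OF modDB modDB S \<omega>] by (simp add: w_def[abs_def] ptd_def)
  note pa = dual_pq(1)[OF T \<alpha>] and qb = dual_pq(2)[OF T \<beta>]
  note i = idm_CAlg[OF T]
  define E1 where "E1 = tens K A T"
  note E = inlr[OF A T, folded E1_def]
  define D2 where "D2 = tens K A' E1"
  note D2 = inlr[OF A' E(1), folded D2_def]
  define x1 where "x1 = Ar X A E1 (inl A T) (qpt A p)"
  define x2 where "x2 = Ar X A' D2 (inl A' E1) (qpt A' q)"
  have x1: "x1 \<in> X $ E1" unfolding x1_def by (rule sX(1)[OF A E(1,2) qpt(1)[OF p]])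
  have x2: "x2 \<in> X $ D2" unfolding x2_def by (rule sX(1)[OF A' D2(1,2) qpt(1)[OF q]])
  note rf = compose_CAlg[OF S f E(3)]
  note c = cop_facts[OF A S E(1,2) rf]
  note rc = compose_CAlg[OF AS(1) c(1) D2(3)]
  define d where "d = cop A' (tens K A S) D2 (inl A' E1) (inr A' E1 o[tens K A S] (cop A S E1 (inl A T) (inr A T o[S] f)))"
  note dd = cop_facts[OF A' AS(1) D2(1,2) rc, folded d_def]
  have d2: "d o[tens K A S] (inr A' (tens K A S)) =
    (inr A' E1) o[tens K A S] (cop A S E1 (inl A T) (inr A T o[S] f))"
    unfolding d_def by (rule cop_inr[OF A' AS(1) D2(1,2) rc])
  have c2: "(cop A S E1 (inl A T) (inr A T o[S] f)) o[S] inr A S = inr A T o[S] f"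
    by (rule cop_inr[OF A S E(1,2) rf])
  have dd1: "d o[A] d1 = inr A' E1 o[A] inl A T"
    unfolding compose_compose[OF AS(2)] d2
    by (simp only: compose_compose[OF AS(2), symmetric] c(5))
  have ddS: "d o[S] dS = inr A' E1 o[S] (inr A T o[S] f)"
    unfolding compose_compose[OF AS(3)] d2
    by (simp only: compose_compose[OF AS(3), symmetric] c2)
  \<comment> \<open>The second argument is fixed; pairing with a form pulled back along
    \<open>p\<close> sees only \<open>p L\<close>.\<close>
  obtain L where L: "L \<in> B $ T" "\<And>V g \<alpha>. V \<in> CAlg K ==> g \<in> alg_hom K T V ==> \<alpha> \<in> dual_on K B V ==>
    w V (g o[S] f) \<alpha> (Ar DB T V g (dual_map K B (qc K A') q T \<beta>)) = \<alpha> (V, idm V) (Ar B T V g L)"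
    using binat_left(2)[OF S w T f qb] by blast
  have 1: "w T f (dual_map K B (qc K A) p T \<alpha>) (dual_map K B (qc K A') q T \<beta>) = \<alpha> (T, idm T) (p T L)"
    using L(2)[OF T i pa] dual_map_apply[OF T \<alpha> T i L(1)]
    by (simp only: compose_idm_left[OF f] idm_compose_left[OF T qb] sB(2)[OF T L(1)])
  \<comment> \<open>Now the first argument is the universal point of \<open>A\<close> and the second
    is free; in the same way a form pulled back along \<open>q\<close> sees only
    \<open>q M\<close>.\<close>
  obtain M where M: "M \<in> B $ E1" "\<And>V g \<alpha>. V \<in> CAlg K ==> g \<in> alg_hom K E1 V ==> \<alpha> \<in> dual_on K B V ==>
    w V (g o[S] (inr A T o[S] f)) (Ar DB E1 V g (hat E1 x1)) \<alpha> = \<alpha> (V, idm V) (Ar B E1 V g M)"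
    using binat_left(2)[OF S binat_swap[OF w] E(1) rf hat_dual[OF E(1) x1]] by blast
  have q': "Ar DB T E1 (inr A T) (dual_map K B (qc K A') q T \<beta>) \<in> dual_on K B E1" by (rule dual_on_Ar[OF modB T E(1,3) qb])
  have "p T L = hat E1 x1 (E1, idm E1) (Ar B T E1 (inr A T) L)"
    unfolding qpt(2)[OF p T L(1), folded E1_def, folded x1_def] by (rule hat_idm[OF E(1) x1 sB(1)[OF T E(1,3) L(1)], symmetric])
  also have "\<dots> = w E1 (inr A T o[S] f) (hat E1 x1) (Ar DB T E1 (inr A T) (dual_map K B (qc K A') q T \<beta>))"
    by (rule L(2)[OF E(1,3) hat_dual[OF E(1) x1], symmetric])
  also have "\<dots> = Ar DB T E1 (inr A T) (dual_map K B (qc K A') q T \<beta>) (E1, idm E1) M"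
    using M(2)[OF E(1) idm_CAlg[OF E(1)] q']
    by (simp only: compose_idm_left[OF rf] idm_compose_left[OF E(1) hat_dual[OF E(1) x1]] sB(2)[OF E(1) M(1)])
  also have "\<dots> = \<beta> (E1, inr A T) (q E1 M)"
    unfolding dual_on_idm_Ar[OF modB qb T E(1,3) M(1)] by (rule dual_map_apply[OF T \<beta> E(1,3) M(1)])
  finally have 2: "p T L = \<beta> (E1, inr A T) (q E1 M)" .
  have "q E1 M = hat D2 x2 (D2, idm D2) (Ar B E1 D2 (inr A' E1) M)"
    unfolding qpt(2)[OF q E(1) M(1), folded D2_def, folded x2_def] by (rule hat_idm[OF D2(1) x2 sB(1)[OF E(1) D2(1,3) M(1)], symmetric])
  also have "\<dots> = w D2 (inr A' E1 o[S] (inr A T o[S] f)) (Ar DB E1 D2 (inr A' E1) (hat E1 x1)) (hat D2 x2)"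
    by (rule M(2)[OF D2(1,3) hat_dual[OF D2(1) x2], symmetric])
  also have "\<dots> = on_pts \<omega> D2 (d o[S] dS) (Ar X E1 D2 (inr A' E1) x1) x2"
    unfolding ddS hat_Ar[OF E(1) D2(1,3) x1] w_def on_pts_def ..
  \<comment> \<open>Naturality of \<open>on_pts\<close> along \<open>d\<close>, which sends the pair
    of universal points over \<open>DD\<close> to the pair over \<open>D2\<close>.\<close>
  also have "\<dots> = d (val \<omega>)"
  proof -
    note qp = qpt(1)[OF p] and qq = qpt(1)[OF q]
    have "Ar X DD D2 d (Ar X A DD d1 (qpt A p)) = Ar X E1 D2 (inr A' E1) x1"
      unfolding x1_def sX(3)[OF A D(1) D2(1) d1 dd(1) qp, symmetric] dd1 by (rule sX(3)[OF A E(1) D2(1) E(2) D2(3) qp])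
    moreover have "Ar X DD D2 d (Ar X A' DD (inl A' (tens K A S)) (qpt A' q)) = x2"
      unfolding x2_def sX(3)[OF A' D(1) D2(1) D(2) dd(1) qq, symmetric] dd(5) ..
    ultimately show ?thesis
      using on_pts_nat[OF S \<omega> D(1) dS sX(1)[OF A D(1) d1 qp] sX(1)[OF A' D(1,2) qq] D2(1) dd(1)] by (simp only: val_def)
  qed
  finally have "p T L = \<beta> (E1, inr A T) (d (val \<omega>))" using 2 by simp
  moreover have "val \<omega> \<in> carrier DD"
    unfolding val_def by (rule on_pts_closed[OF S \<omega> D(1) dS sX(1)[OF A D(1) d1 qpt(1)[OF p]] sX(1)[OF A' D(1,2) qpt(1)[OF q]]])
  ultimately show ?thesis
    using 1 pairq_psi[OF T f \<alpha> \<beta>, of "val \<omega>"] by (simp only: w_def d_def E1_def D2_def)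
qed

lemma val_closed: "\<omega> \<in> dual_on K BB S ==> val \<omega> \<in> carrier DD"
  unfolding val_def by (rule on_pts_closed[OF S _ D(1) dS sX(1)[OF A D(1) d1 qpt(1)[OF p]] sX(1)[OF A' D(1,2) qpt(1)[OF q]]])

text \<open>By \<open>pullback_psi\<close> the form pulled back to the quotients is
  \<open>tensor_eval\<close> of \<open>psi (val \<omega>)\<close>, so the \<open>inv_into\<close> in
  the definition finds this element. Projections thus become values at universal points, which makes
  pointwise products visible.\<close>

lemma ttensor_proj:
  assumes \<omega>: "\<omega> \<in> dual_on K BB S"
  shows "ttensor_proj K B B (A, p) (A', q) S \<omega> = psi (val \<omega>)"
proof -
  note mDQ = mod_functor_dual[OF qcA] mod_functor_dual[OF qcA']
  have t: "psi (val \<omega>) \<in> carrier TS" by (rule psi_facts(1)[OF val_closed[OF \<omega>]])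
  note te = dof(1)[OF pairq_binat[OF t], folded tensor_eval_eq]
  let ?\<phi> = "\<lambda>T. tensor_map T (Ob DB T) (Ob DB T) (map_prod (dual_map K B (qc K A) p T) (dual_map K B (qc K A') q T))"
  let ?e = "tensor_eval K (qc K A) (qc K A') S (psi (val \<omega>))"
  have dm: "dual_map K (tensor_functor DQ DQ') BB ?\<phi> S \<omega> = nt_restrict K (tensor_functor DQ DQ') S (\<lambda>T f x. \<omega> (T, f) (?\<phi> T x))"
    unfolding dual_map_def using S \<omega> by simp
  have "dual_map K (tensor_functor DQ DQ') BB ?\<phi> S \<omega> = ?e"
    unfolding dm tensor_eval_def
  proof (rule nt_restrict_cong)
    fix T f x assume T: "T \<in> CAlg K" and f: "f \<in> alg_hom K S T" and x: "x \<in> tensor_functor DQ DQ' $ T"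
    have lM: "lin T (Ob DQ T) (Ob DB T) (dual_map K B (qc K A) p T)" "lin T (Ob DQ' T) (Ob DB T) (dual_map K B (qc K A') q T)"
      using dual_map_Mod_mor[OF modB qcA Alg_morD(1)[OF quotient_mor[OF p]]] dual_map_Mod_mor[OF modB qcA' Alg_morD(1)[OF quotient_mor[OF q]]] T
      by (simp_all add: Mod_mor_def lin_hom_iff)
    note mf = tensor_map_facts[OF two_mod[OF mDQ T] two_mod[OF modDB modDB T] lM, folded tensor_functor_simps]
    have "\<omega> (T, f) (?\<phi> T x) = ?e (T, f) x"
    proof (rule tens_eqI[OF mDQ T x, where D = T])
      fix \<alpha> \<beta> assume "\<alpha> \<in> DQ $ T" "\<beta> \<in> DQ' $ T"
      then have a: "\<alpha> \<in> dual_on K (qc K A) T" "\<beta> \<in> dual_on K (qc K A') T" by simp_all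
      show "\<omega> (T, f) (?\<phi> T (ptens T (Ob DQ T) (Ob DQ' T) \<alpha> \<beta>)) = ?e (T, f) (ptens T (Ob DQ T) (Ob DQ' T) \<alpha> \<beta>)"
        using pullback_psi[OF \<omega> T f a] tensor_eval_apply[OF t T f a] mf(3)[of \<alpha> \<beta>] a by (simp add: ptd_def)
    qed (simp_all only: mf(1,2) dual_onD(2,3)[OF \<omega> T f] dual_onD(2,3)[OF te T f])
    then show "\<omega> (T, f) (?\<phi> T x) = tensor_lift T (\<lambda>(\<alpha>, \<beta>). tensor_lift T (\<lambda>(m, n). \<alpha> (T, idm T) m *[T] \<beta> (T, idm T) n)
      (Ar QQ S T f (psi (val \<omega>)))) x"
      unfolding tensor_eval_def nt_restrict_apply[OF T f x] .
  qed
  then show ?thesis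
    unfolding ttensor_proj.simps by (simp only: inv_into_f_f[OF tensor_eval_inj t])
qed

text \<open>Points that factor through the two quotients are pulled back characters, on which, by
  \<open>pullback_psi\<close>, \<omega> depends on \<open>psi (val \<omega>)\<close> alone.\<close>

lemma psi_val_inj:
  assumes \<omega>: "\<omega> \<in> dual_on K BB S" "\<omega>' \<in> dual_on K BB S" and eq: "psi (val \<omega>) = psi (val \<omega>')"
    and T: "T \<in> CAlg K" and f: "f \<in> alg_hom K S T" and j: "j \<in> alg_hom K A T" and j': "j' \<in> alg_hom K A' T"
  shows "on_pts \<omega> T f (Ar X A T j (qpt A p)) (Ar X A' T j' (qpt A' q)) = on_pts \<omega>' T f (Ar X A T j (qpt A p)) (Ar X A' T j' (qpt A' q))"
  using pullback_psi[OF \<omega>(1) T f qchar_dual[OF A T j] qchar_dual[OF A' T j']] pullback_psi[OF \<omega>(2) T f qchar_dual[OF A T j] qchar_dual[OF A' T j']]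
  by (simp only: on_pts_def eq qchar_pullback[OF p T j] qchar_pullback[OF q T j'])

lemma ttensor_proj_mult:
  assumes \<omega>: "\<omega> \<in> dual_on K BB S" "\<omega>' \<in> dual_on K BB S" "\<omega>'' \<in> dual_on K BB S"
    and eq: "\<And>T f x y. T \<in> CAlg K ==> f \<in> alg_hom K S T ==> x \<in> X $ T ==> y \<in> X $ T ==>
    on_pts \<omega>'' T f x y = on_pts \<omega> T f x y *[T] on_pts \<omega>' T f x y"
  shows "ttensor_proj K B B (A, p) (A', q) S \<omega>'' =
    ttensor_proj K B B (A, p) (A', q) S \<omega> *[TS] ttensor_proj K B B (A, p) (A', q) S \<omega>'"
proof -
  have "val \<omega>'' = val \<omega> *[DD] val \<omega>'"
    unfolding val_def by (rule eq[OF D(1) dS sX(1)[OF A D(1) d1 qpt(1)[OF p]] sX(1)[OF A' D(1,2) qpt(1)[OF q]]])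
  then show ?thesis
    using ring_hom_mult[OF psi_ring_hom val_closed[OF \<omega>(1)] val_closed[OF \<omega>(2)]] by (simp only: ttensor_proj \<omega>)
qed

lemma ttensor_proj_one:
  assumes \<omega>: "\<omega> \<in> dual_on K BB S"
    and eq: "\<And>T f x y. T \<in> CAlg K ==> f \<in> alg_hom K S T ==> x \<in> X $ T ==> y \<in> X $ T ==>
    on_pts \<omega> T f x y = 1[T]"
  shows "ttensor_proj K B B (A, p) (A', q) S \<omega> = 1[TS]"
proof -
  have "val \<omega> = 1[DD]"
    unfolding val_def by (rule eq[OF D(1) dS sX(1)[OF A D(1) d1 qpt(1)[OF p]] sX(1)[OF A' D(1,2) qpt(1)[OF q]]])
  then show ?thesis using ring_hom_one[OF psi_ring_hom] by (simp only: ttensor_proj \<omega>)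
qed

end

text \<open>Any two points over \<open>T\<close> come from universal points, and the projections
  know the values there. This joint injectivity is the uniqueness needed for the \<open>THE\<close>
  in \<open>ttensor_alg\<close>.\<close>

lemma ttensor_proj_inj:
  assumes S: "S \<in> CAlg K" and \<omega>: "\<omega> \<in> dual_on K BB S" "\<omega>' \<in> dual_on K BB S"
    and eq: "\<And>i j. i \<in> qc_quotients K B ==> j \<in> qc_quotients K B ==> ttensor_proj K B B i j S \<omega> = ttensor_proj K B B i j S \<omega>'"
  shows "\<omega> = \<omega>'"
proof (rule on_pts_inj[OF S \<omega>])
  fix T f x y assume T: "T \<in> CAlg K" and f: "f \<in> alg_hom K S T" and x: "x \<in> X $ T" and y: "y \<in> X $ T"
  obtain A p j where p: "(A, p) \<in> qc_quotients K B" "j \<in> alg_hom K A T" "x = Ar X A T j (qpt A p)" using factor[OF T x] by blast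
  obtain A' q j' where q: "(A', q) \<in> qc_quotients K B" "j' \<in> alg_hom K A' T" "y = Ar X A' T j' (qpt A' q)" using factor[OF T y] by blast
  show "on_pts \<omega> T f x y = on_pts \<omega>' T f x y"
    unfolding p(3) q(3)
    by (rule psi_val_inj[OF p(1) q(1) S \<omega> _ T f p(2) q(2)])
      (use eq[OF p(1) q(1)] in \<open>simp only: ttensor_proj[OF p(1) q(1) S] \<omega>\<close>)
qed

text \<open>The pointwise product of two functions on \<open>X \<times> X\<close> exists by
  \<open>on_pts_ex\<close> and satisfies the equations that define the product, since
  \<open>psi\<close> is a ring homomorphism; uniqueness is \<open>ttensor_proj_inj\<close>.\<close>

lemma ttensor_mult:
  assumes S: "S \<in> CAlg K" and \<omega>: "\<omega> \<in> dual_on K BB S" "\<omega>' \<in> dual_on K BB S"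
  shows "\<omega> *[Ob (ttensor_alg K B B) S] \<omega>' \<in> dual_on K BB S" (is "PROP ?A")
    "\<And>T f x y. T \<in> CAlg K ==> f \<in> alg_hom K S T ==> x \<in> X $ T ==> y \<in> X $ T ==>
    on_pts (\<omega> *[Ob (ttensor_alg K B B) S] \<omega>') T f x y = on_pts \<omega> T f x y *[T] on_pts \<omega>' T f x y" (is "PROP ?B")
proof -
  note c = on_pts_closed[OF S \<omega>(1)] on_pts_closed[OF S \<omega>(2)]
  have "\<exists>\<omega>''\<in>dual_on K BB S. \<forall>T f x y. T \<in> CAlg K --> f \<in> alg_hom K S T --> x \<in> X $ T -->
    y \<in> X $ T --> on_pts \<omega>'' T f x y = on_pts \<omega> T f x y *[T] on_pts \<omega>' T f x y"
  proof (rule on_pts_ex[OF S])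
    fix T f V g x y assume *: "T \<in> CAlg K" "f \<in> alg_hom K S T" "V \<in> CAlg K" "g \<in> alg_hom K T V" "x \<in> X $ T" "y \<in> X $ T"
    show "on_pts \<omega> V (g o[S] f) (Ar X T V g x) (Ar X T V g y) *[V]
      on_pts \<omega>' V (g o[S] f) (Ar X T V g x) (Ar X T V g y) = g (on_pts \<omega> T f x y *[T] on_pts \<omega>' T f x y)"
      unfolding on_pts_nat[OF S \<omega>(1) *(1,2,5,6,3,4)] on_pts_nat[OF S \<omega>(2) *(1,2,5,6,3,4)]
      by (rule alg_homD(3)[OF *(4) c(1)[OF *(1,2,5,6)] c(2)[OF *(1,2,5,6)], symmetric])
  qed (intro CAlg_closed(2) c)
  then obtain \<omega>'' where w: "\<omega>'' \<in> dual_on K BB S" "\<And>T f x y. T \<in> CAlg K ==> f \<in> alg_hom K S T ==> x \<in> X $ T ==>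
    y \<in> X $ T ==> on_pts \<omega>'' T f x y = on_pts \<omega> T f x y *[T] on_pts \<omega>' T f x y" by blast
  have pm: "ttensor_proj K B B i j S \<omega>'' = ttensor_proj K B B i j S \<omega> *[Ob (tensor_functor (qc K (fst i)) (qc K (fst j))) S] ttensor_proj K B B i j S \<omega>'"
    if "i \<in> qc_quotients K B" "j \<in> qc_quotients K B" for i j
    using ttensor_proj_mult[of "fst i" "snd i" "fst j" "snd j", OF _ _ S \<omega> w] that by simp
  have "\<omega> *[Ob (ttensor_alg K B B) S] \<omega>' = \<omega>''"
    unfolding ttensor_alg_def ttensor_def func.simps module.simps monoid.simps ring.simps carrier_dual
  proof (simp, rule the_equality)
    show "\<omega>'' \<in> dual_on K BB S \<and> (\<forall>i\<in>qc_quotients K B. \<forall>j\<in>qc_quotients K B. ttensor_proj K B B i j S \<omega>'' =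
      ttensor_proj K B B i j S \<omega> *[tensor S (Ob (qc K (fst i)) S) (Ob (qc K (fst j)) S)] ttensor_proj K B B i j S \<omega>')"
      using w(1) pm by simp
    fix \<eta> assume \<eta>: "\<eta> \<in> dual_on K BB S \<and> (\<forall>i\<in>qc_quotients K B. \<forall>j\<in>qc_quotients K B. ttensor_proj K B B i j S \<eta> =
      ttensor_proj K B B i j S \<omega> *[tensor S (Ob (qc K (fst i)) S) (Ob (qc K (fst j)) S)] ttensor_proj K B B i j S \<omega>')"
    show "\<eta> = \<omega>''" by (rule ttensor_proj_inj[OF S _ w(1)]) (use \<eta> pm in simp_all)
  qed
  then show "PROP ?A"
    "PROP ?B"
    using w by simp_all
qed

lemma ttensor_one:
  assumes S: "S \<in> CAlg K"
  shows "1[Ob (ttensor_alg K B B) S] \<in> dual_on K BB S"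
    "\<And>T f x y. T \<in> CAlg K ==> f \<in> alg_hom K S T ==> x \<in> X $ T ==> y \<in> X $ T ==>
    on_pts 1[Ob (ttensor_alg K B B) S] T f x y = 1[T]" (is "PROP ?A")
proof -
  have "\<exists>\<omega>''\<in>dual_on K BB S. \<forall>T f x y. T \<in> CAlg K --> f \<in> alg_hom K S T --> x \<in> X $ T -->
    y \<in> X $ T --> on_pts \<omega>'' T f x y = 1[T]"
    by (rule on_pts_ex[OF S]) (simp_all add: CAlg_closed alg_homD(5))
  then obtain \<omega>'' where w: "\<omega>'' \<in> dual_on K BB S" "\<And>T f x y. T \<in> CAlg K ==> f \<in> alg_hom K S T ==> x \<in> X $ T ==>
    y \<in> X $ T ==> on_pts \<omega>'' T f x y = 1[T]" by blast
  have pm: "ttensor_proj K B B i j S \<omega>'' = 1[Ob (tensor_functor (qc K (fst i)) (qc K (fst j))) S]"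
    if "i \<in> qc_quotients K B" "j \<in> qc_quotients K B" for i j
    using ttensor_proj_one[of "fst i" "snd i" "fst j" "snd j", OF _ _ S w] that by simp
  have "1[Ob (ttensor_alg K B B) S] = \<omega>''"
    unfolding ttensor_alg_def ttensor_def func.simps module.simps monoid.simps ring.simps carrier_dual
  proof (simp, rule the_equality)
    show "\<omega>'' \<in> dual_on K BB S \<and> (\<forall>i\<in>qc_quotients K B. \<forall>j\<in>qc_quotients K B. ttensor_proj K B B i j S \<omega>'' =
      1[tensor S (Ob (qc K (fst i)) S) (Ob (qc K (fst j)) S)])"
      using w(1) pm by simp
    fix \<eta> assume \<eta>: "\<eta> \<in> dual_on K BB S \<and> (\<forall>i\<in>qc_quotients K B. \<forall>j\<in>qc_quotients K B. ttensor_proj K B B i j S \<eta> =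
      1[tensor S (Ob (qc K (fst i)) S) (Ob (qc K (fst j)) S)])"
    show "\<eta> = \<omega>''" by (rule ttensor_proj_inj[OF S _ w(1)]) (use \<eta> pm in simp_all)
  qed
  then show "1[Ob (ttensor_alg K B B) S] \<in> dual_on K BB S"
    "PROP ?A"
    using w by simp_all
qed

end

section \<open>Bialgebras and monoids\<close>

text \<open>For the dual equipped with \<open>dmult\<close> and \<open>dunit\<close>, which as a
  record differs from the dual as a module although the module fields agree.\<close>

lemma module_fields:
  fixes M N :: "('r, 'a) module"
  assumes "module R M" and "carrier N = carrier M" "add N = add M" "ring.zero N = ring.zero M" "smult N = smult M"
  shows "module R N"
proof -
  have "add_monoid N = add_monoid M" using assms by simp
  then have "abelian_group N" using module.axioms(2)[OF assms(1)] assms(2-4)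
    by (simp add: abelian_group_def abelian_monoid_def abelian_group_axioms_def)
  then show ?thesis using assms by (simp add: module_def module_axioms_def)
qed

lemma dual_alg_simps [simp]:
  "dual_alg K B $ S = dual_on K (Alg B) S"
  "add (Ob (dual_alg K B) S) = add (Ob (dual K (Alg B)) S)"
  "ring.zero (Ob (dual_alg K B) S) = ring.zero (Ob (dual K (Alg B)) S)"
  "smult (Ob (dual_alg K B) S) = smult (Ob (dual K (Alg B)) S)"
  "monoid.mult (Ob (dual_alg K B) S) = dmult B S" "one (Ob (dual_alg K B) S) = dunit B S"
  "Ar (dual_alg K B) = Ar (dual K (Alg B))"
  by (simp_all add: dual_alg_def flip: carrier_dual)

lemma Mod_mor_dual_alg: "Mod_mor K (dual_alg K B) (dual_alg K C) = Mod_mor K (dual K (Alg B)) (dual K (Alg C))"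
  by (simp add: Mod_mor_def Mor_def lin_hom_def)

lemma mod_functor_dual_alg:
  assumes "mod_functor K (Alg B)"
  shows "mod_functor K (dual_alg K B)"
proof -
  have "module S (Ob (dual_alg K B) S)" if "S \<in> CAlg K" for S
    by (rule module_fields[OF mod_functorD(2)[OF mod_functor_dual[OF assms] that]]) simp_all
  then show ?thesis
    using mod_functor_dual[OF assms] by (simp add: mod_functor_def set_functor_def)
qed

lemma ttensor_alg_simps [simp]:
  "ttensor_alg K B C $ S = dual_on K (tensor_functor (dual K B) (dual K C)) S"
  "add (Ob (ttensor_alg K B C) S) = add (Ob (dual K (tensor_functor (dual K B) (dual K C))) S)"
  "smult (Ob (ttensor_alg K B C) S) = smult (Ob (dual K (tensor_functor (dual K B) (dual K C))) S)"
  "Ar (ttensor_alg K B C) = Ar (dual K (tensor_functor (dual K B) (dual K C)))"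
  by (simp_all add: ttensor_alg_def ttensor_def)

context
  fixes K :: "'u ring" and B :: "'u bialg"
  assumes mB: "mod_functor K (Alg B)" and dA: "alg_functor K (dual_alg K B)"
begin

lemmas mDB = mod_functor_dual[OF mB]
lemmas sB = set_functorD[OF mod_functorD(1)[OF mB]]

lemma dmult_facts:
  assumes S: "S \<in> CAlg K" and \<alpha>: "\<alpha> \<in> dual_on K (Alg B) S" and \<beta>: "\<beta> \<in> dual_on K (Alg B) S"
  shows "dmult B S \<alpha> \<beta> \<in> dual_on K (Alg B) S" "dunit B S \<in> dual_on K (Alg B) S"
    "\<gamma> \<in> dual_on K (Alg B) S ==> dmult B S (\<alpha> +[Ob (dual K (Alg B)) S] \<gamma>) \<beta> = dmult B S \<alpha> \<beta> +[Ob (dual K (Alg B)) S] dmult B S \<gamma> \<beta>"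
    "\<gamma> \<in> dual_on K (Alg B) S ==> dmult B S \<alpha> (\<beta> +[Ob (dual K (Alg B)) S] \<gamma>) = dmult B S \<alpha> \<beta> +[Ob (dual K (Alg B)) S] dmult B S \<alpha> \<gamma>"
    "s \<in> carrier S ==> dmult B S (s \<cdot>[Ob (dual K (Alg B)) S] \<alpha>) \<beta> = s \<cdot>[Ob (dual K (Alg B)) S] dmult B S \<alpha> \<beta>"
    "s \<in> carrier S ==> dmult B S \<alpha> (s \<cdot>[Ob (dual K (Alg B)) S] \<beta>) = s \<cdot>[Ob (dual K (Alg B)) S] dmult B S \<alpha> \<beta>"
    "T \<in> CAlg K ==> f \<in> alg_hom K S T ==> Ar (dual K (Alg B)) S T f (dmult B S \<alpha> \<beta>) =
    dmult B T (Ar (dual K (Alg B)) S T f \<alpha>) (Ar (dual K (Alg B)) S T f \<beta>)"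
    "T \<in> CAlg K ==> f \<in> alg_hom K S T ==> Ar (dual K (Alg B)) S T f (dunit B S) = dunit B T"
  using ring.ring_simprules(5,6,13,23)[OF alg_functorD(4)[OF dA S]] alg_functorD(3)[OF dA S] \<alpha> \<beta>
    ring_hom_mult[OF alg_functorD(5)[OF dA S], of T f \<alpha> \<beta>] ring_hom_one[OF alg_functorD(5)[OF dA S], of T f]
  by (simp_all add: assoc_algebra_def)

lemma comult_binat:
  assumes S: "S \<in> CAlg K" and b: "b \<in> Alg B $ S"
  shows "binat K (dual K (Alg B)) (dual K (Alg B)) S (\<lambda>T f \<alpha> \<beta>. bidual K (Alg B) S b (T, f) (dmult B T \<alpha> \<beta>))"
  unfolding binat_def carrier_dual
proof (intro ballI conjI)
  note d = dual_onD(2-5)[OF bidual_dual_on[OF mB S b], unfolded carrier_dual]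
  fix T f \<alpha> \<beta> assume T: "T \<in> CAlg K" and f: "f \<in> alg_hom K S T" and \<alpha>: "\<alpha> \<in> dual_on K (Alg B) T" and \<beta>: "\<beta> \<in> dual_on K (Alg B) T"
  note m = dmult_facts[OF T]
  show "bidual K (Alg B) S b (V, g o[S] f) (dmult B V (Ar (dual K (Alg B)) T V g \<alpha>) (Ar (dual K (Alg B)) T V g \<beta>)) =
    g (bidual K (Alg B) S b (T, f) (dmult B T \<alpha> \<beta>))" if V: "V \<in> CAlg K" and g: "g \<in> alg_hom K T V" for V g
    unfolding m(7)[OF \<alpha> \<beta> V g, symmetric] by (rule d(4)[OF T f V g m(1)[OF \<alpha> \<beta>]])
qed (simp_all only: dmult_facts dual_onD(2-4)[OF bidual_dual_on[OF mB S b]] carrier_dual)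

text \<open>In \<open>comult\<close> the multiplication is lifted to the tensor product before the
  form is applied, while \<open>dual_of\<close> lifts the composite; both are additive and agree on
  pure tensors.\<close>

lemma comult_eq:
  assumes S: "S \<in> CAlg K" and b: "b \<in> Alg B $ S"
  shows "comult K B S b = dual_of K (dual K (Alg B)) (dual K (Alg B)) S (\<lambda>T f \<alpha> \<beta>. bidual K (Alg B) S b (T, f) (dmult B T \<alpha> \<beta>))"
    (is "_ = ?D")
proof -
  note \<theta> = bidual_dual_on[OF mB S b]
  note D = dual_of[OF mDB mDB S comult_binat[OF S b]]
  have "comult K B S b = nt_restrict K (tensor_functor (dual K (Alg B)) (dual K (Alg B))) S
    (\<lambda>T f z. bidual K (Alg B) S b (T, f) (tensor_lift (Ob (dual_alg K B) T) (\<lambda>(\<alpha>, \<beta>). dmult B T \<alpha> \<beta>) z))"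
    using S b \<theta> by (simp add: comult_def dual_map_def)
  also have "\<dots> = ?D"
    unfolding dual_of_def[OF mDB mDB]
  proof (rule nt_restrict_cong)
    fix T f z assume T: "T \<in> CAlg K" and f: "f \<in> alg_hom K S T"
      and z: "z \<in> (tensor_functor (dual K (Alg B)) (dual K (Alg B))) $ T"
    interpret T: two_modules T "Ob (dual K (Alg B)) T" "Ob (dual K (Alg B)) T" by (rule two_mod[OF mDB mDB T])
    interpret R: ring "Ob (dual_alg K B) T" by (rule alg_functorD(4)[OF dA T])
    have bl: "bilin T (Ob (dual K (Alg B)) T) (Ob (dual K (Alg B)) T) (Ob (dual_alg K B) T) (\<lambda>(\<alpha>, \<beta>). dmult B T \<alpha> \<beta>)"
      by (rule bilinI) (simp_all add: dmult_facts[OF T])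
    note l = T.tensor_lift_closed[OF R.abelian_group_axioms bl, unfolded dual_alg_simps]
      T.tensor_lift_add[OF R.abelian_group_axioms bl, unfolded dual_alg_simps]
      T.tensor_lift_ptens[OF R.abelian_group_axioms bl, unfolded prod.case]
    have "bidual K (Alg B) S b (T, f) (tensor_lift (Ob (dual_alg K B) T) (\<lambda>(\<alpha>, \<beta>). dmult B T \<alpha> \<beta>) z) = ?D (T, f) z"
    proof (rule tens_eqI[OF mDB mDB T z, where D = T])
      fix \<alpha> \<beta> assume a: "\<alpha> \<in> (dual K (Alg B)) $ T" "\<beta> \<in> (dual K (Alg B)) $ T"
      show "bidual K (Alg B) S b (T, f) (tensor_lift (Ob (dual_alg K B) T) (\<lambda>(\<alpha>, \<beta>). dmult B T \<alpha> \<beta>)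
        (ptens T (Ob (dual K (Alg B)) T) (Ob (dual K (Alg B)) T) \<alpha> \<beta>)) =
      ?D (T, f) (ptens T (Ob (dual K (Alg B)) T) (Ob (dual K (Alg B)) T) \<alpha> \<beta>)"
        unfolding D(2)[OF T f a] l(3)[OF a] ..
    qed (simp_all only: tensor_functor_simps l(1,2) dual_onD(2,3)[OF \<theta> T f] carrier_dual dual_onD(2,3)[OF D(1) T f, unfolded tensor_functor_simps])
    then show "bidual K (Alg B) S b (T, f) (tensor_lift (Ob (dual_alg K B) T) (\<lambda>(\<alpha>, \<beta>). dmult B T \<alpha> \<beta>) z) =
      tensor_lift T (\<lambda>(\<alpha>, \<beta>). bidual K (Alg B) S b (T, f) (dmult B T \<alpha> \<beta>)) z"
      unfolding dual_of_def[OF mDB mDB] nt_restrict_apply[OF T f z] .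
  qed
  finally show ?thesis .
qed

lemma comult:
  assumes S: "S \<in> CAlg K" and b: "b \<in> Alg B $ S"
  shows "comult K B S b \<in> dual_on K (tensor_functor (dual K (Alg B)) (dual K (Alg B))) S"
    "T \<in> CAlg K ==> f \<in> alg_hom K S T ==> \<alpha> \<in> dual_on K (Alg B) T ==> \<beta> \<in> dual_on K (Alg B) T ==>
    comult K B S b (T, f) (ptens T (Ob (dual K (Alg B)) T) (Ob (dual K (Alg B)) T) \<alpha> \<beta>) =
    dmult B T \<alpha> \<beta> (T, idm T) (Ar (Alg B) S T f b)"
  using dual_of[OF mDB mDB S comult_binat[OF S b], folded comult_eq[OF S b]] bidual_apply[OF mB S] dmult_facts(1)
  by simp_all

lemma comult_Mod_mor: "comult K B \<in> Mod_mor K (Alg B) (ttensor_alg K (Alg B) (Alg B))"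
proof -
  let ?BB = "tensor_functor (dual K (Alg B)) (dual K (Alg B))"
  note mBB = mod_functor_tensor[OF mDB mDB] and c = comult(1)
  note E = dual_tens_eqI[OF mDB mDB, unfolded carrier_dual]
  have r: "comult K B = (\<lambda>S\<in>CAlg K. \<lambda>b\<in>(Alg B) $ S. comult K B S b)"
    by (auto simp: comult_def restrict_def fun_eq_iff)
  have m: "comult K B \<in> Mor K (Alg B) (ttensor_alg K (Alg B) (Alg B))"
  proof (subst r, rule MorI)
    show "set_functor K (Alg B)" by (rule mod_functorD(1)[OF mB])
    fix S T f b assume S: "S \<in> CAlg K" and T: "T \<in> CAlg K" and f: "f \<in> alg_hom K S T" and b: "b \<in> Alg B $ S"
      and fb: "Ar (Alg B) S T f b \<in> Alg B $ T"
    show "comult K B T (Ar (Alg B) S T f b) = Ar (ttensor_alg K (Alg B) (Alg B)) S T f (comult K B S b)"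
      unfolding ttensor_alg_simps
      by (rule E[OF c[OF T fb] dual_on_Ar[OF mBB S T f c[OF S b]]])
        (simp add: comult[OF T fb] dual_apply(3) tens_ops(5)[OF mDB mDB, simplified] comult[OF S b] compose_alg_hom[OF f _ CAlg_AAlg[OF S]] sB(3)[OF S T _ f _ b])
  qed (simp add: c)
  note a = mod_functorD(3,4)[OF mB] and cB = mod_functor_closed[OF mB]
  show ?thesis
  proof (rule Mod_morI[OF m], unfold ttensor_alg_simps)
    fix S b assume S: "S \<in> CAlg K" and b: "b \<in> Alg B $ S"
    show "comult K B S (b +[Ob (Alg B) S] b') = comult K B S b +[Ob (dual K ?BB) S] comult K B S b'"
      if b': "b' \<in> Alg B $ S" for b'
      by (rule E[OF c[OF S cB(1)[OF S b b']] dual_on_ops(1)[OF mBB S c[OF S b] c[OF S b']]])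
        (simp add: comult[OF S cB(1)[OF S b b']] dual_apply(1) tens_ops(5)[OF mDB mDB, simplified] comult[OF S b] comult[OF S b']
          a(1)[OF S _ _ b b'] sB(1)[OF S _ _ b] sB(1)[OF S _ _ b'] dual_onD(3)[OF dmult_facts(1)] idm_alg_hom CAlg_AAlg)
    fix s assume s: "s \<in> carrier S"
    show "comult K B S (s \<cdot>[Ob (Alg B) S] b) = s \<cdot>[Ob (dual K ?BB) S] comult K B S b"
      by (rule E[OF c[OF S cB(2)[OF S s b]] dual_on_ops(2)[OF mBB S s c[OF S b]]])
        (simp add: comult[OF S cB(2)[OF S s b]] dual_apply(2) tens_ops(5)[OF mDB mDB, simplified] comult[OF S b]
          a(2)[OF S _ _ b s] sB(1)[OF S _ _ b] dual_onD(4)[OF dmult_facts(1)] idm_alg_hom CAlg_AAlg alg_homD(1)[OF _ s])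
  qed
qed

lemma counit:
  assumes S: "S \<in> CAlg K" and b: "b \<in> Alg B $ S"
  shows "counit K B S b = dunit B S (S, idm S) b"
proof -
  note i = idm_CAlg[OF S] and u = dmult_facts(2)[OF S]
  interpret M: module S "Ob (dual K (Alg B)) S" by (rule mod_functorD(2)[OF mDB S])
  have u: "dunit B S \<in> dual_on K (Alg B) S" using ring.ring_simprules(6)[OF alg_functorD(4)[OF dA S]] by simp
  have "counit K B S b = bidual K (Alg B) S b (S, idm S) (1[S] \<cdot>[Ob (dual K (Alg B)) S] dunit B S)"
    using S b i bidual_dual_on[OF mB S b] CAlg_closed(3)[OF S] by (simp add: counit_def dual_map_def)
  also have "\<dots> = dunit B S (S, idm S) b"
    using u M.smult_one[of "dunit B S"] bidual_apply[OF mB S S i u, of b] sB(2)[OF S b] by simp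
  finally show ?thesis .
qed

lemma counit_Mod_mor: "counit K B \<in> Mod_mor K (Alg B) Rfun"
proof -
  have u: "dunit B S \<in> dual_on K (Alg B) S" if S: "S \<in> CAlg K" for S using ring.ring_simprules(6)[OF alg_functorD(4)[OF dA S]] by simp
  have r: "counit K B = (\<lambda>S\<in>CAlg K. \<lambda>b\<in>(Alg B) $ S. counit K B S b)"
    by (auto simp: counit_def restrict_def fun_eq_iff)
  note i = idm_CAlg and d = dual_onD(2-5)[OF u]
  have m: "counit K B \<in> Mor K (Alg B) Rfun"
  proof (subst r, rule MorI)
    show "set_functor K (Alg B)" by (rule mod_functorD(1)[OF mB])
    fix S T f b assume S: "S \<in> CAlg K" and T: "T \<in> CAlg K" and f: "f \<in> alg_hom K S T" and b: "b \<in> Alg B $ S"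
      and fb: "Ar (Alg B) S T f b \<in> Alg B $ T"
    have "dunit B T (T, idm T) (Ar (Alg B) S T f b) = dunit B S (T, f) (Ar (Alg B) S T f b)"
      using dual_on_idm_Ar[OF mB u[OF S] S T f fb] dmult_facts(8)[OF S u[OF S] u[OF S] T f] by simp
    then show "counit K B T (Ar (Alg B) S T f b) = Ar Rfun S T f (counit K B S b)"
      using d(4)[OF S S i[OF S] T f b] by (simp add: counit S T b fb compose_idm_right[OF f])
  qed (simp add: counit d(1) i)
  show ?thesis
    by (rule Mod_morI[OF m]) (simp_all add: counit mod_functor_closed[OF mB] d i)
qed

end

text \<open>If the points multiply inside the dual, then the comultiplication is multiplicative, because
  the completed tensor product consists of functions on \<open>X \<times> X\<close>.\<close>

lemma comm_bialgebraI:
  fixes B :: "'u bialg"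
  assumes P: "pairing K X (Alg B) ev" and dA: "alg_functor K (dual_alg K B)"
    and m: "\<And>S x y. S \<in> CAlg K ==> x \<in> X $ S ==> y \<in> X $ S ==>
    \<exists>z\<in>X $ S. dmult B S (char_pairing.hat K X (Alg B) ev S x) (char_pairing.hat K X (Alg B) ev S y) = char_pairing.hat K X (Alg B) ev S z"
    and u: "\<And>S. S \<in> CAlg K ==> \<exists>z\<in>X $ S. dunit B S = char_pairing.hat K X (Alg B) ev S z"
  shows "comm_bialgebra K B"
proof -
  interpret pairing K X "Alg B" ev by (rule P)
  note c = comult[OF modB dA]
  \<comment> \<open>The comultiplication of \<open>b\<close> at \<open>(x, y)\<close> is
    \<open>b\<close> at the product point \<open>z\<close>, the same \<open>z\<close> for all
    \<open>b\<close>; multiplicativity of evaluation at \<open>z\<close> then gives that of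
    \<open>comult\<close>.\<close>
  have on: "\<exists>z\<in>X $ T. \<forall>b\<in>(Alg B) $ S. on_pts (comult K B S b) T f x y = ev T z (Ar (Alg B) S T f b)"
    if S: "S \<in> CAlg K" and T: "T \<in> CAlg K" and f: "f \<in> alg_hom K S T" and x: "x \<in> X $ T" and y: "y \<in> X $ T" for S T f x y
  proof -
    obtain z where z: "z \<in> X $ T" "dmult B T (hat T x) (hat T y) = hat T z" using m[OF T x y] by blast
    show ?thesis
      by (rule bexI[OF _ z(1)])
        (simp add: on_pts_def ptd_def c(2)[OF S _ T f hat_dual[OF T x] hat_dual[OF T y]] z(2) hat_idm[OF T z(1)] sB(1)[OF S T f])
  qed
  have "comult K B \<in> Alg_mor K (Alg B) (ttensor_alg K (Alg B) (Alg B))"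
  proof (rule Alg_morI[OF comult_Mod_mor[OF modB dA]])
    fix S assume S: "S \<in> CAlg K"
    show "comult K B S 1[Ob (Alg B) S] = 1[Ob (ttensor_alg K (Alg B) (Alg B)) S]"
    proof (rule on_pts_inj[OF S c(1)[OF S multB_closed(2)[OF S]] ttensor_one(1)[OF S]])
      fix T f x y assume *: "T \<in> CAlg K" "f \<in> alg_hom K S T" "x \<in> X $ T" "y \<in> X $ T"
      show "on_pts (comult K B S 1[Ob (Alg B) S]) T f x y = on_pts 1[Ob (ttensor_alg K (Alg B) (Alg B)) S] T f x y"
        using on[OF S *] ring_hom_one[OF alg_functorD(5)[OF B S *(1,2)]] by (auto simp: ttensor_one(2)[OF S *] multB_closed[OF S] ev_one *)
    qed
    fix b b' assume b: "b \<in> Alg B $ S" "b' \<in> Alg B $ S"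
    note cb = c(1)[OF S b(1)] c(1)[OF S b(2)]
    show "comult K B S (b *[Ob (Alg B) S] b') = comult K B S b *[Ob (ttensor_alg K (Alg B) (Alg B)) S] comult K B S b'"
    proof (rule on_pts_inj[OF S c(1)[OF S multB_closed(1)[OF S b]] ttensor_mult(1)[OF S cb]])
      fix T f x y assume *: "T \<in> CAlg K" "f \<in> alg_hom K S T" "x \<in> X $ T" "y \<in> X $ T"
      show "on_pts (comult K B S (b *[Ob (Alg B) S] b')) T f x y =
        on_pts (comult K B S b *[Ob (ttensor_alg K (Alg B) (Alg B)) S] comult K B S b') T f x y"
        using on[OF S *] ring_hom_mult[OF alg_functorD(5)[OF B S *(1,2)] b]
        by (auto simp: ttensor_mult(2)[OF S cb *] multB_closed[OF S] b ev_mult * sB(1)[OF S])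
    qed
  qed
  moreover have "counit K B \<in> Alg_mor K (Alg B) Rfun"
  proof (rule Alg_morI[OF counit_Mod_mor[OF modB dA]])
    fix S assume S: "S \<in> CAlg K"
    obtain z where z: "z \<in> X $ S" "dunit B S = hat S z" using u[OF S] by blast
    have e: "counit K B S b = ev S z b" if "b \<in> Alg B $ S" for b
      using that by (simp add: counit[OF modB dA S] z hat_idm[OF S])
    show "counit K B S 1[Ob (Alg B) S] = 1[Ob Rfun S]" by (simp add: e multB_closed S ev_one z)
    show "counit K B S (b *[Ob (Alg B) S] b') = counit K B S b *[Ob Rfun S] counit K B S b'"
      if "b \<in> Alg B $ S" "b' \<in> Alg B $ S" for b b'
      using that by (simp add: e multB_closed S ev_mult z)
  qed
  ultimately show ?thesis
    using rB pro_quasicoherent dA B_comm by (simp add: comm_bialgebra_def bialgebra_def)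
qed

lemma monoid_functorD:
  assumes "monoid_functor K X"
  shows "set_functor K X" "S \<in> CAlg K ==> monoid (Ob X S)"
    "S \<in> CAlg K ==> T \<in> CAlg K ==> f \<in> alg_hom K S T ==> x \<in> X $ S ==> y \<in> X $ S ==>
    Ar X S T f (x *[Ob X S] y) = Ar X S T f x *[Ob X T] Ar X S T f y"
    "S \<in> CAlg K ==> T \<in> CAlg K ==> f \<in> alg_hom K S T ==> Ar X S T f 1[Ob X S] = 1[Ob X T]"
  using assms by (auto simp: monoid_functor_def hom_def)

section \<open>Convolution on the dual of the functions on a monoid\<close>

locale monoid_pairing = pairing K X B ev
  for K :: "'u ring" and X :: "'u monfunc" and B :: "('u, 'u) mfunc" and ev +
  assumes monX: "monoid_functor K X"
begin

interpretation K: field K by (rule K_field)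

lemmas mX = monoid.m_closed[OF monoid_functorD(2)[OF monX]] monoid.one_closed[OF monoid_functorD(2)[OF monX]]
  monoid.m_assoc[OF monoid_functorD(2)[OF monX]] monoid.l_one[OF monoid_functorD(2)[OF monX]]
  monoid.r_one[OF monoid_functorD(2)[OF monX]] monoid_functorD(3,4)[OF monX]

text \<open>Translation of a function \<open>b\<close> by a point, \<open>y \<mapsto> b (x y)\<close>, and its convolution with an element of
  the dual, \<open>x \<mapsto> \<beta> (y \<mapsto> b (x y))\<close>.\<close>

definition transl :: "'u alg => 'u => 'u => 'u" where
  "transl S x b = repr S (\<lambda>T f y. ev T (Ar X S T f x *[Ob X T] y) (Ar B S T f b))"

definition convl :: "'u alg => ('u, 'u) nt => 'u => 'u" where
  "convl S \<beta> b = repr S (\<lambda>T f x. \<beta> (T, f) (transl T x (Ar B S T f b)))"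

text \<open>The convolution product
  \<open>b |-> \<alpha> (x |-> \<beta> (y |-> b (x y)))\<close>.\<close>

definition conv :: "'u alg => ('u, 'u) nt => ('u, 'u) nt => ('u, 'u) nt" where
  "conv S \<alpha> \<beta> = nt_restrict K B S (\<lambda>T f b. \<alpha> (T, f) (convl T (Ar (dual K B) S T f \<beta>) b))"

context
  fixes S assumes S: "S \<in> CAlg K"
begin

lemma transl:
  assumes x: "x \<in> X $ S" and b: "b \<in> B $ S"
  shows "transl S x b \<in> B $ S"
    "T \<in> CAlg K ==> f \<in> alg_hom K S T ==> y \<in> X $ T ==>
    ev T y (Ar B S T f (transl S x b)) = ev T (Ar X S T f x *[Ob X T] y) (Ar B S T f b)"
  unfolding transl_def
  by (rule repr[OF S]; simp add: ev_closed mX(1) sX(1)[OF S _ _ x] sB(1)[OF S _ _ b] sX(3)[OF S _ _ _ _ x] sB(3)[OF S _ _ _ _ b]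
    mX(6)[symmetric] ev_nat)+

lemma translI:
  assumes "x \<in> X $ S" "b \<in> B $ S" "c \<in> B $ S"
    and "\<And>T f y. T \<in> CAlg K ==> f \<in> alg_hom K S T ==> y \<in> X $ T ==>
    ev T y (Ar B S T f c) = ev T (Ar X S T f x *[Ob X T] y) (Ar B S T f b)"
  shows "c = transl S x b"
  by (rule fun_sep[OF S assms(3) transl(1)[OF assms(1,2)]]) (simp add: assms(4) transl(2)[OF assms(1,2)])

lemma ev_transl: "x \<in> X $ S ==> y \<in> X $ S ==> b \<in> B $ S ==>
    ev S y (transl S x b) = ev S (x *[Ob X S] y) b"
  using transl(2)[OF _ _ S idm_CAlg[OF S], of x b y] transl(1)[of x b] by (simp add: sB(2)[OF S] sX(2)[OF S])

lemma transl_one: "b \<in> B $ S ==> transl S 1[Ob X S] b = b"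
  by (rule translI[symmetric]) (simp_all add: mX S)

lemma transl_transl: "x \<in> X $ S ==> y \<in> X $ S ==> b \<in> B $ S ==>
    transl S y (transl S x b) = transl S (x *[Ob X S] y) b"
  by (rule translI) (simp_all add: transl mX S sX(1)[OF S])

lemma transl_lin:
  assumes x: "x \<in> X $ S" and b: "b \<in> B $ S"
  shows "c \<in> B $ S ==> transl S x (b +[Ob B S] c) = transl S x b +[Ob B S] transl S x c"
    "s \<in> carrier S ==> transl S x (s \<cdot>[Ob B S] b) = s \<cdot>[Ob B S] transl S x b"
  by (rule translI[symmetric]; simp add: x b clB[OF S] transl mod_functorD(3,4)[OF modB S] ev_add ev_smult
    sB(1)[OF S] sX(1)[OF S] mX alg_homD(1))+

end

lemma transl_Ar:
  assumes S: "S \<in> CAlg K" and T: "T \<in> CAlg K" and f: "f \<in> alg_hom K S T" and x: "x \<in> X $ S" and b: "b \<in> B $ S"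
  shows "Ar B S T f (transl S x b) = transl T (Ar X S T f x) (Ar B S T f b)"
  by (rule translI[OF T sX(1)[OF S T f x] sB(1)[OF S T f b] sB(1)[OF S T f transl(1)[OF S x b]]])
    (simp add: sB(3)[OF S T _ f _ transl(1)[OF S x b], symmetric] sB(3)[OF S T _ f _ b, symmetric] sX(3)[OF S T _ f _ x, symmetric]
      transl(2)[OF S x b] compose_CAlg[OF S f])

context
  fixes S assumes S: "S \<in> CAlg K"
begin

lemma convl:
  assumes \<beta>: "\<beta> \<in> dual_on K B S" and b: "b \<in> B $ S"
  shows "convl S \<beta> b \<in> B $ S"
    "T \<in> CAlg K ==> f \<in> alg_hom K S T ==> x \<in> X $ T ==>
    ev T x (Ar B S T f (convl S \<beta> b)) = \<beta> (T, f) (transl T x (Ar B S T f b))"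
  unfolding convl_def
  by (rule repr[OF S]; simp add: dual_onD[OF \<beta>] transl(1) sB(1)[OF S _ _ b] sB(3)[OF S _ _ _ _ b] transl_Ar[symmetric])+

lemma convlI:
  assumes "\<beta> \<in> dual_on K B S" "b \<in> B $ S" "c \<in> B $ S"
    and "\<And>T f x. T \<in> CAlg K ==> f \<in> alg_hom K S T ==> x \<in> X $ T ==>
    ev T x (Ar B S T f c) = \<beta> (T, f) (transl T x (Ar B S T f b))"
  shows "c = convl S \<beta> b"
  by (rule fun_sep[OF S assms(3) convl(1)[OF assms(1,2)]]) (simp add: assms(4) convl(2)[OF assms(1,2)])

lemma convl_hat_one: "b \<in> B $ S ==> convl S (hat S 1[Ob X S]) b = b"
  by (rule convlI[symmetric])
    (simp_all add: hat_dual mX S hat_apply transl(1) ev_transl sB(1)[OF S])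

lemma convl_lin:
  assumes \<beta>: "\<beta> \<in> dual_on K B S" and b: "b \<in> B $ S"
  shows "c \<in> B $ S ==> convl S \<beta> (b +[Ob B S] c) = convl S \<beta> b +[Ob B S] convl S \<beta> c"
    "s \<in> carrier S ==> convl S \<beta> (s \<cdot>[Ob B S] b) = s \<cdot>[Ob B S] convl S \<beta> b"
    "\<gamma> \<in> dual_on K B S ==> convl S (\<beta> +[Ob (dual K B) S] \<gamma>) b = convl S \<beta> b +[Ob B S] convl S \<gamma> b"
    "s \<in> carrier S ==> convl S (s \<cdot>[Ob (dual K B) S] \<beta>) b = s \<cdot>[Ob B S] convl S \<beta> b"
  by (rule convlI[symmetric]; simp add: \<beta> b clB[OF S] convl transl(1) transl_lin mod_functorD(3,4)[OF modB S] ev_add ev_smult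
    sB(1)[OF S] alg_homD(1) dual_on_ops[OF modB S] dual_apply(1,2) dual_onD(3,4)[OF \<beta>])+

end

lemma convl_Ar:
  assumes S: "S \<in> CAlg K" and T: "T \<in> CAlg K" and f: "f \<in> alg_hom K S T" and \<beta>: "\<beta> \<in> dual_on K B S" and b: "b \<in> B $ S"
  shows "Ar B S T f (convl S \<beta> b) = convl T (Ar (dual K B) S T f \<beta>) (Ar B S T f b)"
  by (rule convlI[OF T dual_on_Ar[OF modB S T f \<beta>] sB(1)[OF S T f b] sB(1)[OF S T f convl(1)[OF S \<beta> b]]])
    (simp add: sB(3)[OF S T _ f _ convl(1)[OF S \<beta> b], symmetric] sB(3)[OF S T _ f _ b, symmetric] sB(1)[OF S _ _ b]
      convl(2)[OF S \<beta> b] compose_CAlg[OF S f] transl(1) dual_apply(3))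

text \<open>Associativity of \<open>X\<close>: a translation multiplies on the left, while
  \<open>convl\<close> integrates a factor on the right.\<close>

lemma convl_transl:
  assumes S: "S \<in> CAlg K" and \<beta>: "\<beta> \<in> dual_on K B S" and x: "x \<in> X $ S" and b: "b \<in> B $ S"
  shows "transl S x (convl S \<beta> b) = convl S \<beta> (transl S x b)"
  by (rule convlI[OF S \<beta> transl(1)[OF S x b] transl(1)[OF S x convl(1)[OF S \<beta> b]]])
    (simp add: transl(2)[OF S x convl(1)[OF S \<beta> b]] convl(2)[OF S \<beta> b] mX sX(1)[OF S _ _ x] sB(1)[OF S _ _ b] transl_Ar[OF S _ _ x b] transl_transl)

context
  fixes S assumes S: "S \<in> CAlg K"
begin

lemma conv_apply: "T \<in> CAlg K ==> f \<in> alg_hom K S T ==> b \<in> B $ T ==>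
    conv S \<alpha> \<beta> (T, f) b = \<alpha> (T, f) (convl T (Ar (dual K B) S T f \<beta>) b)"
  by (simp add: conv_def)

lemma conv_dual:
  assumes \<alpha>: "\<alpha> \<in> dual_on K B S" and \<beta>: "\<beta> \<in> dual_on K B S"
  shows "conv S \<alpha> \<beta> \<in> dual_on K B S"
  unfolding conv_def
  by (rule nt_restrict_dual_on[OF modB S])
    (simp_all add: dual_onD[OF \<alpha>] convl(1) convl_lin dual_on_Ar[OF modB S _ _ \<beta>] \<beta> clB
      set_functorD(3)[OF mod_functorD(1)[OF mod_functor_dual[OF modB]] S] convl_Ar[symmetric])

lemma conv_hat:
  assumes x: "x \<in> X $ S" and y: "y \<in> X $ S"
  shows "conv S (hat S x) (hat S y) = hat S (x *[Ob X S] y)"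
proof (rule dual_on_eqI[OF conv_dual[OF hat_dual[OF S x] hat_dual[OF S y]] hat_dual[OF S mX(1)[OF S x y]]])
  fix T f b assume T: "T \<in> CAlg K" and f: "f \<in> alg_hom K S T" and b: "b \<in> B $ T"
  note i = idm_CAlg[OF T]
  note fx = sX(1)[OF S T f x] and fy = sX(1)[OF S T f y] and c = convl[OF T hat_dual[OF T sX(1)[OF S T f y]] b]
  have "ev T (Ar X S T f x) (convl T (hat T (Ar X S T f y)) b) = ev T (Ar X S T f x *[Ob X T] Ar X S T f y) b"
    using c(2)[OF T i fx] c(1) by (simp add: sB(2)[OF T] b hat_idm[OF T fy transl(1)[OF T fx b]] ev_transl[OF T fx fy b])
  then show "conv S (hat S x) (hat S y) (T, f) b = hat S (x *[Ob X S] y) (T, f) b"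
    using c(1) by (simp add: conv_apply T f b hat_Ar[OF S T f y] hat_apply mX(6)[OF S T f x y])
qed

end

text \<open>Convolution becomes composition of the operators \<open>convl S \<beta>\<close> on
  \<open>B\<close>, which yields associativity of \<open>conv\<close>.\<close>

lemma convl_conv:
  assumes S: "S \<in> CAlg K" and \<beta>: "\<beta> \<in> dual_on K B S" and \<gamma>: "\<gamma> \<in> dual_on K B S" and b: "b \<in> B $ S"
  shows "convl S \<beta> (convl S \<gamma> b) = convl S (conv S \<beta> \<gamma>) b"
  by (rule convlI[OF S conv_dual[OF S \<beta> \<gamma>] b convl(1)[OF S \<beta> convl(1)[OF S \<gamma> b]]])
    (simp add: convl(2)[OF S \<beta> convl(1)[OF S \<gamma> b]] convl_Ar[OF S _ _ \<gamma> b] conv_apply[OF S] transl(1) sB(1)[OF S _ _ b]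
      convl_transl[OF _ dual_on_Ar[OF modB S _ _ \<gamma>]])

lemma conv_Ar:
  assumes S: "S \<in> CAlg K" and T: "T \<in> CAlg K" and f: "f \<in> alg_hom K S T" and \<alpha>: "\<alpha> \<in> dual_on K B S" and \<beta>: "\<beta> \<in> dual_on K B S"
  shows "Ar (dual K B) S T f (conv S \<alpha> \<beta>) = conv T (Ar (dual K B) S T f \<alpha>) (Ar (dual K B) S T f \<beta>)"
  by (rule dual_on_eqI[OF dual_on_Ar[OF modB S T f conv_dual[OF S \<alpha> \<beta>]]
        conv_dual[OF T dual_on_Ar[OF modB S T f \<alpha>] dual_on_Ar[OF modB S T f \<beta>]]])
    (simp add: dual_apply(3) conv_apply[OF S] conv_apply[OF T] compose_CAlg[OF S f] convl(1) dual_on_Ar[OF modB S _ _ \<beta>]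
      set_functorD(3)[OF mod_functorD(1)[OF mod_functor_dual[OF modB]], unfolded carrier_dual, OF S T _ f _ \<beta>, symmetric])

definition bialg :: "'u bialg" where
  "bialg = \<lparr>Alg = B, dmult = conv, dunit = (\<lambda>S. hat S 1[Ob X S])\<rparr>"

lemma bialg_simps [simp]: "Alg bialg = B" "dmult bialg = conv" "dunit bialg S = hat S 1[Ob X S]"
  by (simp_all add: bialg_def)

lemma alg_functor_dual_bialg: "alg_functor K (dual_alg K bialg)"
proof -
  note E = dual_on_eqI and o = dual_on_ops[OF modB] and A = dual_on_Ar[OF modB] and cd = conv_dual
  note Al = mod_functorD(3,4)[OF mod_functor_dual[OF modB], unfolded carrier_dual]
  have u: "hat S 1[Ob X S] \<in> dual_on K B S" if "S \<in> CAlg K" for S using that by (simp add: hat_dual mX)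
  have uAr: "Ar (dual K B) S T f (hat S 1[Ob X S]) = hat T 1[Ob X T]" if "S \<in> CAlg K" "T \<in> CAlg K" "f \<in> alg_hom K S T" for S T f
    using that by (simp add: hat_Ar mX)
  have lin: "conv S (\<alpha> +[Ob (dual K B) S] \<gamma>) \<beta> = conv S \<alpha> \<beta> +[Ob (dual K B) S] conv S \<gamma> \<beta>" (is "PROP ?A")
    "conv S \<beta> (\<alpha> +[Ob (dual K B) S] \<gamma>) = conv S \<beta> \<alpha> +[Ob (dual K B) S] conv S \<beta> \<gamma>" (is "PROP ?B")
    "s \<in> carrier S ==> conv S (s \<cdot>[Ob (dual K B) S] \<alpha>) \<beta> = s \<cdot>[Ob (dual K B) S] conv S \<alpha> \<beta>"
    "s \<in> carrier S ==> conv S \<alpha> (s \<cdot>[Ob (dual K B) S] \<beta>) = s \<cdot>[Ob (dual K B) S] conv S \<alpha> \<beta>"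
    "conv S (conv S \<alpha> \<beta>) \<gamma> = conv S \<alpha> (conv S \<beta> \<gamma>)" (is "PROP ?C")
    "conv S (hat S 1[Ob X S]) \<alpha> = \<alpha>" "conv S \<alpha> (hat S 1[Ob X S]) = \<alpha>"
    if S: "S \<in> CAlg K" and \<alpha>: "\<alpha> \<in> dual_on K B S" and \<beta>: "\<beta> \<in> dual_on K B S" and \<gamma>: "\<gamma> \<in> dual_on K B S" for S \<alpha> \<beta> \<gamma> s
  proof -
    note f = conv_apply[OF S] convl convl_lin dual_apply(1,2) Al[OF S] A[OF S]
    show "PROP ?A"
      by (rule E[OF cd[OF S o(1)[OF S \<alpha> \<gamma>] \<beta>] o(1)[OF S cd[OF S \<alpha> \<beta>] cd[OF S \<gamma> \<beta>]]]) (simp add: f \<beta>)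
    show "PROP ?B"
      by (rule E[OF cd[OF S \<beta> o(1)[OF S \<alpha> \<gamma>]] o(1)[OF S cd[OF S \<beta> \<alpha>] cd[OF S \<beta> \<gamma>]]]) (simp add: f \<alpha> \<gamma> dual_onD(3)[OF \<beta>])
    show "conv S (s \<cdot>[Ob (dual K B) S] \<alpha>) \<beta> = s \<cdot>[Ob (dual K B) S] conv S \<alpha> \<beta>" if s: "s \<in> carrier S"
      by (rule E[OF cd[OF S o(2)[OF S s \<alpha>] \<beta>] o(2)[OF S s cd[OF S \<alpha> \<beta>]]]) (simp add: f \<beta>)
    show "conv S \<alpha> (s \<cdot>[Ob (dual K B) S] \<beta>) = s \<cdot>[Ob (dual K B) S] conv S \<alpha> \<beta>" if s: "s \<in> carrier S"
      by (rule E[OF cd[OF S \<alpha> o(2)[OF S s \<beta>]] o(2)[OF S s cd[OF S \<alpha> \<beta>]]]) (simp add: f \<beta> s dual_onD(4)[OF \<alpha>] alg_homD(1)[OF _ s])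
    show "PROP ?C"
      by (rule E[OF cd[OF S cd[OF S \<alpha> \<beta>] \<gamma>] cd[OF S \<alpha> cd[OF S \<beta> \<gamma>]]]) (simp add: f \<beta> \<gamma> conv_Ar[OF S] convl_conv)
    show "conv S (hat S 1[Ob X S]) \<alpha> = \<alpha>"
    proof (rule E[OF cd[OF S u[OF S] \<alpha>] \<alpha>])
      fix T f b assume T: "T \<in> CAlg K" and g: "f \<in> alg_hom K S T" and b: "b \<in> B $ T"
      note c = convl[OF T A[OF S T g \<alpha>] b]
      show "conv S (hat S 1[Ob X S]) \<alpha> (T, f) b = \<alpha> (T, f) b"
        using c(2)[OF T idm_CAlg[OF T] mX(2)[OF T]] c(1)
        by (simp add: conv_apply[OF S T g b] hat_apply[OF T g] mX(7)[OF S T g] sB(2)[OF T] b transl_one[OF T b]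
            dual_on_idm_Ar[OF modB \<alpha> S T g b])
    qed
    show "conv S \<alpha> (hat S 1[Ob X S]) = \<alpha>"
      by (rule E[OF cd[OF S \<alpha> u[OF S]] \<alpha>]) (simp add: conv_apply[OF S] uAr[OF S] convl_hat_one)
  qed
  have "ring (Ob (dual_alg K bialg) S)" if S: "S \<in> CAlg K" for S
  proof (rule ringI)
    interpret M: module S "Ob (dual_alg K bialg) S"
      by (rule mod_functorD(2)[OF mod_functor_dual_alg S]) (simp add: modB)
    show "abelian_group (Ob (dual_alg K bialg) S)" by (rule M.abelian_group_axioms)
    show "monoid (Ob (dual_alg K bialg) S)"
      by (rule monoidI) (simp_all add: cd[OF S] u[OF S] lin(5-7)[OF S])
  qed (simp_all add: lin(1,2)[OF S])
  moreover have "mod_functor K (dual_alg K bialg)" by (rule mod_functor_dual_alg) (simp add: modB)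
  ultimately show ?thesis
    unfolding alg_functor_def assoc_algebra_def
    by (auto simp: mod_functorD lin cd conv_Ar uAr A Al intro!: ring_hom_memI)
qed

lemma comm_bialgebra: "comm_bialgebra K bialg"
proof (rule comm_bialgebraI[of K X bialg ev])
  show "pairing K X (Alg bialg) ev" using pairing_axioms by simp
qed (use alg_functor_dual_bialg conv_hat mX in auto)

end

text \<open>The link between an object of one category and one of the other, independent of how
  either is built from the other: points multiply in \<open>X\<close> as they do in the dual of
  \<open>B\<close>.\<close>

locale dual_pair = pairing K X "Alg B" ev
  for K :: "'u ring" and X :: "'u monfunc" and B :: "'u bialg" and ev +
  assumes X_monoid: "monoid_functor K X" and X_small: "small_functor K X" and B_bialg: "comm_bialgebra K B"
    and dmult_hat: "\<And>S x y. S \<in> CAlg K ==> x \<in> X $ S ==> y \<in> X $ S ==>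
    dmult B S (hat S x) (hat S y) = hat S (x *[Ob X S] y)"
    and dunit_hat: "\<And>S. S \<in> CAlg K ==> dunit B S = hat S 1[Ob X S]"

lemma (in monoid_pairing) dual_pair: "small_functor K X ==> dual_pair K X bialg ev"
  using pairing_axioms comm_bialgebra monX conv_hat by (simp add: dual_pair_def dual_pair_axioms_def)

section \<open>From affine monoids to bialgebras\<close>

definition copy_functor :: "('u, 'b) mfunc => ('u, 'u) mfunc" where
  "copy_functor F = \<lparr>Ob = (\<lambda>S. copy (Ob F S)), Ar = (\<lambda>S T f z. enc (Ob F T) (Ar F S T f (dec (Ob F S) z)))\<rparr>"

context base
begin

interpretation K: field K by (rule K_field)

text \<open>Functions on \<open>X\<close> live in a type larger than \<open>'u\<close>, but a
  \<open>bialg\<close> has its values in \<open>'u\<close>. Reflexivity includes smallness of the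
  values, so a copy exists, and a pairing is insensitive to it.\<close>

lemma copy_pairing:
  fixes F :: "('u, 'b) mfunc"
  assumes P: "pairing K X F ev"
  shows "pairing K X (copy_functor F) (\<lambda>S x b. ev S x (dec (Ob F S) b))"
proof -
  interpret pairing K X F ev by (rule P)
  let ?C = "copy_functor F"
  have sc: "small_copy TYPE('u) (Ob F S)" if "S \<in> CAlg K" for S
    using rB that by unfold_locales (simp add: reflexive_def small_functor_def)
  have [simp]: "Ob ?C S = copy (Ob F S)" "Ar ?C S T f z = enc (Ob F T) (Ar F S T f (dec (Ob F S) z))" for S T f z
    by (simp_all add: copy_functor_def)
  note e = small_copy.dec_enc[OF sc] small_copy.enc_dec[OF sc] small_copy.enc_closed[OF sc] small_copy.dec_closed[OF sc]
  note c = small_copy.copy_simps[OF sc]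
  have d: "dec (Ob F S) (b +[copy (Ob F S)] b' :: 'u) = dec (Ob F S) b +[Ob F S] dec (Ob F S) b'"
    "dec (Ob F S) (b *[copy (Ob F S)] b' :: 'u) = dec (Ob F S) b *[Ob F S] dec (Ob F S) b'"
    if "S \<in> CAlg K" "b \<in> carrier (copy (Ob F S))" "b' \<in> carrier (copy (Ob F S))" for S b b'
    using that by (simp_all add: c e clB multB_closed)
  have ds: "dec (Ob F S) (s \<cdot>[copy (Ob F S)] b :: 'u) = s \<cdot>[Ob F S] dec (Ob F S) b"
    if "S \<in> CAlg K" "b \<in> carrier (copy (Ob F S))" "s \<in> carrier S" for S b s
    using that by (simp add: c e clB)
  have one: "dec (Ob F S) (1[copy (Ob F S)] :: 'u) = 1[Ob F S]" if "S \<in> CAlg K" for S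
    using that by (simp add: c e multB_closed)
  have mC: "mod_functor K ?C"
    unfolding mod_functor_def set_functor_def
    by (auto simp: small_copy.copy_module[OF sc mod_functorD(2)[OF modB]] e sB mod_functorD(3,4)[OF modB] c clB alg_homD(1))
  have A: "alg_functor K ?C"
    unfolding alg_functor_def
    by (auto simp: mC small_copy.copy_assoc_algebra[OF sc alg_functorD(3)[OF B]] e sB c multB_closed clB
      ring_hom_mult[OF alg_functorD(5)[OF B]] ring_hom_one[OF alg_functorD(5)[OF B]] mod_functorD(3)[OF modB] intro!: ring_hom_memI)
  have E: "(\<lambda>S\<in>CAlg K. \<lambda>b\<in>F $ S. enc (Ob F S) b) \<in> Mod_mor K F ?C"
    by (intro Mod_morI MorI alg_functorD(2)[OF B]) (simp_all add: e c clB)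
  \<comment> \<open>Characters of the copy become characters of \<open>F\<close> through
    \<open>enc\<close>, so completeness carries over.\<close>
  have dr: "nt_restrict K F S (\<lambda>T f b. \<chi> (T, f) (enc (Ob F T) b)) \<in> chars K F S" if S: "S \<in> CAlg K" and \<chi>: "\<chi> \<in> chars K ?C S" for S \<chi>
  proof -
    note m = dual_onD[OF charsD(1)[OF \<chi>], simplified] charsD(3,4)[OF \<chi>, simplified]
    have h: "enc (Ob F T) (b +[Ob F T] b') = enc (Ob F T) b +[copy (Ob F T)] (enc (Ob F T) b' :: 'u)"
      "enc (Ob F T) (b *[Ob F T] b') = enc (Ob F T) b *[copy (Ob F T)] (enc (Ob F T) b' :: 'u)"
      "enc (Ob F T) (t \<cdot>[Ob F T] b) = t \<cdot>[copy (Ob F T)] (enc (Ob F T) b :: 'u)"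
      "enc (Ob F T) 1[Ob F T] = (1[copy (Ob F T)] :: 'u)"
      if "T \<in> CAlg K" "b \<in> F $ T" "b' \<in> F $ T" for T b b' t using that by (simp_all add: c e)
    have h1: "enc (Ob F T) 1[Ob F T] = (1[copy (Ob F T)] :: 'u)" if "T \<in> CAlg K" for T using that by (simp add: c)
    have n: "\<chi> (V, g o[S] f) (enc (Ob F V) (Ar F T V g b)) = g (\<chi> (T, f) (enc (Ob F T) b))"
      if "T \<in> CAlg K" "f \<in> alg_hom K S T" "V \<in> CAlg K" "g \<in> alg_hom K T V" "b \<in> F $ T" for T f V g b
      using m(5)[of T f V g "enc (Ob F T) b"] that by (simp add: e)
    show ?thesis
    proof (rule charsI)
      show "nt_restrict K F S (\<lambda>T f b. \<chi> (T, f) (enc (Ob F T) b)) \<in> dual_on K F S"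
        by (rule nt_restrict_dual_on[OF modB S]) (simp_all add: m h e n)
    qed (simp_all add: multB_closed h h1 e m)
  qed
  have cr: "cring (copy (Ob F S) :: ('u, 'u) module)" if S: "S \<in> CAlg K" for S
  proof (rule cring.intro)
    interpret R: cring "Ob F S" by (rule B_comm[OF S])
    show r: "ring (copy (Ob F S) :: ('u, 'u) module)" using alg_functorD(4)[OF A S] by simp
    interpret r: ring "copy (Ob F S) :: ('u, 'u) module" by (rule r)
    show "comm_monoid (copy (Ob F S) :: ('u, 'u) module)"
      by (rule monoid.monoid_comm_monoidI) (simp_all add: r.monoid_axioms c[OF S] e[OF S] R.m_comm)
  qed
  show ?thesis
  proof (intro pairing.intro char_pairing.intro char_pairing_axioms.intro pairing_axioms.intro, goal_cases)
    case (4)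
    have "bij_betw ((\<lambda>S\<in>CAlg K. \<lambda>b\<in>F $ S. enc (Ob F S) b) S) (F $ S) (?C $ S)" if "S \<in> CAlg K" for S
      using that by (intro bij_betw_byWitness[where f' = "dec (Ob F S)"]) (auto simp: e)
    then show ?case by (rule reflexive_iso[OF mC E _ rB])
  next
    case (12 S \<chi>)
    obtain x where x: "x \<in> X $ S" "\<And>T f b. T \<in> CAlg K ==> f \<in> alg_hom K S T ==> b \<in> F $ T ==>
      nt_restrict K F S (\<lambda>T f b. \<chi> (T, f) (enc (Ob F T) b)) (T, f) b = ev T (Ar X S T f x) b"
      using char_complete[OF 12(1) dr[OF 12]] by blast
    show ?case
    proof (intro bexI[OF _ x(1)] allI impI)
      fix T f b assume "T \<in> CAlg K" "f \<in> alg_hom K S T" "b \<in> ?C $ T"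
      then show "\<chi> (T, f) b = ev T (Ar X S T f x) (dec (Ob F T) b)" using x(2)[of T f "dec (Ob F T) b"] by (simp add: e)
    qed
  next
    case (13 S x y) show ?case
    proof (rule char_sep[OF 13(1-3)])
      fix T f b assume "T \<in> CAlg K" "f \<in> alg_hom K S T" "b \<in> F $ T"
      then show "ev T (Ar X S T f x) b = ev T (Ar X S T f y) b" using 13(4)[of T f "enc (Ob F T) b"] by (simp add: e)
    qed
  next
    case (14 S \<theta>)
    obtain b where "b \<in> F $ S" "\<forall>T f x. T \<in> CAlg K --> f \<in> alg_hom K S T --> x \<in> X $ T --> ev T x (Ar F S T f b) = \<theta> (T, f) x"
      using fun_complete[OF 14] by blast
    then show ?case using 14(1) by (intro bexI[of _ "enc (Ob F S) b"]) (simp_all add: e sB(1))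
  next
    case (15 S b b')
    then have b: "b \<in> carrier (copy (Ob F S))" "b' \<in> carrier (copy (Ob F S))" by simp_all
    have "dec (Ob F S) b = dec (Ob F S) b'"
    proof (rule fun_sep[OF 15(1) e(4)[OF 15(1) b(1)] e(4)[OF 15(1) b(2)]])
      fix T f x assume *: "T \<in> CAlg K" "f \<in> alg_hom K S T" "x \<in> X $ T"
      show "ev T x (Ar F S T f (dec (Ob F S) b)) = ev T x (Ar F S T f (dec (Ob F S) b'))"
        using 15(4)[OF *] sB(1)[OF 15(1) *(1,2)] b by (simp add: e 15(1) *(1))
    qed
    then show ?case using e(2)[OF 15(1) b(1)] e(2)[OF 15(1) b(2)] by metis
  qed (simp_all add: base_axioms X A cr d ds one e ev_closed ev_add ev_mult ev_smult ev_one ev_nat sB(1))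
qed

text \<open>The tautological pairing. The functions are complete by definition; completeness of
  characters is the bijectivity of \<open>to_Spec\<close>, after a character is turned into a
  morphism to \<open>qc K S\<close>.\<close>

lemma affine_pairing:
  assumes X: "affine K X"
  shows "pairing K X (fun_functor K X) (\<lambda>S x \<theta>. \<theta> (S, idm S) x)"
proof -
  have sX: "set_functor K X" and r: "reflexive K (fun_functor K X)"
    and bij: "\<And>S. S \<in> CAlg K ==> bij_betw (to_Spec K X S) (X $ S) ((Spec K (fun_functor K X)) $ S)"
    using X by (simp_all add: affine_def)
  note F = alg_functor_fun[OF sX] and s = set_functorD[OF sX] and i = idm_CAlg and d = fun_onD
  have Ar: "Ar (fun_functor K X) S T f \<theta> (T, idm T) x = \<theta> (T, f) x"
    if "T \<in> CAlg K" "f \<in> alg_hom K S T" "x \<in> X $ T" for S T f \<theta> x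
    using that by (simp add: fun_functor_simps i compose_idm_left)
  show ?thesis
  proof (intro pairing.intro char_pairing.intro char_pairing_axioms.intro pairing_axioms.intro, goal_cases)
    case (5 S) show ?case
    proof (rule cring.intro)
      show R: "ring (Ob (fun_functor K X) S)" by (rule alg_functorD(4)[OF F 5])
      show "comm_monoid (Ob (fun_functor K X) S)"
      proof (rule monoid.monoid_comm_monoidI[OF ring.axioms(2)[OF R]])
        fix \<theta> \<eta> assume t: "\<theta> \<in> fun_functor K X $ S" "\<eta> \<in> fun_functor K X $ S"
        show "\<theta> *[Ob (fun_functor K X) S] \<eta> = \<eta> *[Ob (fun_functor K X) S] \<theta>"
          unfolding fun_functor_simps
          by (rule nt_restrict_cong) (use t in \<open>simp add: fun_functor_simps cring.cring_simprules(14)[OF CAlg_cring] d\<close>)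
      qed
    qed
  next
    case (11 S T f x \<theta>) then show ?case
      using d(2)[of \<theta> K X S S "idm S" T f x] by (simp add: Ar s i fun_functor_simps(1) compose_idm_right)
  next
    case (12 S \<chi>)
    define \<phi> where "\<phi> = (\<lambda>R\<in>CAlg K. \<lambda>\<theta>\<in>(fun_functor K X) $ R. \<chi> (tens K S R, inl S R) (Ar (fun_functor K X) R (tens K S R) (inr S R) \<theta>))"
    have "\<phi> \<in> Alg_mor K (fun_functor K X) (qc K S)" unfolding \<phi>_def by (rule char_mor_Alg_mor[OF F 12])
    then have "\<phi> \<in> to_Spec K X S ` (X $ S)" using bij[OF 12(1)] by (simp add: bij_betw_def Spec_def)
    then obtain x where x: "x \<in> X $ S" "\<phi> = to_Spec K X S x" by blast
    show ?case
    proof (intro bexI[OF _ x(1)] allI impI)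
      fix T f \<theta> assume T: "T \<in> CAlg K" and f: "f \<in> alg_hom K S T" and \<theta>: "\<theta> \<in> fun_functor K X $ T"
      note j = inlr[OF 12(1) T] and a = act_facts(1)[OF 12(1) T f]
      have "\<chi> (T, f) \<theta> = act S T f (\<phi> T \<theta>)" using char_mor_char[OF F 12(1) charsD(1)[OF 12(2)] T f \<theta>] T \<theta> by (simp add: \<phi>_def)
      also have "\<phi> T \<theta> = \<theta> (tens K S T, inr S T) (Ar X S (tens K S T) (inl S T) x)"
        using T \<theta> by (simp add: x to_Spec_def inl_def[symmetric] inr_def[symmetric])
      also have "act S T f \<dots> = \<theta> (T, idm T) (Ar X S T f x)"
        using d(2)[of \<theta> K X T, OF _ j(1,3) T a s(1)[OF 12(1) j(1,2) x(1)]] \<theta>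
        by (simp add: fun_functor_simps(1) act_inl[OF 12(1) T f] act_inr[OF 12(1) T f] s(3)[OF 12(1) j(1) T j(2) a x(1), symmetric])
      finally show "\<chi> (T, f) \<theta> = \<theta> (T, idm T) (Ar X S T f x)" .
    qed
  next
    case (13 S x y)
    have "to_Spec K X S x = to_Spec K X S y"
      unfolding to_Spec_def inl_def[symmetric] inr_def[symmetric]
    proof (intro restrict_ext)
      fix R \<theta> assume R: "R \<in> CAlg K" and \<theta>: "\<theta> \<in> fun_functor K X $ R"
      note j = inlr[OF 13(1) R]
      show "\<theta> (tens K S R, inr S R) (Ar X S (tens K S R) (inl S R) x) = \<theta> (tens K S R, inr S R) (Ar X S (tens K S R) (inl S R) y)"
        using 13(4)[OF j(1,2) set_functorD(1)[OF alg_functorD(2)[OF F] R j(1,3) \<theta>]] s(1)[OF 13(1) j(1,2)] 13(2,3) by (simp add: Ar j)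
    qed
    then show ?case using bij[OF 13(1)] 13 by (auto simp: bij_betw_def inj_on_def)
  next
    case (14 S \<theta>) then show ?case by (intro bexI[of _ \<theta>]) (simp_all add: Ar fun_functor_simps(1))
  next
    case (15 S \<theta> \<eta>) show ?case
      by (rule fun_on_eqI[of \<theta> K X S]) (use 15 in \<open>simp_all add: Ar fun_functor_simps(1)\<close>)
  qed (simp_all add: base_axioms sX F r, simp_all add: fun_functor_simps i d CAlg_closed)
qed

lemma dual_pair_of_monoid:
  assumes aff: "affine K X" and m: "monoid_functor K X"
  shows "\<exists>B ev. comm_bialgebra K B \<and> dual_pair K X B ev"
proof -
  interpret monoid_pairing K X "copy_functor (fun_functor K X)" "\<lambda>S x b. dec (Ob (fun_functor K X) S) b (S, idm S) x"
    by (intro monoid_pairing.intro copy_pairing affine_pairing aff monoid_pairing_axioms.intro m)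
  show ?thesis using comm_bialgebra dual_pair aff unfolding affine_def by blast
qed

end

section \<open>From bialgebras to affine monoids\<close>

lemma comm_bialgebraD:
  assumes "comm_bialgebra K B"
  shows "reflexive K (Alg B)" "pro_quasicoherent K (Alg B)" "alg_functor K (Alg B)" "mod_functor K (Alg B)"
    "alg_functor K (dual_alg K B)" "comult K B \<in> Alg_mor K (Alg B) (ttensor_alg K (Alg B) (Alg B))"
    "counit K B \<in> Alg_mor K (Alg B) Rfun" "S \<in> CAlg K ==> cring (Ob (Alg B) S)"
  using assms by (auto simp: comm_bialgebra_def bialgebra_def pro_quasicoherent_def alg_functor_def)

lemma chars_Ar:
  assumes A: "mod_functor K A" and S: "S \<in> CAlg K" and T: "T \<in> CAlg K" and f: "f \<in> alg_hom K S T" and \<chi>: "\<chi> \<in> chars K A S"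
    and "alg_functor K A"
  shows "Ar (dual K A) S T f \<chi> \<in> chars K A T"
  by (rule charsI[OF dual_on_Ar[OF A S T f charsD(1)[OF \<chi>]]])
    (use ring.ring_simprules(5,6)[OF alg_functorD(4)[OF assms(6)]] in
      \<open>simp_all add: dual_apply(3) charsD[OF \<chi>] compose_alg_hom[OF f _ CAlg_AAlg[OF S]]\<close>)

context base
begin

interpretation K: field K by (rule K_field)

text \<open>The points are the characters of \<open>B\<close>, multiplied in the dual.
  Pro-quasicoherence makes \<open>B\<close> all functions on them, so products in the completed
  tensor product are pointwise on \<open>X \<times> X\<close>; multiplicativity of
  \<open>comult\<close> then says that products of characters are characters.\<close>

lemma dual_pair_of_bialgebra:
  fixes B :: "'u bialg"
  assumes bi: "comm_bialgebra K B"
  shows "\<exists>X ev. affine K X \<and> monoid_functor K X \<and> dual_pair K X B ev"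
proof -
  note b = comm_bialgebraD[OF bi]
  note mB = b(4) and dA = b(5)
  define D where "D = Ob (dual K (Alg B))"
  \<comment> \<open>Characters live in a type above \<open>'u\<close>; they are encoded through the
    whole dual, which is small by reflexivity.\<close>
  define X :: "'u monfunc" where "X = \<lparr>Ob = (\<lambda>S. \<lparr>carrier = enc (D S) ` chars K (Alg B) S,
    monoid.mult = (\<lambda>x y. enc (D S) (dmult B S (dec (D S) x) (dec (D S) y))), one = enc (D S) (dunit B S)\<rparr>),
    Ar = (\<lambda>S T f x. enc (D T) (Ar (dual K (Alg B)) S T f (dec (D S) x)))\<rparr>"
  have [simp]: "X $ S = enc (D S) ` chars K (Alg B) S" "1[Ob X S] = enc (D S) (dunit B S)"
    "x *[Ob X S] y = enc (D S) (dmult B S (dec (D S) x) (dec (D S) y))"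
    "Ar X S T f x = enc (D T) (Ar (dual K (Alg B)) S T f (dec (D S) x))" for S T f x y
    by (simp_all add: X_def)
  define ev :: "'u alg => 'u => 'u => 'u" where "ev S x b = dec (D S) x (S, idm S) b" for S x b
  have sc: "small_copy TYPE('u) (D S)" if "S \<in> CAlg K" for S
    using b(1) that by unfold_locales (simp add: reflexive_def small_functor_def D_def)
  have de [simp]: "dec (D S) (enc (D S) \<chi> :: 'u) = \<chi>" if "S \<in> CAlg K" "\<chi> \<in> chars K (Alg B) S" for S \<chi>
    using small_copy.dec_enc[OF sc[OF that(1)]] charsD(1)[OF that(2)] by (simp add: D_def)
  note i = idm_CAlg and cAr = chars_Ar[OF mB _ _ _ _ b(3)] and dual = charsD(1)
  note sD = set_functorD[OF mod_functorD(1)[OF mod_functor_dual[OF mB]], unfolded carrier_dual]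
  note ia = dual_on_idm_Ar[OF mB dual]
  have sX: "set_functor K X"
    unfolding set_functor_def by (auto simp: cAr sD(2)[OF _ dual] sD(3)[OF _ _ _ _ _ dual])
  have ev: "c \<in> Alg B $ S ==> ev S x c \<in> carrier S"
    "c \<in> Alg B $ S ==> c' \<in> Alg B $ S ==> ev S x (c +[Ob (Alg B) S] c') = ev S x c +[S] ev S x c'" (is "PROP ?A")
    "c \<in> Alg B $ S ==> c' \<in> Alg B $ S ==> ev S x (c *[Ob (Alg B) S] c') = ev S x c *[S] ev S x c'" (is "PROP ?B")
    "c \<in> Alg B $ S ==> s \<in> carrier S ==> ev S x (s \<cdot>[Ob (Alg B) S] c) = s *[S] ev S x c" (is "PROP ?C")
    "ev S x 1[Ob (Alg B) S] = 1[S]" if S: "S \<in> CAlg K" and x: "x \<in> X $ S" for S x c c' s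
  proof -
    obtain \<chi> where \<chi>: "\<chi> \<in> chars K (Alg B) S" "dec (D S) x = \<chi>" using x de[OF S] by auto
    note m = dual_onD(2-4)[OF dual[OF \<chi>(1)] S i[OF S]] charsD(3,4)[OF \<chi>(1) S i[OF S]]
    show "c \<in> Alg B $ S ==> ev S x c \<in> carrier S"
    "PROP ?A"
    "PROP ?B"
    "PROP ?C"
    "ev S x 1[Ob (Alg B) S] = 1[S]"
      unfolding ev_def \<chi>(2) by (fact m)+
  qed
  have "char_pairing K X (Alg B) ev"
  proof (intro char_pairing.intro char_pairing_axioms.intro base_axioms sX b(1,3,8), goal_cases)
    case (7 S T f x c)
    then obtain \<chi> where \<chi>: "\<chi> \<in> chars K (Alg B) S" "x = enc (D S) \<chi>" by auto
    show ?case
      using 7 dual_onD(5)[OF dual[OF \<chi>(1)] 7(1) i[OF 7(1)] 7(2,3,5)] ia[OF \<chi>(1) 7(1-3)] set_functorD(1)[OF alg_functorD(2)[OF b(3)] 7(1-3,5)]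
      by (simp add: ev_def \<chi> cAr compose_idm_right[OF 7(3)])
  next
    case (8 S \<chi>) then show ?case
      by (intro bexI[of _ "enc (D S) \<chi>"]) (simp_all add: ev_def cAr ia)
  next
    case (9 S x y)
    then obtain \<chi> \<psi> where c: "\<chi> \<in> chars K (Alg B) S" "x = enc (D S) \<chi>" "\<psi> \<in> chars K (Alg B) S" "y = enc (D S) \<psi>" by auto
    have "\<chi> = \<psi>"
    proof (rule dual_on_eqI[OF dual[OF c(1)] dual[OF c(3)]])
      fix T f d assume *: "T \<in> CAlg K" "f \<in> alg_hom K S T" "d \<in> Alg B $ T"
      show "\<chi> (T, f) d = \<psi> (T, f) d"
        using 9(4)[OF *] cAr[OF 9(1) *(1,2)] ia[OF _ 9(1) *] c by (simp add: ev_def 9(1) *(1))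
    qed
    then show ?case by (simp add: c)
  qed (assumption | rule ev)+
  then interpret char_pairing K X "Alg B" ev .
  \<comment> \<open>Here pro-quasicoherence enters: it supplies completeness and separation of
    functions.\<close>
  interpret pairing K X "Alg B" ev
    by (rule pairing.intro[OF char_pairing_axioms], rule pairing_axioms.intro, erule (1) pro_qc_functions(2)[OF b(2)], rule pro_qc_functions(1)[OF b(2)])
  have hat: "hat S (enc (D S) \<chi>) = \<chi>" if S: "S \<in> CAlg K" and \<chi>: "\<chi> \<in> chars K (Alg B) S" for S \<chi>
    by (rule dual_on_eqI[OF hat_dual[OF S] dual[OF \<chi>]]) (use S \<chi> in \<open>simp_all add: hat_apply ev_def cAr ia\<close>)
  note df = dmult_facts[OF mB dA]
  have mult: "dmult B S \<chi> \<psi> \<in> chars K (Alg B) S"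
    if S: "S \<in> CAlg K" and \<chi>: "\<chi> \<in> chars K (Alg B) S" and \<psi>: "\<psi> \<in> chars K (Alg B) S" for S \<chi> \<psi>
  proof -
    \<comment> \<open>The product of two characters, evaluated at \<open>c\<close>, is the
      comultiplication of \<open>c\<close> at the corresponding pair of points, where products are
      pointwise.\<close>
    have e: "\<exists>x\<in>X $ T. \<exists>y\<in>X $ T. \<forall>c\<in>(Alg B) $ T. dmult B S \<chi> \<psi> (T, f) c = on_pts (comult K B T c) T (idm T) x y"
      if T: "T \<in> CAlg K" and f: "f \<in> alg_hom K S T" for T f
    proof -
      let ?\<chi> = "Ar (dual K (Alg B)) S T f \<chi>" and ?\<psi> = "Ar (dual K (Alg B)) S T f \<psi>"
      have c: "?\<chi> \<in> chars K (Alg B) T" "?\<psi> \<in> chars K (Alg B) T" by (rule cAr[OF S T f]; fact)+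
      have "dmult B S \<chi> \<psi> (T, f) c = on_pts (comult K B T c) T (idm T) (enc (D T) ?\<chi>) (enc (D T) ?\<psi>)"
        if "c \<in> Alg B $ T" for c
        using dual_on_idm_Ar[OF mB df(1)[OF S dual[OF \<chi>] dual[OF \<psi>]] S T f that] df(7)[OF S dual[OF \<chi>] dual[OF \<psi>] T f]
          comult(2)[OF mB dA T that T i[OF T] dual[OF c(1)] dual[OF c(2)]]
        by (simp add: on_pts_def ptd_def hat[OF T c(1)] hat[OF T c(2)] sB(2)[OF T that])
      then show ?thesis using c by auto
    qed
    show ?thesis
    proof (rule charsI[OF df(1)[OF S dual[OF \<chi>] dual[OF \<psi>]]])
      fix T f assume T: "T \<in> CAlg K" and f: "f \<in> alg_hom K S T"
      obtain x y where xy: "x \<in> X $ T" "y \<in> X $ T"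
        "\<And>c. c \<in> Alg B $ T ==> dmult B S \<chi> \<psi> (T, f) c = on_pts (comult K B T c) T (idm T) x y"
        using e[OF T f] by blast
      note C = comult(1)[OF mB dA T] and a = Alg_morD(3,4)[OF b(6)]
      show "dmult B S \<chi> \<psi> (T, f) 1[Ob (Alg B) T] = 1[T]"
        unfolding xy(3)[OF multB_closed(2)[OF T]] a(2)[OF T] by (rule ttensor_one(2)[OF T T i[OF T] xy(1,2)])
      show "dmult B S \<chi> \<psi> (T, f) (c *[Ob (Alg B) T] c') = dmult B S \<chi> \<psi> (T, f) c *[T] dmult B S \<chi> \<psi> (T, f) c'"
        if c: "c \<in> Alg B $ T" "c' \<in> Alg B $ T" for c c'
        unfolding xy(3)[OF multB_closed(1)[OF T c]] xy(3)[OF c(1)] xy(3)[OF c(2)] a(1)[OF T c]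
        by (rule ttensor_mult(2)[OF T C[OF c(1)] C[OF c(2)] T i[OF T] xy(1,2)])
    qed
  qed
  have du: "dunit B S \<in> dual_on K (Alg B) S" if "S \<in> CAlg K" for S
    using ring.ring_simprules(6)[OF alg_functorD(4)[OF dA that]] by simp
  have unit: "dunit B S \<in> chars K (Alg B) S" if S: "S \<in> CAlg K" for S
  proof (rule charsI[OF du[OF S]])
    fix T f assume T: "T \<in> CAlg K" and f: "f \<in> alg_hom K S T"
    have e: "dunit B S (T, f) c = counit K B T c" if c: "c \<in> Alg B $ T" for c
      using dual_on_idm_Ar[OF mB du[OF S] S T f c] df(8)[OF S du[OF S] du[OF S] T f] by (simp add: counit[OF mB dA T c])
    note a = Alg_morD(3,4)[OF b(7)]
    show "dunit B S (T, f) 1[Ob (Alg B) T] = 1[T]" using a(2)[OF T] by (simp add: e multB_closed T)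
    show "dunit B S (T, f) (c *[Ob (Alg B) T] c') = dunit B S (T, f) c *[T] dunit B S (T, f) c'"
      if "c \<in> Alg B $ T" "c' \<in> Alg B $ T" for c c'
      using a(1)[OF T that] that by (simp add: e multB_closed T)
  qed
  note mon = ring.axioms(2)[OF alg_functorD(4)[OF dA]]
  note ml = monoid.m_assoc[OF mon, unfolded dual_alg_simps] monoid.l_one[OF mon, unfolded dual_alg_simps]
    monoid.r_one[OF mon, unfolded dual_alg_simps]
  have mX: "monoid_functor K X"
    unfolding monoid_functor_def
  proof (intro conjI ballI X)
    fix S assume S: "S \<in> CAlg K"
    show "monoid (Ob X S)"
      by (rule monoidI) (use S in \<open>auto simp: mult unit ml dual\<close>)
    fix T f assume T: "T \<in> CAlg K" and f: "f \<in> alg_hom K S T"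
    show "Ar X S T f \<in> hom (Ob X S) (Ob X T)"
      using S T f by (auto simp: hom_def mult cAr df(7)[OF S dual dual T f])
    show "Ar X S T f 1[Ob X S] = 1[Ob X T]"
      using S T f by (simp add: unit df(8)[OF S du[OF S] du[OF S] T f])
  qed
  have small: "small_functor K X"
    unfolding small_functor_def
  proof (intro ballI)
    fix S assume S: "S \<in> CAlg K"
    have "X $ S \<subseteq> carrier (copy (D S))"
      using small_copy.enc_closed[OF sc[OF S]] dual[of _ K "Alg B" S] by (auto simp: D_def subset_iff)
    then show "X $ S \<prec> (UNIV :: 'u set)"
      using small_copy.copy_small[OF sc[OF S]] by (rule lesspoll_trans1[OF subset_imp_lepoll])
  qed
  have "dual_pair K X B ev"
  proof (intro dual_pair.intro pairing_axioms dual_pair_axioms.intro mX small bi)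
    fix S x y assume S: "S \<in> CAlg K" and "x \<in> X $ S" "y \<in> X $ S"
    then show "dmult B S (hat S x) (hat S y) = hat S (x *[Ob X S] y)" using mult[OF S] by (auto simp: hat)
  qed (simp add: hat unit)
  then show ?thesis using affine[OF small] mX by blast
qed

end

section \<open>Morphisms\<close>

lemma Mon_morD:
  assumes "\<phi> \<in> Mon_mor K X Y"
  shows "\<phi> \<in> Mor K X Y" "S \<in> CAlg K ==> x \<in> X $ S ==> \<phi> S x \<in> Y $ S"
    "S \<in> CAlg K ==> x \<in> X $ S ==> y \<in> X $ S ==> \<phi> S (x *[Ob X S] y) = \<phi> S x *[Ob Y S] \<phi> S y"
    "S \<in> CAlg K ==> \<phi> S 1[Ob X S] = 1[Ob Y S]"
    "S \<in> CAlg K ==> T \<in> CAlg K ==> f \<in> alg_hom K S T ==> x \<in> X $ S ==> \<phi> T (Ar X S T f x) = Ar Y S T f (\<phi> S x)"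
  using assms MorD(1,2)[of \<phi> K X Y] by (auto simp: Mon_mor_def hom_def)

lemma binat_compose:
  "binat K P Q S w ==> u \<in> Mod_mor K P' P ==> v \<in> Mod_mor K Q' Q ==> binat K P' Q' S (\<lambda>T f \<alpha> \<beta>. w T f (u T \<alpha>) (v T \<beta>))"
  unfolding binat_def by (simp add: Mod_morD[of u] Mod_morD[of v])

lemma bialg_morD:
  assumes "f \<in> bialg_mor K C B"
  shows "f \<in> Alg_mor K (Alg C) (Alg B)" "f \<in> Mod_mor K (Alg C) (Alg B)" "f \<in> Mor K (Alg C) (Alg B)"
    "dual_map K (Alg C) (Alg B) f \<in> Alg_mor K (dual_alg K B) (dual_alg K C)"
  using assms by (auto simp: bialg_mor_def Alg_mor_def Mod_mor_def)

lemma bialg_morI: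
  assumes "f \<in> Alg_mor K (Alg C) (Alg B)" and C: "mod_functor K (Alg C)" and B: "mod_functor K (Alg B)"
    and "\<And>S \<alpha> \<beta>. S \<in> CAlg K ==> \<alpha> \<in> dual_on K (Alg B) S ==> \<beta> \<in> dual_on K (Alg B) S ==>
    dual_map K (Alg C) (Alg B) f S (dmult B S \<alpha> \<beta>) = dmult C S (dual_map K (Alg C) (Alg B) f S \<alpha>) (dual_map K (Alg C) (Alg B) f S \<beta>)"
    and "\<And>S. S \<in> CAlg K ==> dual_map K (Alg C) (Alg B) f S (dunit B S) = dunit C S"
  shows "f \<in> bialg_mor K C B"
  unfolding bialg_mor_def
  using assms dual_map_Mod_mor[OF C B Alg_morD(1)[OF assms(1)]] by (auto simp: Mod_mor_dual_alg intro!: Alg_morI)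

locale dual_pairs = P: dual_pair K X B ev + Q: dual_pair K Y C ev'
  for K :: "'u ring" and X :: "'u monfunc" and B :: "'u bialg" and ev and Y :: "'u monfunc" and C :: "'u bialg" and ev'
begin

interpretation K: field K by (rule P.K_field)

text \<open>Adjointness with respect to the evaluations: \<open>f\<close> is composition of
  functions with \<phi>.\<close>

definition rel where
  "rel \<phi> f \<longleftrightarrow> (\<forall>S\<in>CAlg K. \<forall>c\<in>(Alg C) $ S. \<forall>x\<in>X $ S. ev S x (f S c) = ev' S (\<phi> S x) c)"

lemma rel_unique_hom:
  assumes f: "f \<in> bialg_mor K C B" "f' \<in> bialg_mor K C B" and r: "rel \<phi> f" "rel \<phi> f'"
  shows "f = f'"
proof (rule Mor_eqI[OF bialg_morD(3)[OF f(1)] bialg_morD(3)[OF f(2)]])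
  fix S c assume S: "S \<in> CAlg K" and c: "c \<in> Alg C $ S"
  note m = Mod_morD[OF bialg_morD(2)[OF f(1)]] and m' = Mod_morD[OF bialg_morD(2)[OF f(2)]]
  show "f S c = f' S c"
  proof (rule P.fun_sep[OF S m(2)[OF S c] m'(2)[OF S c]])
    fix T h x assume *: "T \<in> CAlg K" "h \<in> alg_hom K S T" "x \<in> X $ T"
    show "ev T x (Ar (Alg B) S T h (f S c)) = ev T x (Ar (Alg B) S T h (f' S c))"
      using r * Q.sB(1)[OF S *(1,2) c] by (simp add: m(5)[OF S *(1,2) c, symmetric] m'(5)[OF S *(1,2) c, symmetric] rel_def)
  qed
qed

lemma rel_unique_points:
  assumes f: "\<phi> \<in> Mon_mor K X Y" "\<phi>' \<in> Mon_mor K X Y" and r: "rel \<phi> f" "rel \<phi>' f"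
  shows "\<phi> = \<phi>'"
proof (rule Mor_eqI[OF Mon_morD(1)[OF f(1)] Mon_morD(1)[OF f(2)]])
  fix S x assume S: "S \<in> CAlg K" and x: "x \<in> X $ S"
  note m = Mon_morD[OF f(1)] and m' = Mon_morD[OF f(2)]
  show "\<phi> S x = \<phi>' S x"
  proof (rule Q.char_sep[OF S m(2)[OF S x] m'(2)[OF S x]])
    fix T h c assume *: "T \<in> CAlg K" "h \<in> alg_hom K S T" "c \<in> Alg C $ T"
    have "ev' T (\<phi> T (Ar X S T h x)) c = ev' T (\<phi>' T (Ar X S T h x)) c"
      using r * P.sX(1)[OF S *(1,2) x] by (simp add: rel_def)
    then show "ev' T (Ar Y S T h (\<phi> S x)) c = ev' T (Ar Y S T h (\<phi>' S x)) c" by (simp only: m(5)[OF S *(1,2) x] m'(5)[OF S *(1,2) x])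
  qed
qed

text \<open>\<open>f\<close> pulls functions back along \<phi>, so its dual map sends
  \<open>hat\<close> of a point to \<open>hat\<close> of its image. Compatibility with the products
  of the duals is a statement about bilinear families, decided on points by
  \<open>binat_density\<close>.\<close>

lemma rel_hom_ex:
  assumes \<phi>: "\<phi> \<in> Mon_mor K X Y"
  shows "\<exists>f\<in>bialg_mor K C B. rel \<phi> f"
proof -
  note m = Mon_morD[OF \<phi>]
  note c = P.clB Q.clB P.multB_closed Q.multB_closed P.sB(1) Q.sB(1) P.ev_add Q.ev_add P.ev_mult Q.ev_mult P.ev_smult Q.ev_smult P.ev_one Q.ev_one
  define g where "g S c = P.repr S (\<lambda>T h x. ev' T (\<phi> T x) (Ar (Alg C) S T h c))" for S c
  have g: "g S c \<in> Alg B $ S"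
    "\<And>T h x. T \<in> CAlg K ==> h \<in> alg_hom K S T ==> x \<in> X $ T ==> ev T x (Ar (Alg B) S T h (g S c)) = ev' T (\<phi> T x) (Ar (Alg C) S T h c)"
    if S: "S \<in> CAlg K" and c: "c \<in> Alg C $ S" for S c
    unfolding g_def by (rule P.repr[OF S]; simp add: Q.ev_closed m(2) m(5) Q.sB(1)[OF S _ _ c] Q.sB(3)[OF S _ _ _ _ c] Q.ev_nat)+
  have gI: "b = g S c" if S: "S \<in> CAlg K" and c: "c \<in> Alg C $ S" and b: "b \<in> Alg B $ S"
    and "\<And>T h x. T \<in> CAlg K ==> h \<in> alg_hom K S T ==> x \<in> X $ T ==> ev T x (Ar (Alg B) S T h b) = ev' T (\<phi> T x) (Ar (Alg C) S T h c)" for S c b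
    by (rule P.fun_sep[OF S b g(1)[OF S c]]) (simp add: that g(2)[OF S c])
  define f where "f = (\<lambda>S\<in>CAlg K. \<lambda>c\<in>(Alg C) $ S. g S c)"
  have f: "f S c = g S c" if "S \<in> CAlg K" "c \<in> Alg C $ S" for S c using that by (simp add: f_def)
  have fA: "f \<in> Alg_mor K (Alg C) (Alg B)"
  proof (intro Alg_morI Mod_morI, goal_cases)
    case 1 show ?case unfolding f_def
    proof (rule MorI)
      fix S T h c assume *: "S \<in> CAlg K" "T \<in> CAlg K" "h \<in> alg_hom K S T" "c \<in> Alg C $ S" "Ar (Alg C) S T h c \<in> Alg C $ T"
      show "g T (Ar (Alg C) S T h c) = Ar (Alg B) S T h (g S c)"
        by (rule gI[symmetric]) (simp_all add: * P.sB(1)[OF *(1-3)] g P.sB(3)[OF *(1,2) _ *(3) _ g(1)[OF *(1,4)], symmetric]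
          Q.sB(3)[OF *(1,2) _ *(3) _ *(4), symmetric] P.compose_CAlg[OF *(1,3)])
    qed (simp_all add: g alg_functorD[OF Q.B])
  next
    case (2 S x y) then show ?case unfolding f[OF 2(1) 2(2)] f[OF 2(1) 2(3)] f[OF 2(1) Q.clB(1)[OF 2]]
      by (intro gI[symmetric]) (simp_all add: c g mod_functorD(3)[OF P.modB _ _ _ g(1) g(1)] mod_functorD(3)[OF Q.modB 2(1)] m)
  next
    case (3 S s x) then show ?case unfolding f[OF 3(1) 3(3)] f[OF 3(1) Q.clB(2)[OF 3]]
      by (intro gI[symmetric]) (simp_all add: c g mod_functorD(4)[OF P.modB _ _ _ g(1)] mod_functorD(4)[OF Q.modB 3(1)] m alg_homD(1))
  next
    case (4 S x y) then show ?case unfolding f[OF 4(1) 4(2)] f[OF 4(1) 4(3)] f[OF 4(1) Q.multB_closed(1)[OF 4]]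
      by (intro gI[symmetric]) (simp_all add: c g ring_hom_mult[OF alg_functorD(5)[OF P.B] g(1) g(1)] ring_hom_mult[OF alg_functorD(5)[OF Q.B 4(1)]] m)
  next
    case (5 S) then show ?case unfolding f[OF 5 Q.multB_closed(2)[OF 5]]
      by (intro gI[symmetric]) (simp_all add: c ring_hom_one[OF alg_functorD(5)[OF P.B 5]] ring_hom_one[OF alg_functorD(5)[OF Q.B 5]] m)
  qed
  have rel: "rel \<phi> f"
    unfolding rel_def
  proof (intro ballI)
    fix S c x assume S: "S \<in> CAlg K" and c: "c \<in> Alg C $ S" and x: "x \<in> X $ S"
    show "ev S x (f S c) = ev' S (\<phi> S x) c"
      using g(2)[OF S c S idm_CAlg[OF S] x] by (simp add: f S c P.sB(2)[OF S g(1)[OF S c]] Q.sB(2)[OF S c])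
  qed
  note fM = Alg_morD(1)[OF fA]
  note dM = dual_map_Mod_mor[OF Q.modB P.modB fM]
  note dm = Mod_morD[OF dM, unfolded carrier_dual] and fm = Mod_morD[OF fM]
  have hat: "dual_map K (Alg C) (Alg B) f S (P.hat S x) = Q.hat S (\<phi> S x)" if S: "S \<in> CAlg K" and x: "x \<in> X $ S" for S x
    by (rule dual_on_eqI[OF dm(2)[OF S P.hat_dual[OF S x]] Q.hat_dual[OF S m(2)[OF S x]]])
      (use rel in \<open>simp add: dual_map_apply[OF S P.hat_dual[OF S x]] P.hat_apply Q.hat_apply fm(2) rel_def P.sX(1)[OF S _ _ x] m(5)[OF S _ _ x, symmetric]\<close>)
  note dP = dmult_facts[OF P.modB comm_bialgebraD(5)[OF P.B_bialg]] and dQ = dmult_facts[OF Q.modB comm_bialgebraD(5)[OF Q.B_bialg]]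
  note mX = monoid.m_closed[OF monoid_functorD(2)[OF P.X_monoid]] monoid.one_closed[OF monoid_functorD(2)[OF P.X_monoid]]
  \<comment> \<open>Both sides are values of bilinear families on the dual of \<open>B\<close>; on
    points they agree because \<phi> is multiplicative.\<close>
  have key: "dmult B S \<alpha> \<beta> (S, idm S) (f S c) = dmult C S (dual_map K (Alg C) (Alg B) f S \<alpha>) (dual_map K (Alg C) (Alg B) f S \<beta>) (S, idm S) c"
    if S: "S \<in> CAlg K" and \<alpha>: "\<alpha> \<in> dual_on K (Alg B) S" and \<beta>: "\<beta> \<in> dual_on K (Alg B) S" and c: "c \<in> Alg C $ S" for S \<alpha> \<beta> c
  proof -
    note i = idm_CAlg[OF S] and fc = fm(2)[OF S c]
    have "bidual K (Alg B) S (f S c) (S, idm S) (dmult B S \<alpha> \<beta>) =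
      bidual K (Alg C) S c (S, idm S) (dmult C S (dual_map K (Alg C) (Alg B) f S \<alpha>) (dual_map K (Alg C) (Alg B) f S \<beta>))"
    proof (rule P.binat_density[OF S comult_binat[OF P.modB comm_bialgebraD(5)[OF P.B_bialg] S fc]
          binat_compose[OF comult_binat[OF Q.modB comm_bialgebraD(5)[OF Q.B_bialg] S c] dM dM] _ S i \<alpha> \<beta>])
      fix T h x y assume T: "T \<in> CAlg K" and h: "h \<in> alg_hom K S T" and x: "x \<in> X $ T" and y: "y \<in> X $ T"
      note xy = mX(1)[OF T x y]
      note ch = Q.sB(1)[OF S T h c]
      show "bidual K (Alg B) S (f S c) (T, h) (dmult B T (P.hat T x) (P.hat T y)) =
        bidual K (Alg C) S c (T, h) (dmult C T (dual_map K (Alg C) (Alg B) f T (P.hat T x)) (dual_map K (Alg C) (Alg B) f T (P.hat T y)))"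
        unfolding hat[OF T x] hat[OF T y] P.dmult_hat[OF T x y] Q.dmult_hat[OF T m(2)[OF T x] m(2)[OF T y]] m(3)[OF T x y, symmetric]
          bidual_apply[OF P.modB S T h P.hat_dual[OF T xy]] bidual_apply[OF Q.modB S T h Q.hat_dual[OF T m(2)[OF T xy]]]
          P.hat_idm[OF T xy fm(2)[OF T ch]] Q.hat_idm[OF T m(2)[OF T xy] ch] fm(5)[OF S T h c, symmetric]
        using rel T xy ch by (simp add: rel_def)
    qed
    then show ?thesis
      by (simp add: bidual_apply[OF P.modB S S i] bidual_apply[OF Q.modB S S i] dP(1)[OF S \<alpha> \<beta>] dQ(1)[OF S dm(2)[OF S \<alpha>] dm(2)[OF S \<beta>]]
        P.sB(2)[OF S fc] Q.sB(2)[OF S c])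
  qed
  have "f \<in> bialg_mor K C B"
  proof (rule bialg_morI[OF fA Q.modB P.modB])
    fix S assume S: "S \<in> CAlg K"
    show "dual_map K (Alg C) (Alg B) f S (dunit B S) = dunit C S"
      unfolding P.dunit_hat[OF S] Q.dunit_hat[OF S] hat[OF S mX(2)[OF S]] m(4)[OF S] ..
    fix \<alpha> \<beta> assume \<alpha>: "\<alpha> \<in> dual_on K (Alg B) S" and \<beta>: "\<beta> \<in> dual_on K (Alg B) S"
    note d = dP(1)[OF S \<alpha> \<beta>] and d' = dQ(1)[OF S dm(2)[OF S \<alpha>] dm(2)[OF S \<beta>]]
    show "dual_map K (Alg C) (Alg B) f S (dmult B S \<alpha> \<beta>) = dmult C S (dual_map K (Alg C) (Alg B) f S \<alpha>) (dual_map K (Alg C) (Alg B) f S \<beta>)"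
    proof (rule dual_on_eqI[OF dm(2)[OF S d] d'])
      fix T h c assume T: "T \<in> CAlg K" and h: "h \<in> alg_hom K S T" and c: "c \<in> Alg C $ T"
      have "dmult B S \<alpha> \<beta> (T, h) (f T c) = dmult C S (dual_map K (Alg C) (Alg B) f S \<alpha>) (dual_map K (Alg C) (Alg B) f S \<beta>) (T, h) c"
        using key[OF T dual_on_Ar[OF P.modB S T h \<alpha>] dual_on_Ar[OF P.modB S T h \<beta>] c]
        unfolding dP(7)[OF S \<alpha> \<beta> T h, symmetric] dual_on_idm_Ar[OF P.modB d S T h fm(2)[OF T c]] dm(5)[OF S T h \<alpha>] dm(5)[OF S T h \<beta>]
          dQ(7)[OF S dm(2)[OF S \<alpha>] dm(2)[OF S \<beta>] T h, symmetric] dual_on_idm_Ar[OF Q.modB d' S T h c] .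
      then show "dual_map K (Alg C) (Alg B) f S (dmult B S \<alpha> \<beta>) (T, h) c =
        dmult C S (dual_map K (Alg C) (Alg B) f S \<alpha>) (dual_map K (Alg C) (Alg B) f S \<beta>) (T, h) c"
        unfolding dual_map_apply[OF S d T h c] .
    qed
  qed
  then show ?thesis using rel by blast
qed

text \<open>The dual map of a morphism of algebras takes characters to characters, which are points
  of \<open>Y\<close>; \<phi> is its restriction to points. It respects products because the dual
  map does and \<open>hat\<close> is injective and multiplicative.\<close>

lemma rel_points_ex:
  assumes f: "f \<in> bialg_mor K C B"
  shows "\<exists>\<phi>\<in>Mon_mor K X Y. rel \<phi> f"
proof -
  note fm = Mod_morD[OF bialg_morD(2)[OF f]] and fa = Alg_morD(3,4)[OF bialg_morD(1)[OF f]]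
  note dA = Alg_morD[OF bialg_morD(4)[OF f], unfolded dual_alg_simps]
  note dm = Mod_morD[OF dA(1), unfolded dual_alg_simps]
  note mX = monoid.m_closed[OF monoid_functorD(2)[OF P.X_monoid]] monoid.one_closed[OF monoid_functorD(2)[OF P.X_monoid]]
  note mY = monoid.m_closed[OF monoid_functorD(2)[OF Q.X_monoid]] monoid.one_closed[OF monoid_functorD(2)[OF Q.X_monoid]]
  let ?d = "dual_map K (Alg C) (Alg B) f"
  define p where "p S x = (SOME y. y \<in> Y $ S \<and> ?d S (P.hat S x) = Q.hat S y)" for S x
  have p: "p S x \<in> Y $ S" "Q.hat S (p S x) = ?d S (P.hat S x)" if S: "S \<in> CAlg K" and x: "x \<in> X $ S" for S x
  proof -
    have "?d S (P.hat S x) \<in> chars K (Alg C) S"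
      by (rule charsI[OF dm(2)[OF S P.hat_dual[OF S x]]])
        (simp_all add: dual_map_apply[OF S P.hat_dual[OF S x]] Q.multB_closed fa charsD[OF P.hat_chars[OF S x]] fm(2))
    from someI_ex[OF Q.chars_hat[OF S this, unfolded Bex_def]] show "p S x \<in> Y $ S" "Q.hat S (p S x) = ?d S (P.hat S x)"
      unfolding p_def by simp_all
  qed
  define \<phi> where "\<phi> = (\<lambda>S\<in>CAlg K. \<lambda>x\<in>X $ S. p S x)"
  have \<phi>: "\<phi> S x = p S x" if "S \<in> CAlg K" "x \<in> X $ S" for S x using that by (simp add: \<phi>_def)
  have "\<phi> \<in> Mor K X Y"
    unfolding \<phi>_def
  proof (rule MorI)
    fix S T h x assume *: "S \<in> CAlg K" "T \<in> CAlg K" "h \<in> alg_hom K S T" "x \<in> X $ S" "Ar X S T h x \<in> X $ T"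
    show "p T (Ar X S T h x) = Ar Y S T h (p S x)"
      by (rule Q.hat_inj[OF *(2) p(1)[OF *(2,5)] Q.sX(1)[OF *(1-3) p(1)[OF *(1,4)]]])
        (simp add: p * Q.hat_Ar[OF *(1-3) p(1)[OF *(1,4)], symmetric] P.hat_Ar[OF *(1-4), symmetric] dm(5)[OF *(1-3) P.hat_dual[OF *(1,4)]])
  qed (simp_all add: p P.X)
  moreover have "\<phi> S \<in> hom (Ob X S) (Ob Y S)" "\<phi> S 1[Ob X S] = 1[Ob Y S]" if S: "S \<in> CAlg K" for S
  proof -
    have "p S (x *[Ob X S] y) = p S x *[Ob Y S] p S y" if x: "x \<in> X $ S" and y: "y \<in> X $ S" for x y
      by (rule Q.hat_inj[OF S p(1)[OF S mX(1)[OF S x y]] mY(1)[OF S p(1)[OF S x] p(1)[OF S y]]])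
        (simp add: p S x y mX P.dmult_hat[symmetric] Q.dmult_hat[symmetric] dA(3)[OF S] P.hat_dual)
    then show "\<phi> S \<in> hom (Ob X S) (Ob Y S)" using S by (auto simp: hom_def \<phi> p mX)
    have "p S 1[Ob X S] = 1[Ob Y S]"
      by (rule Q.hat_inj[OF S p(1)[OF S mX(2)[OF S]] mY(2)[OF S]])
        (simp add: p S mX P.dunit_hat[symmetric] Q.dunit_hat[symmetric] dA(4)[OF S])
    then show "\<phi> S 1[Ob X S] = 1[Ob Y S]" using S by (simp add: \<phi> mX)
  qed
  moreover have "rel \<phi> f"
    unfolding rel_def
  proof (intro ballI)
    fix S c x assume S: "S \<in> CAlg K" and c: "c \<in> Alg C $ S" and x: "x \<in> X $ S"
    note i = idm_CAlg[OF S]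
    show "ev S x (f S c) = ev' S (\<phi> S x) c"
      unfolding \<phi>[OF S x] Q.hat_idm[OF S p(1)[OF S x] c, symmetric] p(2)[OF S x] dual_map_apply[OF S P.hat_dual[OF S x] S i c]
      by (rule P.hat_idm[OF S x fm(2)[OF S c], symmetric])
  qed
  ultimately show ?thesis by (auto simp: Mon_mor_def)
qed

end

section \<open>The anti-equivalence\<close>

text \<open>An equivalence given by a relation instead of functors: the links \<open>L\<close> cover
  both classes of objects, and over any two links \<open>R\<close> is a bijection of morphisms
  compatible with identities and composites. Several links over one object are allowed, so no
  canonical partner has to be singled out.\<close>

locale hom_correspondence =
  fixes C :: "('o, 'm) cat" and D :: "('p, 'n) cat" and L :: "'l set" and l :: "'l => 'o" and r :: "'l => 'p"
    and R :: "'l => 'l => 'm => 'n => bool"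
  assumes C: "is_category C" and D: "is_category D"
    and l: "i \<in> L ==> l i \<in> Obj C" and r: "i \<in> L ==> r i \<in> Obj D"
    and l_surj: "x \<in> Obj C ==> \<exists>i\<in>L. l i = x" and r_surj: "y \<in> Obj D ==> \<exists>i\<in>L. r i = y"
    and right: "i \<in> L ==> j \<in> L ==> f \<in> Hom C (l i) (l j) ==> \<exists>!g. g \<in> Hom D (r i) (r j) \<and> R i j f g"
    and left: "i \<in> L ==> j \<in> L ==> g \<in> Hom D (r i) (r j) ==> \<exists>!f. f \<in> Hom C (l i) (l j) \<and> R i j f g"
    and R_id: "i \<in> L ==> R i i (Idt C (l i)) (Idt D (r i))"
    and R_comp: "i \<in> L ==> j \<in> L ==> k \<in> L ==> f \<in> Hom C (l i) (l j) ==> f' \<in> Hom C (l j) (l k) ==>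
    g \<in> Hom D (r i) (r j) ==> g' \<in> Hom D (r j) (r k) ==> R i j f g ==> R j k f' g' ==>
    R i k (Comp C (l i) (l j) (l k) f' f) (Comp D (r i) (r j) (r k) g' g)"
begin

text \<open>An arbitrary link over each object. Different links over one object are compared by the
  morphism related to an identity on the other side.\<close>

definition at_l where "at_l x = (SOME i. i \<in> L \<and> l i = x)"
definition at_r where "at_r y = (SOME i. i \<in> L \<and> r i = y)"
definition to_r where "to_r i j f = (THE g. g \<in> Hom D (r i) (r j) \<and> R i j f g)"
definition to_l where "to_l i j g = (THE f. f \<in> Hom C (l i) (l j) \<and> R i j f g)"
definition F where "F x = r (at_l x)"
definition G where "G y = l (at_r y)"
definition Fm where "Fm x x' = to_r (at_l x) (at_l x')"
definition Gm where "Gm y y' = to_l (at_r y) (at_r y')"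

lemma at_l: "x \<in> Obj C ==> at_l x \<in> L" "x \<in> Obj C ==> l (at_l x) = x"
  unfolding at_l_def using someI_ex[OF l_surj[unfolded Bex_def]] by auto

lemma at_r: "y \<in> Obj D ==> at_r y \<in> L" "y \<in> Obj D ==> r (at_r y) = y"
  unfolding at_r_def using someI_ex[OF r_surj[unfolded Bex_def]] by auto

lemma to_r:
  assumes "i \<in> L" "j \<in> L" "f \<in> Hom C (l i) (l j)"
  shows "to_r i j f \<in> Hom D (r i) (r j)" "R i j f (to_r i j f)"
    "g \<in> Hom D (r i) (r j) ==> R i j f g ==> to_r i j f = g"
  using theI'[OF right[OF assms]] right[OF assms] unfolding to_r_def by blast+

lemma to_l:
  assumes "i \<in> L" "j \<in> L" "g \<in> Hom D (r i) (r j)"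
  shows "to_l i j g \<in> Hom C (l i) (l j)" "R i j (to_l i j g) g"
    "f \<in> Hom C (l i) (l j) ==> R i j f g ==> to_l i j g = f"
  using theI'[OF left[OF assms]] left[OF assms] unfolding to_l_def by blast+

lemma catC: "x \<in> Obj C ==> Idt C x \<in> Hom C x x"
  "x \<in> Obj C ==> y \<in> Obj C ==> z \<in> Obj C ==> f \<in> Hom C x y ==> g \<in> Hom C y z ==> Comp C x y z g f \<in> Hom C x z"
  "x \<in> Obj C ==> y \<in> Obj C ==> f \<in> Hom C x y ==> Comp C x x y f (Idt C x) = f"
  "x \<in> Obj C ==> y \<in> Obj C ==> f \<in> Hom C x y ==> Comp C x y y (Idt C y) f = f"
  using C unfolding is_category_def by blast+

lemma catD: "x \<in> Obj D ==> Idt D x \<in> Hom D x x"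
  "x \<in> Obj D ==> y \<in> Obj D ==> z \<in> Obj D ==> f \<in> Hom D x y ==> g \<in> Hom D y z ==> Comp D x y z g f \<in> Hom D x z"
  "x \<in> Obj D ==> y \<in> Obj D ==> f \<in> Hom D x y ==> Comp D x x y f (Idt D x) = f"
  "x \<in> Obj D ==> y \<in> Obj D ==> f \<in> Hom D x y ==> Comp D x y y (Idt D y) f = f"
  using D unfolding is_category_def by blast+

text \<open>Functoriality is uniqueness: identities and composites are related to the expected
  morphisms by \<open>R_id\<close> and \<open>R_comp\<close>, and \<open>right\<close> admits only
  one.\<close>

lemma functor_F: "is_functor C D F Fm"
  unfolding is_functor_def
proof (intro conjI ballI)
  fix x assume x: "x \<in> Obj C"
  note ax = at_l[OF x]
  show "F x \<in> Obj D" unfolding F_def by (rule r[OF ax(1)])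
  show "Fm x x (Idt C x) = Idt D (F x)"
    unfolding Fm_def F_def
    by (rule to_r(3)[OF ax(1) ax(1)]) (use R_id[OF ax(1)] catC(1)[OF x] catD(1)[OF r[OF ax(1)]] ax in simp_all)
  fix y f assume y: "y \<in> Obj C" and f: "f \<in> Hom C x y"
  note ay = at_l[OF y]
  have f': "f \<in> Hom C (l (at_l x)) (l (at_l y))" using f ax ay by simp
  show "Fm x y f \<in> Hom D (F x) (F y)" unfolding Fm_def F_def by (rule to_r(1)[OF ax(1) ay(1) f'])
  fix z g assume z: "z \<in> Obj C" and g: "g \<in> Hom C y z"
  note az = at_l[OF z]
  have g': "g \<in> Hom C (l (at_l y)) (l (at_l z))" using g az ay by simp
  note tf = to_r[OF ax(1) ay(1) f'] and tg = to_r[OF ay(1) az(1) g']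
  show "Fm x z (Comp C x y z g f) = Comp D (F x) (F y) (F z) (Fm y z g) (Fm x y f)"
    unfolding Fm_def F_def
    by (rule to_r(3)[OF ax(1) az(1)])
      (use R_comp[OF ax(1) ay(1) az(1) f' g' tf(1) tg(1) tf(2) tg(2)] catC(2)[OF x y z f g]
        catD(2)[OF r[OF ax(1)] r[OF ay(1)] r[OF az(1)] tf(1) tg(1)] ax ay az in simp_all)
qed

text \<open>The component at \<open>x\<close> is the morphism corresponding to the identity of \<open>F x\<close>.\<close>

lemma iso: "iso_to_identity C (\<lambda>x. G (F x)) (\<lambda>x y f. Gm (F x) (F y) (Fm x y f))"
  unfolding iso_to_identity_def
proof (intro exI conjI ballI)
  let ?\<tau> = "\<lambda>x. to_l (at_r (F x)) (at_l x) (Idt D (F x))"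
  fix x assume x: "x \<in> Obj C"
  have a: "at_l x \<in> L" "l (at_l x) = x" "F x \<in> Obj D" "r (at_l x) = F x" "at_r (F x) \<in> L" "r (at_r (F x)) = F x" "l (at_r (F x)) = G (F x)" "G (F x) \<in> Obj C"
    if "x \<in> Obj C" for x
    using at_l[OF that] r[OF at_l(1)[OF that]] at_r[of "F x"] l[of "at_r (F x)"] by (auto simp: F_def G_def)
  have i: "Idt D (F x) \<in> Hom D (F x) (F x)" if "x \<in> Obj C" for x by (rule catD(1)[OF a(3)[OF that]])
  have t: "?\<tau> x \<in> Hom C (G (F x)) x" "R (at_r (F x)) (at_l x) (?\<tau> x) (Idt D (F x))" if x: "x \<in> Obj C" for x
    using to_l(1,2)[OF a(5,1)[OF x], of "Idt D (F x)"] i[OF x] by (simp_all add: a[OF x])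
  have t': "to_l (at_l x) (at_r (F x)) (Idt D (F x)) \<in> Hom C x (G (F x))"
    "R (at_l x) (at_r (F x)) (to_l (at_l x) (at_r (F x)) (Idt D (F x))) (Idt D (F x))"
    using to_l(1,2)[OF a(1,5)[OF x], of "Idt D (F x)"] i[OF x] by (simp_all add: a[OF x])
  have uniq: "f = f'" if "i \<in> L" "j \<in> L" "g \<in> Hom D (r i) (r j)" "f \<in> Hom C (l i) (l j)" "f' \<in> Hom C (l i) (l j)" "R i j f g" "R i j f' g" for i j f f' g
    using to_l(3)[OF that(1-3,4,6)] to_l(3)[OF that(1-3,5,7)] by simp
  have ii: "Comp D (F x) (F x) (F x) (Idt D (F x)) (Idt D (F x)) = Idt D (F x)" by (rule catD(3)[OF a(3)[OF x] a(3)[OF x] i[OF x]])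
  show "iso_in C (G (F x)) x (?\<tau> x)"
    unfolding iso_in_def
  proof (intro conjI bexI)
    show "Comp C (G (F x)) x (G (F x)) (to_l (at_l x) (at_r (F x)) (Idt D (F x))) (?\<tau> x) = Idt C (G (F x))"
      by (rule uniq[of "at_r (F x)" "at_r (F x)" "Idt D (F x)"])
        (use R_comp[OF a(5,1,5)[OF x], of "?\<tau> x" "to_l (at_l x) (at_r (F x)) (Idt D (F x))" "Idt D (F x)" "Idt D (F x)"]
          R_id[OF a(5)[OF x]] t[OF x] t' i[OF x] ii catC(1)[OF a(8)[OF x]] catC(2)[OF a(8)[OF x] x a(8)[OF x] t(1)[OF x] t'(1)] in \<open>simp_all add: a[OF x]\<close>)
    show "Comp C x (G (F x)) x (?\<tau> x) (to_l (at_l x) (at_r (F x)) (Idt D (F x))) = Idt C x"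
      by (rule uniq[of "at_l x" "at_l x" "Idt D (F x)"])
        (use R_comp[OF a(1,5,1)[OF x], of "to_l (at_l x) (at_r (F x)) (Idt D (F x))" "?\<tau> x" "Idt D (F x)" "Idt D (F x)"]
          R_id[OF a(1)[OF x]] t[OF x] t' i[OF x] ii catC(1)[OF x] catC(2)[OF x a(8)[OF x] x t'(1) t(1)[OF x]] in \<open>simp_all add: a[OF x]\<close>)
  qed (rule t(1)[OF x], rule t'(1))
  fix y f assume y: "y \<in> Obj C" and f: "f \<in> Hom C x y"
  have F: "Fm x y f \<in> Hom D (F x) (F y)" "R (at_l x) (at_l y) f (Fm x y f)"
    using to_r(1,2)[OF a(1)[OF x] a(1)[OF y], of f] f by (simp_all add: Fm_def a x y)
  have G: "Gm (F x) (F y) (Fm x y f) \<in> Hom C (G (F x)) (G (F y))" "R (at_r (F x)) (at_r (F y)) (Gm (F x) (F y) (Fm x y f)) (Fm x y f)"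
    using to_l(1,2)[OF a(5)[OF x] a(5)[OF y], of "Fm x y f"] F by (simp_all add: Gm_def a x y)
  show "Comp C (G (F x)) (G (F y)) y (?\<tau> y) (Gm (F x) (F y) (Fm x y f)) = Comp C (G (F x)) x y f (?\<tau> x)"
    by (rule uniq[of "at_r (F x)" "at_l y" "Fm x y f"])
      (use R_comp[OF a(5)[OF x] a(5)[OF y] a(1)[OF y], of "Gm (F x) (F y) (Fm x y f)" "?\<tau> y" "Fm x y f" "Idt D (F y)"]
        R_comp[OF a(5)[OF x] a(1)[OF x] a(1)[OF y], of "?\<tau> x" f "Idt D (F x)" "Fm x y f"]
        t[OF x] t[OF y] i[OF x] i[OF y] F G f catD(3,4)[OF a(3)[OF x] a(3)[OF y] F(1)]
        catC(2)[OF a(8)[OF x] a(8)[OF y] y G(1) t(1)[OF y]] catC(2)[OF a(8)[OF x] x y t(1)[OF x] f] in \<open>simp_all add: a[OF x] a[OF y]\<close>)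
qed

end

text \<open>The assumptions are symmetric in \<open>C\<close> and \<open>D\<close>; the second
  functor and its natural isomorphism come from the same locale with the sides exchanged.\<close>

lemma (in hom_correspondence) equivalent: "equivalent C D"
proof -
  interpret op: hom_correspondence D C L r l "\<lambda>i j g f. R i j f g"
    by unfold_locales (rule C D l r l_surj r_surj right left R_id R_comp; assumption)+
  have e: "op.F = G" "op.G = F" "op.Fm = Gm" "op.Gm = Fm"
    by (simp_all add: fun_eq_iff op.F_def op.G_def op.Fm_def op.Gm_def F_def G_def Fm_def Gm_def op.at_l_def op.at_r_def at_l_def at_r_def
      op.to_l_def op.to_r_def to_l_def to_r_def)
  show ?thesis
    unfolding equivalent_def using C D functor_F iso op.functor_F op.iso unfolding e by blast
qed

lemma Mor_comp:
  assumes "\<phi> \<in> Mor K F G" "\<psi> \<in> Mor K G H" "set_functor K F"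
  shows "(\<lambda>S\<in>CAlg K. compose (F $ S) (\<psi> S) (\<phi> S)) \<in> Mor K F H"
  unfolding compose_def
  by (rule MorI[OF _ _ assms(3)]) (use MorD(1,2)[OF assms(1)] MorD(1,2)[OF assms(2)] in \<open>simp_all add: Pi_iff\<close>)

lemma Mor_id: "set_functor K F ==> (\<lambda>S\<in>CAlg K. idm (Ob F S)) \<in> Mor K F F"
  unfolding idm_def by (rule MorI) (auto dest: set_functorD)

text \<open>In both categories morphisms are natural transformations composed pointwise, with
  extensional functions; so the laws hold once the classes of morphisms contain identities and are
  closed under composition.\<close>

lemma is_categoryI:
  fixes Ob' :: "'o => ('u, 'u, ('u, 'z) partial_object_scheme) func"
  assumes s: "\<And>x. x \<in> A ==> set_functor K (Ob' x)"
    and i: "\<And>x. x \<in> A ==> (\<lambda>S\<in>CAlg K. idm (Ob (Ob' x) S)) \<in> H x x"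
    and c: "\<And>x y z f g. x \<in> A ==> y \<in> A ==> z \<in> A ==> f \<in> H x y ==> g \<in> H y z ==>
    (\<lambda>S\<in>CAlg K. compose (Ob' x $ S) (g S) (f S)) \<in> H x z"
    and m: "\<And>x y f. x \<in> A ==> y \<in> A ==> f \<in> H x y ==> f \<in> Mor K (Ob' x) (Ob' y)"
  shows "is_category \<lparr>Obj = A, Hom = H, Idt = (\<lambda>x. \<lambda>S\<in>CAlg K. idm (Ob (Ob' x) S)),
    Comp = (\<lambda>x y z g f. \<lambda>S\<in>CAlg K. compose (Ob' x $ S) (g S) (f S))\<rparr>"
  unfolding is_category_def cat.simps
proof (intro conjI ballI i c)
  fix x y f assume x: "x \<in> A" and y: "y \<in> A" and f: "f \<in> H x y"
  note M = Mor_eqI[OF m[OF x y c[OF x x y i[OF x] f]] m[OF x y f]] Mor_eqI[OF m[OF x y c[OF x y y f i[OF y]]] m[OF x y f]]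
  show "(\<lambda>S\<in>CAlg K. compose (Ob' x $ S) (f S) ((\<lambda>S\<in>CAlg K. idm (Ob (Ob' x) S)) S)) = f"
    by (rule M(1)) (simp add: compose_def)
  show "(\<lambda>S\<in>CAlg K. compose (Ob' x $ S) ((\<lambda>S\<in>CAlg K. idm (Ob (Ob' y) S)) S) (f S)) = f"
    by (rule M(2)) (use MorD(1)[OF m[OF x y f]] in \<open>simp add: compose_def Pi_iff\<close>)
next
  fix w x y z f g h assume w: "w \<in> A" and x: "x \<in> A" and y: "y \<in> A" and z: "z \<in> A" and f: "f \<in> H w x" and g: "g \<in> H x y" and h: "h \<in> H y z"
  show "(\<lambda>S\<in>CAlg K. compose (Ob' w $ S) (h S) ((\<lambda>S\<in>CAlg K. compose (Ob' w $ S) (g S) (f S)) S)) =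
    (\<lambda>S\<in>CAlg K. compose (Ob' w $ S) ((\<lambda>S\<in>CAlg K. compose (Ob' x $ S) (h S) (g S)) S) (f S))"
    by (rule Mor_eqI[OF m[OF w z c[OF w y z c[OF w x y f g] h]] m[OF w z c[OF w x z f c[OF x y z g h]]]])
      (use MorD(1)[OF m[OF w x f]] in \<open>simp add: compose_def Pi_iff\<close>)
qed

lemma is_category_AffineMonoids: "is_category (AffineMonoids K)"
  unfolding AffineMonoids_def
proof (rule is_categoryI)
  fix X assume X: "X \<in> {X. affine K X \<and> monoid_functor K X}"
  then show s: "set_functor K X" by (simp add: affine_def)
  note m = monoid_functorD(2)[of K X]
  show "(\<lambda>S\<in>CAlg K. idm (Ob X S)) \<in> Mon_mor K X X"
    using X Mor_id[OF s] monoid.m_closed[OF m] monoid.one_closed[OF m] by (simp add: Mon_mor_def hom_def)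
next
  fix X Y Z \<phi> \<psi> assume X: "X \<in> {X. affine K X \<and> monoid_functor K X}" and \<phi>: "\<phi> \<in> Mon_mor K X Y" and \<psi>: "\<psi> \<in> Mon_mor K Y Z"
  then have s: "set_functor K X" and mX: "monoid_functor K X" by (simp_all add: affine_def)
  note m = monoid_functorD(2)[OF mX] and p = Mon_morD[OF \<phi>] and q = Mon_morD[OF \<psi>]
  show "(\<lambda>S\<in>CAlg K. compose (X $ S) (\<psi> S) (\<phi> S)) \<in> Mon_mor K X Z"
    using Mor_comp[OF p(1) q(1) s] monoid.m_closed[OF m] monoid.one_closed[OF m]
    by (simp add: Mon_mor_def hom_def compose_def p(2-4) q(2-4) Pi_iff)
qed (simp add: Mon_mor_def)

lemma is_category_CommBialgebras: "is_category (CommBialgebras K)"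
  unfolding CommBialgebras_def
proof (rule is_categoryI)
  fix B assume "B \<in> {B. comm_bialgebra K B}"
  then have b: "comm_bialgebra K B" by simp
  note A = comm_bialgebraD(3)[OF b] and M = comm_bialgebraD(4)[OF b] and dA = comm_bialgebraD(5)[OF b]
  show s: "set_functor K (Alg B)" by (rule alg_functorD(2)[OF A])
  have 1: "(\<lambda>S\<in>CAlg K. idm (Ob (Alg B) S)) \<in> Alg_mor K (Alg B) (Alg B)"
    by (intro Alg_morI Mod_morI Mor_id[OF s])
      (simp_all add: mod_functor_closed[OF M] ring.ring_simprules(5,6)[OF alg_functorD(4)[OF A]])
  have d: "dual_map K (Alg B) (Alg B) (\<lambda>S\<in>CAlg K. idm (Ob (Alg B) S)) S \<alpha> = \<alpha>" if S: "S \<in> CAlg K" and \<alpha>: "\<alpha> \<in> dual_on K (Alg B) S" for S \<alpha>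
    by (rule dual_on_eqI[OF dual_map_dual_on[OF M Alg_morD(1)[OF 1] S \<alpha>] \<alpha>]) (simp add: dual_map_apply[OF S \<alpha>])
  have u: "dunit B S \<in> dual_on K (Alg B) S" if "S \<in> CAlg K" for S
    using ring.ring_simprules(6)[OF alg_functorD(4)[OF dA that]] by simp
  show "(\<lambda>S\<in>CAlg K. idm (Ob (Alg B) S)) \<in> bialg_mor K B B"
    by (rule bialg_morI[OF 1 M M]) (simp_all only: d u dmult_facts(1)[OF M dA])
next
  fix A B C f g assume "A \<in> {B. comm_bialgebra K B}" "B \<in> {B. comm_bialgebra K B}" "C \<in> {B. comm_bialgebra K B}"
    and f: "f \<in> bialg_mor K A B" and g: "g \<in> bialg_mor K B C"
  then have a: "comm_bialgebra K A" and b: "comm_bialgebra K B" and c: "comm_bialgebra K C" by simp_all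
  let ?h = "\<lambda>S\<in>CAlg K. compose (Alg A $ S) (g S) (f S)"
  note MA = comm_bialgebraD(4)[OF a] and MB = comm_bialgebraD(4)[OF b] and MC = comm_bialgebraD(4)[OF c] and dC = comm_bialgebraD(5)[OF c]
  note F = Mod_morD[OF bialg_morD(2)[OF f]] Alg_morD(3,4)[OF bialg_morD(1)[OF f]]
  note G = Mod_morD[OF bialg_morD(2)[OF g]] Alg_morD(3,4)[OF bialg_morD(1)[OF g]]
  note s = alg_functorD(2,4)[OF comm_bialgebraD(3)[OF a]]
  have h: "?h \<in> Alg_mor K (Alg A) (Alg C)"
    by (intro Alg_morI Mod_morI Mor_comp[OF F(1) G(1) s(1)])
      (simp_all add: compose_def mod_functor_closed[OF MA] ring.ring_simprules(5,6)[OF s(2)] F(2-4,6,7) G(2-4,6,7))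
  have d: "dual_map K (Alg A) (Alg C) ?h S \<alpha> = dual_map K (Alg A) (Alg B) f S (dual_map K (Alg B) (Alg C) g S \<alpha>)" (is "PROP ?A")
    "dual_map K (Alg B) (Alg C) g S \<alpha> \<in> dual_on K (Alg B) S" (is "PROP ?B")
    if S: "S \<in> CAlg K" and \<alpha>: "\<alpha> \<in> dual_on K (Alg C) S" for S \<alpha>
  proof -
    show g': "PROP ?B" by (rule dual_map_dual_on[OF MB bialg_morD(2)[OF g] S \<alpha>])
    show "PROP ?A"
      by (rule dual_on_eqI[OF dual_map_dual_on[OF MA Alg_morD(1)[OF h] S \<alpha>] dual_map_dual_on[OF MA bialg_morD(2)[OF f] S g']])
        (simp add: dual_map_apply[OF S \<alpha>] dual_map_apply[OF S g'] F(2) compose_def)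
  qed
  note df = Alg_morD(3,4)[OF bialg_morD(4)[OF f], unfolded dual_alg_simps] and dg = Alg_morD(3,4)[OF bialg_morD(4)[OF g], unfolded dual_alg_simps]
  have u: "dunit C S \<in> dual_on K (Alg C) S" if "S \<in> CAlg K" for S
    using ring.ring_simprules(6)[OF alg_functorD(4)[OF dC that]] by simp
  show "?h \<in> bialg_mor K A C"
    by (rule bialg_morI[OF h MA MC]) (simp_all only: d df dg u dmult_facts(1)[OF MC dC])
qed (simp add: bialg_morD)

lemma is_category_opposite: "is_category C ==> is_category (opposite C)"
  unfolding is_category_def opposite_def cat.simps by (intro conjI ballI) (metis (no_types))+

context base
begin

lemma anti_equivalence: "anti_equivalent (AffineMonoids K) (CommBialgebras K)"
proof -
  \<comment> \<open>A link carries its evaluation, which is part of the data relating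
    \<open>X\<close> and \<open>B\<close>.\<close>
  define L where "L = {(X, B, ev). affine K X \<and> monoid_functor K X \<and> comm_bialgebra K B \<and> dual_pair K X B ev}"
  \<comment> \<open>A morphism from \<open>i\<close> to \<open>j\<close> in the opposite category is
    a map of points from \<open>j\<close> to \<open>i\<close>, to be matched with a map of
    bialgebras from \<open>i\<close> to \<open>j\<close>; hence the exchanged order of
    arguments.\<close>
  define R where "R i j \<phi> f \<longleftrightarrow> dual_pairs.rel K (fst j) (snd (snd j)) (fst (snd i)) (snd (snd i)) \<phi> f"
    for i j :: "'u monfunc \<times> 'u bialg \<times> ('u alg => 'u => 'u => 'u)" and \<phi> f
  have P: "dual_pairs K X B ev Y C ev'" if "(X, B, ev) \<in> L" "(Y, C, ev') \<in> L" for X B ev Y C ev'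
    using that by (simp add: L_def dual_pairs_def)
  have cats: "is_category (opposite (AffineMonoids K))" "is_category (CommBialgebras K)"
    by (rule is_category_opposite[OF is_category_AffineMonoids], rule is_category_CommBialgebras)
  interpret hom_correspondence "opposite (AffineMonoids K)" "CommBialgebras K" L fst "\<lambda>i. fst (snd i)" R
  proof (unfold_locales, rule cats, rule cats, goal_cases)
    case 1 then show ?case by (auto simp: L_def opposite_def AffineMonoids_def)
  next
    case 2 then show ?case by (auto simp: L_def CommBialgebras_def)
  next
    case (3 X) then show ?case using dual_pair_of_monoid[of X] by (force simp: L_def opposite_def AffineMonoids_def)
  next
    case (4 B) then show ?case using dual_pair_of_bialgebra[of B] by (force simp: L_def CommBialgebras_def)
  next
    case (5 i j f)
    obtain X B ev Y C ev' where ij: "i = (X, B, ev)" "j = (Y, C, ev')" by (cases i, cases j)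
    interpret dual_pairs K Y C ev' X B ev using P 5 by (simp add: ij)
    show ?case
      using 5(3) rel_hom_ex[of f] rel_unique_hom[of _ _ f] unfolding R_def ij by (simp add: opposite_def AffineMonoids_def CommBialgebras_def) blast
  next
    case (6 i j g)
    obtain X B ev Y C ev' where ij: "i = (X, B, ev)" "j = (Y, C, ev')" by (cases i, cases j)
    interpret dual_pairs K Y C ev' X B ev using P 6 by (simp add: ij)
    show ?case
      using 6(3) rel_points_ex[of g] rel_unique_points[of _ _ g] unfolding R_def ij by (simp add: opposite_def AffineMonoids_def CommBialgebras_def) blast
  next
    case (7 i)
    obtain X B ev where i: "i = (X, B, ev)" by (cases i)
    interpret dual_pairs K X B ev X B ev using P 7 by (simp add: i)
    show ?case unfolding R_def i by (simp add: rel_def opposite_def AffineMonoids_def CommBialgebras_def)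
  next
    case (8 i j k f f' g g')
    obtain X B ev Y C ev' Z D ev'' where ijk: "i = (X, B, ev)" "j = (Y, C, ev')" "k = (Z, D, ev'')" by (cases i, cases j, cases k)
    interpret ij: dual_pairs K Y C ev' X B ev using P 8 by (simp add: ijk)
    interpret jk: dual_pairs K Z D ev'' Y C ev' using P 8 by (simp add: ijk)
    interpret ik: dual_pairs K Z D ev'' X B ev using P 8 by (simp add: ijk)
    have h: "f' \<in> Mon_mor K Z Y" "g \<in> bialg_mor K B C"
      using 8(5,6) by (simp_all add: ijk opposite_def AffineMonoids_def CommBialgebras_def)
    show ?case
      using 8(8,9) unfolding R_def ijk
      by (simp add: ij.rel_def jk.rel_def ik.rel_def opposite_def AffineMonoids_def CommBialgebras_def compose_def
        Mon_morD(2)[OF h(1)] Mod_morD(2)[OF bialg_morD(2)[OF h(2)]])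
  qed
  show ?thesis unfolding anti_equivalent_def by (rule equivalent)
qed

end

theorem theorem8p13:
  fixes K :: "'u ring"
  assumes "field K"
    and "carrier K \<prec> (UNIV :: 'u set)"
    and "uncountable (UNIV :: 'u set)"
  shows "anti_equivalent (AffineMonoids K) (CommBialgebras K)"
proof -
  interpret base K using assms by (rule base.intro)
  show ?thesis by (rule anti_equivalence)
qed

end
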